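(* Let $F$ be a solution of the linear wave equation on $\mathbb{R}\times\mathbb{R}^3$, let $I=[a,b]\subseteq[0,\infty)$ be a compact time interval, and let $v:I\times\mathbb{R}^3\to\mathbb{R}$ be a solution of the forced nonlinear wave equation $-\partial_{tt}v+\Delta v=(v+F)^5$ with data in $\dot H^1_x(\mathbb{R}^3)\times L^2_x(\mathbb{R}^3)$. Let $w\in L^1_\tau(\mathbb{R})$ be nonnegative. Then $$\begin{aligned} \int_I\int_{\mathbb{R}^3}w(t-|x|)\,|v|^6(t,x)\,dx\,dt \lesssim\;& \|w\|_{L^1_\tau(\mathbb{R})}\sup_{t\in I}E[v](t)+\|w\|_{L^1_\tau(\mathbb{R})}\|F\|_{L^\infty_tL^6_x(I\times\mathbb{R}^3)}\sup_{t\in I}E[v](t)^{\frac56}\\ &+\left|\int_I\int_{\mathbb{R}^3}\left(\int_{-\infty}^{t-|x|}w(\tau)\,d\tau\right)\partial_t(F)\,v^5\,dx\,dt\right|+\left|\int_I\int_{\mathbb{R}^3}w(t-|x|)\,F\,v^5\,dx\,dt\right|\\ &+\|w\|_{L^1_\tau(\mathbb{R})}\int_I\int_{\mathbb{R}^3}|F|^2(|F|+|v|)^3|\partial_tv|\,dx\,dt , \end{aligned}$$ where the implicit constant is absolute.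
   Context: The energy is $E[v](t)=\int_{\mathbb{R}^3}\frac12|\nabla v|^2+\frac12|\partial_tv|^2+\frac16|v|^6\,dx$. All functions are real-valued. $F$ solves $-\partial_{tt}F+\Delta F=0$ and lies in $L_t^5L_x^{10}(\mathbb{R}\times\mathbb{R}^3)$; the solution $v$ satisfies $v\in C_t^0\dot H^1_x(I\times\mathbb{R}^3)\cap L^5_{t,\mathrm{loc}}L^{10}_x(I\times\mathbb{R}^3)$, $\partial_tv\in C_t^0L^2_x(I\times\mathbb{R}^3)$. The inequality is an a priori estimate: it is understood that the signed integrals on the right-hand side are well defined (absolutely convergent). *)

theory Defs
  imports "HOL-Analysis.Analysis" "HOL-Probability.Essential_Supremum"
begin

text \<open>
  Functions on spacetime have type \<open>real \<times> (real^3) \<Rightarrow> real\<close> and are evaluated as \<open>f (t, x)\<close>.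
  Equivalence classes modulo null sets are represented by Borel functions.
\<close>

text \<open>Powers of extended nonnegative reals; only used for exponents \<open>r > 0\<close>.\<close>
definition epowr :: "ennreal \<Rightarrow> real \<Rightarrow> ennreal" where
  "epowr x r = (if x = \<infinity> then \<infinity> else ennreal (enn2real x powr r))"

definition Lp_norm :: "real \<Rightarrow> ('a::euclidean_space \<Rightarrow> 'b::real_normed_vector) \<Rightarrow> ennreal" where
  "Lp_norm p f = epowr (\<integral>\<^sup>+x. ennreal (norm (f x) powr p) \<partial>lborel) (1 / p)"

definition in_Lp :: "real \<Rightarrow> ('a::euclidean_space \<Rightarrow> 'b::real_normed_vector) \<Rightarrow> bool" where
  "in_Lp p f \<longleftrightarrow> f \<in> borel_measurable borel \<and> Lp_norm p f < \<infinity>"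

text \<open>The mixed norms in \<open>L\<^sup>p\<^sub>t L\<^sup>q\<^sub>x\<close> and \<open>L\<^sup>\<infinity>\<^sub>t L\<^sup>q\<^sub>x\<close> over \<open>I \<times> \<real>\<^sup>3\<close>.\<close>
definition LtLx_norm :: "real \<Rightarrow> real \<Rightarrow> real set \<Rightarrow> (real \<times> (real^3) \<Rightarrow> real) \<Rightarrow> ennreal" where
  "LtLx_norm p q I f =
     epowr (\<integral>\<^sup>+t\<in>I. epowr (Lp_norm q (\<lambda>x. f (t, x))) p \<partial>lborel) (1 / p)"

definition LtinfLx_norm :: "real \<Rightarrow> real set \<Rightarrow> (real \<times> (real^3) \<Rightarrow> real) \<Rightarrow> ennreal" where
  "LtinfLx_norm q I f = esssup (restrict_space lborel I) (\<lambda>t. Lp_norm q (\<lambda>x. f (t, x)))"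

text \<open>\<open>f \<in> C\<^sup>0\<^sub>t L\<^sup>p\<^sub>x(I \<times> \<real>\<^sup>3)\<close>\<close>
definition cont_in_Lp ::
  "real \<Rightarrow> real set \<Rightarrow> (real \<times> (real^3) \<Rightarrow> 'b::real_normed_vector) \<Rightarrow> bool" where
  "cont_in_Lp p I f \<longleftrightarrow>
     (\<forall>t\<in>I. in_Lp p (\<lambda>x. f (t, x))) \<and>
     (\<forall>s\<in>I. ((\<lambda>t. Lp_norm p (\<lambda>x. f (t, x) - f (s, x))) \<longlongrightarrow> 0) (at s within I))"

definition partial :: "'a::euclidean_space \<Rightarrow> ('a \<Rightarrow> real) \<Rightarrow> 'a \<Rightarrow> real" where
  "partial i f x = frechet_derivative f (at x) i"

fun C_diff :: "nat \<Rightarrow> ('a::euclidean_space \<Rightarrow> real) \<Rightarrow> bool" where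
  "C_diff 0 f \<longleftrightarrow> continuous_on UNIV f"
| "C_diff (Suc k) f \<longleftrightarrow> (\<forall>x. f differentiable (at x)) \<and> (\<forall>i\<in>Basis. C_diff k (partial i f))"

text \<open>\<open>C\<^sub>c\<^sup>\<infinity>(\<Omega>)\<close>, as functions on the whole space\<close>
definition test_functions :: "'a::euclidean_space set \<Rightarrow> ('a \<Rightarrow> real) set" where
  "test_functions \<Omega> =
     {\<phi>. (\<forall>k. C_diff k \<phi>) \<and> compact (closure {x. \<phi> x \<noteq> 0}) \<and> closure {x. \<phi> x \<noteq> 0} \<subseteq> \<Omega>}"

definition loc_integrable :: "'a::euclidean_space set \<Rightarrow> ('a \<Rightarrow> real) \<Rightarrow> bool" where
  "loc_integrable \<Omega> f \<longleftrightarrow> (\<forall>K. compact K \<and> K \<subseteq> \<Omega> \<longrightarrow> set_integrable lborel K f)"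

text \<open>\<open>g\<close> is the distributional derivative of \<open>f\<close> on the open set \<open>\<Omega>\<close> in direction \<open>i\<close>.\<close>
definition weak_partial ::
  "'a::euclidean_space set \<Rightarrow> 'a \<Rightarrow> ('a \<Rightarrow> real) \<Rightarrow> ('a \<Rightarrow> real) \<Rightarrow> bool" where
  "weak_partial \<Omega> i f g \<longleftrightarrow>
     loc_integrable \<Omega> f \<and> loc_integrable \<Omega> g \<and>
     (\<forall>\<phi>\<in>test_functions \<Omega>.
        (LINT x:\<Omega>|lborel. f x * partial i \<phi> x) = - (LINT x:\<Omega>|lborel. g x * \<phi> x))"

text \<open>
  \<open>u\<close> belongs to the homogeneous Sobolev space \<open>\<dot>H\<^sup>1(\<real>\<^sup>3)\<close> and has gradient \<open>g\<close>. As usual in dimension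
  three, this space (normed by \<open>\<parallel>\<nabla>u\<parallel>\<close> in \<open>L\<^sup>2\<close>) is realised inside \<open>L\<^sup>6(\<real>\<^sup>3)\<close>, which fixes the
  additive constant.
\<close>
definition Hdot1_with_gradient :: "(real^3 \<Rightarrow> real) \<Rightarrow> (real^3 \<Rightarrow> real^3) \<Rightarrow> bool" where
  "Hdot1_with_gradient u g \<longleftrightarrow>
     in_Lp 6 u \<and> in_Lp 2 g \<and> (\<forall>i\<in>Basis. weak_partial UNIV i u (\<lambda>x. g x \<bullet> i))"

text \<open>
  \<open>v \<in> C\<^sup>0\<^sub>t \<dot>H\<^sup>1\<^sub>x(I \<times> \<real>\<^sup>3)\<close> with spatial gradient \<open>Dv\<close>; as gradients are linear, continuity in
  \<open>\<dot>H\<^sup>1\<close> is continuity of \<open>Dv\<close> in \<open>L\<^sup>2\<close>.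
\<close>
definition cont_in_Hdot1 ::
  "real set \<Rightarrow> (real \<times> (real^3) \<Rightarrow> real) \<Rightarrow> (real \<times> (real^3) \<Rightarrow> real^3) \<Rightarrow> bool" where
  "cont_in_Hdot1 I v Dv \<longleftrightarrow>
     (\<forall>t\<in>I. Hdot1_with_gradient (\<lambda>x. v (t, x)) (\<lambda>x. Dv (t, x))) \<and> cont_in_Lp 2 I Dv"

text \<open>\<open>-\<partial>\<^sub>t\<^sub>t + \<Delta>\<close>\<close>
definition wave_op :: "(real \<times> (real^3) \<Rightarrow> real) \<Rightarrow> real \<times> (real^3) \<Rightarrow> real" where
  "wave_op \<phi> p =
     - partial (1, 0) (partial (1, 0) \<phi>) p + (\<Sum>i\<in>Basis. partial (0, i) (partial (0, i) \<phi>) p)"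

text \<open>\<open>-\<partial>\<^sub>t\<^sub>t u + \<Delta> u = h\<close> in the sense of distributions on the open set \<open>\<Omega>\<close>\<close>
definition wave_eq_on ::
  "(real \<times> (real^3)) set \<Rightarrow> (real \<times> (real^3) \<Rightarrow> real) \<Rightarrow> (real \<times> (real^3) \<Rightarrow> real) \<Rightarrow> bool" where
  "wave_eq_on \<Omega> u h \<longleftrightarrow>
     loc_integrable \<Omega> u \<and> loc_integrable \<Omega> h \<and>
     (\<forall>\<phi>\<in>test_functions \<Omega>.
        (LINT p:\<Omega>|lborel. u p * wave_op \<phi> p) = (LINT p:\<Omega>|lborel. h p * \<phi> p))"

definition linear_wave_solution :: "(real \<times> (real^3) \<Rightarrow> real) \<Rightarrow> bool" where
  "linear_wave_solution F \<longleftrightarrow>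
     F \<in> borel_measurable borel \<and> LtLx_norm 5 10 UNIV F < \<infinity> \<and> wave_eq_on UNIV F (\<lambda>_. 0)"

text \<open>
  \<open>v\<close> solves \<open>-\<partial>\<^sub>t\<^sub>t v + \<Delta> v = (v + F)\<^sup>5\<close> on \<open>[a,b] \<times> \<real>\<^sup>3\<close>, with spatial gradient \<open>Dv\<close> and time
  derivative \<open>vt\<close>. Both are determined by \<open>v\<close> up to null sets at each time (if \<open>a < b\<close>). The values
  of \<open>v\<close> and \<open>vt\<close> at time \<open>a\<close> are the data in \<open>\<dot>H\<^sup>1 \<times> L\<^sup>2\<close>. Since \<open>[a,b]\<close> is compact, being in
  \<open>L\<^sup>5\<close> locally in time on \<open>[a,b]\<close> means being in \<open>L\<^sup>5\<close>.
\<close>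
definition forced_nlw_solution ::
  "real \<Rightarrow> real \<Rightarrow> (real \<times> (real^3) \<Rightarrow> real) \<Rightarrow> (real \<times> (real^3) \<Rightarrow> real) \<Rightarrow>
   (real \<times> (real^3) \<Rightarrow> real^3) \<Rightarrow> (real \<times> (real^3) \<Rightarrow> real) \<Rightarrow> bool" where
  "forced_nlw_solution a b F v Dv vt \<longleftrightarrow>
     set_borel_measurable borel ({a..b} \<times> UNIV) v \<and>
     set_borel_measurable borel ({a..b} \<times> UNIV) Dv \<and>
     set_borel_measurable borel ({a..b} \<times> UNIV) vt \<and>
     cont_in_Hdot1 {a..b} v Dv \<and>
     cont_in_Lp 2 {a..b} vt \<and>
     weak_partial ({a<..<b} \<times> UNIV) (1, 0) v vt \<and>
     LtLx_norm 5 10 {a..b} v < \<infinity> \<and>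
     wave_eq_on ({a<..<b} \<times> UNIV) v (\<lambda>p. (v p + F p) ^ 5)"

text \<open>The energy \<open>E[v](t)\<close>, with \<open>Dv\<close> and \<open>vt\<close> in the roles of \<open>\<nabla>v\<close> and \<open>\<partial>\<^sub>t v\<close>\<close>
definition energy ::
  "(real \<times> (real^3) \<Rightarrow> real) \<Rightarrow> (real \<times> (real^3) \<Rightarrow> real^3) \<Rightarrow> (real \<times> (real^3) \<Rightarrow> real) \<Rightarrow>
   real \<Rightarrow> ennreal" where
  "energy v Dv vt t =
     (\<integral>\<^sup>+x. ennreal (1/2 * (norm (Dv (t, x)))\<^sup>2 + 1/2 * \<bar>vt (t, x)\<bar>\<^sup>2 + 1/6 * \<bar>v (t, x)\<bar> ^ 6) \<partial>lborel)"

end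

theory Submission
  imports Defs
begin

text \<open>
  Let \<open>W(\<tau>) = \<integral>\<^sub>-\<^sub>\<infinity>\<^sup>\<tau> w\<close>. Multiplying the wave equation by \<open>W(t - |x|) \<partial>\<^sub>t v\<close> and integrating, the derivative
  of the weight along the outgoing cones produces \<open>w(t - |x|)\<close> times the nonnegative energy flux
  \<open>|\<partial>\<^sub>t v \<cdot> x/|x| + \<nabla>v|\<^sup>2 / 2\<close>, which may be dropped, and writing \<open>(v + F)\<^sup>5 \<partial>\<^sub>t v\<close> as the time derivative of
  \<open>v\<^sup>6/6 + F v\<^sup>5\<close>, minus \<open>\<partial>\<^sub>t F v\<^sup>5\<close>, plus terms of order \<open>F\<^sup>2 (|F| + |v|)\<^sup>3 |\<partial>\<^sub>t v|\<close>, turns the forcing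
  into the weighted potential energy and the error terms of the claim. The boundary terms are
  bounded by the energy, for the cross term \<open>F v\<^sup>5\<close> with Hoelder's inequality.

  For weak solutions the kinetic part is justified by mollifying in spacetime, and the potential
  part by absolute continuity of \<open>v\<close> and \<open>F\<close> along almost every line in the time direction.
\<close>

section \<open>Smooth functions\<close>

text \<open>The weighted potential energy on the left is not known to be finite in advance:
  \<open>w\<close> is merely integrable, so \<open>w (t - |x|)\<close> is not controlled by the
  energy on a time slice, whereas its primitive is bounded and continuous. This is why the kinetic
  and the potential part are separated. The kinetic part involves only the primitive, and its limits
  are taken in quadratic expressions of first derivatives; the forcing, integrable in time with
  values in L^2, is paired with test functions whose slices stay bounded in L^2. In the potential
  part \<open>w\<close> may enter as an almost everywhere derivative on a line; since its term is
  nonnegative, Tonelli's theorem yields integrability together with the identity.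

  The equation holds in the open strip only, so the boundary terms enter through cut-offs in time
  whose derivatives have total mass at most 2; this is the source of the factors 2. The factor 6
  undoes the 1/6 in the potential energy. The worst resulting coefficient is 72, rounded up to
  100.\<close>

lemma partial_eqI: "(f has_derivative f') (at x) \<Longrightarrow> partial i f x = f' i"
  unfolding partial_def using frechet_derivative_at by metis

text \<open>The derivative is linear, hence determined by its values on the basis. This coordinate
  form can be summed and integrated term by term in the Taylor estimates below.\<close>

lemma partial_has_derivative:
  assumes "f differentiable (at x)"
  shows "(f has_derivative (\<lambda>h. \<Sum>i\<in>Basis. (h \<bullet> i) * partial i f x)) (at x)"
proof -
  have d: "(f has_derivative frechet_derivative f (at x)) (at x)"
    using assms frechet_derivative_works by blast
  then have "linear (frechet_derivative f (at x))"
    using has_derivative_linear by blast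
  then have "frechet_derivative f (at x) h = (\<Sum>i\<in>Basis. (h \<bullet> i) * partial i f x)" for h
    unfolding partial_def
    by (subst (1) euclidean_representation[of h, symmetric])
       (simp add: linear_sum linear_scale del: euclidean_representation)
  then show ?thesis using d by presburger
qed

lemma C_diff_Suc_imp: "C_diff (Suc k) f \<Longrightarrow> C_diff k f"
proof (induction k arbitrary: f)
  case 0
  then show ?case by (auto intro!: continuous_at_imp_continuous_on differentiable_imp_continuous_within)
next
  case (Suc k)
  then show ?case by (metis C_diff.simps(2))
qed

lemma C_diff_const: "C_diff k (\<lambda>x. c)"
proof (induction k arbitrary: c)
  case (Suc k)
  have "partial i (\<lambda>x. c) = (\<lambda>x. 0)" for i :: 'a
    by (rule ext, rule partial_eqI) (auto intro!: derivative_eq_intros)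
  then show ?case using Suc by simp
qed auto

lemma partial_add:
  "f differentiable (at x) \<Longrightarrow> g differentiable (at x) \<Longrightarrow>
   partial i (\<lambda>x. f x + g x) x = partial i f x + partial i g x"
  unfolding partial_def[of i f] partial_def[of i g] frechet_derivative_works
  by (rule partial_eqI) (auto intro!: derivative_eq_intros)

lemma partial_mult:
  "f differentiable (at x) \<Longrightarrow> g differentiable (at x) \<Longrightarrow>
   partial i (\<lambda>x. f x * g x) x = f x * partial i g x + partial i f x * g x"
  unfolding partial_def[of i f] partial_def[of i g] frechet_derivative_works
  by (rule partial_eqI) (auto intro!: derivative_eq_intros)

lemma C_diff_add: "C_diff k f \<Longrightarrow> C_diff k g \<Longrightarrow> C_diff k (\<lambda>x. f x + g x)"
proof (induction k arbitrary: f g)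
  case (Suc k)
  then have "partial i (\<lambda>x. f x + g x) = (\<lambda>x. partial i f x + partial i g x)" for i
    by (intro ext partial_add) auto
  then show ?case using Suc by simp
qed (auto intro: continuous_intros)

lemma C_diff_mult: "C_diff k f \<Longrightarrow> C_diff k g \<Longrightarrow> C_diff k (\<lambda>x. f x * g x)"
proof (induction k arbitrary: f g)
  case (Suc k)
  then have "partial i (\<lambda>x. f x * g x) = (\<lambda>x. f x * partial i g x + partial i f x * g x)" for i
    by (intro ext partial_mult) auto
  moreover have "C_diff k f" "C_diff k g"
    using Suc.prems C_diff_Suc_imp by blast+
  ultimately show ?case using Suc by (auto intro!: C_diff_add)
qed (auto intro: continuous_intros)

lemma C_diff_prod:
  "finite A \<Longrightarrow> (\<And>j. j \<in> A \<Longrightarrow> C_diff k (f j)) \<Longrightarrow> C_diff k (\<lambda>x. \<Prod>j\<in>A. f j x)"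
  by (induction A rule: finite_induct) (auto intro: C_diff_const C_diff_mult)

lemma partial_affine:
  assumes "\<And>x. f differentiable (at x)"
  shows "partial i (\<lambda>x. f (p + s *\<^sub>R x)) x = s * partial i f (p + s *\<^sub>R x)"
proof -
  have *: "((\<lambda>x. p + s *\<^sub>R x) has_derivative (\<lambda>h. s *\<^sub>R h)) (at x)"
    by (auto intro!: derivative_eq_intros)
  have d: "(f has_derivative frechet_derivative f (at (p + s *\<^sub>R x))) (at (p + s *\<^sub>R x))"
    using assms frechet_derivative_works by blast
  have "linear (frechet_derivative f (at (p + s *\<^sub>R x)))"
    using d has_derivative_linear by blast
  then show ?thesis
    using partial_eqI[OF diff_chain_at[OF * d, unfolded o_def], of i]
    by (simp add: linear_scale partial_def)
qed

lemma differentiable_affine: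
  assumes "\<And>x. f differentiable (at x)"
  shows "(\<lambda>x. f (p + s *\<^sub>R x)) differentiable (at x)"
proof -
  have "((\<lambda>x. p + s *\<^sub>R x) has_derivative (\<lambda>h. s *\<^sub>R h)) (at x)"
    by (auto intro!: derivative_eq_intros)
  then show ?thesis
    using differentiable_chain_at[of "\<lambda>x. p + s *\<^sub>R x" x f] assms
    by (auto simp: o_def differentiable_def)
qed

lemma C_diff_affine: "C_diff k f \<Longrightarrow> C_diff k (\<lambda>x. f (p + s *\<^sub>R x))"
proof (induction k arbitrary: f)
  case 0
  then show ?case
    by (auto intro!: continuous_intros continuous_on_compose2[of UNIV f])
next
  case (Suc k)
  then have "partial i (\<lambda>x. f (p + s *\<^sub>R x)) = (\<lambda>x. s * partial i f (p + s *\<^sub>R x))" for i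
    by (intro ext partial_affine) auto
  moreover have "(\<lambda>x. f (p + s *\<^sub>R x)) differentiable (at x)" for x
    using Suc.prems by (intro differentiable_affine) auto
  ultimately show ?case using Suc by (auto intro!: C_diff_mult C_diff_const)
qed

text \<open>Lifts smoothness from one variable to a function of one linear coordinate, for the
  factors of \<open>bump\<close>; \<open>j\<close> is arbitrary, so that \<open>- i\<close> is
  covered as well.\<close>

lemma C_diff_inner: "C_diff k g \<Longrightarrow> C_diff k (\<lambda>x::'a::euclidean_space. g (x \<bullet> j))"
proof (induction k arbitrary: g)
  case 0
  then show ?case
    by (auto intro!: continuous_intros continuous_on_compose2[of UNIV g])
next
  case (Suc k)
  have d: "(g has_derivative (\<lambda>h. h * partial 1 g y)) (at y)" for y
    using partial_has_derivative[of g y] Suc.prems by simp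
  have *: "((\<lambda>x::'a. g (x \<bullet> j)) has_derivative (\<lambda>h. (h \<bullet> j) * partial 1 g (x \<bullet> j))) (at x)" for x
    by (rule has_derivative_compose[of "\<lambda>x. x \<bullet> j" "\<lambda>h. h \<bullet> j" _ _ g, OF _ d[of "x \<bullet> j"]])
       (auto intro!: derivative_eq_intros)
  then have "partial i (\<lambda>x::'a. g (x \<bullet> j)) = (\<lambda>x. (i \<bullet> j) * partial 1 g (x \<bullet> j))" for i
    by (intro ext partial_eqI)
  moreover have "(\<lambda>x::'a. g (x \<bullet> j)) differentiable (at x)" for x
    using * differentiable_def by blast
  ultimately show ?case using Suc by (auto intro!: C_diff_mult C_diff_const)
qed

section \<open>A smooth bump function and mollifiers\<close>

definition flat_exp :: "nat \<Rightarrow> real \<Rightarrow> real" where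
  "flat_exp n s = (if 0 < s then inverse s ^ n * exp (- inverse s) else 0)"

text \<open>For positive \<open>s\<close> this is the product rule, the power contributing the first
  term and the exponential the second. The additional powers of the inverse make the family closed
  under differentiation, as the induction for smoothness requires. At 0 the difference quotient is
  the same expression with one more power, and after the substitution y = 1/h exponentials beat
  powers.\<close>

lemma flat_exp_has_derivative:
  "(flat_exp n has_real_derivative (- real n * flat_exp (Suc n) s + flat_exp (n + 2) s)) (at s)"
proof -
  consider "s > 0" | "s = 0" | "s < 0" by linarith
  then show ?thesis
  proof cases
    case 1
    have "((\<lambda>s. inverse s ^ n * exp (- inverse s)) has_real_derivative
        (- real n * flat_exp (Suc n) s + flat_exp (n + 2) s)) (at s)"
    proof -
      define q where "q = inverse s"
      have i: "(inverse has_real_derivative - (q ^ 2)) (at s)"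
        using DERIV_inverse[of s] 1 by (simp add: q_def numeral_2_eq_2)
      have "((\<lambda>s. inverse s ^ n * exp (- inverse s)) has_real_derivative
          (real n * (- (q ^ 2) * q ^ (n - 1))) * exp (- q) + exp (- q) * (- (- (q ^ 2))) * q ^ n) (at s)"
        unfolding q_def
        using i 1 by (auto intro!: derivative_eq_intros simp: q_def power2_eq_square)
      moreover have "(real n * (- (q ^ 2) * q ^ (n - 1))) * exp (- q) + exp (- q) * (- (- (q ^ 2))) * q ^ n
          = - real n * (q ^ Suc n * exp (- q)) + q ^ (n + 2) * exp (- q)"
        by (cases n) (simp_all add: algebra_simps power2_eq_square)
      ultimately show ?thesis
        using 1 by (simp add: flat_exp_def q_def)
    qed
    then show ?thesis
      by (rule has_field_derivative_transform_within_open[of _ _ _ "{0<..}"])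
         (use 1 in \<open>auto simp: flat_exp_def\<close>)
  next
    case 2
    have "((\<lambda>h. inverse h ^ Suc n * exp (- inverse h)) \<longlongrightarrow> (0::real)) (at_right 0)"
    proof -
      have "((\<lambda>y::real. y ^ Suc n / exp y) \<longlongrightarrow> 0) at_top"
        by (rule tendsto_power_div_exp_0)
      then have "((\<lambda>h. inverse h ^ Suc n / exp (inverse h)) \<longlongrightarrow> (0::real)) (at_right 0)"
        using filterlim_compose filterlim_inverse_at_top_right by blast
      then show ?thesis by (simp add: exp_minus divide_inverse)
    qed
    then have "((\<lambda>h. flat_exp n h / h) \<longlongrightarrow> 0) (at_right 0)"
      by (rule Lim_transform_eventually)
         (auto simp: flat_exp_def divide_inverse eventually_at_filter)
    moreover have "((\<lambda>h. flat_exp n h / h) \<longlongrightarrow> 0) (at_left 0)"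
      by (rule tendsto_eventually)
         (auto simp: flat_exp_def eventually_at_filter)
    ultimately have "((\<lambda>h. flat_exp n h / h) \<longlongrightarrow> 0) (at 0)"
      by (simp add: filterlim_at_split)
    then show ?thesis using 2 by (simp add: DERIV_def flat_exp_def)
  next
    case 3
    have "((\<lambda>s. 0) has_real_derivative (- real n * flat_exp (Suc n) s + flat_exp (n + 2) s)) (at s)"
      using 3 by (auto simp: flat_exp_def)
    then show ?thesis
      by (rule has_field_derivative_transform_within_open[of _ _ _ "{..<0}"])
         (use 3 in \<open>auto simp: flat_exp_def\<close>)
  qed
qed

lemma C_diff_flat_exp: "C_diff k (flat_exp n)"
proof (induction k arbitrary: n)
  case 0
  then show ?case
    using DERIV_isCont[OF flat_exp_has_derivative] by (simp add: continuous_at_imp_continuous_on)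
next
  case (Suc k)
  have d: "(flat_exp n has_derivative (*) (- real n * flat_exp (Suc n) s + flat_exp (n + 2) s)) (at s)" for s
    using flat_exp_has_derivative[of n s] unfolding has_field_derivative_def .
  then have "partial 1 (flat_exp n) = (\<lambda>s. - real n * flat_exp (Suc n) s + flat_exp (n + 2) s)"
    using partial_eqI[OF d, of 1] by auto
  moreover have "flat_exp n differentiable (at s)" for s
    using d differentiable_def by blast
  moreover have "C_diff k (\<lambda>s. - real n * flat_exp (Suc n) s + flat_exp (n + 2) s)"
    by (intro C_diff_add C_diff_mult C_diff_const Suc)
  ultimately show ?case by simp
qed

text \<open>Each coordinate contributes a factor that is positive exactly for -1 < x \<bullet> i <
  1. With \<open>- i\<close> in place of a subtraction both factors fall under
  \<open>C_diff_inner\<close>, and evenness is a mere swap of factors.\<close>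

definition bump :: "'a::euclidean_space \<Rightarrow> real" where
  "bump x = (\<Prod>i\<in>Basis. flat_exp 0 (1 + x \<bullet> i) * flat_exp 0 (1 + x \<bullet> (- i)))"

lemma C_diff_bump: "C_diff k bump"
proof -
  have "C_diff k (\<lambda>x::'a. (\<lambda>s. flat_exp 0 (1 + 1 *\<^sub>R s)) (x \<bullet> j))" for j
    by (intro C_diff_inner C_diff_affine C_diff_flat_exp)
  then have "C_diff k (\<lambda>x::'a. flat_exp 0 (1 + x \<bullet> j))" for j by simp
  then show ?thesis unfolding bump_def
    by (intro C_diff_prod C_diff_mult finite_Basis)
qed

lemma bump_minus: "bump (- x) = bump x"
  by (simp add: bump_def mult.commute)

lemma bump_nonneg: "0 \<le> bump x"
  by (auto simp: bump_def flat_exp_def intro!: prod_nonneg)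

lemma bump_pos: "0 < bump 0"
  by (auto simp: bump_def flat_exp_def intro!: prod_pos)

text \<open>Nonvanishing forces every coordinate below 1 in modulus, and the norm is at most the sum
  of these moduli; this crude count explains the radius \<open>DIM('a)\<close>.\<close>

lemma bump_eq_0: "DIM('a) \<le> norm (x::'a::euclidean_space) \<Longrightarrow> bump x = 0"
proof (rule ccontr)
  assume n: "DIM('a) \<le> norm x" and "bump x \<noteq> 0"
  then have "\<bar>x \<bullet> i\<bar> < 1" if "i \<in> Basis" for i
    using that by (force simp: bump_def flat_exp_def split: if_splits)
  then have "(\<Sum>i\<in>Basis. \<bar>x \<bullet> i\<bar>) < (\<Sum>i\<in>(Basis::'a set). 1)"
    by (intro sum_strict_mono) auto
  then show False using norm_le_l1[of x] n by simp
qed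

text \<open>Evenness is part of the notion because it makes the convolution self-adjoint, which is
  how the mollifier is moved from the test function to the solution.\<close>

definition mollifier :: "real \<Rightarrow> ('a::euclidean_space \<Rightarrow> real) \<Rightarrow> bool" where
  "mollifier \<epsilon> \<rho> \<longleftrightarrow> (\<forall>k. C_diff k \<rho>) \<and> (\<forall>x. 0 \<le> \<rho> x) \<and> (\<forall>x. \<rho> (- x) = \<rho> x) \<and>
     (\<forall>x. \<epsilon> \<le> norm x \<longrightarrow> \<rho> x = 0) \<and> integrable lborel \<rho> \<and> integral\<^sup>L lborel \<rho> = 1"

lemma continuous_bounded_support_integrable:
  fixes f :: "'a::euclidean_space \<Rightarrow> real"
  assumes "continuous_on UNIV f" "\<And>x. r < norm x \<Longrightarrow> f x = 0"
  shows "integrable lborel f"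
proof -
  have "set_integrable lborel (cball 0 r) f"
    unfolding set_integrable_def
    by (intro borel_integrable_compact) (use assms continuous_on_subset[OF assms(1)] in auto)
  then show ?thesis
    unfolding set_integrable_def
    by (rule Bochner_Integration.integrable_cong[THEN iffD1, rotated -1])
       (use assms in \<open>auto simp: indicator_def not_le\<close>)
qed

lemma mollifier_exists:
  assumes "0 < \<epsilon>"
  shows "\<exists>\<rho>::'a::euclidean_space \<Rightarrow> real. mollifier \<epsilon> \<rho>"
proof -
  \<comment> \<open>\<open>bump\<close> vanishes from norm \<open>DIM('a)\<close> on, so this
    dilation shrinks the support into the ball of radius \<open>\<epsilon>\<close>.\<close>
  define s where "s = DIM('a) / \<epsilon>"
  have s: "s > 0" using assms by (simp add: s_def)
  define k :: "'a \<Rightarrow> real" where "k x = bump (0 + s *\<^sub>R x)" for x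
  have C: "C_diff n k" for n
    unfolding k_def by (intro C_diff_affine C_diff_bump)
  then have cont: "continuous_on UNIV k" using C_diff.simps(1) by blast
  have supp: "k x = 0" if "\<epsilon> \<le> norm x" for x
    unfolding k_def using that assms s
    by (intro bump_eq_0) (simp add: s_def field_simps)
  have int: "integrable lborel k"
    using cont supp by (intro continuous_bounded_support_integrable[of _ \<epsilon>]) auto
  define c where "c = integral\<^sup>L lborel k"
  \<comment> \<open>A nonnegative continuous function with integral zero vanishes outside a null
    set; its open set of nonzero values is then empty, contrary to the positive value at 0.\<close>
  have "0 < c"
  proof (rule ccontr)
    assume "\<not> 0 < c"
    moreover have "0 \<le> c" unfolding c_def k_def by (simp add: bump_nonneg)
    ultimately have "c = 0" by simp
    then have "AE x in lborel. k x = 0"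
      using integral_nonneg_eq_0_iff_AE[OF int] by (simp add: c_def k_def bump_nonneg)
    then have "{x. k x \<noteq> 0} \<in> null_sets lborel"
      using borel_measurable_continuous_onI[OF cont]
      by (subst (asm) AE_iff_null) (auto)
    then have "negligible {x. k x \<noteq> 0}"
      by (simp add: negligible_iff_null_sets null_sets_completionI)
    moreover have "open {x. k x \<noteq> 0}"
      using cont by (intro open_Collect_neq) auto
    ultimately have "{x. k x \<noteq> 0} = {}"
      using open_not_negligible by blast
    then have "k 0 = 0" by blast
    then show False using bump_pos[where 'a='a] by (simp add: k_def)
  qed
  define \<rho> where "\<rho> x = inverse c * k x" for x
  have "mollifier \<epsilon> \<rho>"
    unfolding mollifier_def \<rho>_def
  proof (intro conjI allI impI)
    show "C_diff n (\<lambda>x. inverse c * k x)" for n by (intro C_diff_mult C_diff_const C)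
    show "integral\<^sup>L lborel (\<lambda>x. inverse c * k x) = 1" using \<open>0 < c\<close> by (simp add: c_def)
    show "integrable lborel (\<lambda>x. inverse c * k x)" using int by simp
  qed (use \<open>0 < c\<close> supp in \<open>auto simp: k_def bump_nonneg bump_minus\<close>)
  then show ?thesis by blast
qed

section \<open>Convolution with smooth kernels\<close>

text \<open>Sign and mass are left out, so that partial derivatives and wave operators of kernels
  are kernels again. The radius is explicit because balls of that radius are later required to fit
  into slabs.\<close>

definition smooth_kernel :: "real \<Rightarrow> ('a::euclidean_space \<Rightarrow> real) \<Rightarrow> bool" where
  "smooth_kernel r k \<longleftrightarrow> (\<forall>n. C_diff n k) \<and> (\<forall>x. r < norm x \<longrightarrow> k x = 0)"

lemma mollifier_smooth_kernel: "mollifier \<epsilon> \<rho> \<Longrightarrow> smooth_kernel \<epsilon> \<rho>"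
  by (auto simp: mollifier_def smooth_kernel_def)

lemma smooth_kernel_differentiable: "smooth_kernel r k \<Longrightarrow> k differentiable (at x)"
  unfolding smooth_kernel_def by (metis C_diff.simps(2))

lemma smooth_kernel_continuous: "smooth_kernel r k \<Longrightarrow> continuous_on UNIV k"
  unfolding smooth_kernel_def by (metis C_diff.simps(1))

lemma smooth_kernel_measurable: "smooth_kernel r k \<Longrightarrow> k \<in> borel_measurable borel"
  by (simp add: smooth_kernel_continuous borel_measurable_continuous_onI)

section \<open>Symmetry of second partial derivatives\<close>

lemma C_diff_directional:
  assumes "C_diff (Suc 0) f"
  shows "((\<lambda>s. f (x + s *\<^sub>R i)) has_real_derivative partial i f (x + s *\<^sub>R i)) (at s)"
proof -
  have d: "(f has_derivative frechet_derivative f (at (x + s *\<^sub>R i))) (at (x + s *\<^sub>R i))"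
    using assms frechet_derivative_works by auto
  have "((\<lambda>s. x + s *\<^sub>R i) has_derivative (\<lambda>h. h *\<^sub>R i)) (at s)"
    by (auto intro!: derivative_eq_intros)
  from has_derivative_compose[OF this d]
  have "((\<lambda>s. f (x + s *\<^sub>R i)) has_derivative
      (\<lambda>h. frechet_derivative f (at (x + s *\<^sub>R i)) (h *\<^sub>R i))) (at s)" .
  moreover have "linear (frechet_derivative f (at (x + s *\<^sub>R i)))"
    using d has_derivative_linear by blast
  ultimately show ?thesis
    unfolding has_field_derivative_def partial_def
    by (elim has_derivative_eq_rhs) (auto simp: linear_scale)
qed

text \<open>The mean value theorem is applied to the increment in direction \<open>j\<close> as a
  function along \<open>i\<close>, then to \<open>partial i f\<close> along \<open>j\<close>. The
  left side is symmetric in \<open>i\<close> and \<open>j\<close>, which makes it a tool for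
  interchanging derivatives.\<close>

lemma second_difference:
  assumes f: "C_diff 2 f" and ij: "i \<in> Basis" "j \<in> Basis" and s: "0 < s"
  shows "\<exists>y. norm (y - x) \<le> 2 * s \<and>
    f (x + s *\<^sub>R i + s *\<^sub>R j) - f (x + s *\<^sub>R i) - f (x + s *\<^sub>R j) + f x
      = s * s * partial j (partial i f) y"
proof -
  have f1: "C_diff (Suc 0) f" and f2: "C_diff (Suc 0) (partial i f)"
    using f ij C_diff_Suc_imp[of "Suc 0" f] by (auto simp: numeral_2_eq_2)
  have "((\<lambda>\<sigma>. f (x + s *\<^sub>R j + \<sigma> *\<^sub>R i) - f (x + \<sigma> *\<^sub>R i)) has_real_derivative
      partial i f (x + s *\<^sub>R j + \<sigma> *\<^sub>R i) - partial i f (x + \<sigma> *\<^sub>R i)) (at \<sigma>)" for \<sigma>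
    by (intro DERIV_diff C_diff_directional f1)
  then obtain \<sigma> where \<sigma>: "0 < \<sigma>" "\<sigma> < s"
    "(f (x + s *\<^sub>R j + s *\<^sub>R i) - f (x + s *\<^sub>R i)) - (f (x + s *\<^sub>R j + 0 *\<^sub>R i) - f (x + 0 *\<^sub>R i))
      = (s - 0) * (partial i f (x + s *\<^sub>R j + \<sigma> *\<^sub>R i) - partial i f (x + \<sigma> *\<^sub>R i))"
    using MVT2[OF s, of "\<lambda>\<sigma>. f (x + s *\<^sub>R j + \<sigma> *\<^sub>R i) - f (x + \<sigma> *\<^sub>R i)"
        "\<lambda>\<sigma>. partial i f (x + s *\<^sub>R j + \<sigma> *\<^sub>R i) - partial i f (x + \<sigma> *\<^sub>R i)"] by blast
  have "((\<lambda>\<tau>. partial i f (x + \<sigma> *\<^sub>R i + \<tau> *\<^sub>R j)) has_real_derivative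
      partial j (partial i f) (x + \<sigma> *\<^sub>R i + \<tau> *\<^sub>R j)) (at \<tau>)" for \<tau>
    by (intro C_diff_directional f2)
  then obtain \<tau> where \<tau>: "0 < \<tau>" "\<tau> < s"
    "partial i f (x + \<sigma> *\<^sub>R i + s *\<^sub>R j) - partial i f (x + \<sigma> *\<^sub>R i + 0 *\<^sub>R j)
      = (s - 0) * partial j (partial i f) (x + \<sigma> *\<^sub>R i + \<tau> *\<^sub>R j)"
    using MVT2[OF s, of "\<lambda>\<tau>. partial i f (x + \<sigma> *\<^sub>R i + \<tau> *\<^sub>R j)"
        "\<lambda>\<tau>. partial j (partial i f) (x + \<sigma> *\<^sub>R i + \<tau> *\<^sub>R j)"] by blast
  have "norm (\<sigma> *\<^sub>R i + \<tau> *\<^sub>R j) \<le> norm (\<sigma> *\<^sub>R i) + norm (\<tau> *\<^sub>R j)"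
    by (rule norm_triangle_ineq)
  also have "\<dots> \<le> 2 * s" using \<sigma> \<tau> ij by simp
  finally show ?thesis
    using \<sigma>(3) \<tau>(3) by (intro exI[of _ "x + \<sigma> *\<^sub>R i + \<tau> *\<^sub>R j"]) (simp add: add_ac)
qed

text \<open>The symmetric second difference divided by \<open>s n * s n\<close> equals either mixed
  partial at an intermediate point; both families of points collapse to \<open>x\<close>, where the
  mixed partials are continuous.\<close>

lemma partial_commute:
  assumes f: "C_diff 2 f" and ij: "i \<in> Basis" "j \<in> Basis"
  shows "partial i (partial j f) x = partial j (partial i f) x"
proof -
  define s where "s n = inverse (real (Suc n))" for n
  have s: "0 < s n" for n by (simp add: s_def)
  have s0: "s \<longlonglongrightarrow> 0" unfolding s_def by (rule LIMSEQ_inverse_real_of_nat)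
  obtain y z where y: "\<And>n. norm (y n - x) \<le> 2 * s n"
      "\<And>n. f (x + s n *\<^sub>R i + s n *\<^sub>R j) - f (x + s n *\<^sub>R i) - f (x + s n *\<^sub>R j) + f x
        = s n * s n * partial j (partial i f) (y n)"
    and z: "\<And>n. norm (z n - x) \<le> 2 * s n"
      "\<And>n. f (x + s n *\<^sub>R j + s n *\<^sub>R i) - f (x + s n *\<^sub>R j) - f (x + s n *\<^sub>R i) + f x
        = s n * s n * partial i (partial j f) (z n)"
    using second_difference[OF f ij s] second_difference[OF f ij(2,1) s] by metis
  have eq: "partial j (partial i f) (y n) = partial i (partial j f) (z n)" for n
  proof -
    have "s n * s n * partial j (partial i f) (y n) = s n * s n * partial i (partial j f) (z n)"
    proof -
      have "x + s n *\<^sub>R j + s n *\<^sub>R i = x + s n *\<^sub>R i + s n *\<^sub>R j" by simp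
      then have e: "f (x + s n *\<^sub>R j + s n *\<^sub>R i) = f (x + s n *\<^sub>R i + s n *\<^sub>R j)" by (rule arg_cong)
      have r: "A = B \<Longrightarrow> B - a - b + c = p \<Longrightarrow> A - b - a + c = q \<Longrightarrow> p = q" for A B a b c p q :: real
        by simp
      show ?thesis by (rule r[OF e y(2)[of n] z(2)[of n]])
    qed
    then show ?thesis using s[of n] by simp
  qed
  have lim: "u \<longlonglongrightarrow> x" if "\<And>n. norm (u n - x) \<le> 2 * s n" for u
  proof (rule LIM_zero_cancel, rule tendsto_norm_zero_cancel, rule Lim_null_comparison)
    show "\<forall>\<^sub>F n in sequentially. norm (norm (u n - x)) \<le> 2 * s n" using that by simp
    show "(\<lambda>n. 2 * s n) \<longlonglongrightarrow> 0" using tendsto_mult_right_zero[OF s0] by simp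
  qed
  have c: "continuous_on UNIV (partial k (partial l f))" if "k \<in> Basis" "l \<in> Basis" for k l
    using f that unfolding numeral_2_eq_2 by simp
  have "(\<lambda>n. partial j (partial i f) (y n)) \<longlonglongrightarrow> partial j (partial i f) x"
    by (rule continuous_on_tendsto_compose[OF c[OF ij(2,1)] lim[OF y(1)]]) auto
  moreover have "(\<lambda>n. partial i (partial j f) (z n)) \<longlonglongrightarrow> partial i (partial j f) x"
    by (rule continuous_on_tendsto_compose[OF c[OF ij] lim[OF z(1)]]) auto
  ultimately show ?thesis
    using LIMSEQ_unique eq by (metis (no_types, lifting) ext)
qed

section \<open>Uniform bounds and Taylor estimates for kernels\<close>

lemma partial_eq_0_outside:
  assumes "\<And>y. r < norm y \<Longrightarrow> f y = 0" "r < norm x"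
  shows "partial i f x = 0"
proof -
  have "(f has_derivative (\<lambda>h. 0)) (at x)"
  proof (rule has_derivative_transform_within_open[of "\<lambda>x. 0" _ _ _ "{x. r < norm x}"])
    show "open {x::'a. r < norm x}"
      by (intro open_Collect_less continuous_intros)
  qed (use assms in auto)
  then show ?thesis by (rule partial_eqI)
qed

lemma smooth_kernel_partial:
  assumes "smooth_kernel r k" "i \<in> Basis"
  shows "smooth_kernel r (partial i k)"
  unfolding smooth_kernel_def
proof (intro conjI allI impI)
  fix n
  have "C_diff (Suc n) k" using assms(1) unfolding smooth_kernel_def by blast
  then show "C_diff n (partial i k)" using assms(2) by simp
next
  fix x :: 'a assume "r < norm x"
  then show "partial i k x = 0"
    using assms(1) by (intro partial_eq_0_outside[of r]) (auto simp: smooth_kernel_def)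
qed

lemma bounded_support_bounded:
  fixes k :: "'a::euclidean_space \<Rightarrow> real"
  assumes "continuous_on UNIV k" "\<And>x. r < norm x \<Longrightarrow> k x = 0"
  shows "\<exists>B. 0 \<le> B \<and> (\<forall>x. \<bar>k x\<bar> \<le> B)"
proof -
  have "compact (k ` cball 0 r)"
    using assms by (intro compact_continuous_image continuous_on_subset[OF assms(1)]) auto
  then obtain B where B: "\<forall>x\<in>cball 0 r. \<bar>k x\<bar> \<le> B"
    using compact_imp_bounded bounded_real by (metis (no_types, lifting) imageI)
  have "\<bar>k x\<bar> \<le> max B 0" for x
    using B assms(2)[of x] by (cases "norm x \<le> r") (auto simp: le_max_iff_disj)
  then show ?thesis by (metis max.cobounded2)
qed

lemma smooth_kernel_bounded: "smooth_kernel r k \<Longrightarrow> \<exists>B. 0 \<le> B \<and> (\<forall>x. \<bar>k x\<bar> \<le> B)"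
  by (rule bounded_support_bounded[of _ r]) (auto simp: smooth_kernel_continuous smooth_kernel_def)

lemma smooth_kernel_partials_bounded:
  fixes k :: "'a::euclidean_space \<Rightarrow> real"
  assumes "smooth_kernel r k"
  shows "\<exists>B. 0 \<le> B \<and> (\<forall>i\<in>Basis. \<forall>x. \<bar>partial i k x\<bar> \<le> B)"
proof -
  have "\<forall>i\<in>Basis. \<exists>B. 0 \<le> B \<and> (\<forall>x. \<bar>partial i k x\<bar> \<le> B)"
    using smooth_kernel_partial[OF assms] smooth_kernel_bounded by blast
  then obtain B where B: "\<And>i. i \<in> Basis \<Longrightarrow> 0 \<le> B i \<and> (\<forall>x. \<bar>partial i k x\<bar> \<le> B i)" by metis
  have "\<bar>partial i k x\<bar> \<le> sum B Basis" if "i \<in> Basis" for i x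
    using B that member_le_sum[of i Basis B] by (smt (verit, ccfv_SIG) DiffE finite_Basis)
  moreover have "0 \<le> sum B Basis" using B by (intro sum_nonneg) blast
  ultimately show ?thesis by blast
qed

text \<open>With all partials bounded by \<open>B\<close>, the operator norm of the derivative is at
  most \<open>DIM('a) * B\<close>.\<close>

lemma smooth_kernel_Lipschitz:
  fixes k :: "'a::euclidean_space \<Rightarrow> real"
  assumes "smooth_kernel r k"
  shows "\<exists>B. 0 \<le> B \<and> (\<forall>x y. \<bar>k x - k y\<bar> \<le> B * norm (x - y))"
proof -
  obtain B where B: "0 \<le> B" "\<And>i x. i \<in> Basis \<Longrightarrow> \<bar>partial i k x\<bar> \<le> B"
    using smooth_kernel_partials_bounded[OF assms] by blast
  have "\<bar>k x - k y\<bar> \<le> (DIM('a) * B) * norm (x - y)" for x y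
  proof (rule differentiable_bound[of UNIV k "\<lambda>x h. \<Sum>i\<in>Basis. (h \<bullet> i) * partial i k x", unfolded real_norm_def])
    fix x
    show "(k has_derivative (\<lambda>h. \<Sum>i\<in>Basis. (h \<bullet> i) * partial i k x)) (at x)"
      using partial_has_derivative smooth_kernel_differentiable[OF assms] by blast
    show "onorm (\<lambda>h. \<Sum>i\<in>Basis. (h \<bullet> i) * partial i k x) \<le> DIM('a) * B"
    proof (rule onorm_bound)
      fix h
      have "norm (\<Sum>i\<in>Basis. (h \<bullet> i) * partial i k x) \<le> (\<Sum>i\<in>(Basis::'a set). norm h * B)"
        by (intro sum_norm_le)
           (auto simp: abs_mult intro!: mult_mono B Basis_le_norm)
      then show "norm (\<Sum>i\<in>Basis. (h \<bullet> i) * partial i k x) \<le> DIM('a) * B * norm h"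
        by (simp add: mult_ac)
    qed (use B in auto)
  qed auto
  then show ?thesis using B(1) by (intro exI[of _ "DIM('a) * B"]) auto
qed

text \<open>The partials are Lipschitz, so on the ball of radius \<open>norm h\<close> about
  \<open>x\<close> the derivative varies by at most \<open>C * norm h\<close>, and the linearised
  mean value inequality gives a quadratic remainder. Its uniformity in \<open>x\<close> permits
  integration against a function that is merely integrable.\<close>

lemma smooth_kernel_taylor:
  fixes k :: "'a::euclidean_space \<Rightarrow> real"
  assumes "smooth_kernel r k"
  shows "\<exists>B. 0 \<le> B \<and> (\<forall>x h. \<bar>k (x + h) - k x - (\<Sum>i\<in>Basis. (h \<bullet> i) * partial i k x)\<bar> \<le> B * (norm h)\<^sup>2)"
proof -
  have "\<forall>i\<in>Basis. \<exists>B. 0 \<le> B \<and> (\<forall>x y. \<bar>partial i k x - partial i k y\<bar> \<le> B * norm (x - y))"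
    using smooth_kernel_partial[OF assms] smooth_kernel_Lipschitz by blast
  then obtain B where B: "\<And>i. i \<in> Basis \<Longrightarrow> 0 \<le> B i \<and> (\<forall>x y. \<bar>partial i k x - partial i k y\<bar> \<le> B i * norm (x - y))"
    by metis
  define C where "C = sum B Basis"
  have C0: "0 \<le> C" using B unfolding C_def by (intro sum_nonneg) blast
  have "\<bar>k (x + h) - k x - (\<Sum>i\<in>Basis. (h \<bullet> i) * partial i k x)\<bar> \<le> C * (norm h)\<^sup>2" for x h
  proof -
    let ?D = "\<lambda>z h. \<Sum>i\<in>Basis. (h \<bullet> i) * partial i k z"
    have "norm (k (x + h) - k x - ?D x (x + h - x)) \<le> norm (x + h - x) * (C * norm h)"
    proof (rule differentiable_bound_linearization[where S = "cball x (norm h)"])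
      show "x + t *\<^sub>R (x + h - x) \<in> cball x (norm h)" if "t \<in> {0..1}" for t
        using that by (auto simp: dist_norm intro!: mult_left_le_one_le)
      show "(k has_derivative ?D z) (at z within cball x (norm h))" for z
        using has_derivative_at_withinI partial_has_derivative smooth_kernel_differentiable[OF assms] by blast
      show "onorm (?D z - ?D x) \<le> C * norm h" if "z \<in> cball x (norm h)" for z
      proof (rule onorm_bound)
        fix h'
        have "norm ((?D z - ?D x) h') = norm (\<Sum>i\<in>Basis. (h' \<bullet> i) * (partial i k z - partial i k x))"
          by (simp add: sum_subtractf right_diff_distrib)
        also have "\<dots> \<le> (\<Sum>i\<in>Basis. norm h' * (B i * norm h))"
        proof (rule sum_norm_le)
          fix i :: 'a assume i: "i \<in> Basis"
          have "\<bar>partial i k z - partial i k x\<bar> \<le> B i * norm (z - x)" using B i by blast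
          also have "\<dots> \<le> B i * norm h"
            using B[OF i] that by (intro mult_left_mono) (auto simp: dist_norm norm_minus_commute)
          finally show "norm ((h' \<bullet> i) * (partial i k z - partial i k x)) \<le> norm h' * (B i * norm h)"
            using i by (auto simp: abs_mult intro!: mult_mono Basis_le_norm)
        qed
        also have "\<dots> = C * norm h * norm h'"
          by (simp add: C_def sum_distrib_left sum_distrib_right mult_ac)
        finally show "norm ((?D z - ?D x) h') \<le> C * norm h * norm h'" .
      qed (use C0 in auto)
    qed auto
    then show ?thesis by (simp add: power2_eq_square mult_ac)
  qed
  then show ?thesis using C0 by blast
qed

section \<open>Differentiating a convolution\<close>

definition conv :: "('a::euclidean_space \<Rightarrow> real) \<Rightarrow> ('a \<Rightarrow> real) \<Rightarrow> 'a \<Rightarrow> real" where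
  "conv f k x = (LINT y|lborel. f y * k (x - y))"

lemma integrable_mult_bounded:
  fixes f g :: "'a::euclidean_space \<Rightarrow> real"
  assumes "integrable lborel f" "g \<in> borel_measurable borel" "\<And>x. \<bar>g x\<bar> \<le> B"
  shows "integrable lborel (\<lambda>x. f x * g x)"
proof (rule Bochner_Integration.integrable_bound)
  show "integrable lborel (\<lambda>x. \<bar>f x\<bar> * B)" using assms(1) by simp
  have "\<bar>g x\<bar> \<le> \<bar>B\<bar>" for x using assms(3)[of x] by linarith
  then show "AE x in lborel. norm (f x * g x) \<le> norm (\<bar>f x\<bar> * B)"
    by (auto simp: abs_mult intro!: mult_left_mono AE_I2)
qed (use assms in measurable)

lemma smooth_kernel_reflect_measurable:
  "smooth_kernel r k \<Longrightarrow> (\<lambda>y. k (x - y)) \<in> borel_measurable borel"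
  using smooth_kernel_measurable by measurable

lemma conv_integrable:
  assumes "integrable lborel f" "smooth_kernel r k"
  shows "integrable lborel (\<lambda>y. f y * k (x - y))"
proof -
  obtain B where "\<And>x. \<bar>k x\<bar> \<le> B" using smooth_kernel_bounded[OF assms(2)] by blast
  then show ?thesis
    by (intro integrable_mult_bounded[of _ _ B] smooth_kernel_reflect_measurable[OF assms(2)] assms) auto
qed

text \<open>The uniform Taylor remainder of the kernel, integrated against the modulus of
  \<open>f\<close>, leaves an error of at most \<open>A * B * (norm h)\<^sup>2\<close>;
  differentiation under the integral thus rests on an explicit bound.\<close>

lemma conv_has_derivative:
  fixes f k :: "'a::euclidean_space \<Rightarrow> real"
  assumes f: "integrable lborel f" and k: "smooth_kernel r k"
  shows "(conv f k has_derivative (\<lambda>h. \<Sum>i\<in>Basis. (h \<bullet> i) * conv f (partial i k) x)) (at x)"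
proof -
  obtain B where B: "0 \<le> B"
    "\<And>x h. \<bar>k (x + h) - k x - (\<Sum>i\<in>Basis. (h \<bullet> i) * partial i k x)\<bar> \<le> B * (norm h)\<^sup>2"
    using smooth_kernel_taylor[OF k] by blast
  define A where "A = (LINT y|lborel. \<bar>f y\<bar>)"
  have A0: "0 \<le> A" by (simp add: A_def)
  have ik: "integrable lborel (\<lambda>y. f y * k (z - y))" for z using conv_integrable[OF f k] .
  have ip: "integrable lborel (\<lambda>y. f y * partial i k (z - y))" if "i \<in> Basis" for i z
    using conv_integrable[OF f smooth_kernel_partial[OF k that]] .
  have bound: "\<bar>conv f k (x + h) - conv f k x - (\<Sum>i\<in>Basis. (h \<bullet> i) * conv f (partial i k) x)\<bar>
      \<le> A * B * (norm h)\<^sup>2" for h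
  proof -
    let ?R = "\<lambda>y. k (x - y + h) - k (x - y) - (\<Sum>i\<in>Basis. (h \<bullet> i) * partial i k (x - y))"
    have "conv f k (x + h) - conv f k x - (\<Sum>i\<in>Basis. (h \<bullet> i) * conv f (partial i k) x)
      = (LINT y|lborel. f y * k (x + h - y) - f y * k (x - y) - (\<Sum>i\<in>Basis. (h \<bullet> i) * (f y * partial i k (x - y))))"
      unfolding conv_def using ik ip by (simp add: integral_sum)
    also have "\<dots> = (LINT y|lborel. f y * ?R y)"
      by (intro Bochner_Integration.integral_cong refl)
         (simp add: algebra_simps sum_distrib_left)
    finally have eq: "conv f k (x + h) - conv f k x - (\<Sum>i\<in>Basis. (h \<bullet> i) * conv f (partial i k) x)
      = (LINT y|lborel. f y * ?R y)" .
    have "\<bar>LINT y|lborel. f y * ?R y\<bar> \<le> (LINT y|lborel. \<bar>f y * ?R y\<bar>)"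
      by (rule integral_abs_bound)
    also have "\<dots> \<le> (LINT y|lborel. \<bar>f y\<bar> * (B * (norm h)\<^sup>2))"
      by (rule integral_mono') (use f B in \<open>auto simp: abs_mult intro!: mult_left_mono\<close>)
    also have "\<dots> = A * B * (norm h)\<^sup>2" by (simp add: A_def)
    finally show ?thesis by (simp add: eq)
  qed
  show ?thesis
    unfolding has_derivative_at
  proof (intro conjI)
    show "bounded_linear (\<lambda>h. \<Sum>i\<in>Basis. (h \<bullet> i) * conv f (partial i k) x)"
      by (intro bounded_linear_sum bounded_linear_mult_const bounded_linear_inner_left)
    show "(\<lambda>h. norm (conv f k (x + h) - conv f k x - (\<Sum>i\<in>Basis. (h \<bullet> i) * conv f (partial i k) x)) / norm h) \<midarrow>0\<rightarrow> 0"
    proof (rule Lim_null_comparison)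
      show "\<forall>\<^sub>F h in at 0. norm (norm (conv f k (x + h) - conv f k x - (\<Sum>i\<in>Basis. (h \<bullet> i) * conv f (partial i k) x)) / norm h)
          \<le> A * B * norm h"
        using bound by (auto intro!: eventuallyI simp: divide_le_eq power2_eq_square mult_ac)
      show "(\<lambda>h. A * B * norm h) \<midarrow>0\<rightarrow> 0" by (intro tendsto_eq_intros) auto
    qed
  qed
qed

lemma conv_partial:
  assumes "integrable lborel f" "smooth_kernel r k" "i \<in> Basis"
  shows "partial i (conv f k) = conv f (partial i k)"
proof
  fix x
  have "partial i (conv f k) x = (\<Sum>j\<in>Basis. (i \<bullet> j) * conv f (partial j k) x)"
    by (rule partial_eqI[OF conv_has_derivative[OF assms(1,2)]])
  also have "\<dots> = (\<Sum>j\<in>Basis. if j = i then conv f (partial j k) x else 0)"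
    using assms(3) by (intro sum.cong) (auto simp: inner_Basis)
  finally show "partial i (conv f k) x = conv f (partial i k) x" using assms(3) by simp
qed

lemma conv_differentiable:
  "integrable lborel f \<Longrightarrow> smooth_kernel r k \<Longrightarrow> conv f k differentiable (at x)"
  using conv_has_derivative differentiable_def by blast

lemma conv_C_diff:
  "integrable lborel f \<Longrightarrow> smooth_kernel r k \<Longrightarrow> C_diff n (conv f k)"
proof (induction n arbitrary: k)
  case 0
  then show ?case
    by (auto intro!: continuous_at_imp_continuous_on differentiable_imp_continuous_within conv_differentiable)
next
  case (Suc n)
  then show ?case
    using conv_differentiable conv_partial smooth_kernel_partial by (metis C_diff.simps(2))
qed

lemma conv_continuous:
  "integrable lborel f \<Longrightarrow> smooth_kernel r k \<Longrightarrow> continuous_on UNIV (conv f k)"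
  using conv_C_diff C_diff.simps(1) by blast

lemma conv_measurable:
  "integrable lborel f \<Longrightarrow> smooth_kernel r k \<Longrightarrow> conv f k \<in> borel_measurable borel"
  by (simp add: conv_continuous borel_measurable_continuous_onI)

lemma conv_eq_0:
  assumes "\<And>x. r < norm x \<Longrightarrow> k x = 0" "\<And>y. norm (x - y) \<le> r \<Longrightarrow> f y = 0"
  shows "conv f k x = 0"
proof -
  have "f y * k (x - y) = 0" for y
    using assms(1)[of "x - y"] assms(2)[of y] by (metis mult_zero_left mult_zero_right not_le)
  then show ?thesis by (simp only: conv_def Bochner_Integration.integral_zero)
qed

section \<open>Convergence of mollifications in the mean\<close>

lemma lborel_distr_reflect: "distr lborel borel (\<lambda>x. t - x) = (lborel :: 'a::euclidean_space measure)"
  using lborel_affine[of "-1" t] by (simp add: density_1)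

lemma nn_integral_reflect:
  assumes "f \<in> borel_measurable borel"
  shows "(\<integral>\<^sup>+x. f (t - x) \<partial>lborel) = (\<integral>\<^sup>+x. f x \<partial>(lborel :: 'a::euclidean_space measure))"
  by (subst (2) lborel_distr_reflect[of t, symmetric]) (simp add: nn_integral_distr assms)

lemma nn_integral_translate:
  assumes "f \<in> borel_measurable borel"
  shows "(\<integral>\<^sup>+x. f (t + x) \<partial>lborel) = (\<integral>\<^sup>+x. f x \<partial>(lborel :: 'a::euclidean_space measure))"
  by (subst (2) lborel_distr_plus[of t, symmetric]) (simp add: nn_integral_distr assms)

lemma lebesgue_integral_translate:
  fixes f :: "'a::euclidean_space \<Rightarrow> real"
  assumes "f \<in> borel_measurable borel"
  shows "(LINT x|lborel. f (t + x)) = (LINT x|lborel. f x)"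
  by (subst (2) lborel_distr_plus[of t, symmetric]) (simp add: integral_distr assms)

lemma integrable_translate:
  fixes f :: "'a::euclidean_space \<Rightarrow> real"
  assumes "integrable lborel f"
  shows "integrable lborel (\<lambda>x. f (t + x))"
proof -
  have "integrable (distr lborel borel ((+) t)) f" using assms by (simp add: lborel_distr_plus)
  then show ?thesis by (subst (asm) integrable_distr_eq) (use assms in auto)
qed

lemma integrable_reflect:
  fixes f :: "'a::euclidean_space \<Rightarrow> real"
  assumes "integrable lborel f"
  shows "integrable lborel (\<lambda>x. f (t - x))"
proof -
  have "integrable (distr lborel borel (\<lambda>x. t - x)) f" using assms by (simp add: lborel_distr_reflect)
  then show ?thesis by (subst (asm) integrable_distr_eq) (use assms in auto)
qed

lemma lebesgue_integral_reflect:
  fixes f :: "'a::euclidean_space \<Rightarrow> real"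
  assumes "f \<in> borel_measurable borel"
  shows "(LINT x|lborel. f (t - x)) = (LINT x|lborel. f x)"
  by (subst (2) lborel_distr_reflect[of t, symmetric]) (simp add: integral_distr assms)

lemma mollifier_sym: "mollifier \<epsilon> \<rho> \<Longrightarrow> \<rho> (x - y) = \<rho> (y - x)"
  unfolding mollifier_def by (metis minus_diff_eq)

lemma mollifier_nonneg: "mollifier \<epsilon> \<rho> \<Longrightarrow> 0 \<le> \<rho> x"
  by (simp add: mollifier_def)

lemma mollifier_measurable: "mollifier \<epsilon> \<rho> \<Longrightarrow> \<rho> \<in> borel_measurable borel"
  using mollifier_smooth_kernel smooth_kernel_measurable by blast

lemma mollifier_integrable: "mollifier \<epsilon> \<rho> \<Longrightarrow> integrable lborel (\<lambda>y. \<rho> (x - y))"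
  by (auto simp: mollifier_def intro: integrable_reflect)

lemma mollifier_integral: "mollifier \<epsilon> \<rho> \<Longrightarrow> (LINT y|lborel. \<rho> (x - y)) = 1"
  by (subst lebesgue_integral_reflect) (auto simp: mollifier_def mollifier_measurable)

lemma mollifier_nn_integral: "mollifier \<epsilon> \<rho> \<Longrightarrow> (\<integral>\<^sup>+y. ennreal (\<rho> (x - y)) \<partial>lborel) = 1"
  by (subst nn_integral_eq_integral)
     (auto simp: mollifier_integrable mollifier_integral mollifier_nonneg)

lemma mollifier_nn_integral': "mollifier \<epsilon> \<rho> \<Longrightarrow> (\<integral>\<^sup>+x. ennreal (\<rho> (x - y)) \<partial>lborel) = 1"
  using mollifier_nn_integral[of \<epsilon> \<rho> y] by (simp add: mollifier_sym[of \<epsilon> \<rho> _ y])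

text \<open>Jensen's inequality for the probability density y |-> \<open>\<rho> (x - y)\<close>. For
  the exponent 2 it is the nonnegativity of the variance of \<open>f\<close> about its mean
  \<open>conv f \<rho> x\<close>; if the right side is infinite there is nothing to show.\<close>

lemma conv_power_le:
  assumes f: "integrable lborel f" and \<rho>: "mollifier \<epsilon> \<rho>" and p: "p = 1 \<or> p = 2"
  shows "ennreal (\<bar>conv f \<rho> x\<bar> ^ p) \<le> (\<integral>\<^sup>+y. ennreal (\<bar>f y\<bar> ^ p) * ennreal (\<rho> (x - y)) \<partial>lborel)"
proof -
  have [measurable]: "f \<in> borel_measurable borel" "\<rho> \<in> borel_measurable borel"
    using f mollifier_measurable[OF \<rho>] by auto
  have i1: "integrable lborel (\<lambda>y. f y * \<rho> (x - y))"
    using conv_integrable[OF f mollifier_smooth_kernel[OF \<rho>]] .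
  have eq: "(\<integral>\<^sup>+y. ennreal (\<bar>f y\<bar> ^ p) * ennreal (\<rho> (x - y)) \<partial>lborel)
      = (\<integral>\<^sup>+y. ennreal (\<bar>f y\<bar> ^ p * \<rho> (x - y)) \<partial>lborel)"
    by (simp add: ennreal_mult mollifier_nonneg[OF \<rho>])
  show ?thesis
  proof (cases "p = 1")
    case True
    have "\<bar>conv f \<rho> x\<bar> \<le> (LINT y|lborel. \<bar>f y * \<rho> (x - y)\<bar>)"
      unfolding conv_def by (rule integral_abs_bound)
    also have "\<dots> = (LINT y|lborel. \<bar>f y\<bar> * \<rho> (x - y))"
      by (simp add: abs_mult mollifier_nonneg[OF \<rho>])
    finally have "ennreal \<bar>conv f \<rho> x\<bar> \<le> ennreal (LINT y|lborel. \<bar>f y\<bar> * \<rho> (x - y))"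
      by (rule ennreal_leI)
    also have "\<dots> = (\<integral>\<^sup>+y. ennreal (\<bar>f y\<bar> * \<rho> (x - y)) \<partial>lborel)"
      using integrable_abs[OF i1]
      by (intro nn_integral_eq_integral[symmetric])
         (auto simp: abs_mult mollifier_nonneg[OF \<rho>])
    finally show ?thesis using True eq by simp
  next
    case False
    then have p2: "p = 2" using p by simp
    show ?thesis
    proof (cases "(\<integral>\<^sup>+y. ennreal (\<bar>f y\<bar> ^ 2 * \<rho> (x - y)) \<partial>lborel) = \<infinity>")
      case True
      then show ?thesis unfolding eq unfolding p2 by simp
    next
      case fin: False
      have i2: "integrable lborel (\<lambda>y. f y ^ 2 * \<rho> (x - y))"
        using fin by (intro integrableI_nonneg)
          (auto simp: mollifier_nonneg[OF \<rho>] top.not_eq_extremum)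
      define c where "c = conv f \<rho> x"
      have "0 \<le> (LINT y|lborel. (f y - c) ^ 2 * \<rho> (x - y))"
        by (intro integral_nonneg_AE AE_I2) (simp add: mollifier_nonneg[OF \<rho>])
      also have "\<dots> = (LINT y|lborel. f y ^ 2 * \<rho> (x - y) - 2 * c * (f y * \<rho> (x - y)) + c ^ 2 * \<rho> (x - y))"
        by (intro Bochner_Integration.integral_cong refl) (simp add: power2_diff algebra_simps)
      also have "\<dots> = (LINT y|lborel. f y ^ 2 * \<rho> (x - y)) - 2 * c * c + c ^ 2"
        using i1 i2 mollifier_integrable[OF \<rho>, of x] mollifier_integral[OF \<rho>, of x]
        by (simp add: c_def conv_def)
      finally have "c ^ 2 \<le> (LINT y|lborel. f y ^ 2 * \<rho> (x - y))"
        by (simp add: power2_eq_square)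
      then have "ennreal (c ^ 2) \<le> ennreal (LINT y|lborel. f y ^ 2 * \<rho> (x - y))"
        by (rule ennreal_leI)
      also have "\<dots> = (\<integral>\<^sup>+y. ennreal (f y ^ 2 * \<rho> (x - y)) \<partial>lborel)"
        using i2 by (intro nn_integral_eq_integral[symmetric]) (auto simp: mollifier_nonneg[OF \<rho>])
      finally show ?thesis unfolding eq unfolding p2 c_def by simp
    qed
  qed
qed

lemma nn_integral_conv:
  fixes g :: "'a::euclidean_space \<Rightarrow> ennreal"
  assumes [measurable]: "g \<in> borel_measurable borel" and \<rho>: "mollifier \<epsilon> \<rho>"
  shows "(\<integral>\<^sup>+x. (\<integral>\<^sup>+y. g y * ennreal (\<rho> (x - y)) \<partial>lborel) \<partial>lborel) = (\<integral>\<^sup>+y. g y \<partial>lborel)"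
proof -
  have [measurable]: "\<rho> \<in> borel_measurable borel" using mollifier_measurable[OF \<rho>] .
  have "(\<integral>\<^sup>+x. (\<integral>\<^sup>+y. g y * ennreal (\<rho> (x - y)) \<partial>lborel) \<partial>lborel)
      = (\<integral>\<^sup>+y. (\<integral>\<^sup>+x. g y * ennreal (\<rho> (x - y)) \<partial>lborel) \<partial>lborel)"
    by (rule lborel_pair.Fubini'[symmetric]) measurable
  also have "\<dots> = (\<integral>\<^sup>+y. g y \<partial>lborel)"
    by (simp add: nn_integral_cmult mollifier_nn_integral'[OF \<rho>])
  finally show ?thesis .
qed

lemma conv_Lp_contraction:
  assumes f: "integrable lborel f" and \<rho>: "mollifier \<epsilon> \<rho>" and p: "p = 1 \<or> p = 2"
  shows "(\<integral>\<^sup>+x. ennreal (\<bar>conv f \<rho> x\<bar> ^ p) \<partial>lborel) \<le> (\<integral>\<^sup>+x. ennreal (\<bar>f x\<bar> ^ p) \<partial>lborel)"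
proof -
  have "(\<integral>\<^sup>+x. ennreal (\<bar>conv f \<rho> x\<bar> ^ p) \<partial>lborel)
      \<le> (\<integral>\<^sup>+x. (\<integral>\<^sup>+y. ennreal (\<bar>f y\<bar> ^ p) * ennreal (\<rho> (x - y)) \<partial>lborel) \<partial>lborel)"
    by (intro nn_integral_mono conv_power_le[OF f \<rho> p])
  also have "\<dots> = (\<integral>\<^sup>+x. ennreal (\<bar>f x\<bar> ^ p) \<partial>lborel)"
    using f by (intro nn_integral_conv[OF _ \<rho>]) auto
  finally show ?thesis .
qed

text \<open>After Jensen and Tonelli, the slice of the convolution at time \<open>t\<close> is
  bounded by an average of the slice integrals of \<open>f\<close> over all times, with the time
  marginal of \<open>\<rho>\<close> as weight. A bound uniform in time survives this averaging,
  which the contraction in L^2 of spacetime would not show.\<close>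

lemma conv_slice_bound:
  fixes f :: "'a::euclidean_space \<times> 'b::euclidean_space \<Rightarrow> real"
  assumes f: "integrable lborel f" and \<rho>: "mollifier \<epsilon> \<rho>"
    and M: "\<And>s. (\<integral>\<^sup>+y. ennreal (\<bar>f (s, y)\<bar> ^ 2) \<partial>lborel) \<le> M"
  shows "(\<integral>\<^sup>+x. ennreal (\<bar>conv f \<rho> (t, x)\<bar> ^ 2) \<partial>lborel) \<le> M"
proof -
  have [measurable]: "f \<in> borel_measurable borel" "\<rho> \<in> borel_measurable borel"
    using f mollifier_measurable[OF \<rho>] by auto
  have [measurable]: "f \<in> borel_measurable (borel \<Otimes>\<^sub>M borel)" "\<rho> \<in> borel_measurable (borel \<Otimes>\<^sub>M borel)"
    by (simp_all add: borel_prod)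
  have mp [measurable]: "(\<lambda>(s, y). ennreal (\<bar>f (s, y)\<bar> ^ 2) * ennreal (\<rho> (t - s, x - y)))
      \<in> borel_measurable (lborel \<Otimes>\<^sub>M lborel)" for x
    by measurable
  \<comment> \<open>The time marginal of the mollifier; translation invariance in space removes the
    dependence on \<open>y\<close>, and its total mass is 1.\<close>
  define r where "r s = (\<integral>\<^sup>+x. ennreal (\<rho> (t - s, x)) \<partial>lborel)" for s
  have r: "(\<integral>\<^sup>+x. ennreal (\<rho> (t - s, x - y)) \<partial>lborel) = r s" for s y
  proof -
    have "(\<integral>\<^sup>+x. ennreal (\<rho> (t - s, - y + x)) \<partial>lborel) = r s"
      unfolding r_def by (rule nn_integral_translate) measurable
    then show ?thesis by simp
  qed
  have "(\<integral>\<^sup>+x. ennreal (\<bar>conv f \<rho> (t, x)\<bar> ^ 2) \<partial>lborel)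
      \<le> (\<integral>\<^sup>+x. (\<integral>\<^sup>+q. ennreal (\<bar>f q\<bar> ^ 2) * ennreal (\<rho> ((t, x) - q)) \<partial>lborel) \<partial>lborel)"
    by (intro nn_integral_mono conv_power_le[OF f \<rho>]) auto
  also have "\<dots> = (\<integral>\<^sup>+x. (\<integral>\<^sup>+q. (case q of (s, y) \<Rightarrow> ennreal (\<bar>f (s, y)\<bar> ^ 2) * ennreal (\<rho> (t - s, x - y)))
      \<partial>(lborel \<Otimes>\<^sub>M lborel)) \<partial>lborel)"
    by (simp add: lborel_prod case_prod_unfold minus_prod_def)
  also have "\<dots> = (\<integral>\<^sup>+x. (\<integral>\<^sup>+s. (\<integral>\<^sup>+y. ennreal (\<bar>f (s, y)\<bar> ^ 2) * ennreal (\<rho> (t - s, x - y)) \<partial>lborel) \<partial>lborel) \<partial>lborel)"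
    by (subst lborel.nn_integral_fst[symmetric]) (simp_all add: case_prod_unfold)
  also have "\<dots> = (\<integral>\<^sup>+s. (\<integral>\<^sup>+x. (\<integral>\<^sup>+y. ennreal (\<bar>f (s, y)\<bar> ^ 2) * ennreal (\<rho> (t - s, x - y)) \<partial>lborel) \<partial>lborel) \<partial>lborel)"
    by (rule lborel_pair.Fubini'[symmetric]) measurable
  also have "\<dots> = (\<integral>\<^sup>+s. (\<integral>\<^sup>+y. (\<integral>\<^sup>+x. ennreal (\<bar>f (s, y)\<bar> ^ 2) * ennreal (\<rho> (t - s, x - y)) \<partial>lborel) \<partial>lborel) \<partial>lborel)"
    by (intro nn_integral_cong lborel_pair.Fubini'[symmetric]) measurable
  also have "\<dots> = (\<integral>\<^sup>+s. (\<integral>\<^sup>+y. ennreal (\<bar>f (s, y)\<bar> ^ 2) \<partial>lborel) * r s \<partial>lborel)"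
    by (simp add: nn_integral_cmult nn_integral_multc r)
  also have "\<dots> \<le> (\<integral>\<^sup>+s. M * r s \<partial>lborel)"
    by (intro nn_integral_mono mult_right_mono M) auto
  also have "\<dots> = M * (\<integral>\<^sup>+s. r s \<partial>lborel)"
    unfolding r_def by (rule nn_integral_cmult) measurable
  also have "(\<integral>\<^sup>+s. r s \<partial>lborel) = (\<integral>\<^sup>+s. (\<integral>\<^sup>+x. ennreal (\<rho> (s, x)) \<partial>lborel) \<partial>lborel)"
    unfolding r_def by (rule nn_integral_reflect[of "\<lambda>s. \<integral>\<^sup>+x. ennreal (\<rho> (s, x)) \<partial>lborel"]) measurable
  also have "\<dots> = (\<integral>\<^sup>+q. ennreal (\<rho> q) \<partial>(lborel \<Otimes>\<^sub>M lborel))"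
    by (subst lborel.nn_integral_fst[symmetric]) simp_all
  also have "\<dots> = (\<integral>\<^sup>+q. ennreal (\<rho> (0 - q)) \<partial>lborel)"
    unfolding lborel_prod by (rule nn_integral_reflect[symmetric]) measurable
  also have "\<dots> = 1" by (rule mollifier_nn_integral[OF \<rho>])
  finally show ?thesis by simp
qed

section \<open>Density of continuous functions and convergence of mollifications\<close>

definition power_norm :: "nat \<Rightarrow> ('a::euclidean_space \<Rightarrow> real) \<Rightarrow> ennreal" where
  "power_norm p f = (\<integral>\<^sup>+x. ennreal (\<bar>f x\<bar> ^ p) \<partial>lborel)"

text \<open>\<open>power_norm\<close> is the norm without its root, so only a quasi-triangle
  inequality holds. Its factor comes from bounding |a + b| by twice the larger modulus and is
  harmless in limits.\<close>

lemma power_norm_add: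
  assumes [measurable]: "f \<in> borel_measurable borel" "g \<in> borel_measurable borel"
  shows "power_norm p (\<lambda>x. f x + g x) \<le> 2 ^ p * (power_norm p f + power_norm p g)"
proof -
  have le: "\<bar>a + b\<bar> ^ p \<le> 2 ^ p * (\<bar>a\<bar> ^ p + \<bar>b\<bar> ^ p)" for a b :: real
  proof -
    have "\<bar>a + b\<bar> ^ p \<le> (2 * max \<bar>a\<bar> \<bar>b\<bar>) ^ p" by (intro power_mono) auto
    also have "\<dots> = 2 ^ p * max \<bar>a\<bar> \<bar>b\<bar> ^ p" by (simp add: power_mult_distrib)
    also have "max \<bar>a\<bar> \<bar>b\<bar> ^ p \<le> \<bar>a\<bar> ^ p + \<bar>b\<bar> ^ p" by (simp add: max_def)
    finally show ?thesis by simp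
  qed
  have "power_norm p (\<lambda>x. f x + g x)
      \<le> (\<integral>\<^sup>+x. 2 ^ p * (ennreal (\<bar>f x\<bar> ^ p) + ennreal (\<bar>g x\<bar> ^ p)) \<partial>lborel)"
    unfolding power_norm_def
  proof (intro nn_integral_mono)
    fix x
    have "ennreal (\<bar>f x + g x\<bar> ^ p) \<le> ennreal (2 ^ p * (\<bar>f x\<bar> ^ p + \<bar>g x\<bar> ^ p))"
      by (intro ennreal_leI le)
    then show "ennreal (\<bar>f x + g x\<bar> ^ p) \<le> 2 ^ p * (ennreal (\<bar>f x\<bar> ^ p) + ennreal (\<bar>g x\<bar> ^ p))"
      by (simp add: ennreal_mult ennreal_power[symmetric])
  qed
  also have "\<dots> = 2 ^ p * (power_norm p f + power_norm p g)"
    unfolding power_norm_def by (simp add: nn_integral_cmult nn_integral_add)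
  finally show ?thesis .
qed

lemma ennreal_le_epsilon_exists:
  fixes X :: "nat \<Rightarrow> ennreal"
  assumes "X \<longlonglongrightarrow> 0" "0 < e"
  shows "\<exists>n. X n < e"
  using order_tendstoD(2)[OF assms] eventually_happens'[OF sequentially_bot] by blast

text \<open>The cut-off \<open>x \<mapsto> max 0 (min 1 (N + 1 - \<bar>x\<bar>))\<close> and truncation at height \<open>N\<close> reduce the
  approximation to the library fact that measurable functions are almost everywhere limits of
  continuous ones.\<close>

lemma power_norm_approx:
  fixes f :: "'a::euclidean_space \<Rightarrow> real"
  assumes f [measurable]: "f \<in> borel_measurable borel" and fin: "power_norm p f < \<infinity>" and p: "0 < p"
    and e: "0 < e"
  shows "\<exists>g r. continuous_on UNIV g \<and> (\<forall>x. r < norm x \<longrightarrow> g x = 0) \<and>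
    power_norm p (\<lambda>x. f x - g x) \<le> ennreal e"
proof -
  define c where "c N x = max 0 (min 1 (real N + 1 - norm x))" for N and x :: 'a
  define tr where "tr N y = max (- real N) (min (real N) y)" for N and y :: real
  have c_cont: "continuous_on UNIV (c N)" for N
    unfolding c_def by (intro continuous_intros)
  have c01: "0 \<le> c N x" "c N x \<le> 1" for N x by (auto simp: c_def)
  have c0: "c N x = 0" if "real N + 1 < norm x" for N x using that by (simp add: c_def)
  have tr_le: "\<bar>tr N y\<bar> \<le> real N" for N y by (auto simp: tr_def)
  have [measurable]: "c N \<in> borel_measurable borel" "tr N \<in> borel_measurable borel" for N
    unfolding c_def tr_def by measurable
  \<comment> \<open>Two errors below \<open>d\<close>, added with the factor \<open>2 ^ p\<close>,
    make up exactly \<open>e\<close>.\<close>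
  define d where "d = e / (2 * 2 ^ p)"
  have e2: "0 < ennreal d" using e by (simp add: d_def)
  define F where "F N x = tr N (f x) * c N x" for N x
  have [measurable]: "F N \<in> borel_measurable borel" for N unfolding F_def by measurable
  have "(\<lambda>N. power_norm p (\<lambda>x. f x - F N x)) \<longlonglongrightarrow> power_norm p (\<lambda>x::'a. 0)"
    unfolding power_norm_def
  proof (rule nn_integral_dominated_convergence[where w = "\<lambda>x. ennreal (\<bar>f x\<bar> ^ p)"])
    show "AE x in lborel. ennreal (\<bar>f x - F N x\<bar> ^ p) \<le> ennreal (\<bar>f x\<bar> ^ p)" for N
    proof (intro AE_I2 ennreal_leI power_mono)
      fix x
      have "0 \<le> f x * tr N (f x)"
        by (cases "0 \<le> f x") (auto simp: tr_def intro: mult_nonneg_nonneg mult_nonpos_nonpos)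
      then have "0 \<le> f x * F N x"
        using c01[of N x] by (simp add: F_def mult.assoc[symmetric])
      moreover have "\<bar>tr N (f x)\<bar> * c N x \<le> \<bar>tr N (f x)\<bar>"
        using c01[of N x] by (intro mult_right_le_one_le) auto
      moreover have "\<bar>tr N (f x)\<bar> \<le> \<bar>f x\<bar>" by (auto simp: tr_def)
      ultimately have "\<bar>F N x\<bar> \<le> \<bar>f x\<bar>"
        using c01[of N x] unfolding F_def abs_mult by simp
      with \<open>0 \<le> f x * F N x\<close> show "\<bar>f x - F N x\<bar> \<le> \<bar>f x\<bar>" by (auto simp: zero_le_mult_iff)
    qed simp
    show "AE x in lborel. (\<lambda>N. ennreal (\<bar>f x - F N x\<bar> ^ p)) \<longlonglongrightarrow> ennreal (\<bar>0\<bar> ^ p)"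
    proof (intro AE_I2)
      fix x
      obtain n0 :: nat where n0: "\<bar>f x\<bar> + norm x < real n0" using reals_Archimedean2 by blast
      have "F N x = f x" if "n0 \<le> N" for N
      proof -
        have "\<bar>f x\<bar> + norm x < real N" using n0 that by linarith
        then have "\<bar>f x\<bar> < real N" "norm x < real N" using norm_ge_zero[of x] by linarith+
        then have "tr N (f x) = f x" "c N x = 1" by (auto simp: tr_def c_def)
        then show ?thesis by (simp add: F_def)
      qed
      then have "\<forall>\<^sub>F N in sequentially. ennreal (\<bar>f x - F N x\<bar> ^ p) = ennreal (\<bar>0\<bar> ^ p)"
        by (intro eventually_sequentiallyI[of n0]) auto
      then show "(\<lambda>N. ennreal (\<bar>f x - F N x\<bar> ^ p)) \<longlonglongrightarrow> ennreal (\<bar>0\<bar> ^ p)"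
        by (rule tendsto_eventually)
    qed
  qed (use fin in \<open>auto simp: power_norm_def\<close>)
  moreover have "power_norm p (\<lambda>x::'a. 0) = 0" using p by (simp add: power_norm_def zero_power)
  ultimately have "(\<lambda>N. power_norm p (\<lambda>x. f x - F N x)) \<longlonglongrightarrow> 0" by simp
  from ennreal_le_epsilon_exists[OF this e2]
  obtain N where N: "power_norm p (\<lambda>x. f x - F N x) < ennreal d" by blast
  have "f measurable_on UNIV"
    using measurable_completion[of f lborel borel] by (subst measurable_on_iff_borel_measurable) auto
  then obtain Z h where Z: "negligible Z" and h: "\<And>n. continuous_on UNIV (h n)"
    "\<And>x. x \<notin> Z \<Longrightarrow> (\<lambda>n. h n x) \<longlonglongrightarrow> f x"
    unfolding measurable_on_def by auto
  \<comment> \<open>The continuous approximants receive the same truncation and cut-off as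
    \<open>f\<close>. The differences are then bounded by \<open>2 * real N\<close> on a fixed ball
    and vanish outside it, so dominated convergence applies.\<close>
  define H where "H n x = tr N (h n x) * c N x" for n x
  have H_cont: "continuous_on UNIV (H n)" for n
    unfolding H_def tr_def by (intro continuous_intros h c_cont)
  have [measurable]: "H n \<in> borel_measurable borel" for n
    by (intro borel_measurable_continuous_onI H_cont)
  have Z_AE: "AE x in lborel. x \<notin> Z"
    using AE_not_in[of Z lebesgue] Z by (simp add: negligible_iff_null_sets AE_completion_iff)
  have [measurable]: "cball (0::'a) (real N + 1) \<in> sets borel" by simp
  have "(\<lambda>n. power_norm p (\<lambda>x. F N x - H n x)) \<longlonglongrightarrow> power_norm p (\<lambda>x::'a. 0)"
    unfolding power_norm_def
  proof (rule nn_integral_dominated_convergence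
      [where w = "\<lambda>x. ennreal ((2 * real N) ^ p) * indicator (cball 0 (real N + 1)) x"])
    show "AE x in lborel. ennreal (\<bar>F N x - H n x\<bar> ^ p)
        \<le> ennreal ((2 * real N) ^ p) * indicator (cball 0 (real N + 1)) x" for n
    proof (intro AE_I2)
      fix x
      have "F N x - H n x = (tr N (f x) - tr N (h n x)) * c N x"
        by (simp add: F_def H_def left_diff_distrib)
      then have "\<bar>F N x - H n x\<bar> = \<bar>tr N (f x) - tr N (h n x)\<bar> * c N x"
        using c01[of N x] by (simp add: abs_mult)
      also have "\<dots> \<le> (2 * real N) * 1"
        using tr_le[of N "f x"] tr_le[of N "h n x"] c01[of N x] by (intro mult_mono) auto
      finally have "\<bar>F N x - H n x\<bar> ^ p \<le> (2 * real N) ^ p" by (intro power_mono) auto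
      moreover have "F N x - H n x = 0" if "x \<notin> cball 0 (real N + 1)"
        using that c0[of N x] by (simp add: F_def H_def)
      ultimately show "ennreal (\<bar>F N x - H n x\<bar> ^ p)
          \<le> ennreal ((2 * real N) ^ p) * indicator (cball 0 (real N + 1)) x"
        using p by (cases "x \<in> cball 0 (real N + 1)") (auto intro: ennreal_leI simp: zero_power)
    qed
    show "AE x in lborel. (\<lambda>n. ennreal (\<bar>F N x - H n x\<bar> ^ p)) \<longlonglongrightarrow> ennreal (\<bar>0\<bar> ^ p)"
      using Z_AE
    proof (elim AE_mp, intro AE_I2 impI)
      fix x assume "x \<notin> Z"
      then have "(\<lambda>n. H n x) \<longlonglongrightarrow> F N x"
        unfolding H_def F_def tr_def by (intro tendsto_intros h)
      then have "(\<lambda>n. \<bar>F N x - H n x\<bar> ^ p) \<longlonglongrightarrow> \<bar>F N x - F N x\<bar> ^ p"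
        by (intro tendsto_intros)
      then show "(\<lambda>n. ennreal (\<bar>F N x - H n x\<bar> ^ p)) \<longlonglongrightarrow> ennreal (\<bar>0\<bar> ^ p)"
        by (intro tendsto_ennrealI) simp
    qed
    show "(\<integral>\<^sup>+x. ennreal ((2 * real N) ^ p) * indicator (cball 0 (real N + 1)) (x::'a) \<partial>lborel) < \<infinity>"
      using emeasure_compact_finite[OF compact_cball, of "0::'a" "real N + 1"]
      by (simp add: nn_integral_cmult_indicator ennreal_mult_less_top)
  qed measurable
  moreover have "power_norm p (\<lambda>x::'a. 0) = 0" using p by (simp add: power_norm_def zero_power)
  ultimately have "(\<lambda>n. power_norm p (\<lambda>x. F N x - H n x)) \<longlonglongrightarrow> 0" by simp
  from ennreal_le_epsilon_exists[OF this e2]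
  obtain n where n: "power_norm p (\<lambda>x. F N x - H n x) < ennreal d" by blast
  have "power_norm p (\<lambda>x. f x - H n x) = power_norm p (\<lambda>x. (f x - F N x) + (F N x - H n x))"
    by simp
  also have "\<dots> \<le> 2 ^ p * (power_norm p (\<lambda>x. f x - F N x) + power_norm p (\<lambda>x. F N x - H n x))"
    by (intro power_norm_add) measurable
  also have "\<dots> \<le> 2 ^ p * (ennreal d + ennreal d)"
    using N n by (intro mult_left_mono add_mono) auto
  also have "\<dots> = ennreal (2 ^ p * (d + d))"
  proof -
    have "2 ^ p * ennreal y = ennreal (2 ^ p * y)" if "0 \<le> y" for y
      using that by (simp add: ennreal_mult ennreal_power[symmetric])
    moreover have "0 \<le> d" using e by (simp add: d_def)
    then have "ennreal d + ennreal d = ennreal (d + d)" "0 \<le> d + d"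
      by (simp_all only: ennreal_plus add_nonneg_nonneg)
    ultimately show ?thesis by simp
  qed
  also have "2 ^ p * (d + d) = e" by (simp add: d_def)
  finally have "power_norm p (\<lambda>x. f x - H n x) \<le> ennreal e" .
  moreover have "\<forall>x. real N + 1 < norm x \<longrightarrow> H n x = 0" using c0 by (simp add: H_def)
  ultimately show ?thesis using H_cont by blast
qed


text \<open>Continuity is uniform on the compact ball of radius \<open>r + 1\<close>. With steps
  shorter than 1, a pair of points not both in this ball lies entirely outside the support.\<close>

lemma bounded_support_uniformly_continuous:
  fixes g :: "'a::euclidean_space \<Rightarrow> real"
  assumes g: "continuous_on UNIV g" and r: "\<And>x. r < norm x \<Longrightarrow> g x = 0"
  shows "uniformly_continuous_on UNIV g"
  unfolding uniformly_continuous_on_def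
proof (intro allI impI)
  fix e :: real assume e: "0 < e"
  have "uniformly_continuous_on (cball 0 (r + 1)) g"
    by (intro compact_uniformly_continuous continuous_on_subset[OF g]) auto
  then obtain d where d: "0 < d"
    "\<And>x y. x \<in> cball 0 (r + 1) \<Longrightarrow> y \<in> cball 0 (r + 1) \<Longrightarrow> dist y x < d \<Longrightarrow> dist (g y) (g x) < e"
    using e unfolding uniformly_continuous_on_def by meson
  have "dist (g y) (g x) < e" if "dist y x < min d 1" for x y
  proof (cases "x \<in> cball 0 (r + 1) \<and> y \<in> cball 0 (r + 1)")
    case True
    then show ?thesis using d that by auto
  next
    case False
    have "norm y \<le> norm x + dist y x" "norm x \<le> norm y + dist y x"
      using norm_triangle_sub[of y x] norm_triangle_sub[of x y] by (auto simp: dist_norm norm_minus_commute)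
    then have "r < norm x" "r < norm y" using False that by auto
    then show ?thesis using r e by simp
  qed
  then show "\<exists>d>0. \<forall>x\<in>UNIV. \<forall>x'\<in>UNIV. dist x' x < d \<longrightarrow> dist (g x') (g x) < e"
    using d(1) by (intro exI[of _ "min d 1"]) auto
qed

lemma mollifier_uniform_approx:
  fixes g :: "'a::euclidean_space \<Rightarrow> real"
  assumes g: "integrable lborel g" and \<rho>: "mollifier \<epsilon> \<rho>"
    and close: "\<And>x y. norm (x - y) < \<epsilon> \<Longrightarrow> \<bar>g y - g x\<bar> \<le> e"
    and e: "0 \<le> e"
  shows "\<bar>conv g \<rho> x - g x\<bar> \<le> e"
proof -
  have i: "integrable lborel (\<lambda>y. g y * \<rho> (x - y))"
    using conv_integrable[OF g mollifier_smooth_kernel[OF \<rho>]] .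
  have i2: "integrable lborel (\<lambda>y. g x * \<rho> (x - y))"
    using mollifier_integrable[OF \<rho>] by simp
  have "conv g \<rho> x - g x = (LINT y|lborel. g y * \<rho> (x - y)) - (LINT y|lborel. g x * \<rho> (x - y))"
    by (simp add: conv_def mollifier_integral[OF \<rho>])
  also have "\<dots> = (LINT y|lborel. (g y - g x) * \<rho> (x - y))"
    using i i2 by (simp add: left_diff_distrib)
  finally have "\<bar>conv g \<rho> x - g x\<bar> \<le> (LINT y|lborel. \<bar>(g y - g x) * \<rho> (x - y)\<bar>)"
    using integral_abs_bound by metis
  also have "\<dots> \<le> (LINT y|lborel. e * \<rho> (x - y))"
  proof (rule integral_mono')
    show "integrable lborel (\<lambda>y. e * \<rho> (x - y))"
      using mollifier_integrable[OF \<rho>] by simp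
    fix y
    show "\<bar>(g y - g x) * \<rho> (x - y)\<bar> \<le> e * \<rho> (x - y)"
    proof (cases "norm (x - y) < \<epsilon>")
      case True
      then show ?thesis using close mollifier_nonneg[OF \<rho>] by (auto simp: abs_mult intro!: mult_right_mono)
    next
      case False
      then have "\<rho> (x - y) = 0" using \<rho> by (simp add: mollifier_def)
      then show ?thesis by simp
    qed
    show "0 \<le> e * \<rho> (x - y)" using e mollifier_nonneg[OF \<rho>] by simp
  qed
  also have "\<dots> = e" by (simp add: mollifier_integral[OF \<rho>])
  finally show ?thesis .
qed

text \<open>Uniform continuity makes the mollification uniformly close, and for
  \<open>\<epsilon> n < 1\<close> the difference lives in the ball of radius \<open>r + 1\<close>;
  the \<open>p\<close>-th power of the error times the volume \<open>V\<close> of that ball bounds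
  the norm.\<close>

lemma mollifier_power_norm_continuous:
  fixes g :: "'a::euclidean_space \<Rightarrow> real"
  assumes g: "continuous_on UNIV g" and r: "\<And>x. r < norm x \<Longrightarrow> g x = 0" and p: "0 < p"
    and \<rho>: "\<And>n. mollifier (\<epsilon> n) (\<rho> n)" and \<epsilon>: "\<epsilon> \<longlonglongrightarrow> 0"
  shows "(\<lambda>n. power_norm p (\<lambda>x. conv g (\<rho> n) x - g x)) \<longlonglongrightarrow> 0"
proof -
  have gi: "integrable lborel g" by (rule continuous_bounded_support_integrable[OF g r])
  have [measurable]: "conv g (\<rho> n) \<in> borel_measurable borel" for n
    by (rule conv_measurable[OF gi mollifier_smooth_kernel[OF \<rho>]])
  have [measurable]: "g \<in> borel_measurable borel" using gi by auto
  have uc: "uniformly_continuous_on UNIV g" by (rule bounded_support_uniformly_continuous[OF g r])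
  have unif: "\<forall>\<^sub>F n in sequentially. \<forall>x. \<bar>conv g (\<rho> n) x - g x\<bar> \<le> e" if e: "0 < e" for e
  proof -
    obtain d where d: "0 < d" "\<And>x y. dist y x < d \<Longrightarrow> dist (g y) (g x) < e"
      using uc e unfolding uniformly_continuous_on_def by (metis UNIV_I)
    have "\<forall>\<^sub>F n in sequentially. \<epsilon> n < d" using order_tendstoD(2)[OF \<epsilon> d(1)] .
    then show ?thesis
    proof (rule eventually_mono, intro allI)
      fix n and x :: 'a assume n: "\<epsilon> n < d"
      show "\<bar>conv g (\<rho> n) x - g x\<bar> \<le> e"
        by (rule mollifier_uniform_approx[OF gi \<rho> _ less_imp_le[OF e]])
           (use d(2) n e in \<open>force simp: dist_norm norm_minus_commute intro: less_imp_le\<close>)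
    qed
  qed
  have supp: "\<forall>\<^sub>F n in sequentially. \<forall>x. r + 1 < norm x \<longrightarrow> conv g (\<rho> n) x - g x = 0"
  proof -
    have "\<forall>\<^sub>F n in sequentially. \<epsilon> n < 1" using order_tendstoD(2)[OF \<epsilon>, of 1] by simp
    then show ?thesis
    proof (rule eventually_mono, intro allI impI)
      fix n and x :: 'a assume n: "\<epsilon> n < 1" and x: "r + 1 < norm x"
      have "conv g (\<rho> n) x = 0"
      proof (rule conv_eq_0[of "\<epsilon> n"])
        show "\<rho> n z = 0" if "\<epsilon> n < norm z" for z using \<rho>[of n] that by (simp add: mollifier_def)
        fix y assume "norm (x - y) \<le> \<epsilon> n"
        then have "r < norm y" using n x norm_triangle_sub[of x y] by linarith
        then show "g y = 0" by (rule r)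
      qed
      then show "conv g (\<rho> n) x - g x = 0" using r[of x] x by simp
    qed
  qed
  obtain V where V: "emeasure lborel (cball (0::'a) (r + 1)) = ennreal V" "0 \<le> V"
    using emeasure_compact_finite[OF compact_cball, of "0::'a" "r + 1"]
    by (cases "emeasure lborel (cball (0::'a) (r + 1))") auto
  show ?thesis
  proof (rule tendsto_zero_ennreal)
    fix e :: real assume e: "0 < e"
    \<comment> \<open>Being at most 1, \<open>d\<close> dominates its own \<open>p\<close>-th power;
      the \<open>+ 1\<close> in the denominator allows the volume to be 0.\<close>
    define d where "d = min 1 (e / (2 * (V + 1)))"
    have d: "0 < d" "d \<le> 1" using e V by (auto simp: d_def)
    have "d ^ p \<le> d" using d p power_decreasing[of 1 p d] by simp
    then have "d ^ p * V \<le> d * V" using V by (intro mult_right_mono)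
    also have "\<dots> \<le> (e / (2 * (V + 1))) * V" unfolding d_def using V by (intro mult_right_mono) auto
    also have "\<dots> < e"
    proof -
      have "0 < V * e + e * 2" using e V by (intro add_nonneg_pos) auto
      then show ?thesis using V by (simp add: field_simps)
    qed
    finally have small: "d ^ p * V < e" .
    show "\<forall>\<^sub>F n in sequentially. power_norm p (\<lambda>x. conv g (\<rho> n) x - g x) < ennreal e"
      using unif[OF d(1)] supp
    proof eventually_elim
      case (elim n)
      have "power_norm p (\<lambda>x. conv g (\<rho> n) x - g x)
          \<le> (\<integral>\<^sup>+x. ennreal (d ^ p) * indicator (cball 0 (r + 1)) (x::'a) \<partial>lborel)"
        unfolding power_norm_def
      proof (intro nn_integral_mono)
        fix x
        show "ennreal (\<bar>conv g (\<rho> n) x - g x\<bar> ^ p) \<le> ennreal (d ^ p) * indicator (cball 0 (r + 1)) x"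
        proof (cases "x \<in> cball 0 (r + 1)")
          case True
          then show ?thesis using elim(1) by (auto intro!: ennreal_leI power_mono)
        next
          case False
          then have "conv g (\<rho> n) x - g x = 0" using elim(2) by simp
          then show ?thesis using p by (simp only: abs_zero zero_power) simp
        qed
      qed
      also have "\<dots> = ennreal (d ^ p * V)"
        using V d by (simp add: nn_integral_cmult_indicator ennreal_mult)
      also have "\<dots> < ennreal e" using small e by (simp add: ennreal_less_iff d V less_imp_le)
      finally show ?case .
    qed
  qed
qed

text \<open>Density argument: \<open>f\<close> is close to a continuous \<open>g\<close> of bounded
  support, mollification does not increase the distance, and for \<open>g\<close> itself convergence
  is known. The exponents are those for which the contraction property was shown.\<close>

theorem mollifier_power_norm_tendsto:
  fixes f :: "'a::euclidean_space \<Rightarrow> real"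
  assumes f: "integrable lborel f" and fin: "power_norm p f < \<infinity>" and p: "p = 1 \<or> p = 2"
    and \<rho>: "\<And>n. mollifier (\<epsilon> n) (\<rho> n)" and \<epsilon>: "\<epsilon> \<longlonglongrightarrow> 0"
  shows "(\<lambda>n. power_norm p (\<lambda>x. conv f (\<rho> n) x - f x)) \<longlonglongrightarrow> 0"
proof (rule tendsto_zero_ennreal)
  fix e :: real assume e: "0 < e"
  have p0: "0 < p" using p by auto
  have [measurable]: "f \<in> borel_measurable borel" using f by auto
  \<comment> \<open>The quasi-triangle inequality is used twice, so three errors \<open>d\<close>
    cost at most \<open>3 * 4 ^ p * d\<close>, which is three quarters of \<open>e\<close>.\<close>
  define d where "d = e / (4 * 4 ^ p)"
  have d: "0 < d" using e by (simp add: d_def)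
  obtain g r where g: "continuous_on UNIV g" "\<And>x. r < norm x \<Longrightarrow> g x = 0"
    "power_norm p (\<lambda>x. f x - g x) \<le> ennreal d"
    using power_norm_approx[OF _ fin p0 d] by auto
  have gi: "integrable lborel g" by (rule continuous_bounded_support_integrable[OF g(1,2)])
  have [measurable]: "conv g (\<rho> n) \<in> borel_measurable borel" "conv f (\<rho> n) \<in> borel_measurable borel" for n
    using conv_measurable[OF gi mollifier_smooth_kernel[OF \<rho>]]
      conv_measurable[OF f mollifier_smooth_kernel[OF \<rho>]] by auto
  have [measurable]: "g \<in> borel_measurable borel" using gi by auto
  have "\<forall>\<^sub>F n in sequentially. power_norm p (\<lambda>x. conv g (\<rho> n) x - g x) < ennreal d"
    by (rule order_tendstoD(2)[OF mollifier_power_norm_continuous[OF g(1,2) p0 \<rho> \<epsilon>]]) (use d in auto)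
  then show "\<forall>\<^sub>F n in sequentially. power_norm p (\<lambda>x. conv f (\<rho> n) x - f x) < ennreal e"
  proof eventually_elim
    case (elim n)
    have lin: "conv f (\<rho> n) x - conv g (\<rho> n) x = conv (\<lambda>y. f y - g y) (\<rho> n) x" for x
      using conv_integrable[OF f mollifier_smooth_kernel[OF \<rho>]] conv_integrable[OF gi mollifier_smooth_kernel[OF \<rho>]]
      by (simp add: conv_def left_diff_distrib)
    have 1: "power_norm p (\<lambda>x. conv f (\<rho> n) x - conv g (\<rho> n) x) \<le> ennreal d"
      unfolding lin
      using conv_Lp_contraction[OF _ \<rho>[of n] p, of "\<lambda>y. f y - g y"] f gi g(3)
      unfolding power_norm_def by (auto intro: order_trans)
    have 2: "power_norm p (\<lambda>x. g x - f x) \<le> ennreal d"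
      using g(3) by (simp add: power_norm_def abs_minus_commute)
    have 3: "power_norm p (\<lambda>x. (conv g (\<rho> n) x - g x) + (g x - f x)) \<le> 2 ^ p * (ennreal d + ennreal d)"
      by (rule order_trans[OF power_norm_add]) (use elim 2 in \<open>auto intro!: mult_left_mono add_mono\<close>)
    have "power_norm p (\<lambda>x. conv f (\<rho> n) x - f x)
      = power_norm p (\<lambda>x. (conv f (\<rho> n) x - conv g (\<rho> n) x) + ((conv g (\<rho> n) x - g x) + (g x - f x)))"
      by simp
    also have "\<dots> \<le> 2 ^ p * (ennreal d + 2 ^ p * (ennreal d + ennreal d))"
      by (rule order_trans[OF power_norm_add]) (use 1 3 in \<open>auto intro!: mult_left_mono add_mono\<close>)
    also have "\<dots> = ennreal (2 ^ p * (d + 2 ^ p * (d + d)))"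
    proof -
      have "2 ^ p * ennreal y = ennreal (2 ^ p * y)" if "0 \<le> y" for y
        using that by (simp add: ennreal_mult ennreal_power[symmetric])
      then show ?thesis using d by (simp add: ennreal_plus[symmetric] del: ennreal_plus)
    qed
    also have "\<dots> < ennreal e"
    proof (rule ennreal_lessI[OF e])
      have "2 ^ p * (d + 2 ^ p * (d + d)) \<le> 2 ^ p * (2 ^ p * d + 2 ^ p * (d + d))"
        using d by (intro mult_left_mono add_right_mono) (auto simp: le_diff_eq)
      also have "\<dots> = 3 * 4 ^ p * d"
        by (simp add: algebra_simps power_mult_distrib[symmetric])
      also have "\<dots> < e" using e by (simp add: d_def field_simps)
      finally show "2 ^ p * (d + 2 ^ p * (d + d)) < e" .
    qed
    finally show ?case .
  qed
qed

section \<open>Square-integrable functions and weak derivatives\<close>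

text \<open>Young's inequality with the weights \<open>B / (2 * A)\<close> and
  \<open>A / (2 * B)\<close>, chosen so that each square contributes half of \<open>A * B\<close>.
  These weights require positive bounds, hence the separate cases in which one factor vanishes
  almost everywhere. Real bounds instead of norms keep roots of extended reals out.\<close>

lemma nn_integral_cauchy_schwarz:
  fixes f g :: "'a \<Rightarrow> real"
  assumes [measurable]: "f \<in> borel_measurable M" "g \<in> borel_measurable M"
    and A: "(\<integral>\<^sup>+x. ennreal (\<bar>f x\<bar> ^ 2) \<partial>M) \<le> ennreal (A ^ 2)" "0 \<le> A"
    and B: "(\<integral>\<^sup>+x. ennreal (\<bar>g x\<bar> ^ 2) \<partial>M) \<le> ennreal (B ^ 2)" "0 \<le> B"
  shows "(\<integral>\<^sup>+x. ennreal \<bar>f x * g x\<bar> \<partial>M) \<le> ennreal (A * B)"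
proof -
  have zero: "(\<integral>\<^sup>+x. ennreal \<bar>h x * k x\<bar> \<partial>M) = 0"
    if [measurable]: "h \<in> borel_measurable M" and h0: "(\<integral>\<^sup>+x. ennreal (\<bar>h x\<bar> ^ 2) \<partial>M) \<le> ennreal (0 ^ 2)"
    for h k :: "'a \<Rightarrow> real"
  proof -
    have "(\<integral>\<^sup>+x. ennreal (\<bar>h x\<bar> ^ 2) \<partial>M) = 0" using h0 by simp
    then have "AE x in M. ennreal (\<bar>h x\<bar> ^ 2) = 0"
      by (subst (asm) nn_integral_0_iff_AE) auto
    then have "AE x in M. ennreal \<bar>h x * k x\<bar> = 0" by (rule AE_mp) (auto intro!: AE_I2)
    then have "(\<integral>\<^sup>+x. ennreal \<bar>h x * k x\<bar> \<partial>M) = (\<integral>\<^sup>+x. 0 \<partial>M)" by (rule nn_integral_cong_AE)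
    then show ?thesis by simp
  qed
  consider "A = 0" | "B = 0" | "0 < A" "0 < B" using A B by linarith
  then show ?thesis
  proof cases
    case 1
    then show ?thesis using zero[of f g] A by simp
  next
    case 2
    then show ?thesis using zero[of g f] B by (simp add: mult.commute)
  next
    case 3
    define a where "a = B / (2 * A)"
    define b where "b = A / (2 * B)"
    have ab: "0 \<le> a" "0 \<le> b" using 3 by (auto simp: a_def b_def)
    have le: "\<bar>f x * g x\<bar> \<le> a * \<bar>f x\<bar> ^ 2 + b * \<bar>g x\<bar> ^ 2" for x
    proof -
      have "0 \<le> (B * \<bar>f x\<bar> - A * \<bar>g x\<bar>) ^ 2 / (2 * A * B)" using 3 by simp
      also have "\<dots> = a * \<bar>f x\<bar> ^ 2 + b * \<bar>g x\<bar> ^ 2 - \<bar>f x * g x\<bar>"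
        using 3 by (simp add: a_def b_def power2_diff power2_eq_square abs_mult field_simps)
      finally show ?thesis by simp
    qed
    have "(\<integral>\<^sup>+x. ennreal \<bar>f x * g x\<bar> \<partial>M)
        \<le> (\<integral>\<^sup>+x. ennreal a * ennreal (\<bar>f x\<bar> ^ 2) + ennreal b * ennreal (\<bar>g x\<bar> ^ 2) \<partial>M)"
    proof (intro nn_integral_mono)
      fix x
      have "ennreal \<bar>f x * g x\<bar> \<le> ennreal (a * \<bar>f x\<bar> ^ 2 + b * \<bar>g x\<bar> ^ 2)"
        by (intro ennreal_leI le)
      then show "ennreal \<bar>f x * g x\<bar> \<le> ennreal a * ennreal (\<bar>f x\<bar> ^ 2) + ennreal b * ennreal (\<bar>g x\<bar> ^ 2)"
        using ab by (simp add: ennreal_mult ennreal_plus)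
    qed
    also have "\<dots> = ennreal a * (\<integral>\<^sup>+x. ennreal (\<bar>f x\<bar> ^ 2) \<partial>M) + ennreal b * (\<integral>\<^sup>+x. ennreal (\<bar>g x\<bar> ^ 2) \<partial>M)"
      by (simp add: nn_integral_add nn_integral_cmult)
    also have "\<dots> \<le> ennreal a * ennreal (A ^ 2) + ennreal b * ennreal (B ^ 2)"
      by (intro add_mono mult_left_mono A B) auto
    also have "\<dots> = ennreal (a * A ^ 2 + b * B ^ 2)"
      using ab by (simp add: ennreal_mult ennreal_plus)
    also have "a * A ^ 2 + b * B ^ 2 = A * B"
      using 3 by (simp add: a_def b_def power2_eq_square)
    finally show ?thesis .
  qed
qed

lemma power_norm_2_bound:
  assumes "power_norm 2 f < \<infinity>"
  shows "\<exists>A. 0 \<le> A \<and> power_norm 2 f \<le> ennreal (A ^ 2)"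
proof -
  obtain r where r: "0 \<le> r" "power_norm 2 f = ennreal r"
    using assms by (cases "power_norm 2 f") auto
  then show ?thesis by (intro exI[of _ "sqrt r"]) simp
qed

lemma integrable_mult_L2:
  fixes f g :: "'a::euclidean_space \<Rightarrow> real"
  assumes [measurable]: "f \<in> borel_measurable borel" "g \<in> borel_measurable borel"
    and f: "power_norm 2 f < \<infinity>" and g: "power_norm 2 g < \<infinity>"
  shows "integrable lborel (\<lambda>x. f x * g x)"
proof (rule integrableI_bounded)
  obtain A B where A: "0 \<le> A" "power_norm 2 f \<le> ennreal (A ^ 2)"
    and B: "0 \<le> B" "power_norm 2 g \<le> ennreal (B ^ 2)"
    using power_norm_2_bound f g by metis
  have "(\<integral>\<^sup>+x. ennreal \<bar>f x * g x\<bar> \<partial>lborel) \<le> ennreal (A * B)"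
    using A B by (intro nn_integral_cauchy_schwarz) (auto simp: power_norm_def)
  then show "(\<integral>\<^sup>+x. ennreal (norm (f x * g x)) \<partial>lborel) < \<infinity>"
    using le_less_trans by fastforce
qed simp

text \<open>The difference of the products is (F - f)(G - g) + (F - f) g + f (G - g), and
  Cauchy-Schwarz handles each term. This is the mode of convergence for the quadratic expressions in
  mollified derivatives, with a bounded factor taken from the multiplier.\<close>

lemma L2_pair_tendsto:
  fixes f g :: "'a::euclidean_space \<Rightarrow> real"
  assumes [measurable]: "f \<in> borel_measurable borel" "g \<in> borel_measurable borel"
      "\<psi> \<in> borel_measurable borel"
      "\<And>n. F n \<in> borel_measurable borel" "\<And>n. G n \<in> borel_measurable borel"
    and \<psi>: "\<And>x. \<bar>\<psi> x\<bar> \<le> C"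
    and fin: "power_norm 2 f < \<infinity>" "power_norm 2 g < \<infinity>"
      "\<And>n. power_norm 2 (F n) < \<infinity>" "\<And>n. power_norm 2 (G n) < \<infinity>"
    and F: "(\<lambda>n. power_norm 2 (\<lambda>x. F n x - f x)) \<longlonglongrightarrow> 0"
    and G: "(\<lambda>n. power_norm 2 (\<lambda>x. G n x - g x)) \<longlonglongrightarrow> 0"
  shows "(\<lambda>n. LINT x|lborel. \<psi> x * (F n x * G n x)) \<longlonglongrightarrow> (LINT x|lborel. \<psi> x * (f x * g x))"
proof (rule tendsto_L1_int)
  have C: "0 \<le> C" using \<psi>[of 0] by linarith
  have int: "integrable lborel (\<lambda>x. \<psi> x * (u x * v x))"
    if [measurable]: "u \<in> borel_measurable borel" "v \<in> borel_measurable borel"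
      and "power_norm 2 u < \<infinity>" "power_norm 2 v < \<infinity>" for u v
    using integrable_mult_bounded[OF integrable_mult_L2[OF that], of \<psi> C] \<psi>
    by (simp add: mult.commute)
  show "integrable lborel (\<lambda>x. \<psi> x * (F n x * G n x))" for n by (intro int fin) auto
  show "integrable lborel (\<lambda>x. \<psi> x * (f x * g x))" by (intro int fin) auto
  obtain A B where A: "0 \<le> A" "power_norm 2 f \<le> ennreal (A ^ 2)"
    and B: "0 \<le> B" "power_norm 2 g \<le> ennreal (B ^ 2)"
    using power_norm_2_bound fin(1,2) by metis
  show "(\<lambda>n. \<integral>\<^sup>+x. ennreal (norm (\<psi> x * (F n x * G n x) - \<psi> x * (f x * g x))) \<partial>lborel) \<longlonglongrightarrow> 0"
  proof (rule tendsto_zero_ennreal)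
    fix e :: real assume e: "0 < e"
    \<comment> \<open>The minimum with 1 absorbs \<open>d * d\<close> into \<open>d\<close>; the
      total is then at most \<open>(C + 1) * (d * (1 + A + B))\<close>, which is at most half of
      \<open>e\<close>.\<close>
    define d where "d = min 1 (e / (2 * (C + 1) * (1 + A + B)))"
    have d: "0 < d" "d \<le> 1" using e C A B by (auto simp: d_def intro!: divide_pos_pos mult_pos_pos)
    have small: "C * (d * d + d * B + A * d) < e"
    proof -
      have "d * d \<le> d * 1" using d by (intro mult_left_mono) auto
      then have "d * d + d * B + A * d \<le> d * (1 + A + B)" by (simp add: algebra_simps)
      then have "C * (d * d + d * B + A * d) \<le> (C + 1) * (d * (1 + A + B))"
        using C d A B by (intro mult_mono) auto
      also have "\<dots> \<le> (C + 1) * ((e / (2 * (C + 1) * (1 + A + B))) * (1 + A + B))"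
        using C A B by (intro mult_left_mono mult_right_mono) (auto simp: d_def)
      also have "\<dots> = e / 2"
        using C A B by (simp add: field_simps add_nonneg_eq_0_iff)
      finally show ?thesis using e by simp
    qed
    have "\<forall>\<^sub>F n in sequentially. power_norm 2 (\<lambda>x. F n x - f x) < ennreal (d ^ 2)"
      by (rule order_tendstoD(2)[OF F]) (use d in auto)
    moreover have "\<forall>\<^sub>F n in sequentially. power_norm 2 (\<lambda>x. G n x - g x) < ennreal (d ^ 2)"
      by (rule order_tendstoD(2)[OF G]) (use d in auto)
    ultimately show "\<forall>\<^sub>F n in sequentially.
        (\<integral>\<^sup>+x. ennreal (norm (\<psi> x * (F n x * G n x) - \<psi> x * (f x * g x))) \<partial>lborel) < ennreal e"
    proof eventually_elim
      case (elim n)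
      let ?u = "\<lambda>x. F n x - f x" and ?v = "\<lambda>x. G n x - g x"
      have 1: "(\<integral>\<^sup>+x. ennreal \<bar>?u x * ?v x\<bar> \<partial>lborel) \<le> ennreal (d * d)"
        using elim d by (intro nn_integral_cauchy_schwarz) (auto simp: power_norm_def)
      have 2: "(\<integral>\<^sup>+x. ennreal \<bar>?u x * g x\<bar> \<partial>lborel) \<le> ennreal (d * B)"
        using elim d B by (intro nn_integral_cauchy_schwarz) (auto simp: power_norm_def)
      have 3: "(\<integral>\<^sup>+x. ennreal \<bar>f x * ?v x\<bar> \<partial>lborel) \<le> ennreal (A * d)"
        using elim d A by (intro nn_integral_cauchy_schwarz) (auto simp: power_norm_def)
      have "(\<integral>\<^sup>+x. ennreal (norm (\<psi> x * (F n x * G n x) - \<psi> x * (f x * g x))) \<partial>lborel)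
          \<le> (\<integral>\<^sup>+x. ennreal C * (ennreal \<bar>?u x * ?v x\<bar> + ennreal \<bar>?u x * g x\<bar> + ennreal \<bar>f x * ?v x\<bar>) \<partial>lborel)"
      proof (intro nn_integral_mono)
        fix x
        have "\<psi> x * (F n x * G n x) - \<psi> x * (f x * g x) = \<psi> x * (?u x * ?v x + ?u x * g x + f x * ?v x)"
          by (simp add: algebra_simps)
        then have "norm (\<psi> x * (F n x * G n x) - \<psi> x * (f x * g x))
            = \<bar>\<psi> x\<bar> * \<bar>?u x * ?v x + ?u x * g x + f x * ?v x\<bar>" by (simp add: abs_mult)
        also have "\<dots> \<le> C * (\<bar>?u x * ?v x\<bar> + \<bar>?u x * g x\<bar> + \<bar>f x * ?v x\<bar>)"
          using \<psi>[of x] C by (intro mult_mono) auto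
        finally have "ennreal (norm (\<psi> x * (F n x * G n x) - \<psi> x * (f x * g x)))
            \<le> ennreal (C * (\<bar>?u x * ?v x\<bar> + \<bar>?u x * g x\<bar> + \<bar>f x * ?v x\<bar>))" by (rule ennreal_leI)
        also have "\<dots> = ennreal C * (ennreal \<bar>?u x * ?v x\<bar> + ennreal \<bar>?u x * g x\<bar> + ennreal \<bar>f x * ?v x\<bar>)"
          using C by (simp add: ennreal_mult ennreal_plus)
        finally show "ennreal (norm (\<psi> x * (F n x * G n x) - \<psi> x * (f x * g x)))
            \<le> ennreal C * (ennreal \<bar>?u x * ?v x\<bar> + ennreal \<bar>?u x * g x\<bar> + ennreal \<bar>f x * ?v x\<bar>)" .
      qed
      also have "\<dots> = ennreal C * ((\<integral>\<^sup>+x. ennreal \<bar>?u x * ?v x\<bar> \<partial>lborel)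
          + (\<integral>\<^sup>+x. ennreal \<bar>?u x * g x\<bar> \<partial>lborel) + (\<integral>\<^sup>+x. ennreal \<bar>f x * ?v x\<bar> \<partial>lborel))"
        by (simp add: nn_integral_add nn_integral_cmult)
      also have "\<dots> \<le> ennreal C * (ennreal (d * d) + ennreal (d * B) + ennreal (A * d))"
        by (intro mult_left_mono add_mono 1 2 3) auto
      also have "\<dots> = ennreal (C * (d * d + d * B + A * d))"
        using C d A B by (simp add: ennreal_mult ennreal_plus)
      also have "\<dots> < ennreal e" using small e by (intro ennreal_lessI)
      finally show ?case .
    qed
  qed
qed

section \<open>Weak derivatives under mollification, and integrals of derivatives\<close>

lemma conv_weak_partial:
  fixes f g :: "'a::euclidean_space \<Rightarrow> real"
  assumes w: "weak_partial \<Omega> i f g" and K: "K \<subseteq> \<Omega>" and p: "cball p r \<subseteq> K" and k: "smooth_kernel r k"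
  shows "conv (\<lambda>q. indicator K q * f q) (partial i k) p = conv (\<lambda>q. indicator K q * g q) k p"
proof -
  \<comment> \<open>The reflected and translated kernel is an admissible test function, since its
    support lies in the ball about \<open>p\<close> and thus in \<open>\<Omega>\<close>. The sign
    produced by the reflection cancels the one in the definition of the weak derivative, and near
    \<open>p\<close> the restriction to \<open>K\<close> is invisible.\<close>
  define \<phi> where "\<phi> q = k (p + (- 1) *\<^sub>R q)" for q
  have kd: "k differentiable (at x)" for x using smooth_kernel_differentiable[OF k] .
  have k0: "k (p - q) = 0" if "q \<notin> cball p r" for q
    using k that by (simp add: smooth_kernel_def dist_norm norm_minus_commute)
  have p0: "partial i k (p - q) = 0" if "q \<notin> cball p r" for q
    by (rule partial_eq_0_outside[of r]) (use k that in \<open>auto simp: smooth_kernel_def dist_norm norm_minus_commute\<close>)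
  have sub: "closure {x. \<phi> x \<noteq> 0} \<subseteq> cball p r"
  proof (rule closure_minimal)
    show "{x. \<phi> x \<noteq> 0} \<subseteq> cball p r"
    proof
      fix x assume "x \<in> {x. \<phi> x \<noteq> 0}"
      then have "k (p - x) \<noteq> 0" by (simp add: \<phi>_def)
      then show "x \<in> cball p r" using k0 by blast
    qed
  qed simp
  have "\<phi> \<in> test_functions \<Omega>"
    unfolding test_functions_def
  proof (intro CollectI conjI allI)
    show "C_diff n \<phi>" for n
      unfolding \<phi>_def using k by (intro C_diff_affine) (simp add: smooth_kernel_def)
    show "compact (closure {x. \<phi> x \<noteq> 0})"
      using bounded_subset[OF bounded_cball order_trans[OF closure_subset sub]] by (simp add: compact_closure)
  qed (use sub p K in blast)
  then have "(LINT x:\<Omega>|lborel. f x * partial i \<phi> x) = - (LINT x:\<Omega>|lborel. g x * \<phi> x)"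
    using w unfolding weak_partial_def by blast
  moreover have "partial i \<phi> x = - partial i k (p - x)" for x
    unfolding \<phi>_def by (subst partial_affine[OF kd]) simp
  ultimately have "(LINT x:\<Omega>|lborel. f x * partial i k (p - x)) = (LINT x:\<Omega>|lborel. g x * k (p - x))"
    by (simp add: \<phi>_def set_lebesgue_integral_def)
  moreover have "indicator \<Omega> x *\<^sub>R (f x * partial i k (p - x)) = indicator K x * f x * partial i k (p - x)" for x
    using p0[of x] p K by (cases "x \<in> cball p r") (auto simp: indicator_def)
  moreover have "indicator \<Omega> x *\<^sub>R (g x * k (p - x)) = indicator K x * g x * k (p - x)" for x
    using k0[of x] p K by (cases "x \<in> cball p r") (auto simp: indicator_def)
  ultimately show ?thesis
    by (simp only: conv_def set_lebesgue_integral_def)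
qed

text \<open>Difference quotients in direction \<open>i\<close> have integral zero by translation
  invariance. They converge to the partial derivative and, by the mean value theorem, are bounded by
  \<open>B\<close>; as the increments are at most 1, they vanish outside the ball of radius
  \<open>r + 1\<close>.\<close>

lemma integral_partial_eq_0:
  fixes f :: "'a::euclidean_space \<Rightarrow> real"
  assumes f: "C_diff (Suc 0) f" and r: "\<And>x. r < norm x \<Longrightarrow> f x = 0" and i: "i \<in> Basis"
  shows "(LINT x|lborel. partial i f x) = 0"
proof -
  have fc: "continuous_on UNIV f" using C_diff_Suc_imp[OF f] by simp
  have pc: "continuous_on UNIV (partial i f)" using f i by simp
  have fi: "integrable lborel f" by (rule continuous_bounded_support_integrable[OF fc r])
  obtain B where B: "0 \<le> B" "\<And>x. \<bar>partial i f x\<bar> \<le> B"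
    using bounded_support_bounded[OF pc, of r] partial_eq_0_outside[of r f] r by blast
  define h where "h n = inverse (real (Suc n))" for n
  have h: "0 < h n" "h n \<le> 1" for n by (auto simp: h_def field_simps)
  have h0: "h \<longlonglongrightarrow> 0" unfolding h_def by (rule LIMSEQ_inverse_real_of_nat)
  define q where "q n x = (f (h n *\<^sub>R i + x) - f x) / h n" for n x
  have [measurable]: "f \<in> borel_measurable borel" "partial i f \<in> borel_measurable borel"
    using fc pc by (auto intro: borel_measurable_continuous_onI)
  have [measurable]: "q n \<in> borel_measurable borel" for n unfolding q_def by measurable
  have der: "((\<lambda>s. f (x + s *\<^sub>R i)) has_real_derivative partial i f (x + s *\<^sub>R i)) (at s)" for x s
    by (rule C_diff_directional[OF f])
  have qB: "\<bar>q n x\<bar> \<le> B * indicator (cball 0 (r + 1)) x" for n x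
  proof (cases "x \<in> cball 0 (r + 1)")
    case True
    obtain z where "f (x + h n *\<^sub>R i) - f (x + 0 *\<^sub>R i) = (h n - 0) * partial i f (x + z *\<^sub>R i)"
      using MVT2[OF h(1), of n "\<lambda>s. f (x + s *\<^sub>R i)" "\<lambda>s. partial i f (x + s *\<^sub>R i)"] der by blast
    then have "q n x = partial i f (x + z *\<^sub>R i)"
      using h(1)[of n] by (simp add: q_def add.commute)
    then show ?thesis using True B(2) by simp
  next
    case False
    then have "f x = 0" using r[of x] by simp
    moreover have "norm x \<le> norm (h n *\<^sub>R i + x) + norm (h n *\<^sub>R i)"
      using norm_triangle_ineq4[of "h n *\<^sub>R i + x" "h n *\<^sub>R i"] by simp
    then have "f (h n *\<^sub>R i + x) = 0" using False r h[of n] i by (intro r) auto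
    ultimately show ?thesis using B(1) by (simp add: q_def)
  qed
  have "(\<lambda>n. LINT x|lborel. q n x) \<longlonglongrightarrow> (LINT x|lborel. partial i f x)"
  proof (rule integral_dominated_convergence[where w = "\<lambda>x. B * indicator (cball 0 (r + 1)) x"])
    show "integrable lborel (\<lambda>x. B * indicator (cball 0 (r + 1)) (x::'a))"
      using emeasure_compact_finite[OF compact_cball, of "0::'a" "r + 1"] by auto
    show "AE x in lborel. (\<lambda>n. q n x) \<longlonglongrightarrow> partial i f x"
    proof (intro AE_I2)
      fix x
      have "((\<lambda>s. (f (x + s *\<^sub>R i) - f x) / s) \<longlongrightarrow> partial i f x) (at 0)"
        using der[of x 0] by (simp add: DERIV_def)
      moreover have "filterlim h (at 0) sequentially"
        using h0 h(1) by (auto simp: filterlim_at intro!: always_eventually) (metis less_irrefl)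
      ultimately have "(\<lambda>n. (f (x + h n *\<^sub>R i) - f x) / h n) \<longlonglongrightarrow> partial i f x"
        by (rule filterlim_compose)
      then show "(\<lambda>n. q n x) \<longlonglongrightarrow> partial i f x" by (simp add: q_def add.commute)
    qed
  qed (use qB in auto)
  moreover have "(LINT x|lborel. q n x) = 0" for n
    using fi integrable_translate[OF fi] lebesgue_integral_translate[of f] by (simp add: q_def)
  ultimately have "(\<lambda>n::nat. 0) \<longlonglongrightarrow> (LINT x|lborel. partial i f x)" by simp
  then show ?thesis by (simp add: LIMSEQ_const_iff)
qed

section \<open>The energy identity for weak solutions\<close>

lemma C_diff_differentiable: "C_diff (Suc k) f \<Longrightarrow> f differentiable (at x)"
  by simp

lemma partial_const [simp]: "partial i (\<lambda>x. c) x = 0"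
  by (rule partial_eqI[OF has_derivative_const])

lemma smooth_kernel_eq_0: "smooth_kernel r k \<Longrightarrow> r < norm x \<Longrightarrow> k x = 0"
  by (simp only: smooth_kernel_def)

lemma C_diff_uminus: "C_diff k f \<Longrightarrow> C_diff k (\<lambda>x. - f x)"
  using C_diff_mult[OF C_diff_const[of k "-1"]] by simp

lemma C_diff_sum:
  "finite A \<Longrightarrow> (\<And>j. j \<in> A \<Longrightarrow> C_diff k (f j)) \<Longrightarrow> C_diff k (\<lambda>x. \<Sum>j\<in>A. f j x)"
  by (induction A rule: finite_induct) (auto intro: C_diff_const C_diff_add)

lemma partial_uminus_even:
  assumes "\<And>x. f differentiable (at x)" "\<And>x. f (- x) = f x"
  shows "partial i f (- x) = - partial i f x"
  using partial_affine[of f i 0 "-1" x] assms by simp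

lemma partial_uminus_odd:
  assumes "\<And>x. f differentiable (at x)" "\<And>x. f (- x) = - f x"
  shows "partial i f (- x) = partial i f x"
proof -
  have "partial i (\<lambda>x. - f x) x = - partial i f (- x)"
    using partial_affine[of f i 0 "-1" x] assms by simp
  moreover have "partial i (\<lambda>x. - f x) x = - partial i f x"
    using partial_mult[of "\<lambda>_. -1" x f i] assms(1) by simp
  ultimately show ?thesis by simp
qed

lemma Basis_time [simp]: "(1::real, 0::'b::euclidean_space) \<in> Basis"
  by (simp add: Basis_prod_def)

lemma Basis_space [simp]: "i \<in> Basis \<Longrightarrow> (0::real, i::'b::euclidean_space) \<in> Basis"
  by (simp add: Basis_prod_def)

lemma smooth_kernel_wave_op:
  assumes "smooth_kernel r k"
  shows "smooth_kernel r (wave_op k)"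
  unfolding smooth_kernel_def
proof (intro conjI allI impI)
  have s: "smooth_kernel r (partial i (partial i k))" if "i \<in> Basis" for i
    using smooth_kernel_partial[OF smooth_kernel_partial[OF assms that] that] .
  fix n
  show "C_diff n (wave_op k)"
    unfolding wave_op_def using s
    by (intro C_diff_add C_diff_uminus C_diff_sum) (auto simp: smooth_kernel_def)
next
  fix x :: "real \<times> (real^3)" assume x: "r < norm x"
  have "partial i (partial i k) x = 0" if "i \<in> Basis" for i
    using smooth_kernel_eq_0[OF smooth_kernel_partial[OF smooth_kernel_partial[OF assms that] that] x] .
  then show "wave_op k x = 0" by (simp add: wave_op_def)
qed

text \<open>One derivative turns even into odd, the second turns odd back into even; hence the
  self-adjointness of convolution applies to the differentiated kernel, too.\<close>

lemma wave_op_even: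
  assumes k: "smooth_kernel r k" and even: "\<And>x. k (- x) = k x"
  shows "wave_op k (- x) = wave_op k x"
proof -
  have "partial i (partial i k) (- x) = partial i (partial i k) x" if "i \<in> Basis" for i
    by (intro partial_uminus_odd partial_uminus_even smooth_kernel_differentiable[OF k]
        smooth_kernel_differentiable[OF smooth_kernel_partial[OF k that]] even)
  then show ?thesis by (simp add: wave_op_def)
qed

lemma wave_op_conv:
  assumes f: "integrable lborel f" and k: "smooth_kernel r k"
  shows "wave_op (conv f k) = conv f (wave_op k)"
proof
  fix p
  have 2: "partial i (partial i (conv f k)) = conv f (partial i (partial i k))" if "i \<in> Basis" for i
    using conv_partial[OF f k that] conv_partial[OF f smooth_kernel_partial[OF k that] that] by simp
  have int: "integrable lborel (\<lambda>y. f y * partial i (partial i k) (p - y))" if "i \<in> Basis" for i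
    by (rule conv_integrable[OF f smooth_kernel_partial[OF smooth_kernel_partial[OF k that] that]])
  have "conv f (wave_op k) p = (LINT y|lborel. - (f y * partial (1, 0) (partial (1, 0) k) (p - y))
      + (\<Sum>i\<in>Basis. f y * partial (0, i) (partial (0, i) k) (p - y)))"
    unfolding conv_def wave_op_def
    by (intro Bochner_Integration.integral_cong refl) (simp add: algebra_simps sum_distrib_left)
  also have "\<dots> = - (LINT y|lborel. f y * partial (1, 0) (partial (1, 0) k) (p - y))
      + (\<Sum>i\<in>Basis. LINT y|lborel. f y * partial (0, i) (partial (0, i) k) (p - y))"
    using int by (simp add: integral_sum)
  finally show "wave_op (conv f k) p = conv f (wave_op k) p"
    by (simp add: wave_op_def 2 conv_def)
qed

text \<open>Fubini, with \<open>k (p - q) = k (q - p)\<close>; boundedness of the kernel makes the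
  integrand integrable on the product space. It transfers a kernel from one factor of a pairing to
  the other.\<close>

lemma conv_adjoint:
  fixes f g :: "'a::euclidean_space \<Rightarrow> real"
  assumes f: "integrable lborel f" and g: "integrable lborel g" and k: "smooth_kernel r k"
    and even: "\<And>x. k (- x) = k x"
  shows "(LINT p|lborel. f p * conv g k p) = (LINT q|lborel. g q * conv f k q)"
proof -
  have [measurable]: "f \<in> borel_measurable borel" "g \<in> borel_measurable borel" "k \<in> borel_measurable borel"
    using f g smooth_kernel_measurable[OF k] by auto
  obtain B where B: "0 \<le> B" "\<And>x. \<bar>k x\<bar> \<le> B" using smooth_kernel_bounded[OF k] by blast
  have int: "integrable (lborel \<Otimes>\<^sub>M lborel) (\<lambda>(p, q). f p * (g q * k (p - q)))"
  proof (rule lborel_pair.Fubini_integrable)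
    show "(\<lambda>(p, q). f p * (g q * k (p - q))) \<in> borel_measurable (lborel \<Otimes>\<^sub>M lborel)" by measurable
    show "AE p in lborel. integrable lborel (\<lambda>q. case (p, q) of (p, q) \<Rightarrow> f p * (g q * k (p - q)))"
      using conv_integrable[OF g k] by simp
    show "integrable lborel (\<lambda>p. LINT q|lborel. norm (case (p, q) of (p, q) \<Rightarrow> f p * (g q * k (p - q))))"
    proof (rule Bochner_Integration.integrable_bound)
      show "integrable lborel (\<lambda>p. \<bar>f p\<bar> * ((LINT q|lborel. \<bar>g q\<bar>) * B))" using f by simp
      show "AE p in lborel. norm (LINT q|lborel. norm (case (p, q) of (p, q) \<Rightarrow> f p * (g q * k (p - q))))
          \<le> norm (\<bar>f p\<bar> * ((LINT q|lborel. \<bar>g q\<bar>) * B))"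
      proof (intro AE_I2)
        fix p
        have "(LINT q|lborel. \<bar>g q * k (p - q)\<bar>) \<le> (LINT q|lborel. \<bar>g q\<bar> * B)"
          by (rule integral_mono') (use g B in \<open>auto simp: abs_mult intro!: mult_left_mono\<close>)
        then have "\<bar>f p\<bar> * (LINT q|lborel. \<bar>g q * k (p - q)\<bar>) \<le> \<bar>f p\<bar> * ((LINT q|lborel. \<bar>g q\<bar>) * B)"
          by (intro mult_left_mono) auto
        moreover have "(LINT q|lborel. norm (f p * (g q * k (p - q)))) = \<bar>f p\<bar> * (LINT q|lborel. \<bar>g q * k (p - q)\<bar>)"
          by (simp add: abs_mult)
        ultimately show "norm (LINT q|lborel. norm (case (p, q) of (p, q) \<Rightarrow> f p * (g q * k (p - q))))
          \<le> norm (\<bar>f p\<bar> * ((LINT q|lborel. \<bar>g q\<bar>) * B))"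
          using B by simp
      qed
    qed measurable
  qed
  have "(LINT p|lborel. f p * conv g k p) = (LINT p|lborel. LINT q|lborel. f p * (g q * k (p - q)))"
    by (simp add: conv_def)
  also have "\<dots> = (LINT q|lborel. LINT p|lborel. f p * (g q * k (p - q)))"
    using lborel_pair.Fubini_integral[of "\<lambda>p q. f p * (g q * k (p - q))"] int by simp
  also have "\<dots> = (LINT q|lborel. LINT p|lborel. g q * (f p * k (q - p)))"
  proof (intro Bochner_Integration.integral_cong refl)
    fix p q
    have "k (p - q) = k (q - p)" using even[of "q - p"] by simp
    then show "f p * (g q * k (p - q)) = g q * (f p * k (q - p))" by simp
  qed
  also have "\<dots> = (LINT q|lborel. g q * conv f k q)" by (simp add: conv_def)
  finally show ?thesis .
qed

text \<open>For a smooth function, u_t (-u_tt + \<Delta>u) = div (u_t \<nabla>u) - d/dt (u_t^2 +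
  |\<nabla>u|^2)/2. Multiplied by the compactly supported \<open>\<Phi>\<close> and integrated, all
  outer derivatives move onto \<open>\<Phi>\<close>, and only first derivatives of \<open>u\<close>
  remain on the right.\<close>

lemma smooth_energy_identity:
  fixes u \<Phi> :: "real \<times> (real^3) \<Rightarrow> real"
  assumes u: "C_diff 2 u" and \<Phi>: "C_diff (Suc 0) \<Phi>" and r: "\<And>p. r < norm p \<Longrightarrow> \<Phi> p = 0"
  shows "(LINT p|lborel. \<Phi> p * partial (1, 0) u p * wave_op u p)
    = (LINT p|lborel. partial (1, 0) \<Phi> p * (((partial (1, 0) u p)\<^sup>2 + (\<Sum>i\<in>Basis. (partial (0, i) u p)\<^sup>2)) / 2)
        - (\<Sum>i\<in>Basis. partial (0, i) \<Phi> p * partial (0, i) u p * partial (1, 0) u p))"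
    (is "integral\<^sup>L lborel ?L = integral\<^sup>L lborel ?R")
proof -
  let ?t = "(1, 0) :: real \<times> (real^3)" and ?s = "\<lambda>i. (0, i) :: real \<times> (real^3)"
  have uC: "C_diff (Suc 0) (partial j u)" if "j \<in> Basis" for j
    using u that by (simp add: numeral_2_eq_2)
  \<comment> \<open>\<open>f0\<close> is \<open>\<Phi>\<close> times the energy density,
    \<open>f i\<close> is \<open>\<Phi>\<close> times the component of the energy flux in direction
    \<open>i\<close>; the two sides of the identity differ by the spacetime divergence built from
    them.\<close>
  define f0 where "f0 p = \<Phi> p * ((1/2) * (partial ?t u p * partial ?t u p + (\<Sum>i\<in>Basis. partial (?s i) u p * partial (?s i) u p)))" for p
  define f where "f i p = \<Phi> p * (partial (?s i) u p * partial ?t u p)" for i p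
  have f0C: "C_diff (Suc 0) f0"
    unfolding f0_def by (intro C_diff_mult C_diff_add C_diff_sum C_diff_const \<Phi> uC) auto
  have fC: "C_diff (Suc 0) (f i)" if "i \<in> Basis" for i
    unfolding f_def using that by (intro C_diff_mult \<Phi> uC) auto
  have f0r: "f0 p = 0" and fr: "f i p = 0" if "r < norm p" for i p
    using r[OF that] by (simp_all add: f0_def f_def)
  have "(LINT p|lborel. partial ?t f0 p) = 0" by (rule integral_partial_eq_0[OF f0C f0r]) auto
  moreover have "(LINT p|lborel. partial (?s i) (f i) p) = 0" if "i \<in> Basis" for i
    by (rule integral_partial_eq_0[OF fC[OF that] fr]) (use that in auto)
  moreover have i0: "integrable lborel (partial ?t f0)"
    using f0C partial_eq_0_outside[of r f0] f0r by (intro continuous_bounded_support_integrable[of _ r]) auto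
  moreover have i1: "integrable lborel (partial (?s i) (f i))" if "i \<in> Basis" for i
    using fC[OF that] that partial_eq_0_outside[of r "f i"] fr
    by (intro continuous_bounded_support_integrable[of _ r]) auto
  ultimately have zero: "(LINT p|lborel. (\<Sum>i\<in>Basis. partial (?s i) (f i) p) - partial ?t f0 p) = 0"
    by (simp add: integral_sum)
  have D: "\<Phi> differentiable (at p)" "j \<in> Basis \<Longrightarrow> partial j u differentiable (at p)" for p j
    using C_diff_differentiable[OF \<Phi>] C_diff_differentiable[OF uC] by blast+
  have Dm: "(\<lambda>p. g p * h p) differentiable (at p)" if "g differentiable (at p)" "h differentiable (at p)"
    for g h :: "real \<times> (real^3) \<Rightarrow> real" and p
    using that by (rule differentiable_mult)
  have comm: "partial (?s i) (partial ?t u) p = partial ?t (partial (?s i) u) p" if "i \<in> Basis" for i p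
    using that by (intro partial_commute[OF u]) auto
  have pf: "partial (?s i) (f i) p = \<Phi> p * (partial (?s i) u p * partial ?t (partial (?s i) u) p
      + partial (?s i) (partial (?s i) u) p * partial ?t u p) + partial (?s i) \<Phi> p * (partial (?s i) u p * partial ?t u p)"
    if "i \<in> Basis" for i p
    unfolding f_def using that by (simp add: partial_mult D Dm comm)
  have psum: "partial j (\<lambda>p. \<Sum>i\<in>A. g i p) p = (\<Sum>i\<in>A. partial j (g i) p) \<and>
      (\<lambda>p. \<Sum>i\<in>A. g i p) differentiable (at p)"
    if "finite A" "\<And>i. i \<in> A \<Longrightarrow> g i differentiable (at p)"
    for A and g :: "real^3 \<Rightarrow> real \<times> (real^3) \<Rightarrow> real" and p j
    using that
  proof (induction A rule: finite_induct)
    case empty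
    then show ?case by simp
  next
    case (insert x F)
    then show ?case by (simp add: partial_add)
  qed
  have pf0: "partial ?t f0 p = \<Phi> p * (partial ?t u p * partial ?t (partial ?t u) p
      + (\<Sum>i\<in>Basis. partial (?s i) u p * partial ?t (partial (?s i) u) p))
      + partial ?t \<Phi> p * ((1/2) * (partial ?t u p * partial ?t u p + (\<Sum>i\<in>Basis. partial (?s i) u p * partial (?s i) u p)))" for p
  proof -
    have 1: "(\<lambda>p. \<Sum>i\<in>Basis. partial (?s i) u p * partial (?s i) u p) differentiable (at p)"
      and 2: "partial ?t (\<lambda>p. \<Sum>i\<in>Basis. partial (?s i) u p * partial (?s i) u p) p
        = (\<Sum>i\<in>Basis. partial ?t (\<lambda>p. partial (?s i) u p * partial (?s i) u p) p)"
      using psum[of Basis "\<lambda>i p. partial (?s i) u p * partial (?s i) u p" p ?t] D Dm by auto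
    have 3: "partial ?t (\<lambda>p. partial (?s i) u p * partial (?s i) u p) p
        = 2 * (partial (?s i) u p * partial ?t (partial (?s i) u) p)" if "i \<in> Basis" for i
      using that by (simp add: partial_mult D)
    have 4: "partial ?t (\<lambda>p. partial ?t u p * partial ?t u p + (\<Sum>i\<in>Basis. partial (?s i) u p * partial (?s i) u p)) p
      = 2 * (partial ?t u p * partial ?t (partial ?t u) p)
        + (\<Sum>i\<in>Basis. 2 * (partial (?s i) u p * partial ?t (partial (?s i) u) p))"
      by (subst partial_add) (use 1 in \<open>auto simp: 2 3 D Dm partial_mult\<close>)
    have 5: "(\<lambda>p. partial ?t u p * partial ?t u p + (\<Sum>i\<in>Basis. partial (?s i) u p * partial (?s i) u p)) differentiable (at p)"
      using 1 by (intro differentiable_add Dm D) auto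
    have 6: "partial ?t (\<lambda>p. (1/2) * (partial ?t u p * partial ?t u p + (\<Sum>i\<in>Basis. partial (?s i) u p * partial (?s i) u p))) p
      = partial ?t u p * partial ?t (partial ?t u) p + (\<Sum>i\<in>Basis. partial (?s i) u p * partial ?t (partial (?s i) u) p)"
      using 5 by (subst partial_mult) (auto simp: 4 sum_distrib_left[symmetric] distrib_left)
    have 7: "(\<lambda>p. (1/2) * (partial ?t u p * partial ?t u p + (\<Sum>i\<in>Basis. partial (?s i) u p * partial (?s i) u p))) differentiable (at p)"
      using 5 by (intro Dm) auto
    show ?thesis
      unfolding f0_def partial_mult[OF D(1) 7] 6 by (rule refl)
  qed
  have point: "?L p - ?R p = (\<Sum>i\<in>Basis. partial (?s i) (f i) p) - partial ?t f0 p" for p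
    by (simp add: pf pf0 wave_op_def algebra_simps sum.distrib sum_distrib_left sum_divide_distrib power2_eq_square)
  have Lint: "integrable lborel ?L"
  proof (rule continuous_bounded_support_integrable[of _ r])
    have c2: "continuous_on UNIV (partial j (partial j u))" if "j \<in> Basis" for j
      using uC[OF that] that by auto
    have c1: "continuous_on UNIV \<Phi>" "continuous_on UNIV (partial ?t u)"
      using C_diff_Suc_imp[OF \<Phi>] C_diff_Suc_imp[OF uC[of ?t]] by auto
    show "continuous_on UNIV ?L"
      unfolding wave_op_def by (intro continuous_intros c1 c2) auto
  qed (simp add: r)
  have "integrable lborel (\<lambda>p. ?L p - ((\<Sum>i\<in>Basis. partial (?s i) (f i) p) - partial ?t f0 p))"
    using Lint i0 i1 by (intro Bochner_Integration.integrable_diff Bochner_Integration.integrable_sum)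
  moreover have "?L p - ((\<Sum>i\<in>Basis. partial (?s i) (f i) p) - partial ?t f0 p) = ?R p" for p
    using point[of p] by linarith
  ultimately have Rint: "integrable lborel ?R" by simp
  have "integral\<^sup>L lborel ?L - integral\<^sup>L lborel ?R = (LINT p|lborel. ?L p - ?R p)"
    using Lint Rint by (rule Bochner_Integration.integral_diff[symmetric])
  also have "\<dots> = 0" unfolding point by (rule zero)
  finally show ?thesis by simp
qed

section \<open>Pairing L^1 in time with bounded in time, with values in L^2\<close>

lemma nn_integral_slices:
  fixes f :: "'a::euclidean_space \<times> 'b::euclidean_space \<Rightarrow> ennreal"
  assumes "f \<in> borel_measurable borel"
  shows "(\<integral>\<^sup>+p. f p \<partial>lborel) = (\<integral>\<^sup>+t. (\<integral>\<^sup>+x. f (t, x) \<partial>lborel) \<partial>lborel)"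
proof -
  have "f \<in> borel_measurable (lborel \<Otimes>\<^sub>M lborel)" using assms by (simp add: lborel_prod)
  then show ?thesis by (subst lborel_prod[symmetric]) (simp add: lborel.nn_integral_fst)
qed

lemma slice_measurable:
  fixes f :: "'a::euclidean_space \<times> 'b::euclidean_space \<Rightarrow> 'c::topological_space"
  assumes "f \<in> borel_measurable borel"
  shows "(\<lambda>x. f (t, x)) \<in> borel_measurable borel"
proof -
  have "f \<in> borel_measurable (borel \<Otimes>\<^sub>M borel)" using assms by (simp add: borel_prod)
  then show ?thesis by measurable
qed

lemma slice_integral_measurable:
  fixes f :: "'a::euclidean_space \<times> 'b::euclidean_space \<Rightarrow> ennreal"
  assumes "f \<in> borel_measurable borel"
  shows "(\<lambda>t. \<integral>\<^sup>+x. f (t, x) \<partial>lborel) \<in> borel_measurable borel"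
proof -
  have [measurable]: "f \<in> borel_measurable (borel \<Otimes>\<^sub>M borel)" using assms by (simp add: borel_prod)
  show ?thesis by measurable
qed

text \<open>Cauchy-Schwarz on each time slice. The function \<open>\<gamma>\<close> majorises the
  L^2 norms of almost all slices of \<open>G\<close>, so its integral plays the role of the norm of
  \<open>G\<close>.\<close>

lemma L1L2_pair_bound:
  fixes G w :: "'a::euclidean_space \<times> 'b::euclidean_space \<Rightarrow> real"
  assumes G [measurable]: "G \<in> borel_measurable borel" and w [measurable]: "w \<in> borel_measurable borel"
    and \<gamma> [measurable]: "\<gamma> \<in> borel_measurable borel" and \<gamma>0: "\<And>t. 0 \<le> \<gamma> t"
    and Gs: "AE t in lborel. (\<integral>\<^sup>+x. ennreal (\<bar>G (t, x)\<bar> ^ 2) \<partial>lborel) \<le> ennreal (\<gamma> t ^ 2)"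
    and ws: "\<And>t. (\<integral>\<^sup>+x. ennreal (\<bar>w (t, x)\<bar> ^ 2) \<partial>lborel) \<le> ennreal (B ^ 2)" and B: "0 \<le> B"
  shows "(\<integral>\<^sup>+p. ennreal \<bar>G p * w p\<bar> \<partial>lborel) \<le> ennreal B * (\<integral>\<^sup>+t. ennreal (\<gamma> t) \<partial>lborel)"
proof -
  have "(\<integral>\<^sup>+p. ennreal \<bar>G p * w p\<bar> \<partial>lborel)
      = (\<integral>\<^sup>+t. (\<integral>\<^sup>+x. ennreal \<bar>G (t, x) * w (t, x)\<bar> \<partial>lborel) \<partial>lborel)"
    by (subst nn_integral_slices) simp_all
  also have "\<dots> \<le> (\<integral>\<^sup>+t. ennreal B * ennreal (\<gamma> t) \<partial>lborel)"
  proof (rule nn_integral_mono_AE, use Gs in eventually_elim)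
    case (elim t)
    have "(\<integral>\<^sup>+x. ennreal \<bar>G (t, x) * w (t, x)\<bar> \<partial>lborel) \<le> ennreal (\<gamma> t * B)"
      using elim ws[of t] B \<gamma>0[of t]
      by (intro nn_integral_cauchy_schwarz) (auto intro: slice_measurable[OF G] slice_measurable[OF w])
    then show ?case using B \<gamma>0[of t] by (simp add: ennreal_mult mult.commute)
  qed
  also have "\<dots> = ennreal B * (\<integral>\<^sup>+t. ennreal (\<gamma> t) \<partial>lborel)" by (simp add: nn_integral_cmult)
  finally show ?thesis .
qed

text \<open>Convergence in L^2 of spacetime alone does not control the pairing, as \<open>G\<close>
  need not be square integrable in time. Times with \<open>\<gamma>\<close> above a level
  \<open>N\<close> are handled by the uniform slice bound and the small tail of
  \<open>\<gamma>\<close>; at the others |G w| is at most \<open>s\<close> G^2 + w^2 / (4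
  \<open>s\<close>), and the square of \<open>\<gamma>\<close> is at most \<open>N\<close> times
  \<open>\<gamma>\<close>.\<close>

lemma L1L2_pair_tendsto_0:
  fixes G :: "'a::euclidean_space \<times> 'b::euclidean_space \<Rightarrow> real"
  assumes G [measurable]: "G \<in> borel_measurable borel" and w [measurable]: "\<And>n. w n \<in> borel_measurable borel"
    and \<gamma> [measurable]: "\<gamma> \<in> borel_measurable borel" and \<gamma>0: "\<And>t. 0 \<le> \<gamma> t"
    and \<gamma>i: "(\<integral>\<^sup>+t. ennreal (\<gamma> t) \<partial>lborel) < \<infinity>"
    and Gs: "AE t in lborel. (\<integral>\<^sup>+x. ennreal (\<bar>G (t, x)\<bar> ^ 2) \<partial>lborel) \<le> ennreal (\<gamma> t ^ 2)"
    and ws: "\<And>n t. (\<integral>\<^sup>+x. ennreal (\<bar>w n (t, x)\<bar> ^ 2) \<partial>lborel) \<le> ennreal (B ^ 2)" and B: "0 \<le> B"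
    and lim: "(\<lambda>n. power_norm 2 (w n)) \<longlonglongrightarrow> 0"
  shows "(\<lambda>n. \<integral>\<^sup>+p. ennreal \<bar>G p * w n p\<bar> \<partial>lborel) \<longlonglongrightarrow> 0"
proof (rule tendsto_zero_ennreal)
  fix e :: real assume e: "0 < e"
  obtain \<Gamma> where \<Gamma>: "0 \<le> \<Gamma>" "(\<integral>\<^sup>+t. ennreal (\<gamma> t) \<partial>lborel) = ennreal \<Gamma>"
    using \<gamma>i by (cases "\<integral>\<^sup>+t. ennreal (\<gamma> t) \<partial>lborel") auto
  define I where "I N t = (if real N < \<gamma> t then \<gamma> t else 0)" for N t
  have [measurable]: "I N \<in> borel_measurable borel" for N unfolding I_def by measurable
  have I0: "0 \<le> I N t" for N t by (simp add: I_def \<gamma>0)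
  have "(\<lambda>N. \<integral>\<^sup>+t. ennreal (I N t) \<partial>lborel) \<longlonglongrightarrow> (\<integral>\<^sup>+(t::'a). 0 \<partial>lborel)"
  proof (rule nn_integral_dominated_convergence[where w = "\<lambda>t. ennreal (\<gamma> t)"])
    show "AE t in lborel. (\<lambda>N. ennreal (I N t)) \<longlonglongrightarrow> 0"
    proof (intro AE_I2 tendsto_eventually)
      fix t
      obtain N0 where "\<gamma> t < real N0" using reals_Archimedean2 by blast
      then show "\<forall>\<^sub>F N in sequentially. ennreal (I N t) = 0"
        by (intro eventually_sequentiallyI[of N0]) (auto simp: I_def)
    qed
  qed (use \<gamma>i \<gamma>0 in \<open>auto simp: I_def intro!: ennreal_leI\<close>)
  then have "(\<lambda>N. \<integral>\<^sup>+t. ennreal (I N t) \<partial>lborel) \<longlonglongrightarrow> 0" by simp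
  moreover have "0 < ennreal (e / (4 * (B + 1)))" using e B by simp
  ultimately obtain N where N: "(\<integral>\<^sup>+t. ennreal (I N t) \<partial>lborel) < ennreal (e / (4 * (B + 1)))"
    using ennreal_le_epsilon_exists by blast
  \<comment> \<open>With this choice the tail, the term with \<open>\<Gamma>\<close> and the term
    with \<open>w n\<close> are each at most a quarter of \<open>e\<close>.\<close>
  define s where "s = e / (4 * (real N + 1) * (\<Gamma> + 1))"
  have s: "0 < s" using e \<Gamma> by (auto simp: s_def intro!: divide_pos_pos mult_pos_pos)
  have "\<forall>\<^sub>F n in sequentially. power_norm 2 (w n) < ennreal (s * e)"
    by (rule order_tendstoD(2)[OF lim]) (use s e in auto)
  then show "\<forall>\<^sub>F n in sequentially. (\<integral>\<^sup>+p. ennreal \<bar>G p * w n p\<bar> \<partial>lborel) < ennreal e"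
  proof eventually_elim
    case (elim n)
    have [measurable]: "(\<lambda>t. \<integral>\<^sup>+x. ennreal (\<bar>w n (t, x)\<bar> ^ 2) \<partial>lborel) \<in> borel_measurable borel"
      by (rule slice_integral_measurable[where f = "\<lambda>p. ennreal (\<bar>w n p\<bar> ^ 2)"]) measurable
    have "(\<integral>\<^sup>+p. ennreal \<bar>G p * w n p\<bar> \<partial>lborel)
        = (\<integral>\<^sup>+t. (\<integral>\<^sup>+x. ennreal \<bar>G (t, x) * w n (t, x)\<bar> \<partial>lborel) \<partial>lborel)"
      by (subst nn_integral_slices) simp_all
    also have "\<dots> \<le> (\<integral>\<^sup>+t. ennreal B * ennreal (I N t) + (ennreal (s * real N) * ennreal (\<gamma> t)
        + ennreal (1 / (4 * s)) * (\<integral>\<^sup>+x. ennreal (\<bar>w n (t, x)\<bar> ^ 2) \<partial>lborel)) \<partial>lborel)"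
    proof (rule nn_integral_mono_AE, use Gs in eventually_elim)
      case (elim t)
      have [measurable]: "(\<lambda>x. G (t, x)) \<in> borel_measurable borel" "(\<lambda>x. w n (t, x)) \<in> borel_measurable borel"
        by (auto intro: slice_measurable[OF G] slice_measurable[OF w])
      show ?case
      proof (cases "real N < \<gamma> t")
        case True
        have "(\<integral>\<^sup>+x. ennreal \<bar>G (t, x) * w n (t, x)\<bar> \<partial>lborel) \<le> ennreal (\<gamma> t * B)"
          using elim ws[of n t] B \<gamma>0[of t] by (intro nn_integral_cauchy_schwarz) auto
        also have "\<dots> = ennreal B * ennreal (I N t)"
          using True B \<gamma>0[of t] by (simp add: I_def ennreal_mult mult.commute)
        finally show ?thesis by (rule order_trans) simp
      next
        case False
        have "(\<integral>\<^sup>+x. ennreal \<bar>G (t, x) * w n (t, x)\<bar> \<partial>lborel)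
            \<le> (\<integral>\<^sup>+x. ennreal s * ennreal (\<bar>G (t, x)\<bar> ^ 2) + ennreal (1 / (4 * s)) * ennreal (\<bar>w n (t, x)\<bar> ^ 2) \<partial>lborel)"
        proof (intro nn_integral_mono)
          fix x
          have "0 \<le> (2 * s * \<bar>G (t, x)\<bar> - \<bar>w n (t, x)\<bar>) ^ 2 / (4 * s)" using s by simp
          also have "\<dots> = s * \<bar>G (t, x)\<bar> ^ 2 + (1 / (4 * s)) * \<bar>w n (t, x)\<bar> ^ 2 - \<bar>G (t, x) * w n (t, x)\<bar>"
            using s by (simp add: power2_diff power2_eq_square abs_mult field_simps)
          finally have "ennreal \<bar>G (t, x) * w n (t, x)\<bar> \<le> ennreal (s * \<bar>G (t, x)\<bar> ^ 2 + (1 / (4 * s)) * \<bar>w n (t, x)\<bar> ^ 2)"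
            by (intro ennreal_leI) simp
          also have "\<dots> = ennreal s * ennreal (\<bar>G (t, x)\<bar> ^ 2) + ennreal (1 / (4 * s)) * ennreal (\<bar>w n (t, x)\<bar> ^ 2)"
          proof -
            have "ennreal (p * P + q * Q) = ennreal p * ennreal P + ennreal q * ennreal Q"
              if "0 \<le> p" "0 \<le> q" "0 \<le> P" "0 \<le> Q" for p q P Q :: real
              using that by (simp add: ennreal_mult ennreal_plus)
            then show ?thesis by this (use s in auto)
          qed
          finally show "ennreal \<bar>G (t, x) * w n (t, x)\<bar>
            \<le> ennreal s * ennreal (\<bar>G (t, x)\<bar> ^ 2) + ennreal (1 / (4 * s)) * ennreal (\<bar>w n (t, x)\<bar> ^ 2)" .
        qed
        also have "\<dots> = ennreal s * (\<integral>\<^sup>+x. ennreal (\<bar>G (t, x)\<bar> ^ 2) \<partial>lborel)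
            + ennreal (1 / (4 * s)) * (\<integral>\<^sup>+x. ennreal (\<bar>w n (t, x)\<bar> ^ 2) \<partial>lborel)"
          by (subst nn_integral_add) (simp_all add: nn_integral_cmult)
        also have "ennreal s * (\<integral>\<^sup>+x. ennreal (\<bar>G (t, x)\<bar> ^ 2) \<partial>lborel) \<le> ennreal s * ennreal (\<gamma> t ^ 2)"
          by (intro mult_left_mono elim) simp
        also have "\<dots> \<le> ennreal (s * real N) * ennreal (\<gamma> t)"
        proof -
          have "s * \<gamma> t ^ 2 \<le> s * real N * \<gamma> t"
            using False \<gamma>0[of t] s by (simp add: power2_eq_square mult_mono)
          then show ?thesis using s \<gamma>0[of t]
            by (simp add: ennreal_mult[symmetric] ennreal_leI)
        qed
        finally show ?thesis by (auto intro: order_trans add_increasing)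
      qed
    qed
    also have "\<dots> = ennreal B * (\<integral>\<^sup>+t. ennreal (I N t) \<partial>lborel) + (ennreal (s * real N) * ennreal \<Gamma>
        + ennreal (1 / (4 * s)) * power_norm 2 (w n))"
    proof -
      have "power_norm 2 (w n) = (\<integral>\<^sup>+t. (\<integral>\<^sup>+x. ennreal (\<bar>w n (t, x)\<bar> ^ 2) \<partial>lborel) \<partial>lborel)"
        unfolding power_norm_def by (rule nn_integral_slices) measurable
      then show ?thesis
        by (subst nn_integral_add) (simp_all add: nn_integral_add nn_integral_cmult \<Gamma>)
    qed
    also have "\<dots> \<le> ennreal B * ennreal (e / (4 * (B + 1))) + (ennreal (s * real N) * ennreal \<Gamma>
        + ennreal (1 / (4 * s)) * ennreal (s * e))"
      using N elim by (intro add_mono mult_left_mono) auto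
    also have "\<dots> = ennreal (B * (e / (4 * (B + 1))) + (s * real N * \<Gamma> + 1 / (4 * s) * (s * e)))"
      using B s e \<Gamma> by (simp only: ennreal_mult[symmetric] ennreal_plus[symmetric] mult_nonneg_nonneg add_nonneg_nonneg
          divide_nonneg_nonneg zero_le_one of_nat_0_le_iff less_imp_le zero_le_numeral)
    also have "\<dots> < ennreal e"
    proof (rule ennreal_lessI[OF e])
      have "B * (e / (4 * (B + 1))) \<le> e / 4" using B e by (simp add: field_simps)
      moreover have "s * real N * \<Gamma> \<le> e / 4"
      proof -
        have "s * real N * \<Gamma> \<le> s * ((real N + 1) * (\<Gamma> + 1))"
          using s \<Gamma> by (simp add: mult.assoc mult_mono)
        also have "\<dots> = e / 4" using \<Gamma> by (simp add: s_def field_simps add_nonneg_eq_0_iff)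
        finally show ?thesis .
      qed
      moreover have "1 / (4 * s) * (s * e) = e / 4" using s by simp
      ultimately show "B * (e / (4 * (B + 1))) + (s * real N * \<Gamma> + 1 / (4 * s) * (s * e)) < e"
        using e by linarith
    qed
    finally show ?case .
  qed
qed

section \<open>Slabs and the passage from smooth to weak solutions\<close>

lemma slab_cball:
  fixes p :: "real \<times> 'b::euclidean_space"
  assumes "p \<in> {\<alpha>..\<beta>} \<times> cball 0 R" "e \<le> \<delta>"
  shows "cball p e \<subseteq> {\<alpha> - \<delta>..\<beta> + \<delta>} \<times> cball 0 (R + \<delta>)"
proof
  fix q assume "q \<in> cball p e"
  then have d: "dist p q \<le> \<delta>" using assms(2) by auto
  have "dist (fst p) (fst q) \<le> \<delta>" "dist (snd p) (snd q) \<le> \<delta>"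
    using dist_fst_le[of p q] dist_snd_le[of p q] d by linarith+
  moreover have "norm (snd q) \<le> norm (snd p) + dist (snd p) (snd q)"
    using norm_triangle_sub[of "snd q" "snd p"] by (simp add: dist_norm norm_minus_commute)
  ultimately show "q \<in> {\<alpha> - \<delta>..\<beta> + \<delta>} \<times> cball 0 (R + \<delta>)"
    using assms(1) by (cases p; cases q) (auto simp: dist_real_def abs_le_iff)
qed

lemma slab_norm:
  fixes p :: "real \<times> 'b::euclidean_space"
  assumes "p \<in> {\<alpha>..\<beta>} \<times> cball 0 R"
  shows "norm p \<le> \<bar>\<alpha>\<bar> + \<bar>\<beta>\<bar> + R"
proof -
  have "norm p \<le> norm (fst p) + norm (snd p)" using norm_Pair_le[of "fst p" "snd p"] by simp
  then show ?thesis using assms by (cases p) auto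
qed


lemma partial_eq_0_off_closed:
  assumes "closed S" "\<And>p. p \<notin> S \<Longrightarrow> f p = 0" "p \<notin> S"
  shows "partial i f p = 0"
proof -
  have "(f has_derivative (\<lambda>h. 0)) (at p)"
    by (rule has_derivative_transform_within_open[of "\<lambda>x. 0" _ _ _ "- S"])
       (use assms in auto)
  then show ?thesis by (rule partial_eqI)
qed

lemma power_norm_slab:
  fixes f :: "real \<times> 'b::euclidean_space \<Rightarrow> real"
  assumes [measurable]: "f \<in> borel_measurable borel"
    and M: "\<And>t. (\<integral>\<^sup>+x. ennreal (\<bar>f (t, x)\<bar> ^ 2) \<partial>lborel) \<le> ennreal (M ^ 2)"
    and supp: "\<And>t x. t \<notin> {\<alpha>..\<beta>} \<Longrightarrow> f (t, x) = 0"
  shows "power_norm 2 f < \<infinity>"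
proof -
  have "power_norm 2 f = (\<integral>\<^sup>+t. (\<integral>\<^sup>+x. ennreal (\<bar>f (t, x)\<bar> ^ 2) \<partial>lborel) \<partial>lborel)"
    unfolding power_norm_def by (rule nn_integral_slices) measurable
  also have "\<dots> \<le> (\<integral>\<^sup>+t. ennreal (M ^ 2) * indicator {\<alpha>..\<beta>} t \<partial>lborel)"
  proof (intro nn_integral_mono)
    fix t
    show "(\<integral>\<^sup>+x. ennreal (\<bar>f (t, x)\<bar> ^ 2) \<partial>lborel) \<le> ennreal (M ^ 2) * indicator {\<alpha>..\<beta>} t"
      using M[of t] supp[of t] by (cases "t \<in> {\<alpha>..\<beta>}") auto
  qed
  also have "\<dots> < \<infinity>"
    using emeasure_compact_finite[OF compact_Icc, of \<alpha> \<beta>]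
    by (simp add: nn_integral_cmult_indicator ennreal_mult_less_top)
  finally show ?thesis .
qed

lemma power_norm_mult_le:
  fixes f \<psi> :: "'a::euclidean_space \<Rightarrow> real"
  assumes [measurable]: "f \<in> borel_measurable borel" and \<psi>: "\<And>x. \<bar>\<psi> x\<bar> \<le> C"
  shows "power_norm p (\<lambda>x. \<psi> x * f x) \<le> ennreal (C ^ p) * power_norm p f"
proof -
  have C: "0 \<le> C" using \<psi>[of 0] by linarith
  have "power_norm p (\<lambda>x. \<psi> x * f x) \<le> (\<integral>\<^sup>+x. ennreal (C ^ p) * ennreal (\<bar>f x\<bar> ^ p) \<partial>lborel)"
    unfolding power_norm_def
  proof (intro nn_integral_mono)
    fix x
    have "\<bar>\<psi> x * f x\<bar> ^ p \<le> C ^ p * \<bar>f x\<bar> ^ p"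
      unfolding abs_mult power_mult_distrib using \<psi>[of x] by (intro mult_right_mono power_mono) auto
    then show "ennreal (\<bar>\<psi> x * f x\<bar> ^ p) \<le> ennreal (C ^ p) * ennreal (\<bar>f x\<bar> ^ p)"
      using C by (simp add: ennreal_mult[symmetric] ennreal_leI)
  qed
  also have "\<dots> = ennreal (C ^ p) * power_norm p f" by (simp add: nn_integral_cmult power_norm_def)
  finally show ?thesis .
qed

lemma ennreal_tendsto_0_le:
  fixes X Y :: "nat \<Rightarrow> ennreal"
  assumes "Y \<longlonglongrightarrow> 0" "\<And>n. X n \<le> ennreal C * Y n"
  shows "X \<longlonglongrightarrow> 0"
proof (rule tendsto_sandwich[of "\<lambda>_. 0" _ _ "\<lambda>n. ennreal C * Y n"])
  show "(\<lambda>n. ennreal C * Y n) \<longlonglongrightarrow> 0"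
    using ennreal_tendsto_cmult[OF _ assms(1), of "ennreal C"] by simp
qed (use assms in auto)

text \<open>The wave equation is tested with a function mollified twice: the time derivative
  \<open>D t0\<close> is mollified, multiplied by \<open>\<Phi>\<close> and mollified again. As the
  mollifier is even, the outer mollification can be moved onto \<open>v\<close>, and the left side
  becomes exactly the smooth identity for the mollified \<open>v\<close>. Only first derivatives
  occur there, and they converge in L^2. On the right the test functions converge to
  \<open>\<Phi>\<close> times \<open>D t0\<close> in L^2 with uniformly bounded slices, as the
  pairing with \<open>G\<close> demands.\<close>

theorem energy_identity:
  fixes v G \<Phi> :: "real \<times> (real^3) \<Rightarrow> real" and D :: "real \<times> (real^3) \<Rightarrow> real \<times> (real^3) \<Rightarrow> real"
  defines "t0 \<equiv> (1, 0) :: real \<times> (real^3)"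
  assumes ab: "a < \<alpha>" "\<alpha> \<le> \<beta>" "\<beta> < b" and R: "0 \<le> R"
    and weak: "\<And>j. j \<in> Basis \<Longrightarrow> weak_partial ({a<..<b} \<times> UNIV) j v (D j)"
    and eq: "\<And>\<phi>. \<phi> \<in> test_functions ({a<..<b} \<times> UNIV) \<Longrightarrow>
      (LINT p:{a<..<b} \<times> UNIV|lborel. v p * wave_op \<phi> p) = (LINT p:{a<..<b} \<times> UNIV|lborel. G p * \<phi> p)"
    and D [measurable]: "\<And>j. D j \<in> borel_measurable borel"
    and G [measurable]: "G \<in> borel_measurable borel"
    and M: "\<And>j t. j \<in> Basis \<Longrightarrow> (\<integral>\<^sup>+x. ennreal (\<bar>D j (t, x)\<bar> ^ 2) \<partial>lborel) \<le> ennreal (M ^ 2)" "0 \<le> M"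
    and \<gamma>: "\<gamma> \<in> borel_measurable borel" "\<And>t. 0 \<le> \<gamma> t" "(\<integral>\<^sup>+t. ennreal (\<gamma> t) \<partial>lborel) < \<infinity>"
      "AE t in lborel. (\<integral>\<^sup>+x. ennreal (\<bar>G (t, x)\<bar> ^ 2) \<partial>lborel) \<le> ennreal (\<gamma> t ^ 2)"
    and \<Phi>: "C_diff (Suc 0) \<Phi>" and supp: "\<And>p. p \<notin> {\<alpha>..\<beta>} \<times> cball 0 R \<Longrightarrow> \<Phi> p = 0"
  shows "(LINT p|lborel. partial t0 \<Phi> p * (((D t0 p)\<^sup>2 + (\<Sum>i\<in>Basis. (D (0, i) p)\<^sup>2)) / 2)
        - (\<Sum>i\<in>Basis. partial (0, i) \<Phi> p * D (0, i) p * D t0 p))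
    = (LINT p|lborel. G p * (\<Phi> p * D t0 p))"
proof -
  define \<Omega> where "\<Omega> = {a<..<b} \<times> (UNIV :: (real^3) set)"
  \<comment> \<open>Each mollification enlarges the support by at most \<open>\<delta>\<close>: from
    \<open>K0\<close> to \<open>K1\<close> for the test functions, and from \<open>K1\<close> to
    \<open>K\<close> for the values of \<open>v\<close> that enter. A third of the distance to the
    endpoints keeps \<open>K\<close> inside the open strip.\<close>
  define \<delta> where "\<delta> = min (\<alpha> - a) (b - \<beta>) / 3"
  have \<delta>: "0 < \<delta>" "\<delta> < (\<alpha> - a) / 2" "\<delta> < (b - \<beta>) / 2"
    using ab by (auto simp: \<delta>_def min_def)
  define K0 where "K0 = {\<alpha>..\<beta>} \<times> cball (0::real^3) R"
  define K1 where "K1 = {\<alpha> - \<delta>..\<beta> + \<delta>} \<times> cball (0::real^3) (R + \<delta>)"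
  define K where "K = {\<alpha> - \<delta> - \<delta>..\<beta> + \<delta> + \<delta>} \<times> cball (0::real^3) (R + \<delta> + \<delta>)"
  have compact: "compact K0" "compact K1" "compact K"
    unfolding K0_def K1_def K_def by (intro compact_Times compact_Icc compact_cball)+
  have closed: "closed K0" "closed K1" using compact compact_imp_closed by auto
  have K\<Omega>: "K \<subseteq> \<Omega>" using \<delta> by (auto simp: K_def \<Omega>_def)
  have K01: "K0 \<subseteq> K1" and K1K: "K1 \<subseteq> K" using \<delta> by (auto simp: K0_def K1_def K_def)
  have ball0: "cball p e \<subseteq> K1" if "p \<in> K0" "e \<le> \<delta>" for p e
    using slab_cball[of p \<alpha> \<beta> R e \<delta>] that by (simp add: K0_def K1_def)
  have ball1: "cball p e \<subseteq> K" if "p \<in> K1" "e \<le> \<delta>" for p e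
    using slab_cball[of p "\<alpha> - \<delta>" "\<beta> + \<delta>" "R + \<delta>" e \<delta>] that by (simp add: K1_def K_def)
  define r where "r = \<bar>\<alpha>\<bar> + \<bar>\<beta>\<bar> + R"
  have rK: "p \<notin> K0" if "r < norm p" for p
    using slab_norm[of p \<alpha> \<beta> R] that by (auto simp: K0_def r_def)
  have \<Phi>0: "\<Phi> p = 0" if "p \<notin> K0" for p using supp that by (simp add: K0_def)
  have \<Phi>r: "\<Phi> p = 0" if "r < norm p" for p using \<Phi>0 rK that by blast
  have p\<Phi>0: "partial j \<Phi> p = 0" if "p \<notin> K0" for j p
    by (rule partial_eq_0_off_closed[OF closed(1) \<Phi>0 that])
  have \<Phi>c: "continuous_on UNIV \<Phi>" "\<And>j. j \<in> Basis \<Longrightarrow> continuous_on UNIV (partial j \<Phi>)"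
    using C_diff_Suc_imp[OF \<Phi>] \<Phi> by auto
  have [measurable]: "\<Phi> \<in> borel_measurable borel"
    using \<Phi>c by (intro borel_measurable_continuous_onI)
  have p\<Phi>m: "partial j \<Phi> \<in> borel_measurable borel" if "j \<in> Basis" for j
    using \<Phi>c that by (intro borel_measurable_continuous_onI)
  obtain C where C: "0 \<le> C" "\<And>p. \<bar>\<Phi> p\<bar> \<le> C"
    using bounded_support_bounded[OF \<Phi>c(1) \<Phi>r] by blast

  define \<epsilon> where "\<epsilon> n = \<delta> * inverse (real (Suc n))" for n
  have \<epsilon>: "0 < \<epsilon> n" "\<epsilon> n \<le> \<delta>" for n
    using \<delta> by (auto simp: \<epsilon>_def field_simps)
  have \<epsilon>0: "\<epsilon> \<longlonglongrightarrow> 0"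
    unfolding \<epsilon>_def by (rule tendsto_mult_right_zero[OF LIMSEQ_inverse_real_of_nat])
  have "\<forall>n. \<exists>\<rho>::real \<times> (real^3) \<Rightarrow> real. mollifier (\<epsilon> n) \<rho>"
    using mollifier_exists \<epsilon>(1) by blast
  then obtain \<rho> :: "nat \<Rightarrow> real \<times> (real^3) \<Rightarrow> real" where \<rho>: "\<And>n. mollifier (\<epsilon> n) (\<rho> n)"
    by metis
  note \<rho>k = mollifier_smooth_kernel[OF \<rho>]
  have \<rho>even: "\<rho> n (- x) = \<rho> n x" for n x using \<rho>[of n] unfolding mollifier_def by blast

  have t0: "t0 \<in> Basis" by (simp add: t0_def)
  \<comment> \<open>Restriction to the compact \<open>K\<close> turns locally integrable functions
    into integrable ones, so that convolutions are defined everywhere; at points of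
    \<open>K0\<close> the derivative of the mollified \<open>v1\<close> is still the mollified
    derivative.\<close>
  define v1 where "v1 p = indicator K p * v p" for p
  define D1 where "D1 j p = indicator K p * D j p" for j p
  have locint: "integrable lborel (\<lambda>p. indicator K p * f p)" if "loc_integrable \<Omega> f" for f
    using that compact(3) K\<Omega> unfolding loc_integrable_def set_integrable_def by auto
  have v1i: "integrable lborel v1"
    unfolding v1_def using weak[OF t0] by (intro locint) (simp add: weak_partial_def \<Omega>_def)
  have D1i: "integrable lborel (D1 j)" if "j \<in> Basis" for j
    unfolding D1_def using weak[OF that] by (intro locint) (simp add: weak_partial_def \<Omega>_def)
  have [measurable]: "K \<in> sets borel" using compact(3) by (simp add: borel_compact)
  have D1m [measurable]: "D1 j \<in> borel_measurable borel" for j unfolding D1_def by measurable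
  have D1s: "(\<integral>\<^sup>+x. ennreal (\<bar>D1 j (t, x)\<bar> ^ 2) \<partial>lborel) \<le> ennreal (M ^ 2)" if "j \<in> Basis" for j t
    by (rule order_trans[OF nn_integral_mono M(1)[OF that, of t]])
       (auto simp: D1_def indicator_def intro!: ennreal_leI)
  have D1f: "power_norm 2 (D1 j) < \<infinity>" if "j \<in> Basis" for j
    by (rule power_norm_slab[OF D1m D1s[OF that], of "\<alpha> - \<delta> - \<delta>" "\<beta> + \<delta> + \<delta>"])
       (auto simp: D1_def K_def)
  have D1D: "D1 j p = D j p" if "p \<in> K0" for j p
    using that K01 K1K by (auto simp: D1_def indicator_def)

  define c where "c n j = conv (D1 j) (\<rho> n)" for n j
  have cc: "continuous_on UNIV (c n j)" if "j \<in> Basis" for n j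
    unfolding c_def by (rule conv_continuous[OF D1i[OF that] \<rho>k])
  have cm: "c n j \<in> borel_measurable borel" if "j \<in> Basis" for n j
    using cc[OF that] by (rule borel_measurable_continuous_onI)
  have cf: "power_norm 2 (c n j) < \<infinity>" if "j \<in> Basis" for n j
    using conv_Lp_contraction[OF D1i[OF that] \<rho>, of 2] D1f[OF that]
    unfolding c_def power_norm_def by (metis (no_types, lifting) le_less_trans)
  have clim: "(\<lambda>n. power_norm 2 (\<lambda>x. c n j x - D1 j x)) \<longlonglongrightarrow> 0" if "j \<in> Basis" for j
    unfolding c_def by (rule mollifier_power_norm_tendsto[OF D1i[OF that] D1f[OF that] _ \<rho> \<epsilon>0]) simp
  have cpart: "partial j (conv v1 (\<rho> n)) p = c n j p" if "j \<in> Basis" "p \<in> K0" for n j p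
  proof -
    have "partial j (conv v1 (\<rho> n)) p = conv v1 (partial j (\<rho> n)) p"
      using conv_partial[OF v1i \<rho>k that(1)] by simp
    also have "\<dots> = c n j p"
      unfolding c_def v1_def[abs_def] D1_def[abs_def]
      by (rule conv_weak_partial[OF weak[OF that(1), folded \<Omega>_def] K\<Omega>
            order_trans[OF ball0[OF that(2) \<epsilon>(2)] K1K] \<rho>k])
    finally show ?thesis .
  qed

  define \<psi> where "\<psi> n p = \<Phi> p * c n t0 p" for n p
  have \<psi>0: "\<psi> n p = 0" if "p \<notin> K0" for n p using \<Phi>0[OF that] by (simp add: \<psi>_def)
  have \<psi>i: "integrable lborel (\<psi> n)" for n
    using rK \<psi>0 unfolding \<psi>_def
    by (intro continuous_bounded_support_integrable[of _ r] continuous_intros \<Phi>c cc t0) auto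
  define \<phi> where "\<phi> n = conv (\<psi> n) (\<rho> n)" for n
  have conv0: "conv (\<psi> n) k p = 0" if "p \<notin> K1" "smooth_kernel (\<epsilon> n) k" for n k p
  proof (rule conv_eq_0[of "\<epsilon> n"])
    show "k x = 0" if "\<epsilon> n < norm x" for x using smooth_kernel_eq_0 that \<open>smooth_kernel (\<epsilon> n) k\<close> by blast
    fix y assume "norm (p - y) \<le> \<epsilon> n"
    then have "p \<in> cball y (\<epsilon> n)" by (simp add: dist_norm norm_minus_commute)
    then have "y \<notin> K0" using ball0[OF _ \<epsilon>(2)] \<open>p \<notin> K1\<close> by blast
    then show "\<psi> n y = 0" by (rule \<psi>0)
  qed
  have test: "\<phi> n \<in> test_functions \<Omega>" for n
  proof -
    have "closure {p. \<phi> n p \<noteq> 0} \<subseteq> K1"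
    proof (rule closure_minimal)
      show "{p. \<phi> n p \<noteq> 0} \<subseteq> K1" using conv0[OF _ \<rho>k] by (auto simp: \<phi>_def)
    qed (rule closed)
    moreover from this have "compact (closure {p. \<phi> n p \<noteq> 0})"
      using compact(2) by (metis closed_closure compact_Int_closed inf.absorb2)
    moreover have "C_diff m (\<phi> n)" for m unfolding \<phi>_def by (rule conv_C_diff[OF \<psi>i \<rho>k])
    ultimately show ?thesis using K1K K\<Omega> unfolding test_functions_def by blast
  qed
  have lhs: "(LINT p:\<Omega>|lborel. v p * wave_op (\<phi> n) p)
      = (LINT p|lborel. partial t0 \<Phi> p * (((c n t0 p)\<^sup>2 + (\<Sum>i\<in>Basis. (c n (0, i) p)\<^sup>2)) / 2)
        - (\<Sum>i\<in>Basis. partial (0, i) \<Phi> p * c n (0, i) p * c n t0 p))" for n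
  proof -
    let ?u = "conv v1 (\<rho> n)"
    have "wave_op (\<phi> n) = conv (\<psi> n) (wave_op (\<rho> n))"
      unfolding \<phi>_def by (rule wave_op_conv[OF \<psi>i \<rho>k])
    moreover have "indicator \<Omega> p *\<^sub>R (v p * conv (\<psi> n) (wave_op (\<rho> n)) p)
        = v1 p * conv (\<psi> n) (wave_op (\<rho> n)) p" for p
      using conv0[OF _ smooth_kernel_wave_op[OF \<rho>k], of p n] K1K K\<Omega>
      by (cases "p \<in> K1") (auto simp: v1_def indicator_def)
    ultimately have "(LINT p:\<Omega>|lborel. v p * wave_op (\<phi> n) p)
        = (LINT p|lborel. v1 p * conv (\<psi> n) (wave_op (\<rho> n)) p)"
      by (simp only: set_lebesgue_integral_def)
    also have "\<dots> = (LINT p|lborel. \<psi> n p * conv v1 (wave_op (\<rho> n)) p)"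
      by (rule conv_adjoint[OF v1i \<psi>i smooth_kernel_wave_op[OF \<rho>k] wave_op_even[OF \<rho>k \<rho>even]])
    also have "\<dots> = (LINT p|lborel. \<Phi> p * partial (1, 0) ?u p * wave_op ?u p)"
    proof (intro Bochner_Integration.integral_cong refl)
      fix p
      show "\<psi> n p * conv v1 (wave_op (\<rho> n)) p = \<Phi> p * partial (1, 0) ?u p * wave_op ?u p"
        using wave_op_conv[OF v1i \<rho>k, of n] cpart[OF t0, of p n] \<Phi>0[of p]
        by (cases "p \<in> K0") (auto simp: \<psi>_def t0_def)
    qed
    also have "\<dots> = (LINT p|lborel. partial (1, 0) \<Phi> p * (((partial (1, 0) ?u p)\<^sup>2 + (\<Sum>i\<in>Basis. (partial (0, i) ?u p)\<^sup>2)) / 2)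
        - (\<Sum>i\<in>Basis. partial (0, i) \<Phi> p * partial (0, i) ?u p * partial (1, 0) ?u p))"
      by (rule smooth_energy_identity[OF conv_C_diff[OF v1i \<rho>k] \<Phi> \<Phi>r])
    also have "\<dots> = (LINT p|lborel. partial t0 \<Phi> p * (((c n t0 p)\<^sup>2 + (\<Sum>i\<in>Basis. (c n (0, i) p)\<^sup>2)) / 2)
        - (\<Sum>i\<in>Basis. partial (0, i) \<Phi> p * c n (0, i) p * c n t0 p))"
    proof (intro Bochner_Integration.integral_cong refl)
      fix p
      show "partial (1, 0) \<Phi> p * (((partial (1, 0) ?u p)\<^sup>2 + (\<Sum>i\<in>Basis. (partial (0, i) ?u p)\<^sup>2)) / 2)
          - (\<Sum>i\<in>Basis. partial (0, i) \<Phi> p * partial (0, i) ?u p * partial (1, 0) ?u p)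
        = partial t0 \<Phi> p * (((c n t0 p)\<^sup>2 + (\<Sum>i\<in>Basis. (c n (0, i) p)\<^sup>2)) / 2)
          - (\<Sum>i\<in>Basis. partial (0, i) \<Phi> p * c n (0, i) p * c n t0 p)"
      proof (cases "p \<in> K0")
        case True
        then show ?thesis using cpart[OF t0 True, of n] cpart[OF Basis_space True, of _ n]
          by (simp add: t0_def)
      next
        case False
        then show ?thesis by (simp add: p\<Phi>0)
      qed
    qed
    finally show ?thesis .
  qed

  have pB: "\<exists>B. \<forall>p. \<bar>partial j \<Phi> p\<bar> \<le> B" if "j \<in> Basis" for j
    using bounded_support_bounded[OF \<Phi>c(2)[OF that], of r] p\<Phi>0 rK by blast
  have pair: "(\<lambda>n. LINT p|lborel. partial j \<Phi> p * (c n k p * c n l p))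
      \<longlonglongrightarrow> (LINT p|lborel. partial j \<Phi> p * (D1 k p * D1 l p))"
    and pint: "integrable lborel (\<lambda>p. partial j \<Phi> p * (c n k p * c n l p))"
    and pintD: "integrable lborel (\<lambda>p. partial j \<Phi> p * (D1 k p * D1 l p))"
    if jkl: "j \<in> Basis" "k \<in> Basis" "l \<in> Basis" for j k l n
  proof -
    obtain B where B: "\<And>p. \<bar>partial j \<Phi> p\<bar> \<le> B" using pB[OF jkl(1)] by blast
    show "(\<lambda>n. LINT p|lborel. partial j \<Phi> p * (c n k p * c n l p))
      \<longlonglongrightarrow> (LINT p|lborel. partial j \<Phi> p * (D1 k p * D1 l p))"
      using jkl by (intro L2_pair_tendsto[of _ _ _ _ _ B] D1m p\<Phi>m cm B D1f cf clim)
    show "integrable lborel (\<lambda>p. partial j \<Phi> p * (c n k p * c n l p))"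
      using integrable_mult_bounded[OF integrable_mult_L2[OF cm cm cf cf] p\<Phi>m B] jkl
      by (simp add: mult.commute)
    show "integrable lborel (\<lambda>p. partial j \<Phi> p * (D1 k p * D1 l p))"
      using integrable_mult_bounded[OF integrable_mult_L2[OF D1m D1m D1f D1f] p\<Phi>m B] jkl
      by (simp add: mult.commute)
  qed
  have split: "(LINT p|lborel. partial t0 \<Phi> p * (((e t0 p)\<^sup>2 + (\<Sum>i\<in>Basis. (e (0, i) p)\<^sup>2)) / 2)
        - (\<Sum>i\<in>Basis. partial (0, i) \<Phi> p * e (0, i) p * e t0 p))
      = ((LINT p|lborel. partial t0 \<Phi> p * (e t0 p * e t0 p))
          + (\<Sum>i\<in>Basis. LINT p|lborel. partial t0 \<Phi> p * (e (0, i) p * e (0, i) p))) / 2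
        - (\<Sum>i\<in>Basis. LINT p|lborel. partial (0, i) \<Phi> p * (e (0, i) p * e t0 p))"
    if e: "\<And>j k l. j \<in> Basis \<Longrightarrow> k \<in> Basis \<Longrightarrow> l \<in> Basis \<Longrightarrow> integrable lborel (\<lambda>p. partial j \<Phi> p * (e k p * e l p))"
    for e :: "real \<times> (real^3) \<Rightarrow> real \<times> (real^3) \<Rightarrow> real"
  proof -
    have "partial t0 \<Phi> p * (((e t0 p)\<^sup>2 + (\<Sum>i\<in>Basis. (e (0, i) p)\<^sup>2)) / 2)
        - (\<Sum>i\<in>Basis. partial (0, i) \<Phi> p * e (0, i) p * e t0 p)
      = (partial t0 \<Phi> p * (e t0 p * e t0 p) + (\<Sum>i\<in>Basis. partial t0 \<Phi> p * (e (0, i) p * e (0, i) p))) / 2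
        - (\<Sum>i\<in>Basis. partial (0, i) \<Phi> p * (e (0, i) p * e t0 p))" for p
      by (simp add: power2_eq_square sum_distrib_left distrib_left mult.assoc)
    then show ?thesis using e t0 by (simp add: integral_sum)
  qed
  have lim1: "(\<lambda>n. LINT p:\<Omega>|lborel. v p * wave_op (\<phi> n) p)
      \<longlonglongrightarrow> (LINT p|lborel. partial t0 \<Phi> p * (((D1 t0 p)\<^sup>2 + (\<Sum>i\<in>Basis. (D1 (0, i) p)\<^sup>2)) / 2)
        - (\<Sum>i\<in>Basis. partial (0, i) \<Phi> p * D1 (0, i) p * D1 t0 p))"
  proof -
    have s1: "(LINT p:\<Omega>|lborel. v p * wave_op (\<phi> n) p)
      = ((LINT p|lborel. partial t0 \<Phi> p * (c n t0 p * c n t0 p))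
          + (\<Sum>i\<in>Basis. LINT p|lborel. partial t0 \<Phi> p * (c n (0, i) p * c n (0, i) p))) / 2
        - (\<Sum>i\<in>Basis. LINT p|lborel. partial (0, i) \<Phi> p * (c n (0, i) p * c n t0 p))" for n
      unfolding lhs by (rule split) (rule pint)
    have s2: "(LINT p|lborel. partial t0 \<Phi> p * (((D1 t0 p)\<^sup>2 + (\<Sum>i\<in>Basis. (D1 (0, i) p)\<^sup>2)) / 2)
        - (\<Sum>i\<in>Basis. partial (0, i) \<Phi> p * D1 (0, i) p * D1 t0 p))
      = ((LINT p|lborel. partial t0 \<Phi> p * (D1 t0 p * D1 t0 p))
          + (\<Sum>i\<in>Basis. LINT p|lborel. partial t0 \<Phi> p * (D1 (0, i) p * D1 (0, i) p))) / 2
        - (\<Sum>i\<in>Basis. LINT p|lborel. partial (0, i) \<Phi> p * (D1 (0, i) p * D1 t0 p))"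
      by (rule split) (rule pintD)
    show ?thesis
      unfolding s1 s2 by (intro tendsto_intros pair t0 Basis_space) auto
  qed

  \<comment> \<open>The distance of the test function to its limit splits into the mollification of
    \<open>\<psi> n\<close> minus that limit, a contraction applied to a null sequence, and the
    mollification error of a fixed function.\<close>
  define w where "w n p = \<phi> n p - \<Phi> p * D1 t0 p" for n p
  have \<Phi>Di: "integrable lborel (\<lambda>p. \<Phi> p * D1 t0 p)"
    using integrable_mult_bounded[OF D1i[OF t0], of \<Phi> C] C by (simp add: mult.commute)
  have \<Phi>Df: "power_norm 2 (\<lambda>p. \<Phi> p * D1 t0 p) < \<infinity>"
    using power_norm_mult_le[of "D1 t0" \<Phi> C 2] C D1f[OF t0]
    by (metis D1m ennreal_less_top ennreal_mult_less_top infinity_ennreal_def le_less_trans)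
  have [measurable]: "\<phi> n \<in> borel_measurable borel" for n
    unfolding \<phi>_def by (rule conv_measurable[OF \<psi>i \<rho>k])
  have wm [measurable]: "w n \<in> borel_measurable borel" for n unfolding w_def by measurable
  have wlim: "(\<lambda>n. power_norm 2 (w n)) \<longlonglongrightarrow> 0"
  proof -
    let ?f = "\<lambda>p. \<Phi> p * D1 t0 p"
    have 1: "(\<lambda>n. power_norm 2 (\<lambda>p. conv ?f (\<rho> n) p - ?f p)) \<longlonglongrightarrow> 0"
      by (rule mollifier_power_norm_tendsto[OF \<Phi>Di \<Phi>Df _ \<rho> \<epsilon>0]) simp
    have 2: "(\<lambda>n. power_norm 2 (\<lambda>p. conv (\<lambda>q. \<psi> n q - ?f q) (\<rho> n) p)) \<longlonglongrightarrow> 0"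
    proof (rule ennreal_tendsto_0_le[OF clim[OF t0]])
      fix n
      have "power_norm 2 (\<lambda>p. conv (\<lambda>q. \<psi> n q - ?f q) (\<rho> n) p) \<le> power_norm 2 (\<lambda>q. \<psi> n q - ?f q)"
        unfolding power_norm_def
        by (rule conv_Lp_contraction[OF Bochner_Integration.integrable_diff[OF \<psi>i \<Phi>Di] \<rho>]) simp
      also have "power_norm 2 (\<lambda>q. \<psi> n q - ?f q) = power_norm 2 (\<lambda>q. \<Phi> q * (c n t0 q - D1 t0 q))"
        by (simp add: \<psi>_def right_diff_distrib)
      also have "\<dots> \<le> ennreal (C ^ 2) * power_norm 2 (\<lambda>q. c n t0 q - D1 t0 q)"
        by (intro power_norm_mult_le C borel_measurable_diff cm t0 D1m)
      finally show "power_norm 2 (\<lambda>p. conv (\<lambda>q. \<psi> n q - ?f q) (\<rho> n) p)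
        \<le> ennreal (C ^ 2) * power_norm 2 (\<lambda>q. c n t0 q - D1 t0 q)" .
    qed
    have weq: "w n p = conv (\<lambda>q. \<psi> n q - ?f q) (\<rho> n) p + (conv ?f (\<rho> n) p - ?f p)" for n p
      using conv_integrable[OF \<psi>i \<rho>k] conv_integrable[OF \<Phi>Di \<rho>k]
      by (simp add: w_def \<phi>_def conv_def left_diff_distrib)
    show ?thesis
    proof (rule ennreal_tendsto_0_le[of "\<lambda>n. power_norm 2 (\<lambda>p. conv (\<lambda>q. \<psi> n q - ?f q) (\<rho> n) p)
          + power_norm 2 (\<lambda>p. conv ?f (\<rho> n) p - ?f p)"])
      show "(\<lambda>n. power_norm 2 (\<lambda>p. conv (\<lambda>q. \<psi> n q - ?f q) (\<rho> n) p)
          + power_norm 2 (\<lambda>p. conv ?f (\<rho> n) p - ?f p)) \<longlonglongrightarrow> 0"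
        using tendsto_add[OF 2 1] by simp
      fix n
      have [measurable]: "conv (\<lambda>q. \<psi> n q - ?f q) (\<rho> n) \<in> borel_measurable borel"
        by (rule conv_measurable[OF Bochner_Integration.integrable_diff[OF \<psi>i \<Phi>Di] \<rho>k])
      have [measurable]: "conv ?f (\<rho> n) \<in> borel_measurable borel" by (rule conv_measurable[OF \<Phi>Di \<rho>k])
      have "power_norm 2 (w n) = power_norm 2 (\<lambda>p. conv (\<lambda>q. \<psi> n q - ?f q) (\<rho> n) p + (conv ?f (\<rho> n) p - ?f p))"
        by (simp add: weq[abs_def])
      also have "\<dots> \<le> 2 ^ 2 * (power_norm 2 (\<lambda>p. conv (\<lambda>q. \<psi> n q - ?f q) (\<rho> n) p)
          + power_norm 2 (\<lambda>p. conv ?f (\<rho> n) p - ?f p))"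
        by (intro power_norm_add) measurable
      finally show "power_norm 2 (w n) \<le> ennreal 4 * (power_norm 2 (\<lambda>p. conv (\<lambda>q. \<psi> n q - ?f q) (\<rho> n) p)
          + power_norm 2 (\<lambda>p. conv ?f (\<rho> n) p - ?f p))" by simp
    qed
  qed
  have mult_slice: "(\<integral>\<^sup>+x. ennreal (\<bar>\<Phi> (t, x) * g (t, x)\<bar> ^ 2) \<partial>lborel) \<le> ennreal ((C * M) ^ 2)"
    if g [measurable]: "g \<in> borel_measurable borel"
      and g2: "(\<integral>\<^sup>+x. ennreal (\<bar>g (t, x)\<bar> ^ 2) \<partial>lborel) \<le> ennreal (M ^ 2)" for g t
  proof -
    have [measurable]: "(\<lambda>x. g (t, x)) \<in> borel_measurable borel" by (rule slice_measurable[OF g])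
    have "(\<integral>\<^sup>+x. ennreal (\<bar>\<Phi> (t, x) * g (t, x)\<bar> ^ 2) \<partial>lborel)
        \<le> (\<integral>\<^sup>+x. ennreal (C ^ 2) * ennreal (\<bar>g (t, x)\<bar> ^ 2) \<partial>lborel)"
    proof (intro nn_integral_mono)
      fix x
      have "\<bar>\<Phi> (t, x) * g (t, x)\<bar> ^ 2 \<le> C ^ 2 * \<bar>g (t, x)\<bar> ^ 2"
        unfolding abs_mult power_mult_distrib using C(2)[of "(t, x)"] by (intro mult_right_mono power_mono) auto
      then show "ennreal (\<bar>\<Phi> (t, x) * g (t, x)\<bar> ^ 2) \<le> ennreal (C ^ 2) * ennreal (\<bar>g (t, x)\<bar> ^ 2)"
        by (subst ennreal_mult[symmetric]) (auto intro: ennreal_leI)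
    qed
    also have "\<dots> = ennreal (C ^ 2) * (\<integral>\<^sup>+x. ennreal (\<bar>g (t, x)\<bar> ^ 2) \<partial>lborel)"
      by (rule nn_integral_cmult) measurable
    also have "\<dots> \<le> ennreal (C ^ 2) * ennreal (M ^ 2)" by (intro mult_left_mono g2) simp
    also have "\<dots> = ennreal ((C * M) ^ 2)" by (simp add: ennreal_mult[symmetric] power_mult_distrib)
    finally show ?thesis .
  qed
  \<comment> \<open>Both mollifications preserve slice bounds; the multiplication by
    \<open>\<Phi>\<close> between them costs the factor \<open>C\<close>.\<close>
  have \<phi>s: "(\<integral>\<^sup>+x. ennreal (\<bar>\<phi> n (t, x)\<bar> ^ 2) \<partial>lborel) \<le> ennreal ((C * M) ^ 2)" for n t
    unfolding \<phi>_def
  proof (rule conv_slice_bound[OF \<psi>i \<rho>])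
    fix s
    show "(\<integral>\<^sup>+y. ennreal (\<bar>\<psi> n (s, y)\<bar> ^ 2) \<partial>lborel) \<le> ennreal ((C * M) ^ 2)"
      unfolding \<psi>_def
      by (intro mult_slice cm[OF t0]) (unfold c_def, rule conv_slice_bound[OF D1i[OF t0] \<rho> D1s[OF t0]])
  qed
  have Ds: "(\<integral>\<^sup>+x. ennreal (\<bar>\<Phi> (t, x) * D1 t0 (t, x)\<bar> ^ 2) \<partial>lborel) \<le> ennreal ((C * M) ^ 2)" for t
    by (intro mult_slice D1m D1s t0)
  \<comment> \<open>The quasi-triangle inequality produces 8 times the square of
    \<open>C * M\<close>; the constant 4 inside the square rounds this up to 16.\<close>
  have ws: "(\<integral>\<^sup>+x. ennreal (\<bar>w n (t, x)\<bar> ^ 2) \<partial>lborel) \<le> ennreal ((4 * (C * M)) ^ 2)" for n t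
  proof -
    have [measurable]: "(\<lambda>x. \<phi> n (t, x)) \<in> borel_measurable borel" "(\<lambda>x. D1 t0 (t, x)) \<in> borel_measurable borel"
        "(\<lambda>x. \<Phi> (t, x)) \<in> borel_measurable borel"
      by (rule slice_measurable, measurable)+
    have "(\<integral>\<^sup>+x. ennreal (\<bar>w n (t, x)\<bar> ^ 2) \<partial>lborel)
        \<le> 2 ^ 2 * ((\<integral>\<^sup>+x. ennreal (\<bar>\<phi> n (t, x)\<bar> ^ 2) \<partial>lborel) + (\<integral>\<^sup>+x. ennreal (\<bar>\<Phi> (t, x) * D1 t0 (t, x)\<bar> ^ 2) \<partial>lborel))"
      using power_norm_add[of "\<lambda>x. \<phi> n (t, x)" "\<lambda>x. - (\<Phi> (t, x) * D1 t0 (t, x))" 2]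
      by (simp add: power_norm_def w_def)
    also have "\<dots> \<le> 2 ^ 2 * (ennreal ((C * M) ^ 2) + ennreal ((C * M) ^ 2))"
      by (intro mult_left_mono add_mono \<phi>s Ds) simp
    also have "\<dots> = ennreal (8 * (C * M) ^ 2)"
      by (simp add: ennreal_plus[symmetric] ennreal_mult mult.commute del: ennreal_plus)
    also have "\<dots> \<le> ennreal ((4 * (C * M)) ^ 2)" by (intro ennreal_leI) (simp add: power_mult_distrib)
    finally show ?thesis .
  qed
  have Gw: "(\<lambda>n. \<integral>\<^sup>+p. ennreal \<bar>G p * w n p\<bar> \<partial>lborel) \<longlonglongrightarrow> 0"
    using C(1) M(2) by (intro L1L2_pair_tendsto_0[OF G wm \<gamma> ws _ wlim]) simp
  have Gint: "integrable lborel (\<lambda>p. G p * f p)"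
    if [measurable]: "f \<in> borel_measurable borel"
      and f: "\<And>t. (\<integral>\<^sup>+x. ennreal (\<bar>f (t, x)\<bar> ^ 2) \<partial>lborel) \<le> ennreal ((C * M) ^ 2)" for f
  proof (rule integrableI_bounded)
    have "(\<integral>\<^sup>+p. ennreal \<bar>G p * f p\<bar> \<partial>lborel) \<le> ennreal (C * M) * (\<integral>\<^sup>+t. ennreal (\<gamma> t) \<partial>lborel)"
      using C(1) M(2) by (intro L1L2_pair_bound \<gamma> f) auto
    also have "\<dots> < \<infinity>" using \<gamma>(3) by (simp add: ennreal_mult_less_top)
    finally show "(\<integral>\<^sup>+p. ennreal (norm (G p * f p)) \<partial>lborel) < \<infinity>" by simp
  qed measurable
  have lim2: "(\<lambda>n. LINT p|lborel. G p * \<phi> n p) \<longlonglongrightarrow> (LINT p|lborel. G p * (\<Phi> p * D1 t0 p))"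
  proof (rule tendsto_L1_int)
    show "integrable lborel (\<lambda>p. G p * \<phi> n p)" for n by (intro Gint \<phi>s) measurable
    show "integrable lborel (\<lambda>p. G p * (\<Phi> p * D1 t0 p))" by (intro Gint Ds) measurable
    show "(\<lambda>n. \<integral>\<^sup>+p. ennreal (norm (G p * \<phi> n p - G p * (\<Phi> p * D1 t0 p))) \<partial>lborel) \<longlonglongrightarrow> 0"
      using Gw by (simp add: w_def right_diff_distrib)
  qed
  have rhs: "(LINT p:\<Omega>|lborel. v p * wave_op (\<phi> n) p) = (LINT p|lborel. G p * \<phi> n p)" for n
  proof -
    have "indicator \<Omega> p *\<^sub>R (G p * \<phi> n p) = G p * \<phi> n p" for p
      using conv0[OF _ \<rho>k, of p n] K1K K\<Omega> by (cases "p \<in> K1") (auto simp: \<phi>_def indicator_def)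
    then show ?thesis
      using eq[of "\<phi> n"] test[of n] by (simp only: set_lebesgue_integral_def \<Omega>_def)
  qed
  have "(LINT p|lborel. partial t0 \<Phi> p * (((D t0 p)\<^sup>2 + (\<Sum>i\<in>Basis. (D (0, i) p)\<^sup>2)) / 2)
        - (\<Sum>i\<in>Basis. partial (0, i) \<Phi> p * D (0, i) p * D t0 p))
      = (LINT p|lborel. partial t0 \<Phi> p * (((D1 t0 p)\<^sup>2 + (\<Sum>i\<in>Basis. (D1 (0, i) p)\<^sup>2)) / 2)
        - (\<Sum>i\<in>Basis. partial (0, i) \<Phi> p * D1 (0, i) p * D1 t0 p))"
  proof (intro Bochner_Integration.integral_cong refl)
    fix p
    show "partial t0 \<Phi> p * (((D t0 p)\<^sup>2 + (\<Sum>i\<in>Basis. (D (0, i) p)\<^sup>2)) / 2)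
        - (\<Sum>i\<in>Basis. partial (0, i) \<Phi> p * D (0, i) p * D t0 p)
      = partial t0 \<Phi> p * (((D1 t0 p)\<^sup>2 + (\<Sum>i\<in>Basis. (D1 (0, i) p)\<^sup>2)) / 2)
        - (\<Sum>i\<in>Basis. partial (0, i) \<Phi> p * D1 (0, i) p * D1 t0 p)"
      by (cases "p \<in> K0") (simp_all add: D1D p\<Phi>0)
  qed
  also have "\<dots> = (LINT p|lborel. G p * (\<Phi> p * D1 t0 p))"
    using lim1 lim2 unfolding rhs by (rule LIMSEQ_unique)
  also have "\<dots> = (LINT p|lborel. G p * (\<Phi> p * D t0 p))"
  proof (intro Bochner_Integration.integral_cong refl)
    fix p
    show "G p * (\<Phi> p * D1 t0 p) = G p * (\<Phi> p * D t0 p)"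
      by (cases "p \<in> K0") (simp_all add: D1D \<Phi>0)
  qed
  finally show ?thesis .
qed

section \<open>Weighted energy flux\<close>

lemma C1_I:
  assumes "\<And>p. (f has_derivative f' p) (at p)" "\<And>i. i \<in> Basis \<Longrightarrow> continuous_on UNIV (\<lambda>p. f' p i)"
  shows "C_diff (Suc 0) f"
proof -
  have "partial i f = (\<lambda>p. f' p i)" for i using partial_eqI[OF assms(1)] by blast
  then show ?thesis using assms unfolding C_diff.simps by (auto simp: differentiable_def simp del: split_paired_All)
qed

lemma C1_compose:
  assumes h: "C_diff (Suc 0) h" and g: "\<And>p. (g has_real_derivative g' (h p)) (at (h p))"
    and c: "continuous_on UNIV (\<lambda>p. g' (h p))"
  shows "C_diff (Suc 0) (\<lambda>p. g (h p))" "partial i (\<lambda>p. g (h p)) p = g' (h p) * partial i h p"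
proof -
  have d: "((\<lambda>p. g (h p)) has_derivative (\<lambda>k. g' (h p) * frechet_derivative h (at p) k)) (at p)" for p
  proof -
    have "(h has_derivative frechet_derivative h (at p)) (at p)"
      using C_diff_differentiable[OF h] frechet_derivative_works by blast
    moreover have "(g has_derivative (*) (g' (h p))) (at (h p))"
      using g by (simp add: has_field_derivative_def)
    ultimately show ?thesis by (rule has_derivative_compose)
  qed
  show "partial i (\<lambda>p. g (h p)) p = g' (h p) * partial i h p" for p
    using partial_eqI[OF d] by (simp add: partial_def)
  show "C_diff (Suc 0) (\<lambda>p. g (h p))"
  proof (rule C1_I[OF d])
    fix i :: 'a assume "i \<in> Basis"
    then have "continuous_on UNIV (partial i h)" using h by simp
    then show "continuous_on UNIV (\<lambda>p. g' (h p) * frechet_derivative h (at p) i)"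
      using c by (intro continuous_on_mult) (auto simp: partial_def[abs_def])
  qed
qed

lemma C1_fst: "C_diff (Suc 0) (fst :: real \<times> 'b::euclidean_space \<Rightarrow> real)"
  and partial_fst: "partial i (fst :: real \<times> 'b \<Rightarrow> real) p = fst i"
proof -
  have d: "((fst :: real \<times> 'b \<Rightarrow> real) has_derivative fst) (at p)" for p
    by (auto intro!: derivative_eq_intros)
  show "C_diff (Suc 0) (fst :: real \<times> 'b \<Rightarrow> real)" by (rule C1_I[OF d]) auto
  show "partial i (fst :: real \<times> 'b \<Rightarrow> real) p = fst i" by (rule partial_eqI[OF d])
qed

lemma C1_inner_snd: "C_diff (Suc 0) (\<lambda>p :: real \<times> 'b::euclidean_space. snd p \<bullet> snd p)"
  and partial_inner_snd: "partial i (\<lambda>p :: real \<times> 'b. snd p \<bullet> snd p) p = 2 * (snd p \<bullet> snd i)"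
proof -
  have d: "((\<lambda>p :: real \<times> 'b. snd p \<bullet> snd p) has_derivative (\<lambda>h. 2 * (snd p \<bullet> snd h))) (at p)" for p
    by (auto intro!: derivative_eq_intros simp: inner_commute)
  show "C_diff (Suc 0) (\<lambda>p :: real \<times> 'b. snd p \<bullet> snd p)"
    by (rule C1_I[OF d]) (auto intro!: continuous_intros)
  show "partial i (\<lambda>p :: real \<times> 'b. snd p \<bullet> snd p) p = 2 * (snd p \<bullet> snd i)"
    by (rule partial_eqI[OF d])
qed

text \<open>The squared positive part vanishes on a half-line and is continuously differentiable,
  which is the regularity that \<open>energy_identity\<close> asks of its multiplier.\<close>

definition ramp :: "real \<Rightarrow> real" where "ramp z = (max 0 z)\<^sup>2"

lemma ramp_has_derivative: "(ramp has_real_derivative 2 * max 0 z) (at z)"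
proof -
  consider "0 < z" | "z = 0" | "z < 0" by linarith
  then show ?thesis
  proof cases
    case 1
    have "((\<lambda>z. z\<^sup>2) has_real_derivative 2 * max 0 z) (at z)"
      using 1 by (auto intro!: derivative_eq_intros)
    then show ?thesis
      by (rule has_field_derivative_transform_within_open[of _ _ _ "{0<..}"])
         (use 1 in \<open>auto simp: ramp_def\<close>)
  next
    case 2
    have "((\<lambda>h. ramp h / h) \<longlongrightarrow> 0) (at 0)"
    proof (rule Lim_null_comparison)
      show "\<forall>\<^sub>F h in at 0. norm (ramp h / h) \<le> \<bar>h\<bar>"
        by (intro always_eventually allI) (auto simp: ramp_def max_def power2_eq_square)
      show "((\<lambda>h::real. \<bar>h\<bar>) \<longlongrightarrow> 0) (at 0)" by (intro tendsto_eq_intros) auto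
    qed
    then show ?thesis using 2 by (simp add: DERIV_def ramp_def)
  next
    case 3
    have "((\<lambda>z. 0) has_real_derivative 2 * max 0 z) (at z)" using 3 by auto
    then show ?thesis
      by (rule has_field_derivative_transform_within_open[of _ _ _ "{..<0}"])
         (use 3 in \<open>auto simp: ramp_def\<close>)
  qed
qed

text \<open>A C^1 transition from 0 to 1 across the unit interval. The denominator is positive
  because \<open>z\<close> and \<open>1 - z\<close> cannot both be nonpositive.\<close>

definition step :: "real \<Rightarrow> real" where "step z = ramp z / (ramp z + ramp (1 - z))"

definition step' :: "real \<Rightarrow> real" where
  "step' z = (2 * max 0 z * ramp (1 - z) + ramp z * (2 * max 0 (1 - z))) / (ramp z + ramp (1 - z))\<^sup>2"

lemma ramp_sum_pos: "0 < ramp z + ramp (1 - z)"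
proof (cases "0 < z")
  case True
  then have "0 < ramp z" "0 \<le> ramp (1 - z)" by (auto simp: ramp_def)
  then show ?thesis by linarith
next
  case False
  then have "0 < ramp (1 - z)" "0 \<le> ramp z" by (auto simp: ramp_def)
  then show ?thesis by linarith
qed

lemma step_has_derivative: "(step has_real_derivative step' z) (at z)"
proof -
  have r: "((\<lambda>z. ramp (1 - z)) has_real_derivative - (2 * max 0 (1 - z))) (at z)"
  proof -
    have d: "((\<lambda>z. 1 - z) has_real_derivative - 1) (at z)"
      by (auto intro!: derivative_eq_intros)
    show ?thesis
      using DERIV_chain2[where f = ramp and g = "\<lambda>z. 1 - z" and x = z, OF ramp_has_derivative d] by simp
  qed
  have "((\<lambda>z. ramp z / (ramp z + ramp (1 - z))) has_real_derivative
      (2 * max 0 z * (ramp z + ramp (1 - z)) - ramp z * (2 * max 0 z + - (2 * max 0 (1 - z))))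
        / ((ramp z + ramp (1 - z)) * (ramp z + ramp (1 - z)))) (at z)"
    using ramp_sum_pos[of z] by (intro DERIV_divide DERIV_add ramp_has_derivative r) auto
  moreover have "A * (q + r) - q * (A + - B) = A * r + q * B" for A B q r :: real
    by (simp add: algebra_simps)
  ultimately show ?thesis
    unfolding step_def[abs_def] step'_def power2_eq_square by (simp only:)
qed

lemma ramp_nonneg: "0 \<le> ramp z"
  by (simp add: ramp_def)

lemma ramp_eq_0: "z \<le> 0 \<Longrightarrow> ramp z = 0"
  by (simp add: ramp_def)

lemma step_bounds: "0 \<le> step z" "step z \<le> 1"
  unfolding step_def using ramp_nonneg[of z] ramp_nonneg[of "1 - z"] ramp_sum_pos[of z]
  by (simp_all add: divide_le_eq)

lemma step_eq_0: "z \<le> 0 \<Longrightarrow> step z = 0"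
  by (simp add: step_def ramp_eq_0)

lemma step_eq_1: "1 \<le> z \<Longrightarrow> step z = 1"
  using ramp_sum_pos[of z] by (simp add: step_def ramp_eq_0)

lemma step'_nonneg: "0 \<le> step' z"
  unfolding step'_def
  by (intro divide_nonneg_nonneg add_nonneg_nonneg mult_nonneg_nonneg ramp_nonneg) simp_all

lemma step'_eq_0: "z \<le> 0 \<or> 1 \<le> z \<Longrightarrow> step' z = 0"
  by (elim disjE) (simp_all add: step'_def ramp_eq_0)

lemma step'_continuous: "continuous_on UNIV step'"
proof -
  have c: "continuous_on UNIV ramp"
    using DERIV_isCont[OF ramp_has_derivative] by (simp add: continuous_at_imp_continuous_on)
  have c': "continuous_on UNIV (\<lambda>z. ramp (1 - z))"
    by (rule continuous_on_compose2[OF c]) (auto intro!: continuous_intros)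
  have "(ramp z + ramp (1 - z))\<^sup>2 \<noteq> 0" for z using ramp_sum_pos[of z] by simp
  then show ?thesis
    unfolding step'_def by (intro continuous_intros c c') blast
qed

lemma step'_bounded: "\<exists>B. 0 \<le> B \<and> (\<forall>z. \<bar>step' z\<bar> \<le> B)"
  by (rule bounded_support_bounded[OF step'_continuous, of 1]) (auto intro!: step'_eq_0)

text \<open>\<open>V\<close> is the mean of \<open>W\<close> over an interval of length
  \<open>\<delta>\<close>, that is, a difference quotient of an antiderivative. Its derivative is a
  difference quotient of \<open>W\<close>, whence the sign, and monotonicity encloses the mean
  between the endpoint values.\<close>

lemma smooth_average:
  fixes W :: "real \<Rightarrow> real"
  assumes W: "continuous_on UNIV W" and mono: "mono W" and \<delta>: "0 < \<delta>"
  shows "\<exists>V V'. (\<forall>\<tau>. (V has_real_derivative V' \<tau>) (at \<tau>)) \<and> continuous_on UNIV V' \<and> (\<forall>\<tau>. 0 \<le> V' \<tau>)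
    \<and> (\<forall>\<tau>. W \<tau> \<le> V \<tau> \<and> V \<tau> \<le> W (\<tau> + \<delta>))"
proof -
  have "\<exists>F. \<forall>x. -\<infinity> < ereal x \<longrightarrow> ereal x < \<infinity> \<longrightarrow> (F has_vector_derivative W x) (at x)"
    by (rule einterval_antiderivative) (use W in \<open>auto simp: continuous_on_eq_continuous_at\<close>)
  then obtain F where F: "\<And>x. (F has_real_derivative W x) (at x)"
    by (auto simp: has_real_derivative_iff_has_vector_derivative)
  define V where "V \<tau> = (F (\<tau> + \<delta>) - F \<tau>) / \<delta>" for \<tau>
  define V' where "V' \<tau> = (W (\<tau> + \<delta>) - W \<tau>) / \<delta>" for \<tau>
  have "(V has_real_derivative V' \<tau>) (at \<tau>)" for \<tau>
  proof -
    have "((\<lambda>\<tau>. F (\<tau> + \<delta>)) has_real_derivative W (\<tau> + \<delta>) * 1) (at \<tau>)"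
      by (rule DERIV_chain2[OF F]) (auto intro!: derivative_eq_intros)
    then show ?thesis unfolding V_def[abs_def] V'_def
      using F \<delta> by (auto intro!: derivative_eq_intros)
  qed
  moreover have "continuous_on UNIV V'" unfolding V'_def
    using \<delta> by (intro continuous_intros W continuous_on_compose2[OF W]) auto
  moreover have "0 \<le> V' \<tau>" for \<tau>
    unfolding V'_def using \<delta> mono by (auto intro!: divide_nonneg_nonneg simp: monoD)
  moreover have "W \<tau> \<le> V \<tau> \<and> V \<tau> \<le> W (\<tau> + \<delta>)" for \<tau>
  proof -
    obtain z where z: "\<tau> < z" "z < \<tau> + \<delta>" "F (\<tau> + \<delta>) - F \<tau> = (\<tau> + \<delta> - \<tau>) * W z"
      using MVT2[of \<tau> "\<tau> + \<delta>" F W] \<delta> F by auto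
    then have "V \<tau> = W z" using \<delta> by (simp add: V_def)
    then show ?thesis using z mono by (simp add: monoD)
  qed
  ultimately show ?thesis by blast
qed

text \<open>The functions live on all of spacetime, in view of extensions by zero from the strip, so
  that measurability and slice bounds are global. The family \<open>D\<close> holds the time and
  space derivatives under their basis vectors, and \<open>\<gamma>\<close> encodes that
  \<open>G\<close> is integrable in time with values in L^2.\<close>

locale finite_energy_wave =
  fixes a b :: real and v G :: "real \<times> (real^3) \<Rightarrow> real"
    and D :: "real \<times> (real^3) \<Rightarrow> real \<times> (real^3) \<Rightarrow> real" and M :: real and \<gamma> :: "real \<Rightarrow> real"
  assumes weak: "\<And>j. j \<in> Basis \<Longrightarrow> weak_partial ({a<..<b} \<times> UNIV) j v (D j)"
    and weak_eq: "\<And>\<phi>. \<phi> \<in> test_functions ({a<..<b} \<times> UNIV) \<Longrightarrow>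
      (LINT p:{a<..<b} \<times> UNIV|lborel. v p * wave_op \<phi> p) = (LINT p:{a<..<b} \<times> UNIV|lborel. G p * \<phi> p)"
    and D_meas [measurable]: "\<And>j. D j \<in> borel_measurable borel"
    and G_meas [measurable]: "G \<in> borel_measurable borel"
    and D_slice: "\<And>j t. j \<in> Basis \<Longrightarrow> (\<integral>\<^sup>+x. ennreal (\<bar>D j (t, x)\<bar> ^ 2) \<partial>lborel) \<le> ennreal (M ^ 2)"
    and M_nonneg: "0 \<le> M"
    and \<gamma>: "\<gamma> \<in> borel_measurable borel" "\<And>t. 0 \<le> \<gamma> t" "(\<integral>\<^sup>+t. ennreal (\<gamma> t) \<partial>lborel) < \<infinity>"
      "AE t in lborel. (\<integral>\<^sup>+x. ennreal (\<bar>G (t, x)\<bar> ^ 2) \<partial>lborel) \<le> ennreal (\<gamma> t ^ 2)"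
begin

section \<open>The quadratic part of the energy density\<close>

abbreviation vt :: "real \<times> (real^3) \<Rightarrow> real" where "vt \<equiv> D (1, 0)"

definition kin :: "real \<times> (real^3) \<Rightarrow> real" where
  "kin p = ((vt p)\<^sup>2 + (\<Sum>i\<in>Basis. (D (0, i) p)\<^sup>2)) / 2"

definition grad :: "real \<times> (real^3) \<Rightarrow> real^3" where
  "grad p = (\<Sum>i\<in>Basis. D (0, i) p *\<^sub>R i)"

lemma grad_inner: "x \<bullet> grad p = (\<Sum>i\<in>Basis. (x \<bullet> i) * D (0, i) p)"
  by (simp add: grad_def inner_sum_right mult.commute)

lemma grad_Basis: "i \<in> Basis \<Longrightarrow> grad p \<bullet> i = D (0, i) p"
  by (simp add: grad_def inner_sum_left inner_Basis if_distrib cong: if_cong)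

lemma norm_grad: "(norm (grad p))\<^sup>2 = (\<Sum>i\<in>Basis. (D (0, i) p)\<^sup>2)"
  unfolding power2_norm_eq_inner euclidean_inner[of "grad p" "grad p"]
  by (intro sum.cong) (simp_all add: power2_eq_square grad_Basis)

lemma kin_nonneg: "0 \<le> kin p"
  by (simp add: kin_def sum_nonneg)

text \<open>Cauchy-Schwarz in space, followed by the inequality between the product and the mean of
  squares. Divided by any number that is positive and at least \<open>norm x\<close>, this is the
  nonnegativity of the energy flux through the cones.\<close>

lemma grad_vt_le: "\<bar>(x \<bullet> grad p) * vt p\<bar> \<le> norm x * kin p"
proof -
  have "\<bar>x \<bullet> grad p\<bar> \<le> norm x * norm (grad p)" by (rule Cauchy_Schwarz_ineq2)
  then have "\<bar>(x \<bullet> grad p) * vt p\<bar> \<le> norm x * norm (grad p) * \<bar>vt p\<bar>"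
    unfolding abs_mult by (intro mult_right_mono) auto
  also have "\<dots> = norm x * (norm (grad p) * \<bar>vt p\<bar>)" by simp
  also have "norm (grad p) * \<bar>vt p\<bar> \<le> kin p"
  proof -
    have "0 \<le> (norm (grad p) - \<bar>vt p\<bar>)\<^sup>2" by simp
    then show ?thesis by (simp add: kin_def norm_grad[symmetric] power2_diff)
  qed
  finally show ?thesis by (simp add: mult_left_mono)
qed

lemma kin_meas [measurable]: "kin \<in> borel_measurable borel"
  unfolding kin_def by measurable

lemma slab_meas [measurable]: "(\<lambda>p. indicator {\<alpha>..\<beta>} (fst p) * D j p) \<in> borel_measurable borel"
proof -
  have [measurable]: "(fst :: real \<times> (real^3) \<Rightarrow> real) \<in> borel_measurable borel"
    by (intro borel_measurable_continuous_onI continuous_intros)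
  have "(\<lambda>p :: real \<times> (real^3). indicator {\<alpha>..\<beta>} (fst p) :: real) \<in> borel_measurable borel"
    by (rule measurable_compose[of fst borel borel "indicator {\<alpha>..\<beta>}"]) auto
  then show ?thesis using D_meas by (rule borel_measurable_times)
qed

text \<open>The slice bounds are uniform in time, so square integrability over spacetime is obtained
  after restriction to a bounded time interval.\<close>

lemma slab_L2: "power_norm 2 (\<lambda>p. indicator {\<alpha>..\<beta>} (fst p) * D j p) < \<infinity>" if "j \<in> Basis"
proof (rule power_norm_slab[where \<alpha> = \<alpha> and \<beta> = \<beta> and M = M])
  show "(\<lambda>p. indicator {\<alpha>..\<beta>} (fst p) * D j p) \<in> borel_measurable borel" by (rule slab_meas)
  show "(\<integral>\<^sup>+x. ennreal (\<bar>indicator {\<alpha>..\<beta>} (fst (t, x)) * D j (t, x)\<bar> ^ 2) \<partial>lborel) \<le> ennreal (M ^ 2)" for t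
    by (rule order_trans[OF nn_integral_mono D_slice[OF that, of t]])
       (auto simp: indicator_def intro!: ennreal_leI)
qed auto

lemma slab_kin_integrable: "integrable lborel (\<lambda>p. indicator {\<alpha>..\<beta>} (fst p) * kin p)"
proof -
  have 1: "integrable lborel (\<lambda>p. (indicator {\<alpha>..\<beta>} (fst p) * D j p) * (indicator {\<alpha>..\<beta>} (fst p) * D j p))"
    if "j \<in> Basis" for j
    using that by (intro integrable_mult_L2 slab_L2 slab_meas)
  have "integrable lborel (\<lambda>p. ((indicator {\<alpha>..\<beta>} (fst p) * vt p) * (indicator {\<alpha>..\<beta>} (fst p) * vt p)
      + (\<Sum>i\<in>Basis. (indicator {\<alpha>..\<beta>} (fst p) * D (0, i) p) * (indicator {\<alpha>..\<beta>} (fst p) * D (0, i) p))) / 2)"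
    using 1 by (intro Bochner_Integration.integrable_add Bochner_Integration.integrable_sum integrable_divide) auto
  moreover have "((indicator {\<alpha>..\<beta>} (fst p) * vt p) * (indicator {\<alpha>..\<beta>} (fst p) * vt p)
      + (\<Sum>i\<in>Basis. (indicator {\<alpha>..\<beta>} (fst p) * D (0, i) p) * (indicator {\<alpha>..\<beta>} (fst p) * D (0, i) p))) / 2
    = indicator {\<alpha>..\<beta>} (fst p) * kin p" for p
    by (auto simp: kin_def indicator_def power2_eq_square)
  ultimately show ?thesis by simp
qed

lemma G_vt_integrable: "integrable lborel (\<lambda>p. G p * vt p)"
proof (rule integrableI_bounded)
  have "(\<integral>\<^sup>+p. ennreal \<bar>G p * vt p\<bar> \<partial>lborel) \<le> ennreal M * (\<integral>\<^sup>+t. ennreal (\<gamma> t) \<partial>lborel)"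
    using M_nonneg by (intro L1L2_pair_bound \<gamma> D_slice) auto
  also have "\<dots> < \<infinity>" using \<gamma>(3) by (simp add: ennreal_mult_less_top)
  finally show "(\<integral>\<^sup>+p. ennreal (norm (G p * vt p)) \<partial>lborel) < \<infinity>" by simp
qed measurable

end

lemma continuous_measurable:
  fixes f :: "'a::euclidean_space \<Rightarrow> real"
  shows "continuous_on UNIV f \<Longrightarrow> f \<in> borel_measurable borel"
  by (rule borel_measurable_continuous_onI)

context finite_energy_wave
begin

lemma D_vt_le:
  assumes "i \<in> Basis"
  shows "\<bar>D (0, i) p * vt p\<bar> \<le> kin p"
proof -
  have "i \<bullet> grad p = D (0, i) p"
    using grad_Basis[OF assms] by (metis inner_commute)
  then show ?thesis using grad_vt_le[of i p] assms by simp
qed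

text \<open>The test weight is \<open>\<eta>(t) \<chi>(x) V(t - \<surd>(\<delta>\<^sup>2 + \<bar>x\<bar>\<^sup>2))\<close> with \<open>V\<close> an average of \<open>W\<close>. Its derivative along
  the cone has a sign, since \<open>x / \<surd>(\<delta>\<^sup>2 + \<bar>x\<bar>\<^sup>2)\<close> has norm at most one, and the remaining
  terms involve \<open>W\<close> itself rather than its derivative. Hence no regularity of \<open>W\<close> is needed.\<close>

lemma energy_flux_approx:
  assumes ab: "a < \<alpha>" "\<alpha> \<le> \<beta>" "\<beta> < b" and \<delta>: "0 < \<delta>" and R: "1 \<le> R"
    and V: "\<And>\<tau>. (V has_real_derivative V' \<tau>) (at \<tau>)" "continuous_on UNIV V'" "\<And>\<tau>. 0 \<le> V' \<tau>"
    and V01: "\<And>\<tau>. 0 \<le> V \<tau>" "\<And>\<tau>. V \<tau> \<le> w"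
    and \<eta>: "\<And>t. (\<eta> has_real_derivative \<eta>' t) (at t)" "continuous_on UNIV \<eta>'"
      "\<And>t. 0 \<le> \<eta> t" "\<And>t. \<eta> t \<le> 1" "\<And>t. t \<notin> {\<alpha>..\<beta>} \<Longrightarrow> \<eta> t = 0" "\<And>t. t \<notin> {\<alpha>..\<beta>} \<Longrightarrow> \<eta>' t = 0"
    and E: "\<And>t. \<bar>\<eta>' t\<bar> \<le> E" and B: "\<And>z. \<bar>step' z\<bar> \<le> B"
  defines "P \<equiv> \<lambda>p :: real \<times> (real^3). V (fst p - sqrt (\<delta>\<^sup>2 + snd p \<bullet> snd p))"
    and "z \<equiv> \<lambda>p :: real \<times> (real^3). 2 - (snd p \<bullet> snd p) / R\<^sup>2"
  defines "\<Phi> \<equiv> \<lambda>p. \<eta> (fst p) * (step (z p) * P p)"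
    and "A \<equiv> \<lambda>p. \<eta>' (fst p) * (step (z p) * P p) * kin p
      + \<eta> (fst p) * (step' (z p) * (2 / R\<^sup>2) * P p) * ((snd p \<bullet> grad p) * vt p)"
  shows "continuous_on UNIV \<Phi>" "A \<in> borel_measurable borel"
    "\<And>p. \<bar>A p\<bar> \<le> (E * w + 4 * B * w) * (indicator {\<alpha>..\<beta>} (fst p) * kin p)"
    "(LINT p|lborel. A p) \<le> (LINT p|lborel. G p * (\<Phi> p * vt p))"
proof -
  \<comment> \<open>A regularised norm of the spatial variable, bounded below by
    \<open>\<delta>\<close>, which makes the weight C^1 across the spatial origin.\<close>
  define N where "N p = sqrt (\<delta>\<^sup>2 + snd p \<bullet> snd p)" for p :: "real \<times> (real^3)"
  have Npos: "0 < N p" for p using \<delta> by (simp add: N_def add_pos_nonneg)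
  have Nx: "norm (snd p) \<le> N p" for p
    by (simp add: N_def norm_eq_sqrt_inner)
  have w0: "0 \<le> w" using V01[of 0] by linarith
  have E0: "0 \<le> E" using E[of 0] by linarith
  have B0: "0 \<le> B" using B[of 0] by linarith

  have N1: "C_diff (Suc 0) N" and Np: "partial i N p = (snd p \<bullet> snd i) / N p" for i p
  proof -
    have h: "C_diff (Suc 0) (\<lambda>p :: real \<times> (real^3). \<delta>\<^sup>2 + snd p \<bullet> snd p)"
      by (intro C_diff_add C_diff_const C1_inner_snd)
    have hp: "partial i (\<lambda>p :: real \<times> (real^3). \<delta>\<^sup>2 + snd p \<bullet> snd p) p = 2 * (snd p \<bullet> snd i)"
      by (subst partial_add) (simp_all add: partial_inner_snd C_diff_differentiable[OF C1_inner_snd])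
    have c: "continuous_on UNIV N" unfolding N_def by (intro continuous_intros)
    have g: "(sqrt has_real_derivative inverse (sqrt (\<delta>\<^sup>2 + snd p \<bullet> snd p)) / 2) (at (\<delta>\<^sup>2 + snd p \<bullet> snd p))" for p :: "real \<times> (real^3)"
      using \<delta> by (intro DERIV_real_sqrt) (simp add: add_pos_nonneg)
    have nz: "\<forall>p\<in>UNIV. N p \<noteq> 0" using Npos by (metis less_irrefl)
    have "continuous_on UNIV (\<lambda>p. inverse (N p) / 2)"
      by (intro continuous_intros c nz) simp
    then have c': "continuous_on UNIV (\<lambda>p :: real \<times> (real^3). inverse (sqrt (\<delta>\<^sup>2 + snd p \<bullet> snd p)) / 2)"
      by (simp add: N_def)
    note C = C1_compose[where g = sqrt and g' = "\<lambda>y. inverse (sqrt y) / 2", OF h g c']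
    show "C_diff (Suc 0) N" unfolding N_def[abs_def] by (rule C)
    have "inverse x / 2 * (2 * c) = c / x" for x c :: real
      by (simp add: field_simps)
    note r = this[of "N p" "snd p \<bullet> snd i"]
    have "partial i N p = inverse (N p) / 2 * (2 * (snd p \<bullet> snd i))"
      using C(2)[of i p] unfolding hp N_def[abs_def] .
    then show "partial i N p = (snd p \<bullet> snd i) / N p" unfolding r .
  qed
  define T where "T p = fst p - N p" for p
  have T1: "C_diff (Suc 0) T" and Tp: "partial i T p = fst i - (snd p \<bullet> snd i) / N p" for i p
  proof -
    have e: "T = (\<lambda>p. fst p + - 1 * N p)" by (auto simp: T_def)
    show "C_diff (Suc 0) T" unfolding e by (intro C_diff_add C1_fst C_diff_mult C_diff_const N1)
    have "partial i (\<lambda>p. fst p + - 1 * N p) p = partial i fst p + partial i (\<lambda>p. - 1 * N p) p"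
      by (intro partial_add C_diff_differentiable[OF C1_fst]
          C_diff_differentiable[OF C_diff_mult[OF C_diff_const N1]])
    also have "\<dots> = fst i - (snd p \<bullet> snd i) / N p"
      by (subst partial_mult[OF C_diff_differentiable[OF C_diff_const] C_diff_differentiable[OF N1]])
         (simp add: partial_fst Np)
    finally show "partial i T p = fst i - (snd p \<bullet> snd i) / N p" by (simp add: e)
  qed
  have Tc: "continuous_on UNIV T" using C_diff_Suc_imp[OF T1] by simp
  have PT: "P = (\<lambda>p. V (T p))" by (simp add: P_def T_def N_def)
  have P1: "C_diff (Suc 0) P" and Pp: "partial i P p = V' (T p) * (fst i - (snd p \<bullet> snd i) / N p)" for i p
  proof -
    note C = C1_compose[where g = V and g' = V', OF T1 V(1) continuous_on_compose2[OF V(2) Tc subset_UNIV]]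
    show "C_diff (Suc 0) P" unfolding PT by (rule C)
    show "partial i P p = V' (T p) * (fst i - (snd p \<bullet> snd i) / N p)" unfolding PT C(2) Tp by (rule refl)
  qed
  have P01: "0 \<le> P p" "P p \<le> w" for p using V01 by (simp_all add: P_def)

  have z1: "C_diff (Suc 0) z" and zp: "partial i z p = - (2 / R\<^sup>2) * (snd p \<bullet> snd i)" for i p
  proof -
    have e: "z = (\<lambda>p. 2 + (- (1 / R\<^sup>2)) * (snd p \<bullet> snd p))" by (auto simp: z_def)
    have m: "C_diff (Suc 0) (\<lambda>p :: real \<times> (real^3). (- (1 / R\<^sup>2)) * (snd p \<bullet> snd p))"
      by (intro C_diff_mult C_diff_const C1_inner_snd)
    show "C_diff (Suc 0) z" unfolding e by (intro C_diff_add C_diff_const m)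
    show "partial i z p = - (2 / R\<^sup>2) * (snd p \<bullet> snd i)"
      unfolding e partial_add[OF C_diff_differentiable[OF C_diff_const] C_diff_differentiable[OF m]]
        partial_mult[OF C_diff_differentiable[OF C_diff_const] C_diff_differentiable[OF C1_inner_snd]]
      by (simp add: partial_inner_snd)
  qed
  have zc: "continuous_on UNIV z" using C_diff_Suc_imp[OF z1] by simp
  have sc: "continuous_on UNIV (\<lambda>p. step' (z p))"
    by (rule continuous_on_compose2[OF step'_continuous zc subset_UNIV])
  note S = C1_compose[where g = step and g' = step', OF z1 step_has_derivative sc]
  have \<eta>c': "continuous_on UNIV (\<lambda>p :: real \<times> (real^3). \<eta>' (fst p))"
    by (rule continuous_on_compose2[OF \<eta>(2)]) (auto intro!: continuous_intros)
  note H = C1_compose[where g = \<eta> and g' = \<eta>', OF C1_fst \<eta>(1) \<eta>c']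
  have SP1: "C_diff (Suc 0) (\<lambda>p. step (z p) * P p)" by (intro C_diff_mult S(1) P1)
  have \<Phi>1: "C_diff (Suc 0) \<Phi>" unfolding \<Phi>_def by (intro C_diff_mult H(1) SP1)
  then show \<Phi>c: "continuous_on UNIV \<Phi>" using C_diff_Suc_imp by fastforce
  have \<Phi>p: "partial i \<Phi> p = \<eta> (fst p) * (step (z p) * (V' (T p) * (fst i - (snd p \<bullet> snd i) / N p))
      + step' (z p) * (- (2 / R\<^sup>2) * (snd p \<bullet> snd i)) * P p) + \<eta>' (fst p) * fst i * (step (z p) * P p)" for i p
    unfolding \<Phi>_def
      partial_mult[OF C_diff_differentiable[OF H(1)] C_diff_differentiable[OF SP1]]
      partial_mult[OF C_diff_differentiable[OF S(1)] C_diff_differentiable[OF P1]]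
      H(2) S(2) Pp zp partial_fst by (rule refl)
  have meas [measurable]: "(\<lambda>p :: real \<times> (real^3). \<eta>' (fst p)) \<in> borel_measurable borel"
    "(\<lambda>p. step (z p) * P p) \<in> borel_measurable borel" "(\<lambda>p :: real \<times> (real^3). \<eta> (fst p)) \<in> borel_measurable borel"
    "(\<lambda>p. step' (z p)) \<in> borel_measurable borel" "P \<in> borel_measurable borel" "\<Phi> \<in> borel_measurable borel"
    using \<eta>c' C_diff_Suc_imp[OF SP1] C_diff_Suc_imp[OF H(1)] sc C_diff_Suc_imp[OF P1] \<Phi>c
    by (auto intro: continuous_measurable)
  have xgrad [measurable]: "(\<lambda>p. (snd p \<bullet> grad p) * vt p) \<in> borel_measurable borel"
    unfolding grad_inner by (intro borel_measurable_times borel_measurable_sum D_meas continuous_measurable continuous_intros)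
  show A_meas [measurable]: "A \<in> borel_measurable borel"
    unfolding A_def
    by (rule borel_measurable_add[OF borel_measurable_times[OF borel_measurable_times[OF meas(1,2)] kin_meas]
          borel_measurable_times[OF borel_measurable_times[OF meas(3)
            borel_measurable_times[OF borel_measurable_times[OF meas(4) borel_measurable_const] meas(5)]] xgrad]])
  \<comment> \<open>\<open>step (z p)\<close> is 1 up to norm R and vanishes from norm sqrt 2 times
    R on; 2 R is a convenient larger radius.\<close>
  have small: "norm (snd p) \<le> 2 * R" if "0 < z p" for p
  proof -
    have "snd p \<bullet> snd p < 2 * R\<^sup>2" using that R by (simp add: z_def field_simps)
    also have "\<dots> \<le> (2 * R)\<^sup>2" by (simp add: power_mult_distrib)
    finally have "(norm (snd p))\<^sup>2 \<le> (2 * R)\<^sup>2" by (simp add: power2_norm_eq_inner)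
    then show ?thesis by (rule power2_le_imp_le) (use R in simp)
  qed
  show A_bound: "\<bar>A p\<bar> \<le> (E * w + 4 * B * w) * (indicator {\<alpha>..\<beta>} (fst p) * kin p)" for p
  proof (cases "fst p \<in> {\<alpha>..\<beta>}")
    case True
    have 1: "\<bar>\<eta>' (fst p) * (step (z p) * P p) * kin p\<bar> \<le> E * w * kin p"
    proof -
      have "step (z p) * P p \<le> 1 * w" using step_bounds P01 by (intro mult_mono) auto
      moreover have "0 \<le> step (z p) * P p" using step_bounds P01 by simp
      ultimately have "\<bar>\<eta>' (fst p)\<bar> * (step (z p) * P p) \<le> E * w" using E E0 by (intro mult_mono) auto
      then show ?thesis
        using kin_nonneg[of p] step_bounds(1)[of "z p"] P01(1)[of p]
        unfolding abs_mult by (simp add: mult_right_mono)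
    qed
    \<comment> \<open>The derivative of the spatial cut-off brings 2 / R^2 and the factor
      \<open>snd p\<close> at most 2 R; the product 4 / R is at most 4, so the bound does not depend
      on R.\<close>
    have 2: "\<bar>\<eta> (fst p) * (step' (z p) * (2 / R\<^sup>2) * P p) * ((snd p \<bullet> grad p) * vt p)\<bar> \<le> 4 * B * w * kin p"
    proof (cases "0 < z p")
      case False
      then show ?thesis using step'_eq_0[of "z p"] B0 w0 kin_nonneg[of p] by simp
    next
      case z: True
      have "\<bar>(snd p \<bullet> grad p) * vt p\<bar> \<le> norm (snd p) * kin p" by (rule grad_vt_le)
      also have "\<dots> \<le> 2 * R * kin p" using small[OF z] kin_nonneg by (intro mult_right_mono)
      finally have g: "\<bar>(snd p \<bullet> grad p) * vt p\<bar> \<le> 2 * R * kin p" .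
      have "\<bar>step' (z p)\<bar> * (2 / R\<^sup>2) * P p \<le> B * (2 / R\<^sup>2) * w"
        using B P01 B0 by (intro mult_mono) auto
      then have "\<eta> (fst p) * (\<bar>step' (z p)\<bar> * (2 / R\<^sup>2) * P p) \<le> 1 * (B * (2 / R\<^sup>2) * w)"
        by (rule mult_mono[OF \<eta>(4)]) (use P01(1)[of p] in auto)
      then have "\<eta> (fst p) * (\<bar>step' (z p)\<bar> * (2 / R\<^sup>2) * P p) * \<bar>(snd p \<bullet> grad p) * vt p\<bar>
          \<le> 1 * (B * (2 / R\<^sup>2) * w) * (2 * R * kin p)"
        by (rule mult_mono[OF _ g]) (use B0 w0 in auto)
      also have "\<dots> = 4 * B * w * kin p * (1 / R)" using R by (simp add: field_simps power2_eq_square)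
      also have "\<dots> \<le> 4 * B * w * kin p * 1"
        using R B0 w0 kin_nonneg[of p] by (intro mult_left_mono) (auto simp: field_simps)
      finally show ?thesis
        using \<eta>(3)[of "fst p"] P01(1)[of p] R unfolding abs_mult by simp
    qed
    have "\<bar>A p\<bar> \<le> E * w * kin p + 4 * B * w * kin p"
      unfolding A_def by (rule order_trans[OF abs_triangle_ineq add_mono[OF 1 2]])
    then show ?thesis using True by (simp add: distrib_right)
  next
    case False
    then show ?thesis using \<eta>(5,6) by (simp add: A_def)
  qed
  have Ai: "integrable lborel A"
  proof (rule Bochner_Integration.integrable_bound)
    show "integrable lborel (\<lambda>p. (E * w + 4 * B * w) * (indicator {\<alpha>..\<beta>} (fst p) * kin p))"
      using slab_kin_integrable by simp
    show "AE p in lborel. norm (A p) \<le> norm ((E * w + 4 * B * w) * (indicator {\<alpha>..\<beta>} (fst p) * kin p))"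
      using A_bound by (intro AE_I2) (metis abs_ge_self order_trans real_norm_def)
  qed measurable

  have supp: "\<Phi> p = 0" if "p \<notin> {\<alpha>..\<beta>} \<times> cball 0 (2 * R)" for p
  proof (cases "fst p \<in> {\<alpha>..\<beta>}")
    case True
    then have "\<not> 0 < z p" using small[of p] that by (cases p) auto
    then show ?thesis by (simp add: \<Phi>_def step_eq_0)
  qed (simp add: \<Phi>_def \<eta>(5))
  have supp': "partial i \<Phi> p = 0" if "p \<notin> {\<alpha>..\<beta>} \<times> cball 0 (2 * R)" for i p
    by (rule partial_eq_0_off_closed[OF _ supp that]) (intro closed_Times closed_atLeastAtMost closed_cball)
  let ?I = "\<lambda>p. partial (1, 0) \<Phi> p * (((vt p)\<^sup>2 + (\<Sum>i\<in>Basis. (D (0, i) p)\<^sup>2)) / 2)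
        - (\<Sum>i\<in>Basis. partial (0, i) \<Phi> p * D (0, i) p * vt p)"
  have identity: "(LINT p|lborel. ?I p) = (LINT p|lborel. G p * (\<Phi> p * vt p))"
    using R by (intro energy_identity[OF ab _ weak weak_eq D_meas G_meas D_slice M_nonneg \<gamma> \<Phi>1 supp]) auto
  \<comment> \<open>The derivative of \<open>V\<close> enters through \<open>a1\<close> alone,
    multiplied by \<open>kin\<close> plus the flux in the direction \<open>snd p / N p\<close>, a
    vector of norm at most 1. This factor is nonnegative; dropping it is the only loss and leaves
    \<open>A\<close>.\<close>
  have I_ge: "A p \<le> ?I p" for p
  proof -
    define a1 where "a1 = \<eta> (fst p) * (step (z p) * V' (T p))"
    define a2 where "a2 = \<eta>' (fst p) * (step (z p) * P p)"
    define a3 where "a3 = \<eta> (fst p) * (step' (z p) * (2 / R\<^sup>2) * P p)"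
    have time: "partial (1, 0) \<Phi> p = a1 + a2"
      unfolding \<Phi>p a1_def a2_def by simp
    have space: "partial (0, i) \<Phi> p = - (a1 / N p + a3) * (snd p \<bullet> i)" for i
      unfolding \<Phi>p a1_def a3_def by (simp add: algebra_simps)
    have "(\<Sum>i\<in>Basis. partial (0, i) \<Phi> p * D (0, i) p * vt p)
        = - (a1 / N p + a3) * ((snd p \<bullet> grad p) * vt p)"
      unfolding space grad_inner sum_distrib_left sum_distrib_right by (simp add: mult.assoc)
    then have "?I p = (a1 + a2) * kin p + (a1 / N p + a3) * ((snd p \<bullet> grad p) * vt p)"
      unfolding time kin_def[symmetric] by (simp only: mult_minus_left diff_minus_eq_add)
    also have "\<dots> = A p + a1 * (kin p + (snd p \<bullet> grad p) * vt p / N p)"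
      unfolding A_def a2_def[symmetric] a3_def[symmetric] by (simp add: algebra_simps)
    finally have eq: "?I p = A p + \<eta> (fst p) * (step (z p) * V' (T p)) * (kin p + (snd p \<bullet> grad p) * vt p / N p)"
      unfolding a1_def .
    have "\<bar>(snd p \<bullet> grad p) * vt p\<bar> \<le> N p * kin p"
      using grad_vt_le[of "snd p" p] Nx[of p] kin_nonneg[of p] by (meson mult_right_mono order_trans)
    then have "- (N p * kin p) \<le> (snd p \<bullet> grad p) * vt p" by linarith
    then have "- kin p \<le> (snd p \<bullet> grad p) * vt p / N p"
      using Npos[of p] by (simp add: le_divide_eq mult.commute)
    then have "0 \<le> kin p + (snd p \<bullet> grad p) * vt p / N p" by linarith
    then show ?thesis unfolding eq using \<eta>(3) step_bounds V(3) by simp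
  qed
  have pc: "continuous_on UNIV (partial j \<Phi>)" if "j \<in> Basis" for j
    using \<Phi>1 that by simp
  have "\<exists>C. \<forall>p. \<bar>partial j \<Phi> p\<bar> \<le> C" if "j \<in> Basis" for j
    using bounded_support_bounded[OF pc[OF that], of "\<bar>\<alpha>\<bar> + \<bar>\<beta>\<bar> + 2 * R"] supp' slab_norm[of _ \<alpha> \<beta> "2 * R"]
    by (metis not_le)
  then obtain C where C: "\<And>j p. j \<in> Basis \<Longrightarrow> \<bar>partial j \<Phi> p\<bar> \<le> C j" by metis
  have Ii: "integrable lborel ?I"
  proof (rule Bochner_Integration.integrable_bound)
    let ?k = "\<lambda>p. indicator {\<alpha>..\<beta>} (fst p) * kin p"
    show "integrable lborel (\<lambda>p. (C (1, 0) + (\<Sum>i\<in>Basis. C (0, i))) * ?k p)"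
      using slab_kin_integrable by simp
    have pm: "partial j \<Phi> \<in> borel_measurable borel" if "j \<in> Basis" for j
      by (rule continuous_measurable[OF pc[OF that]])
    have "?I \<in> borel_measurable borel"
      by (rule borel_measurable_diff[OF borel_measurable_times[OF pm[OF Basis_time] kin_meas[unfolded kin_def[abs_def]]]
            borel_measurable_sum]) (intro borel_measurable_times pm D_meas Basis_space)
    then show "?I \<in> borel_measurable lborel" by simp
    show "AE p in lborel. norm (?I p) \<le> norm ((C (1, 0) + (\<Sum>i\<in>Basis. C (0, i))) * ?k p)"
    proof (intro AE_I2)
      fix p
      show "norm (?I p) \<le> norm ((C (1, 0) + (\<Sum>i\<in>Basis. C (0, i))) * ?k p)"
      proof (cases "fst p \<in> {\<alpha>..\<beta>}")
        case True
        have "\<bar>partial (1, 0) \<Phi> p * kin p\<bar> \<le> C (1, 0) * kin p"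
          unfolding abs_mult using C[of "(1, 0)" p] kin_nonneg[of p] by (simp add: mult_right_mono)
        moreover have "\<bar>\<Sum>i\<in>Basis. partial (0, i) \<Phi> p * D (0, i) p * vt p\<bar> \<le> (\<Sum>i\<in>Basis. C (0, i) * kin p)"
        proof (rule order_trans[OF sum_abs sum_mono])
          fix i :: "real^3" assume i: "i \<in> Basis"
          have "\<bar>partial (0, i) \<Phi> p\<bar> * \<bar>D (0, i) p * vt p\<bar> \<le> C (0, i) * kin p"
            using C[OF Basis_space[OF i], of p] D_vt_le[OF i, of p] by (intro mult_mono) auto
          then show "\<bar>partial (0, i) \<Phi> p * D (0, i) p * vt p\<bar> \<le> C (0, i) * kin p"
            by (simp add: abs_mult mult.assoc)
        qed
        ultimately have "\<bar>?I p\<bar> \<le> (C (1, 0) + (\<Sum>i\<in>Basis. C (0, i))) * kin p"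
          unfolding kin_def[symmetric] by (simp add: distrib_right sum_distrib_right)
        then show ?thesis using True by simp
      next
        case False
        then have "p \<notin> {\<alpha>..\<beta>} \<times> cball 0 (2 * R)" by (cases p) auto
        then show ?thesis by (simp add: supp')
      qed
    qed
  qed
  have "(LINT p|lborel. A p) \<le> (LINT p|lborel. ?I p)"
    by (rule integral_mono[OF Ai Ii I_ge])
  then show "(LINT p|lborel. A p) \<le> (LINT p|lborel. G p * (\<Phi> p * vt p))"
    using identity by simp
qed

end

context finite_energy_wave
begin

text \<open>The regularisation \<open>\<delta>\<close> tends to 0 while the cut-off radius
  \<open>R\<close> tends to infinity. Continuity of \<open>W\<close> and the enclosure of its
  averages give pointwise convergence of the weight, and the cut-off is eventually 1 with derivative
  0 at every point. The bounds on \<open>A\<close> are uniform in \<open>n\<close> and integrable on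
  the time slab, so dominated convergence applies to both sides.\<close>

theorem energy_flux:
  assumes ab: "a < \<alpha>" "\<alpha> \<le> \<beta>" "\<beta> < b"
    and W: "continuous_on UNIV W" "mono W" "\<And>\<tau>. 0 \<le> W \<tau>" "\<And>\<tau>. W \<tau> \<le> w"
    and \<eta>: "\<And>t. (\<eta> has_real_derivative \<eta>' t) (at t)" "continuous_on UNIV \<eta>'"
      "\<And>t. 0 \<le> \<eta> t" "\<And>t. \<eta> t \<le> 1" "\<And>t. t \<notin> {\<alpha>..\<beta>} \<Longrightarrow> \<eta> t = 0" "\<And>t. t \<notin> {\<alpha>..\<beta>} \<Longrightarrow> \<eta>' t = 0"
  shows "(LINT p|lborel. \<eta>' (fst p) * W (fst p - norm (snd p)) * kin p)
    \<le> (LINT p|lborel. G p * (\<eta> (fst p) * W (fst p - norm (snd p)) * vt p))"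
proof -
  obtain B where B: "0 \<le> B" "\<And>z. \<bar>step' z\<bar> \<le> B" using step'_bounded by blast
  have "\<eta>' t = 0" if "\<bar>\<alpha>\<bar> + \<bar>\<beta>\<bar> < norm t" for t
    by (intro \<eta>(6)) (use that in auto)
  then obtain E where E: "0 \<le> E" "\<And>t. \<bar>\<eta>' t\<bar> \<le> E" using bounded_support_bounded[OF \<eta>(2)] by blast
  define \<delta> where "\<delta> n = inverse (real (Suc n))" for n
  have \<delta>: "0 < \<delta> n" for n by (simp add: \<delta>_def)
  have \<delta>0: "\<delta> \<longlonglongrightarrow> 0" unfolding \<delta>_def by (rule LIMSEQ_inverse_real_of_nat)
  have "\<forall>n. \<exists>V V'. (\<forall>\<tau>. (V has_real_derivative V' \<tau>) (at \<tau>)) \<and> continuous_on UNIV V' \<and> (\<forall>\<tau>. 0 \<le> V' \<tau>)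
    \<and> (\<forall>\<tau>. W \<tau> \<le> V \<tau> \<and> V \<tau> \<le> W (\<tau> + \<delta> n))"
    using smooth_average[OF W(1,2) \<delta>] by blast
  then obtain V V' where V: "\<And>n \<tau>. (V n has_real_derivative V' n \<tau>) (at \<tau>)" "\<And>n. continuous_on UNIV (V' n)"
      "\<And>n \<tau>. 0 \<le> V' n \<tau>" "\<And>n \<tau>. W \<tau> \<le> V n \<tau>" "\<And>n \<tau>. V n \<tau> \<le> W (\<tau> + \<delta> n)"
    by metis
  have V01: "0 \<le> V n \<tau>" "V n \<tau> \<le> w" for n \<tau>
    using W(3)[of \<tau>] W(4)[of "\<tau> + \<delta> n"] V(4,5)[of _ n] V(4)[of \<tau> n] V(5)[of n \<tau>] by linarith+
  define P where "P n p = V n (fst p - sqrt ((\<delta> n)\<^sup>2 + snd p \<bullet> snd p))" for n and p :: "real \<times> (real^3)"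
  define R where "R n = real (Suc n)" for n
  have R: "1 \<le> R n" for n by (simp add: R_def)
  define z where "z n p = 2 - (snd p \<bullet> snd p) / (R n)\<^sup>2" for n and p :: "real \<times> (real^3)"
  define \<Phi> where "\<Phi> n p = \<eta> (fst p) * (step (z n p) * P n p)" for n p
  define A where "A n p = \<eta>' (fst p) * (step (z n p) * P n p) * kin p
      + \<eta> (fst p) * (step' (z n p) * (2 / (R n)\<^sup>2) * P n p) * ((snd p \<bullet> grad p) * vt p)" for n p
  note approx = energy_flux_approx[where \<delta> = "\<delta> n" and R = "R n" and V = "V n" and V' = "V' n" for n,
      OF ab \<delta> R V(1,2,3) V01 \<eta> E(2) B(2), folded P_def z_def, folded \<Phi>_def A_def]
  have Nlim: "(\<lambda>n. fst p - sqrt ((\<delta> n)\<^sup>2 + snd p \<bullet> snd p)) \<longlonglongrightarrow> fst p - norm (snd p)" for p :: "real \<times> (real^3)"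
  proof -
    have "(\<lambda>n. fst p - sqrt ((\<delta> n)\<^sup>2 + snd p \<bullet> snd p)) \<longlonglongrightarrow> fst p - sqrt (0\<^sup>2 + snd p \<bullet> snd p)"
      by (intro tendsto_intros \<delta>0)
    then show ?thesis by (simp add: norm_eq_sqrt_inner)
  qed
  have Plim: "(\<lambda>n. P n p) \<longlonglongrightarrow> W (fst p - norm (snd p))" for p
  proof (rule tendsto_sandwich)
    have Wc: "isCont W \<tau>" for \<tau> using W(1) by (simp add: continuous_on_eq_continuous_at)
    show "(\<lambda>n. W (fst p - sqrt ((\<delta> n)\<^sup>2 + snd p \<bullet> snd p))) \<longlonglongrightarrow> W (fst p - norm (snd p))"
      by (rule isCont_tendsto_compose[OF Wc Nlim])
    show "(\<lambda>n. W (fst p - sqrt ((\<delta> n)\<^sup>2 + snd p \<bullet> snd p) + \<delta> n)) \<longlonglongrightarrow> W (fst p - norm (snd p))"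
      by (rule isCont_tendsto_compose[OF Wc]) (use tendsto_add[OF Nlim \<delta>0, of p] in simp)
  qed (use V(4,5) in \<open>auto simp: P_def\<close>)
  have zlim: "\<forall>\<^sub>F n in sequentially. 1 \<le> z n p" for p
  proof -
    obtain n0 where n0: "norm (snd p) < real n0" using reals_Archimedean2 by blast
    show ?thesis
    proof (rule eventually_sequentiallyI[of n0])
      fix n assume "n0 \<le> n"
      then have "norm (snd p) \<le> R n" using n0 by (simp add: R_def)
      then have "snd p \<bullet> snd p \<le> (R n)\<^sup>2"
        unfolding power2_norm_eq_inner[symmetric] by (intro power_mono) auto
      then have "(snd p \<bullet> snd p) / (R n)\<^sup>2 \<le> 1" using R[of n] by (simp add: divide_le_eq)
      then show "1 \<le> z n p" unfolding z_def by linarith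
    qed
  qed
  have slim: "(\<lambda>n. step (z n p)) \<longlonglongrightarrow> 1" for p
    by (rule tendsto_eventually) (rule eventually_mono[OF zlim], rule step_eq_1)
  have Wm: "(\<lambda>p :: real \<times> (real^3). W (fst p - norm (snd p))) \<in> borel_measurable borel"
    by (intro continuous_measurable continuous_on_compose2[OF W(1)] continuous_intros) auto
  have \<eta>c: "continuous_on UNIV \<eta>"
    using DERIV_isCont[OF \<eta>(1)] by (simp add: continuous_at_imp_continuous_on)
  have \<eta>m: "(\<lambda>p :: real \<times> (real^3). \<eta> (fst p)) \<in> borel_measurable borel"
    "(\<lambda>p :: real \<times> (real^3). \<eta>' (fst p)) \<in> borel_measurable borel"
    by (intro continuous_measurable continuous_on_compose2[OF \<eta>c] continuous_on_compose2[OF \<eta>(2)] continuous_intros; auto)+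
  have lim1: "(\<lambda>n. LINT p|lborel. A n p) \<longlonglongrightarrow> (LINT p|lborel. \<eta>' (fst p) * W (fst p - norm (snd p)) * kin p)"
  proof (rule integral_dominated_convergence[where w = "\<lambda>p. (E * w + 4 * B * w) * (indicator {\<alpha>..\<beta>} (fst p) * kin p)"])
    show "(\<lambda>p. \<eta>' (fst p) * W (fst p - norm (snd p)) * kin p) \<in> borel_measurable lborel"
      using borel_measurable_times[OF borel_measurable_times[OF \<eta>m(2) Wm] kin_meas] by simp
    show "A n \<in> borel_measurable lborel" for n using approx(2)[of n] by simp
    show "integrable lborel (\<lambda>p. (E * w + 4 * B * w) * (indicator {\<alpha>..\<beta>} (fst p) * kin p))"
      using slab_kin_integrable by simp
    show "AE p in lborel. norm (A n p) \<le> (E * w + 4 * B * w) * (indicator {\<alpha>..\<beta>} (fst p) * kin p)" for n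
      using approx(3)[of n] by simp
    show "AE p in lborel. (\<lambda>n. A n p) \<longlonglongrightarrow> \<eta>' (fst p) * W (fst p - norm (snd p)) * kin p"
    proof (intro AE_I2)
      fix p
      have "(\<lambda>n. \<eta>' (fst p) * (step (z n p) * P n p) * kin p) \<longlonglongrightarrow> \<eta>' (fst p) * (1 * W (fst p - norm (snd p))) * kin p"
        by (intro tendsto_intros slim Plim)
      moreover have "\<forall>\<^sub>F n in sequentially. \<eta>' (fst p) * (step (z n p) * P n p) * kin p = A n p"
        by (rule eventually_mono[OF zlim[of p]]) (simp add: A_def step'_eq_0)
      ultimately show "(\<lambda>n. A n p) \<longlonglongrightarrow> \<eta>' (fst p) * W (fst p - norm (snd p)) * kin p"
        using Lim_transform_eventually by fastforce
    qed
  qed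
  have lim2: "(\<lambda>n. LINT p|lborel. G p * (\<Phi> n p * vt p))
      \<longlonglongrightarrow> (LINT p|lborel. G p * (\<eta> (fst p) * W (fst p - norm (snd p)) * vt p))"
  proof (rule integral_dominated_convergence[where w = "\<lambda>p. w * norm (G p * vt p)"])
    show "(\<lambda>p. G p * (\<eta> (fst p) * W (fst p - norm (snd p)) * vt p)) \<in> borel_measurable lborel"
      using borel_measurable_times[OF G_meas borel_measurable_times[OF borel_measurable_times[OF \<eta>m(1) Wm] D_meas]] by simp
    show "(\<lambda>p. G p * (\<Phi> n p * vt p)) \<in> borel_measurable lborel" for n
      using borel_measurable_times[OF G_meas borel_measurable_times[OF continuous_measurable[OF approx(1)[of n]] D_meas]] by simp
    show "integrable lborel (\<lambda>p. w * norm (G p * vt p))"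
      using G_vt_integrable by simp
    show "AE p in lborel. norm (G p * (\<Phi> n p * vt p)) \<le> w * norm (G p * vt p)" for n
    proof (intro AE_I2)
      fix p
      have "step (z n p) * P n p \<le> 1 * w"
        using step_bounds V01 by (intro mult_mono) (auto simp: P_def)
      moreover have "0 \<le> step (z n p) * P n p" using step_bounds V01 by (simp add: P_def)
      ultimately have "\<eta> (fst p) * (step (z n p) * P n p) \<le> 1 * (1 * w)"
        by (intro mult_mono[OF \<eta>(4)]) simp_all
      moreover have "0 \<le> \<Phi> n p" using \<open>0 \<le> step (z n p) * P n p\<close> \<eta>(3) by (simp add: \<Phi>_def)
      ultimately have "\<bar>\<Phi> n p\<bar> * \<bar>G p * vt p\<bar> \<le> w * \<bar>G p * vt p\<bar>"
        by (intro mult_right_mono) (auto simp: \<Phi>_def)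
      then show "norm (G p * (\<Phi> n p * vt p)) \<le> w * norm (G p * vt p)"
        by (simp add: abs_mult mult_ac)
    qed
    show "AE p in lborel. (\<lambda>n. G p * (\<Phi> n p * vt p)) \<longlonglongrightarrow> G p * (\<eta> (fst p) * W (fst p - norm (snd p)) * vt p)"
    proof (intro AE_I2)
      fix p
      have "(\<lambda>n. G p * (\<Phi> n p * vt p)) \<longlonglongrightarrow> G p * (\<eta> (fst p) * (1 * W (fst p - norm (snd p))) * vt p)"
        unfolding \<Phi>_def by (intro tendsto_intros slim Plim)
      then show "(\<lambda>n. G p * (\<Phi> n p * vt p)) \<longlonglongrightarrow> G p * (\<eta> (fst p) * W (fst p - norm (snd p)) * vt p)" by simp
    qed
  qed
  show ?thesis
    using lim1 lim2 by (rule LIMSEQ_le) (use approx(4) in blast)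
qed

end

section \<open>Absolutely continuous functions on an interval\<close>

text \<open>Absolute continuity encoded as the fundamental theorem of calculus with an integrable
  density; \<open>f'\<close> may be changed on null sets, as suits weak derivatives and the weight
  \<open>w\<close>.\<close>

definition ac_on :: "real \<Rightarrow> real \<Rightarrow> (real \<Rightarrow> real) \<Rightarrow> (real \<Rightarrow> real) \<Rightarrow> bool" where
  "ac_on \<alpha> \<beta> f f' \<longleftrightarrow> integrable lborel (\<lambda>s. indicator {\<alpha>..\<beta>} s * f' s) \<and>
     (\<forall>t\<in>{\<alpha>..\<beta>}. f t = f \<alpha> + (LINT s|lborel. indicator {\<alpha>..t} s * f' s))"

lemma ac_on_integrable: "ac_on \<alpha> \<beta> f f' \<Longrightarrow> integrable lborel (\<lambda>s. indicator {\<alpha>..\<beta>} s * f' s)"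
  unfolding ac_on_def by blast

lemma ac_on_eq:
  "ac_on \<alpha> \<beta> f f' \<Longrightarrow> t \<in> {\<alpha>..\<beta>} \<Longrightarrow> f t = f \<alpha> + (LINT s|lborel. indicator {\<alpha>..t} s * f' s)"
  unfolding ac_on_def by blast

lemma primitive_measurable:
  fixes h :: "real \<Rightarrow> real"
  assumes [measurable]: "h \<in> borel_measurable borel"
  shows "(\<lambda>s. LINT r|lborel. indicator {..s} r * h r) \<in> borel_measurable borel"
proof -
  have "Measurable.pred (borel \<Otimes>\<^sub>M borel) (\<lambda>(s, r::real). r \<le> s)" by measurable
  then have "(\<lambda>(s, r). (if r \<le> s then 1 else 0) * h r :: real) \<in> borel_measurable (borel \<Otimes>\<^sub>M lborel)"
    by measurable
  then have "(\<lambda>s. LINT r|lborel. (if r \<le> s then 1 else 0) * h r) \<in> borel_measurable borel"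
    by (rule lborel.borel_measurable_lebesgue_integral)
  then show ?thesis by (simp add: indicator_def of_bool_def cong: if_cong)
qed

lemma primitive_bound:
  fixes h :: "real \<Rightarrow> real"
  assumes "integrable lborel h"
  shows "\<bar>LINT r|lborel. indicator {..s} r * h r\<bar> \<le> (LINT r|lborel. \<bar>h r\<bar>)"
proof -
  have "\<bar>LINT r|lborel. indicator {..s} r * h r\<bar> \<le> (LINT r|lborel. \<bar>indicator {..s} r * h r\<bar>)"
    by (rule integral_abs_bound)
  also have "\<dots> \<le> (LINT r|lborel. \<bar>h r\<bar>)"
    by (rule integral_mono') (use assms in \<open>auto simp: indicator_def\<close>)
  finally show ?thesis .
qed

lemma integrable_indicator_mult':
  fixes h :: "'a::euclidean_space \<Rightarrow> real"
  assumes "integrable lborel h" "A \<in> sets borel"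
  shows "integrable lborel (\<lambda>r. indicator A r * h r)"
  using integrable_mult_indicator[of A lborel h] assms by simp

text \<open>Integration by parts for primitives: the plane is split into the regions r \<le> s and r
  > s, and the order of integration is exchanged in the second one. The two descriptions of the
  diagonal differ by a null set.\<close>

lemma primitive_product:
  fixes h k :: "real \<Rightarrow> real"
  assumes h: "integrable lborel h" and k: "integrable lborel k"
  shows "(LINT s|lborel. h s) * (LINT r|lborel. k r)
    = (LINT s|lborel. h s * (LINT r|lborel. indicator {..s} r * k r)
        + (LINT r|lborel. indicator {..s} r * h r) * k s)"
proof -
  have [measurable]: "h \<in> borel_measurable borel" "k \<in> borel_measurable borel" using h k by auto
  define H where "H s = (LINT r|lborel. indicator {..s} r * h r)" for s
  define K where "K s = (LINT r|lborel. indicator {..s} r * k r)" for s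
  have Hm: "H \<in> borel_measurable borel"
    unfolding H_def by (rule primitive_measurable) measurable
  have Km: "K \<in> borel_measurable borel"
    unfolding K_def by (rule primitive_measurable) measurable
  have ind: "(indicator {s<..} r :: real) = (if s < r then 1 else 0)" for s r :: real
    by (simp add: indicator_def)
  have ind': "(indicator {s<..} r :: real) = indicator {..<r} s" for s r :: real
    by (simp add: indicator_def)
  have hK: "integrable lborel (\<lambda>s. h s * K s)"
    by (rule integrable_mult_bounded[OF h Km]) (unfold K_def, rule primitive_bound[OF k])
  have kH: "integrable lborel (\<lambda>s. k s * H s)"
    by (rule integrable_mult_bounded[OF k Hm]) (unfold H_def, rule primitive_bound[OF h])
  have int: "integrable (lborel \<Otimes>\<^sub>M lborel) (\<lambda>(s, r). h s * (indicator {s<..} r * k r))"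
  proof (rule lborel_pair.Fubini_integrable)
    have [measurable]: "Measurable.pred (borel \<Otimes>\<^sub>M borel) (\<lambda>(s, r::real). s < r)" by measurable
    have "(\<lambda>(s, r). h s * ((if s < r then 1 else 0) * k r)) \<in> borel_measurable (lborel \<Otimes>\<^sub>M lborel)"
      by measurable
    then show "(\<lambda>(s, r). h s * (indicator {s<..} r * k r)) \<in> borel_measurable (lborel \<Otimes>\<^sub>M lborel)"
      unfolding ind .
    show "AE s in lborel. integrable lborel (\<lambda>r. case (s, r) of (s, r) \<Rightarrow> h s * (indicator {s<..} r * k r))"
      using integrable_indicator_mult'[OF k, of "{s<..}" for s] by simp
    show "integrable lborel (\<lambda>s. LINT r|lborel. norm (case (s, r) of (s, r) \<Rightarrow> h s * (indicator {s<..} r * k r)))"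
    proof (rule Bochner_Integration.integrable_bound)
      show "integrable lborel (\<lambda>s. \<bar>h s\<bar> * (LINT r|lborel. \<bar>k r\<bar>))" using h by simp
      show "AE s in lborel. norm (LINT r|lborel. norm (case (s, r) of (s, r) \<Rightarrow> h s * (indicator {s<..} r * k r)))
          \<le> norm (\<bar>h s\<bar> * (LINT r|lborel. \<bar>k r\<bar>))"
      proof (intro AE_I2)
        fix s
        have "(LINT r|lborel. \<bar>indicator {s<..} r * k r\<bar>) \<le> (LINT r|lborel. \<bar>k r\<bar>)"
          by (rule integral_mono') (use k in \<open>auto simp: indicator_def\<close>)
        then have "\<bar>h s\<bar> * (LINT r|lborel. \<bar>indicator {s<..} r * k r\<bar>) \<le> \<bar>h s\<bar> * (LINT r|lborel. \<bar>k r\<bar>)"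
          by (rule mult_left_mono) simp
        moreover have "norm (LINT r|lborel. norm (h s * (indicator {s<..} r * k r)))
            = \<bar>h s\<bar> * (LINT r|lborel. \<bar>indicator {s<..} r * k r\<bar>)"
          unfolding real_norm_def abs_mult[of "h s"] by simp
        ultimately show "norm (LINT r|lborel. norm (case (s, r) of (s, r) \<Rightarrow> h s * (indicator {s<..} r * k r)))
          \<le> norm (\<bar>h s\<bar> * (LINT r|lborel. \<bar>k r\<bar>))" by simp
      qed
      have "(\<lambda>(s, r). norm (h s * ((if s < r then 1 else 0) * k r))) \<in> borel_measurable (borel \<Otimes>\<^sub>M lborel)"
        by measurable
      then have "(\<lambda>s. LINT r|lborel. norm (h s * ((if s < r then 1 else 0) * k r))) \<in> borel_measurable borel"
        by (rule lborel.borel_measurable_lebesgue_integral)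
      then show "(\<lambda>s. LINT r|lborel. norm (case (s, r) of (s, r) \<Rightarrow> h s * (indicator {s<..} r * k r)))
          \<in> borel_measurable lborel"
        unfolding ind prod.case by simp
    qed
  qed
  have split: "(LINT r|lborel. k r) = K s + (LINT r|lborel. indicator {s<..} r * k r)" for s
  proof -
    have "(LINT r|lborel. k r) = (LINT r|lborel. indicator {..s} r * k r + indicator {s<..} r * k r)"
      by (intro Bochner_Integration.integral_cong refl) (auto simp: indicator_def)
    also have "\<dots> = K s + (LINT r|lborel. indicator {s<..} r * k r)"
      unfolding K_def using integrable_indicator_mult'[OF k] by (intro Bochner_Integration.integral_add) auto
    finally show ?thesis .
  qed
  have swap: "(LINT s|lborel. h s * (LINT r|lborel. indicator {s<..} r * k r)) = (LINT r|lborel. k r * H r)"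
  proof -
    have "(LINT s|lborel. h s * (LINT r|lborel. indicator {s<..} r * k r))
        = (LINT s|lborel. LINT r|lborel. h s * (indicator {s<..} r * k r))" by simp
    also have "\<dots> = (LINT r|lborel. LINT s|lborel. h s * (indicator {s<..} r * k r))"
      using lborel_pair.Fubini_integral[of "\<lambda>s r. h s * (indicator {s<..} r * k r)"] int by simp
    also have "\<dots> = (LINT r|lborel. k r * H r)"
    proof (intro Bochner_Integration.integral_cong refl)
      fix r :: real
      have "AE s in lborel. s \<noteq> r" by (rule AE_lborel_singleton)
      then have "AE s in lborel. h s * (indicator {s<..} r * k r) = k r * (indicator {..r} s * h s)"
        by eventually_elim (auto simp: indicator_def)
      then have "(LINT s|lborel. h s * (indicator {s<..} r * k r)) = (LINT s|lborel. k r * (indicator {..r} s * h s))"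
        unfolding ind' by (rule integral_cong_AE[rotated 2]) measurable
      then show "(LINT s|lborel. h s * (indicator {s<..} r * k r)) = k r * H r"
        by (simp add: H_def)
    qed
    finally show ?thesis .
  qed
  have hKc: "integrable lborel (\<lambda>s. h s * (LINT r|lborel. indicator {s<..} r * k r))"
  proof -
    have "(\<lambda>s. h s * (LINT r|lborel. indicator {s<..} r * k r)) = (\<lambda>s. h s * (LINT r|lborel. k r) - h s * K s)"
    proof
      fix s
      show "h s * (LINT r|lborel. indicator {s<..} r * k r) = h s * (LINT r|lborel. k r) - h s * K s"
        unfolding split[of s] by (simp add: distrib_left)
    qed
    then show ?thesis using h hK by simp
  qed
  have "(LINT s|lborel. h s) * (LINT r|lborel. k r) = (LINT s|lborel. h s * (LINT r|lborel. k r))"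
    by simp
  also have "\<dots> = (LINT s|lborel. h s * K s + h s * (LINT r|lborel. indicator {s<..} r * k r))"
    by (intro Bochner_Integration.integral_cong refl) (metis split distrib_left)
  also have "\<dots> = (LINT s|lborel. h s * K s) + (LINT s|lborel. k s * H s)"
    using hK hKc swap by simp
  also have "\<dots> = (LINT s|lborel. h s * K s + H s * k s)"
    using hK kH by (simp add: mult.commute)
  finally show ?thesis by (simp add: H_def K_def)
qed

text \<open>\<open>ac_on\<close> is silent about \<open>f\<close> outside the interval. The
  primitive of the restricted density is a bounded Borel function on the whole line that agrees with
  \<open>f\<close> on the interval and can serve as a bounded factor in integrals.\<close>

lemma ac_on_bounded_measurable:
  assumes f: "ac_on \<alpha> \<beta> f f'"
  shows "\<exists>g B. g \<in> borel_measurable borel \<and> (\<forall>t. \<bar>g t\<bar> \<le> B) \<and> (\<forall>t\<in>{\<alpha>..\<beta>}. f t = g t)"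
proof -
  define h where "h s = indicator {\<alpha>..\<beta>} s * f' s" for s
  have h: "integrable lborel h" unfolding h_def by (rule ac_on_integrable[OF f])
  define g where "g t = f \<alpha> + (LINT s|lborel. indicator {..t} s * h s)" for t
  have "g \<in> borel_measurable borel"
    unfolding g_def using h by (intro borel_measurable_add primitive_measurable) auto
  moreover have "\<bar>g t\<bar> \<le> \<bar>f \<alpha>\<bar> + (LINT r|lborel. \<bar>h r\<bar>)" for t
    using primitive_bound[OF h, of t] unfolding g_def by linarith
  moreover have "f t = g t" if "t \<in> {\<alpha>..\<beta>}" for t
  proof -
    have "indicator {..t} s * h s = indicator {\<alpha>..t} s * f' s" for s
      using that by (auto simp: h_def indicator_def)
    then show ?thesis using ac_on_eq[OF f that] by (simp only: g_def)
  qed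
  ultimately show ?thesis by blast
qed

text \<open>Integration by parts expresses the product of the two increments from
  \<open>\<alpha>\<close> to \<open>t\<close>; expanding that product and moving the mixed terms to
  the other side leaves the product rule.\<close>

lemma ac_on_mult:
  assumes f: "ac_on \<alpha> \<beta> f f'" and g: "ac_on \<alpha> \<beta> g g'"
  shows "ac_on \<alpha> \<beta> (\<lambda>t. f t * g t) (\<lambda>t. f' t * g t + f t * g' t)"
proof -
  define h where "h s = indicator {\<alpha>..\<beta>} s * f' s" for s
  define k where "k s = indicator {\<alpha>..\<beta>} s * g' s" for s
  have h: "integrable lborel h" and k: "integrable lborel k"
    unfolding h_def k_def by (rule ac_on_integrable[OF f], rule ac_on_integrable[OF g])
  obtain f1 Bf where f1: "f1 \<in> borel_measurable borel" "\<And>t. \<bar>f1 t\<bar> \<le> Bf" "\<And>t. t \<in> {\<alpha>..\<beta>} \<Longrightarrow> f t = f1 t"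
    using ac_on_bounded_measurable[OF f] by blast
  obtain g1 Bg where g1: "g1 \<in> borel_measurable borel" "\<And>t. \<bar>g1 t\<bar> \<le> Bg" "\<And>t. t \<in> {\<alpha>..\<beta>} \<Longrightarrow> g t = g1 t"
    using ac_on_bounded_measurable[OF g] by blast
  have i1: "integrable lborel (\<lambda>s. h s * g1 s)" by (rule integrable_mult_bounded[OF h g1(1,2)])
  have i2: "integrable lborel (\<lambda>s. k s * f1 s)" by (rule integrable_mult_bounded[OF k f1(1,2)])
  have e: "indicator {\<alpha>..\<beta>} s * (f' s * g s + f s * g' s) = h s * g1 s + k s * f1 s" for s
    using f1(3)[of s] g1(3)[of s] by (auto simp: h_def k_def indicator_def)
  have fr: "f t = f \<alpha> + (LINT s|lborel. indicator {\<alpha>..t} s * f' s)" if "t \<in> {\<alpha>..\<beta>}" for t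
    by (rule ac_on_eq[OF f that])
  have gr: "g t = g \<alpha> + (LINT s|lborel. indicator {\<alpha>..t} s * g' s)" if "t \<in> {\<alpha>..\<beta>}" for t
    by (rule ac_on_eq[OF g that])
  show ?thesis
    unfolding ac_on_def
  proof (intro conjI ballI)
    show "integrable lborel (\<lambda>s. indicator {\<alpha>..\<beta>} s * (f' s * g s + f s * g' s))"
      unfolding e using i1 i2 by simp
    fix t assume t: "t \<in> {\<alpha>..\<beta>}"
    \<comment> \<open>Densities restricted to \<open>{\<alpha>..t}\<close> have the increments of
      \<open>f\<close> and \<open>g\<close> as primitives there; outside this interval the densities
      vanish, so the primitives are multiplied by 0.\<close>
    define ht where "ht s = indicator {\<alpha>..t} s * f' s" for s
    define kt where "kt s = indicator {\<alpha>..t} s * g' s" for s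
    have ht_eq: "ht s = indicator {..t} s * h s" and kt_eq: "kt s = indicator {..t} s * k s" for s
      using t by (auto simp: ht_def kt_def h_def k_def indicator_def)
    have ht: "integrable lborel ht" and kt: "integrable lborel kt"
      unfolding ht_eq[abs_def] kt_eq[abs_def] using h k by (simp_all add: integrable_indicator_mult')
    have prim: "(LINT r|lborel. indicator {..s} r * ht r) = f s - f \<alpha>"
        "(LINT r|lborel. indicator {..s} r * kt r) = g s - g \<alpha>" if "s \<in> {\<alpha>..t}" for s
    proof -
      have "indicator {..s} r * ht r = indicator {\<alpha>..s} r * f' r"
        "indicator {..s} r * kt r = indicator {\<alpha>..s} r * g' r" for r
        using that by (auto simp: ht_def kt_def indicator_def)
      then show "(LINT r|lborel. indicator {..s} r * ht r) = f s - f \<alpha>"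
        "(LINT r|lborel. indicator {..s} r * kt r) = g s - g \<alpha>"
        using fr[of s] gr[of s] that t by (simp_all only:) auto
    qed
    have mult: "ht s * (LINT r|lborel. indicator {..s} r * kt r) + (LINT r|lborel. indicator {..s} r * ht r) * kt s
        = indicator {\<alpha>..t} s * (f' s * g s + f s * g' s) - (g \<alpha> * ht s + f \<alpha> * kt s)" for s
    proof (cases "s \<in> {\<alpha>..t}")
      case True
      show ?thesis unfolding prim[OF True] using True by (simp add: ht_def kt_def algebra_simps)
    next
      case False
      then have "ht s = 0" "kt s = 0" by (simp_all add: ht_def kt_def)
      then show ?thesis using False by simp
    qed
    have it: "integrable lborel (\<lambda>s. indicator {\<alpha>..t} s * (f' s * g s + f s * g' s))"
    proof -
      have "indicator {\<alpha>..t} s * (f' s * g s + f s * g' s) = indicator {\<alpha>..t} s * (h s * g1 s + k s * f1 s)" for s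
        using e[of s] t by (auto simp: indicator_def)
      moreover have "integrable lborel (\<lambda>s. indicator {\<alpha>..t} s * (h s * g1 s + k s * f1 s))"
        using i1 i2 by (intro integrable_indicator_mult' Bochner_Integration.integrable_add) auto
      ultimately show ?thesis by (simp only:)
    qed
    have "(f t - f \<alpha>) * (g t - g \<alpha>) = (LINT s|lborel. ht s) * (LINT s|lborel. kt s)"
      using fr[OF t] gr[OF t] unfolding ht_def kt_def by (metis add_diff_cancel_left')
    also have "\<dots> = (LINT s|lborel. indicator {\<alpha>..t} s * (f' s * g s + f s * g' s) - (g \<alpha> * ht s + f \<alpha> * kt s))"
      unfolding primitive_product[OF ht kt] mult by (rule refl)
    also have "\<dots> = (LINT s|lborel. indicator {\<alpha>..t} s * (f' s * g s + f s * g' s))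
        - (g \<alpha> * (f t - f \<alpha>) + f \<alpha> * (g t - g \<alpha>))"
    proof -
      have "(LINT s|lborel. ht s) = f t - f \<alpha>" "(LINT s|lborel. kt s) = g t - g \<alpha>"
        using fr[OF t] gr[OF t] unfolding ht_def kt_def by linarith+
      then show ?thesis using it ht kt by simp
    qed
    finally show "f t * g t = f \<alpha> * g \<alpha> + (LINT s|lborel. indicator {\<alpha>..t} s * (f' s * g s + f s * g' s))"
      by (simp add: algebra_simps)
  qed
qed


text \<open>Weak derivatives determine a function on a line only almost everywhere, so the
  absolutely continuous representative is a separate \<open>g\<close>. Endpoint values of
  \<open>f\<close> carry no meaning, which is why integration by parts is done against a factor that
  vanishes at both ends.\<close>

definition ae_ac :: "real \<Rightarrow> real \<Rightarrow> (real \<Rightarrow> real) \<Rightarrow> (real \<Rightarrow> real) \<Rightarrow> bool" where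
  "ae_ac \<alpha> \<beta> f f' \<longleftrightarrow> f \<in> borel_measurable borel \<and> f' \<in> borel_measurable borel \<and>
     (\<exists>g. ac_on \<alpha> \<beta> g f' \<and> (AE t in lborel. t \<in> {\<alpha>..\<beta>} \<longrightarrow> f t = g t))"

lemma ac_on_cong_AE:
  assumes f: "ac_on \<alpha> \<beta> f f'" and f'': "f'' \<in> borel_measurable borel"
    and eq: "AE t in lborel. t \<in> {\<alpha>..\<beta>} \<longrightarrow> f' t = f'' t"
  shows "ac_on \<alpha> \<beta> f f''"
proof -
  have i: "integrable lborel (\<lambda>s. indicator {\<alpha>..\<beta>} s * f' s)" by (rule ac_on_integrable[OF f])
  have ae: "AE s in lborel. indicator {\<alpha>..\<beta>} s * f' s = indicator {\<alpha>..\<beta>} s * f'' s"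
    using eq by eventually_elim (auto simp: indicator_def)
  have m: "(\<lambda>s. indicator A s * f'' s) \<in> borel_measurable lborel" if "A \<in> sets borel" for A
    using f'' that by simp
  have i2: "integrable lborel (\<lambda>s. indicator {\<alpha>..\<beta>} s * f'' s)"
    using i ae m[of "{\<alpha>..\<beta>}"] by (subst integrable_cong_AE[symmetric, of "\<lambda>s. indicator {\<alpha>..\<beta>} s * f' s"]) auto
  have "(LINT s|lborel. indicator {\<alpha>..t} s * f' s) = (LINT s|lborel. indicator {\<alpha>..t} s * f'' s)"
    if "t \<in> {\<alpha>..\<beta>}" for t
  proof -
    have eq: "indicator {\<alpha>..t} s * h s = indicator {..t} s * (indicator {\<alpha>..\<beta>} s * h s)" for s and h :: "real \<Rightarrow> real"
      using that by (auto simp: indicator_def)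
    show ?thesis
      unfolding eq[of _ f'] eq[of _ f'']
    proof (rule integral_cong_AE)
      show "AE s in lborel. indicator {..t} s * (indicator {\<alpha>..\<beta>} s * f' s) = indicator {..t} s * (indicator {\<alpha>..\<beta>} s * f'' s)"
        using ae by eventually_elim simp
    qed (use i i2 in \<open>auto intro!: borel_measurable_times\<close>)
  qed
  then show ?thesis using f i2 unfolding ac_on_def by metis
qed

lemma ac_on_ae_ac:
  "ac_on \<alpha> \<beta> f f' \<Longrightarrow> f \<in> borel_measurable borel \<Longrightarrow> f' \<in> borel_measurable borel \<Longrightarrow> ae_ac \<alpha> \<beta> f f'"
  unfolding ae_ac_def by (intro conjI exI[of _ f]) auto

lemma ae_ac_mult:
  assumes f: "ae_ac \<alpha> \<beta> f f'" and g: "ae_ac \<alpha> \<beta> g g'"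
  shows "ae_ac \<alpha> \<beta> (\<lambda>t. f t * g t) (\<lambda>t. f' t * g t + f t * g' t)"
proof -
  have [measurable]: "f \<in> borel_measurable borel" "f' \<in> borel_measurable borel"
      "g \<in> borel_measurable borel" "g' \<in> borel_measurable borel"
    using f g by (auto simp: ae_ac_def)
  obtain F H where F: "ac_on \<alpha> \<beta> F f'" "AE t in lborel. t \<in> {\<alpha>..\<beta>} \<longrightarrow> f t = F t"
    and H: "ac_on \<alpha> \<beta> H g'" "AE t in lborel. t \<in> {\<alpha>..\<beta>} \<longrightarrow> g t = H t"
    using f g unfolding ae_ac_def by blast
  have "ac_on \<alpha> \<beta> (\<lambda>t. F t * H t) (\<lambda>t. f' t * g t + f t * g' t)"
  proof (rule ac_on_cong_AE[OF ac_on_mult[OF F(1) H(1)]])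
    show "AE t in lborel. t \<in> {\<alpha>..\<beta>} \<longrightarrow> f' t * H t + F t * g' t = f' t * g t + f t * g' t"
      using F(2) H(2) by eventually_elim auto
  qed measurable
  moreover have "AE t in lborel. t \<in> {\<alpha>..\<beta>} \<longrightarrow> f t * g t = F t * H t"
    using F(2) H(2) by eventually_elim auto
  ultimately show ?thesis unfolding ae_ac_def by (intro conjI exI[of _ "\<lambda>t. F t * H t"]) auto
qed

lemma ae_ac_power:
  assumes f: "ae_ac \<alpha> \<beta> f f'"
  shows "ae_ac \<alpha> \<beta> (\<lambda>t. f t ^ Suc n) (\<lambda>t. real (Suc n) * f t ^ n * f' t)"
proof (induction n)
  case 0
  then show ?case using f by simp
next
  case (Suc n)
  have "(\<lambda>t. f t * f t ^ Suc n) = (\<lambda>t. f t ^ Suc (Suc n))"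
    and "(\<lambda>t. f' t * f t ^ Suc n + f t * (real (Suc n) * f t ^ n * f' t)) = (\<lambda>t. real (Suc (Suc n)) * f t ^ Suc n * f' t)"
    by (auto simp: algebra_simps)
  then show ?case using ae_ac_mult[OF f Suc] by simp
qed

text \<open>The product of \<open>\<eta>\<close> with the continuous representative vanishes at both
  ends, so its density integrates to zero; under the integral the representative may be exchanged
  for \<open>f\<close>.\<close>

lemma ae_ac_integral_zero:
  assumes \<eta>: "ac_on \<alpha> \<beta> \<eta> \<eta>'" "\<eta> \<alpha> = 0" "\<eta> \<beta> = 0" and m: "\<eta> \<in> borel_measurable borel" "\<eta>' \<in> borel_measurable borel"
    and f: "ae_ac \<alpha> \<beta> f f'" and le: "\<alpha> \<le> \<beta>"
  shows "integrable lborel (\<lambda>t. indicator {\<alpha>..\<beta>} t * (\<eta>' t * f t + \<eta> t * f' t))"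
    "(LINT t|lborel. indicator {\<alpha>..\<beta>} t * (\<eta>' t * f t + \<eta> t * f' t)) = 0"
proof -
  have [measurable]: "f \<in> borel_measurable borel" "f' \<in> borel_measurable borel"
    using f by (auto simp: ae_ac_def)
  note [measurable] = m
  obtain F where F: "ac_on \<alpha> \<beta> F f'" "AE t in lborel. t \<in> {\<alpha>..\<beta>} \<longrightarrow> f t = F t"
    using f unfolding ae_ac_def by blast
  have ac: "ac_on \<alpha> \<beta> (\<lambda>t. \<eta> t * F t) (\<lambda>t. \<eta>' t * f t + \<eta> t * f' t)"
  proof (rule ac_on_cong_AE[OF ac_on_mult[OF \<eta>(1) F(1)]])
    show "AE t in lborel. t \<in> {\<alpha>..\<beta>} \<longrightarrow> \<eta>' t * F t + \<eta> t * f' t = \<eta>' t * f t + \<eta> t * f' t"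
      using F(2) by eventually_elim auto
  qed measurable
  show "integrable lborel (\<lambda>t. indicator {\<alpha>..\<beta>} t * (\<eta>' t * f t + \<eta> t * f' t))"
    by (rule ac_on_integrable[OF ac])
  show "(LINT t|lborel. indicator {\<alpha>..\<beta>} t * (\<eta>' t * f t + \<eta> t * f' t)) = 0"
    using ac_on_eq[OF ac, of \<beta>] le \<eta>(2,3) by simp
qed

lemma C1_ac_on:
  fixes \<eta> :: "real \<Rightarrow> real"
  assumes \<eta>: "\<And>t. (\<eta> has_real_derivative \<eta>' t) (at t)" "continuous_on UNIV \<eta>'"
  shows "ac_on \<alpha> \<beta> \<eta> \<eta>'"
  unfolding ac_on_def
proof (intro conjI ballI)
  have "set_integrable lborel {\<alpha>..\<beta>} \<eta>'"
    using borel_integrable_compact[of "{\<alpha>..\<beta>}" \<eta>'] continuous_on_subset[OF \<eta>(2)]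
    by (simp add: set_integrable_def)
  then show "integrable lborel (\<lambda>s. indicator {\<alpha>..\<beta>} s * \<eta>' s)" by (simp add: set_integrable_def)
  fix t assume t: "t \<in> {\<alpha>..\<beta>}"
  have "(LINT s|lborel. indicator {\<alpha>..t} s *\<^sub>R \<eta>' s) = \<eta> t - \<eta> \<alpha>"
    by (rule integral_FTC_Icc) (use t \<eta> in \<open>auto simp: has_real_derivative_iff_has_vector_derivative[symmetric]
        intro: has_field_derivative_at_within continuous_on_subset\<close>)
  then show "\<eta> t = \<eta> \<alpha> + (LINT s|lborel. indicator {\<alpha>..t} s * \<eta>' s)" by simp
qed

section \<open>Absolute continuity on time lines from a weak time derivative\<close>

lemma ennreal_le_plus:
  assumes "a \<le> \<bar>b\<bar> + \<bar>c\<bar>"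
  shows "ennreal a \<le> ennreal \<bar>b\<bar> + ennreal \<bar>c\<bar>"
proof -
  have "ennreal a \<le> ennreal (\<bar>b\<bar> + \<bar>c\<bar>)" using assms by (rule ennreal_leI)
  then show ?thesis by (simp only: ennreal_plus abs_ge_zero)
qed

lemma AE_interval_exists:
  assumes "AE s in lborel. s \<in> {\<alpha>..\<beta>} \<longrightarrow> Q s" "\<alpha> < (\<beta>::real)"
  shows "\<exists>s\<in>{\<alpha>..\<beta>}. Q s"
proof (rule ccontr)
  assume "\<not> (\<exists>s\<in>{\<alpha>..\<beta>}. Q s)"
  then have "AE s in lborel. s \<notin> {\<alpha>..\<beta>}" using assms(1) by (auto elim!: eventually_mono)
  then have "{\<alpha>..\<beta>} \<in> null_sets lborel" by (subst (asm) AE_iff_null_sets[symmetric]) auto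
  then show False using assms(2) by (auto simp: null_sets_def)
qed

text \<open>One good value of \<open>s\<close> exists because the interval has positive measure, and
  \<open>k s\<close> is then the constant. The double integral makes no mention of the constant, so
  it depends measurably on parameters and no constant has to be selected for each line in
  advance.\<close>

lemma oscillation_zero:
  fixes k :: "real \<Rightarrow> real"
  assumes [measurable]: "k \<in> borel_measurable borel"
    and J: "(\<integral>\<^sup>+s. indicator {\<alpha>..\<beta>} s * (\<integral>\<^sup>+t. indicator {\<alpha>..\<beta>} t * ennreal \<bar>k t - k s\<bar> \<partial>lborel) \<partial>lborel) = 0"
    and \<alpha>\<beta>: "\<alpha> < \<beta>"
  shows "\<exists>c. AE t in lborel. t \<in> {\<alpha>..\<beta>} \<longrightarrow> k t = c"
proof -
  have "AE s in lborel. indicator {\<alpha>..\<beta>} s * (\<integral>\<^sup>+t. indicator {\<alpha>..\<beta>} t * ennreal \<bar>k t - k s\<bar> \<partial>lborel) = 0"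
    using J by (subst (asm) nn_integral_0_iff_AE) auto
  then have "AE s in lborel. s \<in> {\<alpha>..\<beta>} \<longrightarrow> (\<integral>\<^sup>+t. indicator {\<alpha>..\<beta>} t * ennreal \<bar>k t - k s\<bar> \<partial>lborel) = 0"
    by eventually_elim (auto simp: indicator_def)
  from AE_interval_exists[OF this \<alpha>\<beta>] obtain s
    where "(\<integral>\<^sup>+t. indicator {\<alpha>..\<beta>} t * ennreal \<bar>k t - k s\<bar> \<partial>lborel) = 0" by blast
  then have "AE t in lborel. indicator {\<alpha>..\<beta>} t * ennreal \<bar>k t - k s\<bar> = 0"
    by (subst (asm) nn_integral_0_iff_AE) auto
  then have "AE t in lborel. t \<in> {\<alpha>..\<beta>} \<longrightarrow> k t = k s"
    by eventually_elim (auto simp: indicator_def)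
  then show ?thesis by blast
qed

text \<open>The triangle inequality through an arbitrary constant \<open>m\<close>, integrated in
  both variables; each of the two terms contributes the length of the interval.\<close>

lemma oscillation_le:
  fixes k :: "real \<Rightarrow> real"
  assumes [measurable]: "k \<in> borel_measurable borel" and \<alpha>\<beta>: "\<alpha> \<le> \<beta>"
  shows "(\<integral>\<^sup>+s. indicator {\<alpha>..\<beta>} s * (\<integral>\<^sup>+t. indicator {\<alpha>..\<beta>} t * ennreal \<bar>k t - k s\<bar> \<partial>lborel) \<partial>lborel)
    \<le> 2 * ennreal (\<beta> - \<alpha>) * (\<integral>\<^sup>+t. indicator {\<alpha>..\<beta>} t * ennreal \<bar>k t - m\<bar> \<partial>lborel)"
proof -
  let ?X = "\<integral>\<^sup>+t. indicator {\<alpha>..\<beta>} t * ennreal \<bar>k t - m\<bar> \<partial>lborel"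
  have em: "(\<integral>\<^sup>+t. indicator {\<alpha>..\<beta>} t \<partial>lborel) = ennreal (\<beta> - \<alpha>)"
    using \<alpha>\<beta> by simp
  have inner: "(\<integral>\<^sup>+t. indicator {\<alpha>..\<beta>} t * ennreal \<bar>k t - k s\<bar> \<partial>lborel)
      \<le> ?X + ennreal (\<beta> - \<alpha>) * ennreal \<bar>k s - m\<bar>" for s
  proof -
    have "(\<integral>\<^sup>+t. indicator {\<alpha>..\<beta>} t * ennreal \<bar>k t - k s\<bar> \<partial>lborel)
        \<le> (\<integral>\<^sup>+t. indicator {\<alpha>..\<beta>} t * ennreal \<bar>k t - m\<bar> + indicator {\<alpha>..\<beta>} t * ennreal \<bar>k s - m\<bar> \<partial>lborel)"
    proof (intro nn_integral_mono)
      fix t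
      have "ennreal \<bar>k t - k s\<bar> \<le> ennreal (\<bar>k t - m\<bar> + \<bar>k s - m\<bar>)" by (intro ennreal_leI) linarith
      then show "indicator {\<alpha>..\<beta>} t * ennreal \<bar>k t - k s\<bar>
          \<le> indicator {\<alpha>..\<beta>} t * ennreal \<bar>k t - m\<bar> + indicator {\<alpha>..\<beta>} t * ennreal \<bar>k s - m\<bar>"
        by (simp add: distrib_left[symmetric] mult_left_mono)
    qed
    also have "\<dots> = ?X + ennreal (\<beta> - \<alpha>) * ennreal \<bar>k s - m\<bar>"
      by (simp add: nn_integral_add nn_integral_multc em)
    finally show ?thesis .
  qed
  have "(\<integral>\<^sup>+s. indicator {\<alpha>..\<beta>} s * (\<integral>\<^sup>+t. indicator {\<alpha>..\<beta>} t * ennreal \<bar>k t - k s\<bar> \<partial>lborel) \<partial>lborel)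
      \<le> (\<integral>\<^sup>+s. indicator {\<alpha>..\<beta>} s * ?X + ennreal (\<beta> - \<alpha>) * (indicator {\<alpha>..\<beta>} s * ennreal \<bar>k s - m\<bar>) \<partial>lborel)"
  proof (intro nn_integral_mono)
    fix s
    have "indicator {\<alpha>..\<beta>} s * (\<integral>\<^sup>+t. indicator {\<alpha>..\<beta>} t * ennreal \<bar>k t - k s\<bar> \<partial>lborel)
        \<le> indicator {\<alpha>..\<beta>} s * (?X + ennreal (\<beta> - \<alpha>) * ennreal \<bar>k s - m\<bar>)"
      by (intro mult_left_mono inner) simp
    then show "indicator {\<alpha>..\<beta>} s * (\<integral>\<^sup>+t. indicator {\<alpha>..\<beta>} t * ennreal \<bar>k t - k s\<bar> \<partial>lborel)
        \<le> indicator {\<alpha>..\<beta>} s * ?X + ennreal (\<beta> - \<alpha>) * (indicator {\<alpha>..\<beta>} s * ennreal \<bar>k s - m\<bar>)"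
      by (simp add: distrib_left mult_ac)
  qed
  also have "\<dots> = ennreal (\<beta> - \<alpha>) * ?X + ennreal (\<beta> - \<alpha>) * ?X"
    by (subst nn_integral_add) (simp_all add: nn_integral_multc nn_integral_cmult em)
  also have "\<dots> = 2 * ennreal (\<beta> - \<alpha>) * ?X" by (simp add: mult_2 distrib_right)
  finally show ?thesis .
qed

lemma nn_integral_slices':
  fixes f :: "'a::euclidean_space \<times> 'b::euclidean_space \<Rightarrow> ennreal"
  assumes "f \<in> borel_measurable borel"
  shows "(\<integral>\<^sup>+p. f p \<partial>lborel) = (\<integral>\<^sup>+x. (\<integral>\<^sup>+t. f (t, x) \<partial>lborel) \<partial>lborel)"
proof -
  have "(\<lambda>(t, x). f (t, x)) \<in> borel_measurable (lborel \<Otimes>\<^sub>M lborel)" using assms by (simp add: lborel_prod)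
  then show ?thesis
    unfolding nn_integral_slices[OF assms] by (rule lborel_pair.Fubini'[symmetric])
qed

text \<open>On almost every line in the time direction, a function with a locally integrable weak time
  derivative agrees with a primitive: mollifications do so exactly, and the oscillation of the
  difference passes to the limit in \<open>L\<^sup>1\<close>.\<close>

lemma weak_partial_ae_ac_ball:
  fixes f g :: "real \<times> 'b::euclidean_space \<Rightarrow> real"
  assumes weak: "weak_partial ({a<..<b} \<times> UNIV) (1, 0) f g"
    and f [measurable]: "f \<in> borel_measurable borel" and g [measurable]: "g \<in> borel_measurable borel"
    and ab: "a < \<alpha>" "\<alpha> < \<beta>" "\<beta> < b" and R: "0 \<le> R"
  shows "AE x in lborel. norm x \<le> R \<longrightarrow> ae_ac \<alpha> \<beta> (\<lambda>t. f (t, x)) (\<lambda>t. g (t, x))"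
proof -
  define \<Omega> where "\<Omega> = {a<..<b} \<times> (UNIV :: 'b set)"
  define \<delta> where "\<delta> = min (\<alpha> - a) (b - \<beta>) / 2"
  have \<delta>: "0 < \<delta>" "\<delta> < \<alpha> - a" "\<delta> < b - \<beta>" using ab by (auto simp: \<delta>_def min_def)
  define K0 where "K0 = {\<alpha>..\<beta>} \<times> cball (0::'b) R"
  define K where "K = {\<alpha> - \<delta>..\<beta> + \<delta>} \<times> cball (0::'b) (R + \<delta>)"
  have "compact K" unfolding K_def by (intro compact_Times compact_Icc compact_cball)
  have K\<Omega>: "K \<subseteq> \<Omega>" using \<delta> by (auto simp: K_def \<Omega>_def)
  have K0K: "K0 \<subseteq> K" using \<delta> by (auto simp: K0_def K_def)
  have ball: "cball p e \<subseteq> K" if "p \<in> K0" "e \<le> \<delta>" for p e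
    using slab_cball[of p \<alpha> \<beta> R e \<delta>] that by (simp add: K0_def K_def)
  have [measurable]: "K \<in> sets borel" using \<open>compact K\<close> by (simp add: borel_compact)
  define f1 where "f1 p = indicator K p * f p" for p
  define g1 where "g1 p = indicator K p * g p" for p
  have f1i: "integrable lborel f1" and g1i: "integrable lborel g1"
    using weak \<open>compact K\<close> K\<Omega> unfolding weak_partial_def loc_integrable_def set_integrable_def f1_def g1_def \<Omega>_def
    by auto
  have [measurable]: "f1 \<in> borel_measurable borel" "g1 \<in> borel_measurable borel"
    unfolding f1_def g1_def by measurable
  have fin: "power_norm 1 f1 < \<infinity>" "power_norm 1 g1 < \<infinity>"
    using f1i g1i unfolding power_norm_def integrable_iff_bounded by auto
  define \<epsilon> where "\<epsilon> n = \<delta> * inverse (real (Suc n))" for n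
  have \<epsilon>: "0 < \<epsilon> n" "\<epsilon> n \<le> \<delta>" for n using \<delta> by (auto simp: \<epsilon>_def field_simps)
  have \<epsilon>0: "\<epsilon> \<longlonglongrightarrow> 0"
    unfolding \<epsilon>_def by (rule tendsto_mult_right_zero[OF LIMSEQ_inverse_real_of_nat])
  have "\<forall>n. \<exists>\<rho>::real \<times> 'b \<Rightarrow> real. mollifier (\<epsilon> n) \<rho>" using mollifier_exists \<epsilon>(1) by blast
  then obtain \<rho> :: "nat \<Rightarrow> real \<times> 'b \<Rightarrow> real" where \<rho>: "\<And>n. mollifier (\<epsilon> n) (\<rho> n)" by metis
  note \<rho>k = mollifier_smooth_kernel[OF \<rho>]
  define u where "u n = conv f1 (\<rho> n)" for n
  define h where "h n = conv g1 (\<rho> n)" for n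
  have uC: "C_diff (Suc 0) (u n)" for n unfolding u_def by (rule conv_C_diff[OF f1i \<rho>k])
  have hc: "continuous_on UNIV (h n)" for n unfolding h_def by (rule conv_continuous[OF g1i \<rho>k])
  have [measurable]: "u n \<in> borel_measurable borel" "h n \<in> borel_measurable borel" for n
    unfolding u_def h_def by (rule conv_measurable[OF f1i \<rho>k], rule conv_measurable[OF g1i \<rho>k])
  have ulim: "(\<lambda>n. power_norm 1 (\<lambda>p. u n p - f1 p)) \<longlonglongrightarrow> 0"
    unfolding u_def by (rule mollifier_power_norm_tendsto[OF f1i fin(1) _ \<rho> \<epsilon>0]) simp
  have hlim: "(\<lambda>n. power_norm 1 (\<lambda>p. h n p - g1 p)) \<longlonglongrightarrow> 0"
    unfolding h_def by (rule mollifier_power_norm_tendsto[OF g1i fin(2) _ \<rho> \<epsilon>0]) simp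
  have upart: "partial (1, 0) (u n) p = h n p" if "p \<in> K0" for n p
  proof -
    have "partial (1, 0) (u n) p = conv f1 (partial (1, 0) (\<rho> n)) p"
      unfolding u_def using conv_partial[OF f1i \<rho>k Basis_time] by simp
    also have "\<dots> = h n p"
      unfolding h_def f1_def[abs_def] g1_def[abs_def]
      by (rule conv_weak_partial[OF weak[folded \<Omega>_def] K\<Omega> ball[OF that \<epsilon>(2)] \<rho>k])
    finally show ?thesis .
  qed
  \<comment> \<open>The primitive of the weak derivative from time \<open>\<alpha>\<close>; the
    conditional in place of an indicator of a varying set exhibits joint measurability.\<close>
  define \<Gamma> where "\<Gamma> p = (LINT r|lborel. (if \<alpha> \<le> r \<and> r \<le> fst p then 1 else 0) * g1 (r, snd p))" for p
  have [measurable]: "f1 \<in> borel_measurable (borel \<Otimes>\<^sub>M borel)" "g1 \<in> borel_measurable (borel \<Otimes>\<^sub>M borel)"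
      "u n \<in> borel_measurable (borel \<Otimes>\<^sub>M borel)" "h n \<in> borel_measurable (borel \<Otimes>\<^sub>M borel)" for n
    by (simp_all add: borel_prod)
  have "(\<lambda>(p, r). (if \<alpha> \<le> r \<and> r \<le> fst p then 1 else 0) * g1 (r, snd p)) \<in> borel_measurable ((borel \<Otimes>\<^sub>M borel) \<Otimes>\<^sub>M lborel)"
    by measurable
  then have [measurable]: "\<Gamma> \<in> borel_measurable (borel \<Otimes>\<^sub>M borel)"
    unfolding \<Gamma>_def by (rule lborel.borel_measurable_lebesgue_integral)
  define k where "k p = f1 p - \<Gamma> p" for p
  have [measurable]: "k \<in> borel_measurable (borel \<Otimes>\<^sub>M borel)" unfolding k_def by measurable
  have g1int: "AE x in lborel. integrable lborel (\<lambda>r. g1 (r, x))"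
  proof -
    have "integrable (lborel \<Otimes>\<^sub>M lborel) (\<lambda>(r, x). g1 (r, x))" using g1i by (simp add: lborel_prod)
    then show ?thesis by (rule lborel_pair.AE_integrable_snd)
  qed
  define X where "X n x = (\<integral>\<^sup>+t. ennreal \<bar>u n (t, x) - f1 (t, x)\<bar> \<partial>lborel)" for n x
  define Y where "Y n x = (\<integral>\<^sup>+t. ennreal \<bar>h n (t, x) - g1 (t, x)\<bar> \<partial>lborel)" for n x
  \<comment> \<open>For the mollifications the fundamental theorem of calculus holds exactly on
    \<open>K0\<close>. Hence \<open>k\<close> differs from \<open>u n (\<alpha>, x)\<close>, which
    does not depend on \<open>t\<close>, by no more than the mollification errors of
    \<open>f1\<close> and of \<open>g1\<close> on this line.\<close>
  have key: "ennreal \<bar>k (t, x) - u n (\<alpha>, x)\<bar> \<le> ennreal \<bar>u n (t, x) - f1 (t, x)\<bar> + Y n x"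
    if t: "t \<in> {\<alpha>..\<beta>}" and x: "norm x \<le> R" and int: "integrable lborel (\<lambda>r. g1 (r, x))" for t x n
  proof -
    have der: "((\<lambda>t. u n (t, x)) has_real_derivative partial (1, 0) (u n) (t, x)) (at t)" for t
      using C_diff_directional[OF uC[of n], where x = "(0, x)" and s = t and i = "(1, 0)"] by simp
    have hx: "continuous_on UNIV (\<lambda>r. h n (r, x))"
      by (rule continuous_on_compose2[OF hc]) (auto intro!: continuous_intros)
    have "(LINT r|lborel. indicator {\<alpha>..t} r *\<^sub>R h n (r, x)) = u n (t, x) - u n (\<alpha>, x)"
    proof (rule integral_FTC_Icc)
      show "((\<lambda>t. u n (t, x)) has_vector_derivative h n (r, x)) (at r within {\<alpha>..t})" if "\<alpha> \<le> r" "r \<le> t" for r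
        using der[of r] upart[of "(r, x)" n] that t x
        by (auto simp: K0_def has_real_derivative_iff_has_vector_derivative intro: has_vector_derivative_at_within)
    qed (use t continuous_on_subset[OF hx] in auto)
    then have ftc: "u n (t, x) - u n (\<alpha>, x) = (LINT r|lborel. indicator {\<alpha>..t} r * h n (r, x))" by simp
    have "set_integrable lborel {\<alpha>..t} (\<lambda>r. h n (r, x))"
      unfolding set_integrable_def by (intro borel_integrable_compact continuous_on_subset[OF hx]) auto
    then have i1: "integrable lborel (\<lambda>r. indicator {\<alpha>..t} r * h n (r, x))" by (simp add: set_integrable_def)
    have i2: "integrable lborel (\<lambda>r. indicator {\<alpha>..t} r * g1 (r, x))"
      by (rule integrable_indicator_mult'[OF int]) simp
    have \<Gamma>: "\<Gamma> (t, x) = (LINT r|lborel. indicator {\<alpha>..t} r * g1 (r, x))"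
      unfolding \<Gamma>_def by (intro Bochner_Integration.integral_cong refl) (auto simp: indicator_def)
    have "k (t, x) - u n (\<alpha>, x) = (f1 (t, x) - u n (t, x)) + (LINT r|lborel. indicator {\<alpha>..t} r * h n (r, x) - indicator {\<alpha>..t} r * g1 (r, x))"
      using i1 i2 ftc by (simp add: k_def \<Gamma>)
    then have "\<bar>k (t, x) - u n (\<alpha>, x)\<bar> \<le> \<bar>u n (t, x) - f1 (t, x)\<bar>
        + \<bar>LINT r|lborel. indicator {\<alpha>..t} r * h n (r, x) - indicator {\<alpha>..t} r * g1 (r, x)\<bar>" by linarith
    then have "ennreal \<bar>k (t, x) - u n (\<alpha>, x)\<bar> \<le> ennreal \<bar>u n (t, x) - f1 (t, x)\<bar>
        + ennreal \<bar>LINT r|lborel. indicator {\<alpha>..t} r * h n (r, x) - indicator {\<alpha>..t} r * g1 (r, x)\<bar>"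
      by (rule ennreal_le_plus)
    also have "ennreal \<bar>LINT r|lborel. indicator {\<alpha>..t} r * h n (r, x) - indicator {\<alpha>..t} r * g1 (r, x)\<bar>
        \<le> (\<integral>\<^sup>+r. ennreal \<bar>indicator {\<alpha>..t} r * h n (r, x) - indicator {\<alpha>..t} r * g1 (r, x)\<bar> \<partial>lborel)"
      using integral_norm_bound_ennreal[OF Bochner_Integration.integrable_diff[OF i1 i2]] by simp
    also have "\<dots> \<le> Y n x"
      unfolding Y_def by (intro nn_integral_mono ennreal_leI) (auto simp: indicator_def)
    finally show ?thesis by (simp add: add_left_mono)
  qed
  \<comment> \<open>The oscillation of \<open>k\<close> on the line over \<open>x\<close>. It does
    not involve \<open>n\<close>, while its integral over the ball is bounded by errors that tend to
    0.\<close>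
  define J where "J x = (\<integral>\<^sup>+s. indicator {\<alpha>..\<beta>} s * (\<integral>\<^sup>+t. indicator {\<alpha>..\<beta>} t * ennreal \<bar>k (t, x) - k (s, x)\<bar> \<partial>lborel) \<partial>lborel)" for x
  have [measurable]: "J \<in> borel_measurable borel" unfolding J_def by measurable
  have [measurable]: "X n \<in> borel_measurable borel" "Y n \<in> borel_measurable borel" for n
    unfolding X_def Y_def by measurable
  define L where "L = ennreal (\<beta> - \<alpha>)"
  have Jle: "J x \<le> 2 * L * (X n x + L * Y n x)" if x: "norm x \<le> R" and int: "integrable lborel (\<lambda>r. g1 (r, x))" for x n
  proof -
    have "J x \<le> 2 * L * (\<integral>\<^sup>+t. indicator {\<alpha>..\<beta>} t * ennreal \<bar>k (t, x) - u n (\<alpha>, x)\<bar> \<partial>lborel)"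
      unfolding J_def L_def by (rule oscillation_le) (use ab in auto)
    also have "\<dots> \<le> 2 * L * (\<integral>\<^sup>+t. ennreal \<bar>u n (t, x) - f1 (t, x)\<bar> + indicator {\<alpha>..\<beta>} t * Y n x \<partial>lborel)"
    proof (intro mult_left_mono nn_integral_mono)
      fix t
      show "indicator {\<alpha>..\<beta>} t * ennreal \<bar>k (t, x) - u n (\<alpha>, x)\<bar>
          \<le> ennreal \<bar>u n (t, x) - f1 (t, x)\<bar> + indicator {\<alpha>..\<beta>} t * Y n x"
        using key[OF _ x int, of t n] by (cases "t \<in> {\<alpha>..\<beta>}") auto
    qed simp
    also have "\<dots> = 2 * L * (X n x + L * Y n x)"
      using ab by (subst nn_integral_add) (simp_all add: X_def L_def nn_integral_multc)
    finally show ?thesis .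
  qed
  have "(\<integral>\<^sup>+x. indicator (cball 0 R) x * J x \<partial>lborel) \<le> 2 * L * (power_norm 1 (\<lambda>p. u n p - f1 p) + L * power_norm 1 (\<lambda>p. h n p - g1 p))" for n
  proof -
    have "(\<integral>\<^sup>+x. indicator (cball 0 R) x * J x \<partial>lborel) \<le> (\<integral>\<^sup>+x. 2 * L * (X n x + L * Y n x) \<partial>lborel)"
    proof (rule nn_integral_mono_AE, use g1int in eventually_elim)
      case (elim x)
      then show ?case using Jle[OF _ elim, of n] by (auto simp: indicator_def)
    qed
    also have "\<dots> = 2 * L * ((\<integral>\<^sup>+x. X n x \<partial>lborel) + L * (\<integral>\<^sup>+x. Y n x \<partial>lborel))"
      by (simp add: nn_integral_cmult nn_integral_add)
    also have "(\<integral>\<^sup>+x. X n x \<partial>lborel) = power_norm 1 (\<lambda>p. u n p - f1 p)"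
      unfolding X_def power_norm_def by (subst nn_integral_slices') simp_all
    also have "(\<integral>\<^sup>+x. Y n x \<partial>lborel) = power_norm 1 (\<lambda>p. h n p - g1 p)"
      unfolding Y_def power_norm_def by (subst nn_integral_slices') simp_all
    finally show ?thesis .
  qed
  moreover have "(\<lambda>n. 2 * L * (power_norm 1 (\<lambda>p. u n p - f1 p) + L * power_norm 1 (\<lambda>p. h n p - g1 p))) \<longlonglongrightarrow> 0"
  proof -
    have Lf: "L < top" by (simp add: L_def)
    have "(\<lambda>n. L * power_norm 1 (\<lambda>p. h n p - g1 p)) \<longlonglongrightarrow> L * 0"
      by (rule ennreal_tendsto_cmult[OF Lf hlim])
    then have "(\<lambda>n. power_norm 1 (\<lambda>p. u n p - f1 p) + L * power_norm 1 (\<lambda>p. h n p - g1 p)) \<longlonglongrightarrow> 0"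
      using tendsto_add[OF ulim] by fastforce
    then have "(\<lambda>n. 2 * L * (power_norm 1 (\<lambda>p. u n p - f1 p) + L * power_norm 1 (\<lambda>p. h n p - g1 p))) \<longlonglongrightarrow> 2 * L * 0"
      using Lf by (intro ennreal_tendsto_cmult) (auto simp: ennreal_mult_less_top)
    then show ?thesis by simp
  qed
  ultimately have "(\<integral>\<^sup>+x. indicator (cball 0 R) x * J x \<partial>lborel) \<le> 0"
    by (intro LIMSEQ_le_const[where X = "\<lambda>n. 2 * L * (power_norm 1 (\<lambda>p. u n p - f1 p) + L * power_norm 1 (\<lambda>p. h n p - g1 p))"]) auto
  then have "(\<integral>\<^sup>+x. indicator (cball 0 R) x * J x \<partial>lborel) = 0" by simp
  then have "AE x in lborel. indicator (cball 0 R) x * J x = 0"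
    by (subst (asm) nn_integral_0_iff_AE) (measurable, auto)
  then show ?thesis using g1int
  proof eventually_elim
    case (elim x)
    show ?case
    proof
      assume x: "norm x \<le> R"
      then have J0: "J x = 0" using elim(1) by auto
      have "(\<lambda>t. k (t, x)) \<in> borel_measurable borel" by measurable
      from oscillation_zero[OF this J0[unfolded J_def]] ab
      obtain c where c: "AE t in lborel. t \<in> {\<alpha>..\<beta>} \<longrightarrow> k (t, x) = c" by auto
      have fg: "f1 (t, x) = f (t, x)" "g1 (t, x) = g (t, x)" if "t \<in> {\<alpha>..\<beta>}" for t
      proof -
        have "(t, x) \<in> K" using that x by (intro subsetD[OF K0K]) (simp add: K0_def)
        then show "f1 (t, x) = f (t, x)" "g1 (t, x) = g (t, x)" by (simp_all add: f1_def g1_def)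
      qed
      \<comment> \<open>The absolutely continuous representative. On the interval \<open>g\<close>
        and its restriction \<open>g1\<close> agree, so the density can be \<open>g\<close>
        itself.\<close>
      define H where "H t = c + (LINT r|lborel. indicator {\<alpha>..t} r * g (r, x))" for t
      have Hg: "H t = c + \<Gamma> (t, x)" if "t \<in> {\<alpha>..\<beta>}" for t
      proof -
        have "(if \<alpha> \<le> r \<and> r \<le> t then 1 else 0) * g1 (r, x) = indicator {\<alpha>..t} r * g (r, x)" for r
          using fg(2)[of r] that by auto
        then show ?thesis by (simp add: H_def \<Gamma>_def)
      qed
      have "AE r in lborel. indicator {\<alpha>..\<alpha>} r * g (r, x) = 0"
        using AE_lborel_singleton[of \<alpha>] by eventually_elim auto
      then have "(LINT r|lborel. indicator {\<alpha>..\<alpha>} r * g (r, x)) = 0"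
        by (rule integral_eq_zero_AE)
      then have H\<alpha>: "H \<alpha> = c" by (simp add: H_def)
      have "integrable lborel (\<lambda>r. indicator {\<alpha>..\<beta>} r * g1 (r, x))"
        by (rule integrable_indicator_mult'[OF elim(2)]) simp
      moreover have "indicator {\<alpha>..\<beta>} r * g1 (r, x) = indicator {\<alpha>..\<beta>} r * g (r, x)" for r
        using fg(2)[of r] by (auto simp: indicator_def)
      ultimately have "integrable lborel (\<lambda>r. indicator {\<alpha>..\<beta>} r * g (r, x))" by (simp only:)
      then have ac: "ac_on \<alpha> \<beta> H (\<lambda>t. g (t, x))"
        unfolding ac_on_def H\<alpha> by (simp add: H_def)
      have "AE t in lborel. t \<in> {\<alpha>..\<beta>} \<longrightarrow> f (t, x) = H t"
        using c by eventually_elim (use Hg fg(1) in \<open>auto simp: k_def\<close>)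
      moreover have "(\<lambda>t. f (t, x)) \<in> borel_measurable borel" "(\<lambda>t. g (t, x)) \<in> borel_measurable borel"
        using measurable_compose[OF measurable_Pair2'[of x borel borel], of f borel]
          measurable_compose[OF measurable_Pair2'[of x borel borel], of g borel] f g
        by (simp_all add: borel_prod)
      ultimately show "ae_ac \<alpha> \<beta> (\<lambda>t. f (t, x)) (\<lambda>t. g (t, x))"
        unfolding ae_ac_def using ac by blast
    qed
  qed
qed

lemma weak_partial_ae_ac:
  fixes f g :: "real \<times> 'b::euclidean_space \<Rightarrow> real"
  assumes "weak_partial ({a<..<b} \<times> UNIV) (1, 0) f g"
    and "f \<in> borel_measurable borel" "g \<in> borel_measurable borel" "a < \<alpha>" "\<alpha> < \<beta>" "\<beta> < b"
  shows "AE x in lborel. ae_ac \<alpha> \<beta> (\<lambda>t. f (t, x)) (\<lambda>t. g (t, x))"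
proof -
  have "\<forall>n. AE x in lborel. norm x \<le> real n \<longrightarrow> ae_ac \<alpha> \<beta> (\<lambda>t. f (t, x)) (\<lambda>t. g (t, x))"
    using weak_partial_ae_ac_ball[OF assms] by simp
  then have "AE x in lborel. \<forall>n. norm x \<le> real n \<longrightarrow> ae_ac \<alpha> \<beta> (\<lambda>t. f (t, x)) (\<lambda>t. g (t, x))"
    by (subst AE_all_countable)
  then show ?thesis
    by eventually_elim (meson real_arch_simple)
qed

section \<open>The weighted estimate\<close>

definition primitive :: "(real \<Rightarrow> real) \<Rightarrow> real \<Rightarrow> real" where
  "primitive w \<tau> = (LINT r|lborel. indicator {..\<tau>} r * w r)"

lemma primitive_bounds:
  assumes w: "integrable lborel w" "\<And>\<tau>. 0 \<le> w \<tau>"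
  shows "0 \<le> primitive w \<tau>" "primitive w \<tau> \<le> (LINT r|lborel. w r)"
proof -
  show "0 \<le> primitive w \<tau>" unfolding primitive_def using w(2) by simp
  show "primitive w \<tau> \<le> (LINT r|lborel. w r)"
    unfolding primitive_def by (rule integral_mono') (use w in \<open>auto simp: indicator_def\<close>)
qed

lemma primitive_mono:
  assumes w: "integrable lborel w" "\<And>\<tau>. 0 \<le> w \<tau>"
  shows "mono (primitive w)"
proof (rule monoI)
  fix \<sigma> \<tau> :: real assume "\<sigma> \<le> \<tau>"
  then show "primitive w \<sigma> \<le> primitive w \<tau>"
    unfolding primitive_def using w
    by (intro integral_mono integrable_indicator_mult') (auto simp: indicator_def)
qed

text \<open>The indicators converge except possibly at the single point \<open>\<tau>\<close>, and
  the modulus of \<open>w\<close> dominates; as \<open>w\<close> may be unbounded, nothing stronger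
  than continuity is claimed.\<close>

lemma primitive_continuous:
  assumes w: "integrable lborel w"
  shows "continuous_on UNIV (primitive w)"
proof (rule continuous_at_imp_continuous_on, intro ballI)
  fix \<tau> :: real
  show "isCont (primitive w) \<tau>"
  proof (rule continuous_at_sequentiallyI)
    fix s :: "nat \<Rightarrow> real" assume s: "s \<longlonglongrightarrow> \<tau>"
    show "(\<lambda>n. primitive w (s n)) \<longlonglongrightarrow> primitive w \<tau>"
      unfolding primitive_def
    proof (rule integral_dominated_convergence[where w = "\<lambda>r. \<bar>w r\<bar>"])
      show "AE r in lborel. (\<lambda>n. indicator {..s n} r * w r) \<longlonglongrightarrow> indicator {..\<tau>} r * w r"
        using AE_lborel_singleton[of \<tau>]
      proof eventually_elim
        case (elim r)
        have "\<forall>\<^sub>F n in sequentially. indicator {..s n} r * w r = indicator {..\<tau>} r * w r"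
        proof (cases "r < \<tau>")
          case True
          show ?thesis
            using order_tendstoD(1)[OF s True] by eventually_elim (use True in \<open>auto simp: indicator_def\<close>)
        next
          case False
          then have "\<tau> < r" using elim by linarith
          show ?thesis
            using order_tendstoD(2)[OF s \<open>\<tau> < r\<close>]
            by eventually_elim (use \<open>\<tau> < r\<close> in \<open>auto simp: indicator_def\<close>)
        qed
        then show ?case by (rule tendsto_eventually)
      qed
    qed (use w in \<open>auto simp: indicator_def\<close>)
  qed
qed

text \<open>On the time line over \<open>x\<close> the shift \<open>\<rho>\<close> is the norm of
  \<open>x\<close>, so this identifies \<open>w (t - |x|)\<close> as the time derivative of the
  weight.\<close>

lemma primitive_ac:
  assumes w: "integrable lborel w"
  shows "ac_on \<alpha> \<beta> (\<lambda>t. primitive w (t - \<rho>)) (\<lambda>t. w (t - \<rho>))"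
  unfolding ac_on_def
proof (intro conjI ballI)
  have [measurable]: "w \<in> borel_measurable borel" using w by auto
  have "integrable lborel (\<lambda>t. w (t - \<rho>))"
    using integrable_translate[OF w, of "- \<rho>"] by simp
  then show "integrable lborel (\<lambda>s. indicator {\<alpha>..\<beta>} s * w (s - \<rho>))"
    by (rule integrable_indicator_mult') simp
  fix t assume t: "t \<in> {\<alpha>..\<beta>}"
  have "(LINT s|lborel. indicator {\<alpha>..t} s * w (s - \<rho>)) = (LINT s|lborel. indicator {\<alpha> - \<rho>..t - \<rho>} s * w s)"
  proof -
    have "(LINT s|lborel. indicator {\<alpha> - \<rho>..t - \<rho>} (- \<rho> + s) * w (- \<rho> + s)) = (LINT s|lborel. indicator {\<alpha> - \<rho>..t - \<rho>} s * w s)"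
      by (rule lebesgue_integral_translate[of "\<lambda>s. indicator {\<alpha> - \<rho>..t - \<rho>} s * w s"]) measurable
    moreover have "indicator {\<alpha> - \<rho>..t - \<rho>} (- \<rho> + s) * w (- \<rho> + s) = indicator {\<alpha>..t} s * w (s - \<rho>)" for s
      by (auto simp: indicator_def)
    ultimately show ?thesis by (simp only:)
  qed
  also have "\<dots> = (LINT s|lborel. indicator {..t - \<rho>} s * w s - indicator {..\<alpha> - \<rho>} s * w s)"
  proof (rule integral_cong_AE)
    show "AE s in lborel. indicator {\<alpha> - \<rho>..t - \<rho>} s * w s = indicator {..t - \<rho>} s * w s - indicator {..\<alpha> - \<rho>} s * w s"
      using AE_lborel_singleton[of "\<alpha> - \<rho>"] by eventually_elim (use t in \<open>auto simp: indicator_def\<close>)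
  qed measurable
  also have "\<dots> = primitive w (t - \<rho>) - primitive w (\<alpha> - \<rho>)"
    unfolding primitive_def by (intro Bochner_Integration.integral_diff integrable_indicator_mult' w) auto
  finally show "primitive w (t - \<rho>) = primitive w (\<alpha> - \<rho>) + (LINT s|lborel. indicator {\<alpha>..t} s * w (s - \<rho>))"
    by simp
qed

text \<open>On almost every line the integral of \<open>Y\<close> is minus that of \<open>Z\<close>,
  hence at most that of |Z|. As \<open>Y\<close> is nonnegative, Tonelli turns this into
  integrability over spacetime, and Fubini into the identity. This is the origin of the finiteness
  of the weighted potential energy under a time cut-off.\<close>

lemma integral_by_lines:
  fixes Y Z :: "real \<times> 'b::euclidean_space \<Rightarrow> real"
  assumes Y [measurable]: "Y \<in> borel_measurable borel" and Z: "integrable lborel Z"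
    and nonneg: "\<And>p. 0 \<le> Y p"
    and lines: "AE x in lborel. integrable lborel (\<lambda>t. Y (t, x) + Z (t, x)) \<and> (LINT t|lborel. Y (t, x) + Z (t, x)) = 0"
  shows "integrable lborel Y" "(LINT p|lborel. Y p) = - (LINT p|lborel. Z p)"
proof -
  have [measurable]: "Z \<in> borel_measurable borel" using Z by auto
  have Zp: "integrable (lborel \<Otimes>\<^sub>M lborel) (\<lambda>(t, x). Z (t, x))" using Z by (simp add: lborel_prod)
  have Zx: "AE x in lborel. integrable lborel (\<lambda>t. Z (t, x))" by (rule lborel_pair.AE_integrable_snd[OF Zp])
  have "(\<integral>\<^sup>+p. ennreal (Y p) \<partial>lborel) = (\<integral>\<^sup>+x. (\<integral>\<^sup>+t. ennreal (Y (t, x)) \<partial>lborel) \<partial>lborel)"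
    by (rule nn_integral_slices') measurable
  also have "\<dots> \<le> (\<integral>\<^sup>+x. (\<integral>\<^sup>+t. ennreal \<bar>Z (t, x)\<bar> \<partial>lborel) \<partial>lborel)"
  proof (rule nn_integral_mono_AE, use lines Zx in eventually_elim)
    case (elim x)
    have Yi: "integrable lborel (\<lambda>t. Y (t, x))"
      using Bochner_Integration.integrable_diff[OF conjunct1[OF elim(1)] elim(2)] by simp
    have "(\<integral>\<^sup>+t. ennreal (Y (t, x)) \<partial>lborel) = ennreal (LINT t|lborel. Y (t, x))"
      using nonneg by (intro nn_integral_eq_integral Yi) auto
    also have "(LINT t|lborel. Y (t, x)) = - (LINT t|lborel. Z (t, x))"
      using elim Yi by (simp add: eq_neg_iff_add_eq_0)
    also have "ennreal (- (LINT t|lborel. Z (t, x))) \<le> ennreal \<bar>LINT t|lborel. Z (t, x)\<bar>"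
      by (rule ennreal_leI) simp
    also have "\<dots> \<le> (\<integral>\<^sup>+t. ennreal \<bar>Z (t, x)\<bar> \<partial>lborel)"
      using integral_norm_bound_ennreal[OF elim(2)] by simp
    finally show ?case .
  qed
  also have "\<dots> = (\<integral>\<^sup>+p. ennreal \<bar>Z p\<bar> \<partial>lborel)"
    by (rule nn_integral_slices'[symmetric]) measurable
  also have "\<dots> < \<infinity>" using Z unfolding integrable_iff_bounded by simp
  finally show Yi: "integrable lborel Y" using nonneg by (intro integrableI_nonneg) auto
  have "integrable (lborel \<Otimes>\<^sub>M lborel) (\<lambda>(t, x). Y (t, x) + Z (t, x))"
    using Yi Z by (simp add: lborel_prod case_prod_unfold)
  from lborel_pair.integral_snd[OF this]
  have "(LINT p|lborel. Y p + Z p) = (LINT x|lborel. LINT t|lborel. Y (t, x) + Z (t, x))"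
    by (simp add: lborel_prod case_prod_unfold)
  also have "\<dots> = 0"
    by (rule integral_eq_zero_AE) (use lines in \<open>auto elim!: eventually_mono\<close>)
  finally show "(LINT p|lborel. Y p) = - (LINT p|lborel. Z p)" using Yi Z by simp
qed

text \<open>In the application \<open>\<eta>\<close> is the derivative of a cut-off that rises once
  and falls once, whence the total mass 2; a bound on each slice thus becomes a bound on a boundary
  term.\<close>

lemma slab_integral_bound:
  fixes g :: "real \<times> 'b::euclidean_space \<Rightarrow> real"
  assumes [measurable]: "g \<in> borel_measurable borel" "\<eta> \<in> borel_measurable borel"
    and g: "AE t in lborel. (\<integral>\<^sup>+x. ennreal \<bar>g (t, x)\<bar> \<partial>lborel) \<le> ennreal \<kappa>" and \<kappa>: "0 \<le> \<kappa>"
    and \<eta>: "(\<integral>\<^sup>+t. ennreal \<bar>\<eta> t\<bar> \<partial>lborel) \<le> 2"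
  shows "integrable lborel (\<lambda>p. \<eta> (fst p) * g p)" "\<bar>LINT p|lborel. \<eta> (fst p) * g p\<bar> \<le> 2 * \<kappa>"
proof -
  have [measurable]: "(\<lambda>p :: real \<times> 'b. \<eta> (fst p)) \<in> borel_measurable borel"
    using measurable_compose[of fst borel borel \<eta> borel] borel_measurable_continuous_onI[OF continuous_on_fst[OF continuous_on_id]]
    by simp
  have b: "(\<integral>\<^sup>+p. ennreal (norm (\<eta> (fst p) * g p)) \<partial>lborel) \<le> ennreal (2 * \<kappa>)"
  proof -
    have gx: "(\<lambda>x. g (t, x)) \<in> borel_measurable borel" for t by (rule slice_measurable) measurable
    have "(\<integral>\<^sup>+p. ennreal (norm (\<eta> (fst p) * g p)) \<partial>lborel) = (\<integral>\<^sup>+t. (\<integral>\<^sup>+x. ennreal (norm (\<eta> t * g (t, x))) \<partial>lborel) \<partial>lborel)"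
      by (subst nn_integral_slices) simp_all
    also have "\<dots> \<le> (\<integral>\<^sup>+t. ennreal \<bar>\<eta> t\<bar> * ennreal \<kappa> \<partial>lborel)"
    proof (rule nn_integral_mono_AE, use g in eventually_elim)
      case (elim t)
      have "(\<integral>\<^sup>+x. ennreal (norm (\<eta> t * g (t, x))) \<partial>lborel) = ennreal \<bar>\<eta> t\<bar> * (\<integral>\<^sup>+x. ennreal \<bar>g (t, x)\<bar> \<partial>lborel)"
        using gx by (subst nn_integral_cmult[symmetric]) (auto simp: abs_mult ennreal_mult)
      also have "\<dots> \<le> ennreal \<bar>\<eta> t\<bar> * ennreal \<kappa>" by (intro mult_left_mono elim) simp
      finally show ?case .
    qed
    also have "\<dots> = (\<integral>\<^sup>+t. ennreal \<bar>\<eta> t\<bar> \<partial>lborel) * ennreal \<kappa>" by (rule nn_integral_multc) measurable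
    also have "\<dots> \<le> 2 * ennreal \<kappa>" by (intro mult_right_mono \<eta>) simp
    also have "\<dots> = ennreal (2 * \<kappa>)" using \<kappa> by (simp add: ennreal_mult)
    finally show ?thesis .
  qed
  then show i: "integrable lborel (\<lambda>p. \<eta> (fst p) * g p)"
    by (intro integrableI_bounded) (measurable, auto intro: le_less_trans)
  have "ennreal (norm (LINT p|lborel. \<eta> (fst p) * g p)) \<le> ennreal (2 * \<kappa>)"
    using integral_norm_bound_ennreal[OF i] b by (rule order_trans)
  then show "\<bar>LINT p|lborel. \<eta> (fst p) * g p\<bar> \<le> 2 * \<kappa>" using \<kappa> by (simp add: ennreal_le_iff)
qed

text \<open>After F^2 is factored out, the coefficients 10, 10, 5, 1 are compared with 10 times the
  binomial coefficients 1, 3, 3, 1.\<close>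

lemma quintic_remainder:
  fixes v F :: real
  shows "\<bar>(v + F) ^ 5 - v ^ 5 - 5 * v ^ 4 * F\<bar> \<le> 10 * (\<bar>F\<bar>\<^sup>2 * (\<bar>F\<bar> + \<bar>v\<bar>) ^ 3)"
proof -
  have "(v + F) ^ 5 - v ^ 5 - 5 * v ^ 4 * F = F ^ 2 * (10 * v ^ 3 + 10 * v ^ 2 * F + 5 * v * F ^ 2 + F ^ 3)"
    by (simp add: eval_nat_numeral algebra_simps)
  moreover have "\<bar>10 * v ^ 3 + 10 * v ^ 2 * F + 5 * v * F ^ 2 + F ^ 3\<bar> \<le> 10 * (\<bar>F\<bar> + \<bar>v\<bar>) ^ 3"
  proof -
    have "\<bar>10 * v ^ 3 + 10 * v ^ 2 * F + 5 * v * F ^ 2 + F ^ 3\<bar>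
        \<le> \<bar>10 * v ^ 3\<bar> + \<bar>10 * v ^ 2 * F\<bar> + \<bar>5 * v * F ^ 2\<bar> + \<bar>F ^ 3\<bar>" by linarith
    also have "\<dots> = 10 * \<bar>v\<bar> ^ 3 + 10 * (\<bar>v\<bar> ^ 2 * \<bar>F\<bar>) + 5 * (\<bar>v\<bar> * \<bar>F\<bar> ^ 2) + \<bar>F\<bar> ^ 3"
      by (simp add: abs_mult power_abs)
    also have "\<dots> \<le> 10 * \<bar>v\<bar> ^ 3 + 30 * (\<bar>v\<bar> ^ 2 * \<bar>F\<bar>) + 30 * (\<bar>v\<bar> * \<bar>F\<bar> ^ 2) + 10 * \<bar>F\<bar> ^ 3"
      by (intro add_mono mult_right_mono) auto
    also have "\<dots> = 10 * (\<bar>F\<bar> + \<bar>v\<bar>) ^ 3"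
    proof -
      have "10 * x ^ 3 + 30 * (x ^ 2 * y) + 30 * (x * y ^ 2) + 10 * y ^ 3 = 10 * (y + x) ^ 3" for x y :: real
        by (simp add: eval_nat_numeral algebra_simps)
      then show ?thesis .
    qed
    finally show ?thesis .
  qed
  then have "F\<^sup>2 * \<bar>10 * v ^ 3 + 10 * v ^ 2 * F + 5 * v * F ^ 2 + F ^ 3\<bar> \<le> F\<^sup>2 * (10 * (\<bar>F\<bar> + \<bar>v\<bar>) ^ 3)"
    by (rule mult_left_mono) simp
  ultimately show ?thesis by (simp add: abs_mult mult_ac)
qed

text \<open>\<open>m\<close> stands for a bound of the energy and \<open>\<kappa>\<close> for one of
  the slice integrals of |F v^5|, the two quantities that govern the boundary terms. The
  integrability assumptions concern the separate terms into which the quintic forcing is split, so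
  that each can be integrated on its own. Extension by zero is reflected in
  \<open>v_outside\<close>.\<close>

locale forced_wave = finite_energy_wave +
  fixes F Ft :: "real \<times> (real^3) \<Rightarrow> real" and w :: "real \<Rightarrow> real" and m \<kappa> :: real
  assumes ab: "a < b"
    and v_meas [measurable]: "v \<in> borel_measurable borel"
    and F_meas [measurable]: "F \<in> borel_measurable borel"
    and Ft_meas [measurable]: "Ft \<in> borel_measurable borel"
    and w_int: "integrable lborel w" and w_nonneg: "\<And>\<tau>. 0 \<le> w \<tau>"
    and F_weak: "weak_partial ({a<..<b} \<times> UNIV) (1, 0) F Ft"
    and G_eq: "\<And>p. fst p \<in> {a<..<b} \<Longrightarrow> G p = (v p + F p) ^ 5"
    and v_outside: "\<And>p. fst p \<notin> {a<..<b} \<Longrightarrow> v p = 0"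
    and energy_le: "\<And>t. (\<integral>\<^sup>+x. ennreal (kin (t, x) + \<bar>v (t, x)\<bar> ^ 6 / 6) \<partial>lborel) \<le> ennreal m"
    and m_nonneg: "0 \<le> m"
    and cross_le: "AE t in lborel. (\<integral>\<^sup>+x. ennreal \<bar>F (t, x) * v (t, x) ^ 5\<bar> \<partial>lborel) \<le> ennreal \<kappa>"
    and \<kappa>_nonneg: "0 \<le> \<kappa>"
    and int5: "integrable lborel (\<lambda>p. v p ^ 5 * vt p)"
    and int4: "integrable lborel (\<lambda>p. F p * v p ^ 4 * vt p)"
    and intQ: "integrable lborel (\<lambda>p. \<bar>F p\<bar>\<^sup>2 * (\<bar>F p\<bar> + \<bar>v p\<bar>) ^ 3 * \<bar>vt p\<bar>)"
    and intw: "integrable lborel (\<lambda>p. w (fst p - norm (snd p)) * F p * v p ^ 5)"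
    and intW: "integrable lborel (\<lambda>p. primitive w (fst p - norm (snd p)) * Ft p * v p ^ 5)"
begin

definition W :: "real \<times> (real^3) \<Rightarrow> real" where "W p = primitive w (fst p - norm (snd p))"
definition wc :: "real \<times> (real^3) \<Rightarrow> real" where "wc p = w (fst p - norm (snd p))"
definition w1 :: real where "w1 = (LINT r|lborel. w r)"

lemma w1_nonneg: "0 \<le> w1"
  unfolding w1_def using w_nonneg by simp

lemma W_bounds: "0 \<le> W p" "W p \<le> w1"
  unfolding W_def w1_def by (intro primitive_bounds[OF w_int w_nonneg])+

lemma W_meas [measurable]: "W \<in> borel_measurable borel"
  unfolding W_def
  by (rule continuous_measurable, rule continuous_on_compose2[OF primitive_continuous[OF w_int]])
     (auto intro!: continuous_intros)

lemma wc_meas [measurable]: "wc \<in> borel_measurable borel"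
proof -
  have "(\<lambda>p :: real \<times> (real^3). fst p - norm (snd p)) \<in> borel_measurable borel"
    by (intro continuous_measurable continuous_intros)
  from measurable_compose[OF this, of w borel] w_int show ?thesis
    unfolding wc_def[abs_def] by auto
qed

lemma time_slice_measurable:
  fixes f :: "real \<times> 'b::euclidean_space \<Rightarrow> real"
  assumes "f \<in> borel_measurable borel"
  shows "(\<lambda>t. f (t, x)) \<in> borel_measurable borel"
proof -
  have "f \<in> borel_measurable (borel \<Otimes>\<^sub>M borel)" using assms by (simp add: borel_prod)
  then show ?thesis by measurable
qed

lemma W_ae_ac: "ae_ac \<alpha> \<beta> (\<lambda>t. W (t, x)) (\<lambda>t. wc (t, x))"
  using ac_on_ae_ac[OF primitive_ac[OF w_int]] time_slice_measurable[OF W_meas] time_slice_measurable[OF wc_meas]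
  by (simp add: W_def wc_def)

end

section \<open>The estimate with a cut-off in time\<close>

context forced_wave
begin

text \<open>Three relations are combined. The energy flux gives \<open>a0 \<le> c5 + 5 * c4\<close>
  plus the remainder; integrating the time derivative of the cut-off times W v^6 expresses the
  wanted integral as -6 (\<open>b6\<close> + \<open>c5\<close>); and the same for W F v^5 gives
  \<open>d0 + ew + eW + 5 * c4 = 0\<close>. Eliminating \<open>c5\<close> and \<open>c4\<close>
  leaves the boundary terms \<open>a0 + b6\<close> and \<open>d0\<close>, the signed integrals
  \<open>ew\<close> and \<open>eW\<close>, and the remainder.\<close>

theorem cutoff_estimate:
  assumes \<alpha>\<beta>: "a < \<alpha>" "\<alpha> < \<beta>" "\<beta> < b"
    and \<eta>: "\<And>t. (\<eta> has_real_derivative \<eta>' t) (at t)" "continuous_on UNIV \<eta>'"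
      "\<And>t. 0 \<le> \<eta> t" "\<And>t. \<eta> t \<le> 1" "\<And>t. t \<notin> {\<alpha>..\<beta>} \<Longrightarrow> \<eta> t = 0" "\<And>t. t \<notin> {\<alpha>..\<beta>} \<Longrightarrow> \<eta>' t = 0"
    and ends: "\<eta> \<alpha> = 0" "\<eta> \<beta> = 0"
    and var: "(\<integral>\<^sup>+t. ennreal \<bar>\<eta>' t\<bar> \<partial>lborel) \<le> 2"
  shows "integrable lborel (\<lambda>p. \<eta> (fst p) * (wc p * v p ^ 6))"
    "(LINT p|lborel. \<eta> (fst p) * (wc p * v p ^ 6))
      \<le> 6 * (2 * (w1 * m) + 2 * (w1 * \<kappa>)
          + 10 * w1 * (LINT p|lborel. \<bar>F p\<bar>\<^sup>2 * (\<bar>F p\<bar> + \<bar>v p\<bar>) ^ 3 * \<bar>vt p\<bar>)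
          - (LINT p|lborel. \<eta> (fst p) * (wc p * F p * v p ^ 5))
          - (LINT p|lborel. \<eta> (fst p) * (W p * Ft p * v p ^ 5)))"
proof -
  have \<eta>c: "continuous_on UNIV \<eta>"
    using DERIV_isCont[OF \<eta>(1)] by (simp add: continuous_at_imp_continuous_on)
  have [measurable]: "\<eta> \<in> borel_measurable borel" "\<eta>' \<in> borel_measurable borel"
    by (intro continuous_measurable \<eta>c \<eta>(2))+
  have \<eta>m [measurable]: "(\<lambda>p :: real \<times> (real^3). \<eta> (fst p)) \<in> borel_measurable borel"
    by (intro continuous_measurable continuous_on_compose2[OF \<eta>c] continuous_intros) auto
  have \<eta>m' [measurable]: "(\<lambda>p :: real \<times> (real^3). \<eta>' (fst p)) \<in> borel_measurable borel"
    by (intro continuous_measurable continuous_on_compose2[OF \<eta>(2)] continuous_intros) auto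
  have \<eta>W_bound: "\<bar>\<eta> (fst p) * W p\<bar> \<le> w1" for p
  proof -
    have "\<eta> (fst p) * W p \<le> 1 * w1" by (intro mult_mono \<eta>(4) W_bounds) (use W_bounds in auto)
    then show ?thesis using \<eta>(3)[of "fst p"] W_bounds(1)[of p] by simp
  qed
  have \<eta>_bound: "\<bar>\<eta> (fst p)\<bar> \<le> 1" for p :: "real \<times> (real^3)"
    using \<eta>(3,4)[of "fst p"] by simp
  \<comment> \<open>The function \<open>\<theta>\<close> is the quadratic part of the energy
    density, its potential part, or their sum. The first two choices provide integrability; the sum
    bounds both boundary terms at once by the full energy.\<close>
  have slices: "AE t in lborel. (\<integral>\<^sup>+x. ennreal \<bar>W (t, x) * \<theta> (t, x)\<bar> \<partial>lborel) \<le> ennreal (w1 * m)"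
    if \<theta>: "\<And>p. 0 \<le> \<theta> p" "\<And>p. \<theta> p \<le> kin p + \<bar>v p\<bar> ^ 6 / 6" for \<theta>
  proof (intro AE_I2)
    fix t
    have [measurable]: "(\<lambda>x. kin (t, x) + \<bar>v (t, x)\<bar> ^ 6 / 6) \<in> borel_measurable borel"
      by (rule slice_measurable[of "\<lambda>p. kin p + \<bar>v p\<bar> ^ 6 / 6"]) measurable
    have "(\<integral>\<^sup>+x. ennreal \<bar>W (t, x) * \<theta> (t, x)\<bar> \<partial>lborel)
        \<le> (\<integral>\<^sup>+x. ennreal w1 * ennreal (kin (t, x) + \<bar>v (t, x)\<bar> ^ 6 / 6) \<partial>lborel)"
    proof (intro nn_integral_mono)
      fix x
      have "W (t, x) * \<theta> (t, x) \<le> w1 * (kin (t, x) + \<bar>v (t, x)\<bar> ^ 6 / 6)"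
        by (intro mult_mono W_bounds \<theta> w1_nonneg)
      then show "ennreal \<bar>W (t, x) * \<theta> (t, x)\<bar> \<le> ennreal w1 * ennreal (kin (t, x) + \<bar>v (t, x)\<bar> ^ 6 / 6)"
        using W_bounds(1)[of "(t, x)"] \<theta>(1)[of "(t, x)"] w1_nonneg kin_nonneg[of "(t, x)"]
        by (subst ennreal_mult[symmetric]) (auto intro!: ennreal_leI)
    qed
    also have "\<dots> = ennreal w1 * (\<integral>\<^sup>+x. ennreal (kin (t, x) + \<bar>v (t, x)\<bar> ^ 6 / 6) \<partial>lborel)"
      by (rule nn_integral_cmult) measurable
    also have "\<dots> \<le> ennreal w1 * ennreal m" by (intro mult_left_mono energy_le) simp
    also have "\<dots> = ennreal (w1 * m)" using w1_nonneg by (simp add: ennreal_mult')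
    finally show "(\<integral>\<^sup>+x. ennreal \<bar>W (t, x) * \<theta> (t, x)\<bar> \<partial>lborel) \<le> ennreal (w1 * m)" .
  qed
  have wm: "0 \<le> w1 * m" using w1_nonneg m_nonneg by simp
  have ik: "integrable lborel (\<lambda>p. \<eta>' (fst p) * (W p * kin p))"
    by (rule slab_integral_bound[OF _ _ slices wm var]) (use kin_nonneg in auto)
  have i6: "integrable lborel (\<lambda>p. \<eta>' (fst p) * (W p * (\<bar>v p\<bar> ^ 6 / 6)))"
    by (rule slab_integral_bound[OF _ _ slices wm var]) (use kin_nonneg in auto)
  have bound_e: "\<bar>LINT p|lborel. \<eta>' (fst p) * (W p * (kin p + \<bar>v p\<bar> ^ 6 / 6))\<bar> \<le> 2 * (w1 * m)"
    by (rule slab_integral_bound[OF _ _ slices wm var]) (use kin_nonneg in auto)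
  define a0 where "a0 = (LINT p|lborel. \<eta>' (fst p) * (W p * kin p))"
  define b6 where "b6 = (LINT p|lborel. \<eta>' (fst p) * (W p * (\<bar>v p\<bar> ^ 6 / 6)))"
  have ab6: "\<bar>a0 + b6\<bar> \<le> 2 * (w1 * m)"
  proof -
    have "a0 + b6 = (LINT p|lborel. \<eta>' (fst p) * (W p * kin p) + \<eta>' (fst p) * (W p * (\<bar>v p\<bar> ^ 6 / 6)))"
      unfolding a0_def b6_def by (rule Bochner_Integration.integral_add[OF ik i6, symmetric])
    also have "\<dots> = (LINT p|lborel. \<eta>' (fst p) * (W p * (kin p + \<bar>v p\<bar> ^ 6 / 6)))"
      by (simp only: distrib_left)
    finally show ?thesis using bound_e by simp
  qed
  have cross: "AE t in lborel. (\<integral>\<^sup>+x. ennreal \<bar>W (t, x) * (F (t, x) * v (t, x) ^ 5)\<bar> \<partial>lborel) \<le> ennreal (w1 * \<kappa>)"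
    using cross_le
  proof eventually_elim
    case (elim t)
    have [measurable]: "(\<lambda>x. F (t, x) * v (t, x) ^ 5) \<in> borel_measurable borel"
      by (rule slice_measurable[of "\<lambda>p. F p * v p ^ 5"]) measurable
    have "(\<integral>\<^sup>+x. ennreal \<bar>W (t, x) * (F (t, x) * v (t, x) ^ 5)\<bar> \<partial>lborel)
        \<le> (\<integral>\<^sup>+x. ennreal w1 * ennreal \<bar>F (t, x) * v (t, x) ^ 5\<bar> \<partial>lborel)"
    proof (intro nn_integral_mono)
      fix x
      have "\<bar>W (t, x)\<bar> * \<bar>F (t, x) * v (t, x) ^ 5\<bar> \<le> w1 * \<bar>F (t, x) * v (t, x) ^ 5\<bar>"
        using W_bounds[of "(t, x)"] by (intro mult_right_mono) auto
      then show "ennreal \<bar>W (t, x) * (F (t, x) * v (t, x) ^ 5)\<bar> \<le> ennreal w1 * ennreal \<bar>F (t, x) * v (t, x) ^ 5\<bar>"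
        using w1_nonneg by (subst ennreal_mult[symmetric]) (auto simp: abs_mult intro!: ennreal_leI)
    qed
    also have "\<dots> = ennreal w1 * (\<integral>\<^sup>+x. ennreal \<bar>F (t, x) * v (t, x) ^ 5\<bar> \<partial>lborel)"
      by (rule nn_integral_cmult) measurable
    also have "\<dots> \<le> ennreal w1 * ennreal \<kappa>" by (intro mult_left_mono elim) simp
    also have "\<dots> = ennreal (w1 * \<kappa>)" using w1_nonneg by (simp add: ennreal_mult')
    finally show ?case .
  qed
  have w\<kappa>: "0 \<le> w1 * \<kappa>" using w1_nonneg \<kappa>_nonneg by simp
  have FvM: "(\<lambda>p. W p * (F p * v p ^ 5)) \<in> borel_measurable borel" by measurable
  have id: "integrable lborel (\<lambda>p. \<eta>' (fst p) * (W p * (F p * v p ^ 5)))"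
    by (rule slab_integral_bound(1)[OF FvM _ cross w\<kappa> var]) measurable
  define d0 where "d0 = (LINT p|lborel. \<eta>' (fst p) * (W p * (F p * v p ^ 5)))"
  have d0: "\<bar>d0\<bar> \<le> 2 * (w1 * \<kappa>)"
    unfolding d0_def by (rule slab_integral_bound(2)[OF FvM _ cross w\<kappa> var]) measurable
  have bm: "integrable lborel (\<lambda>p. (\<eta> (fst p) * W p) * f p)" if "integrable lborel f" for f
    using integrable_mult_bounded[OF that _ \<eta>W_bound] by (simp add: mult.commute)
  have bm': "integrable lborel (\<lambda>p. \<eta> (fst p) * f p)" if "integrable lborel f"
    for f :: "real \<times> (real^3) \<Rightarrow> real"
    using integrable_mult_bounded[OF that \<eta>m \<eta>_bound] by (simp add: mult.commute)
  note i5 = bm[OF int5] and i4 = bm[OF int4]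
  have iw: "integrable lborel (\<lambda>p. \<eta> (fst p) * (wc p * F p * v p ^ 5))"
    using bm'[OF intw] by (simp add: wc_def)
  have iW: "integrable lborel (\<lambda>p. \<eta> (fst p) * (W p * Ft p * v p ^ 5))"
    using bm'[OF intW] by (simp add: W_def)
  define c5 where "c5 = (LINT p|lborel. (\<eta> (fst p) * W p) * (v p ^ 5 * vt p))"
  define c4 where "c4 = (LINT p|lborel. (\<eta> (fst p) * W p) * (F p * v p ^ 4 * vt p))"
  define ew where "ew = (LINT p|lborel. \<eta> (fst p) * (wc p * F p * v p ^ 5))"
  define eW where "eW = (LINT p|lborel. \<eta> (fst p) * (W p * Ft p * v p ^ 5))"

  have \<eta>ac: "ac_on \<alpha> \<beta> \<eta> \<eta>'" by (rule C1_ac_on[OF \<eta>(1,2)])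
  have v_lines: "AE x in lborel. ae_ac \<alpha> \<beta> (\<lambda>t. v (t, x)) (\<lambda>t. vt (t, x))"
    by (rule weak_partial_ae_ac[OF weak[OF Basis_time] v_meas D_meas \<alpha>\<beta>])
  have F_lines: "AE x in lborel. ae_ac \<alpha> \<beta> (\<lambda>t. F (t, x)) (\<lambda>t. Ft (t, x))"
    by (rule weak_partial_ae_ac[OF F_weak F_meas Ft_meas \<alpha>\<beta>])
  \<comment> \<open>Since \<open>\<eta>\<close> and its derivative vanish off
    \<open>{\<alpha>..\<beta>}\<close>, the integral over the interval is one over the whole
    line.\<close>
  have zero: "integrable lborel h \<and> (LINT t|lborel. h t) = 0"
    if f: "ae_ac \<alpha> \<beta> f f'" and h: "\<And>t. h t = \<eta>' t * f t + \<eta> t * f' t" for f f' h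
  proof -
    have "h = (\<lambda>t. indicator {\<alpha>..\<beta>} t * (\<eta>' t * f t + \<eta> t * f' t))"
    proof
      fix t
      show "h t = indicator {\<alpha>..\<beta>} t * (\<eta>' t * f t + \<eta> t * f' t)"
        unfolding h using \<eta>(5,6)[of t] by (cases "t \<in> {\<alpha>..\<beta>}") simp_all
    qed
    then show ?thesis
      using ae_ac_integral_zero[OF \<eta>ac ends _ _ f] \<alpha>\<beta> by simp
  qed
  \<comment> \<open>\<open>Y + Z\<close> is the time derivative of the cut-off times W v^6.
    \<open>Z\<close> is integrable, while \<open>Y\<close> contains \<open>w\<close> itself and is
    known at this point only to be nonnegative and measurable.\<close>
  define Y where "Y p = \<eta> (fst p) * (wc p * v p ^ 6)" for p
  define Z where "Z p = 6 * (\<eta>' (fst p) * (W p * (\<bar>v p\<bar> ^ 6 / 6))) + 6 * ((\<eta> (fst p) * W p) * (v p ^ 5 * vt p))" for p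
  have i6': "integrable lborel (\<lambda>p. 6 * (\<eta>' (fst p) * (W p * (\<bar>v p\<bar> ^ 6 / 6))))"
    and i5': "integrable lborel (\<lambda>p. 6 * ((\<eta> (fst p) * W p) * (v p ^ 5 * vt p)))"
    by (intro integrable_mult_right i6, intro integrable_mult_right i5)
  have Zi: "integrable lborel Z" unfolding Z_def by (rule Bochner_Integration.integrable_add[OF i6' i5'])
  have Ym: "Y \<in> borel_measurable borel" unfolding Y_def by measurable
  have Y0: "0 \<le> Y p" for p
    unfolding Y_def wc_def using \<eta>(3) w_nonneg by simp
  have lines6: "AE x in lborel. integrable lborel (\<lambda>t. Y (t, x) + Z (t, x)) \<and> (LINT t|lborel. Y (t, x) + Z (t, x)) = 0"
    using v_lines
  proof eventually_elim
    case (elim x)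
    show ?case
    proof (rule zero[OF ae_ac_mult[OF W_ae_ac[of \<alpha> \<beta> x] ae_ac_power[OF elim, of 5]]])
      fix t
      have "\<bar>v (t, x)\<bar> ^ 6 = v (t, x) ^ 6" by (simp add: power_even_abs)
      then show "Y (t, x) + Z (t, x) = \<eta>' t * (W (t, x) * v (t, x) ^ Suc 5)
          + \<eta> t * (wc (t, x) * v (t, x) ^ Suc 5 + W (t, x) * (real (Suc 5) * v (t, x) ^ 5 * vt (t, x)))"
        by (simp add: Y_def Z_def algebra_simps)
    qed
  qed
  note Y = integral_by_lines[OF Ym Zi Y0 lines6]
  show "integrable lborel (\<lambda>p. \<eta> (fst p) * (wc p * v p ^ 6))"
    using Y(1) by (simp add: Y_def[abs_def])
  have Yeq: "(LINT p|lborel. Y p) = - (6 * b6 + 6 * c5)"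
    unfolding Y(2) Z_def b6_def c5_def
    by (simp only: Bochner_Integration.integral_add[OF i6' i5'] integral_mult_right_zero)

  \<comment> \<open>The time derivative of the cut-off times W F v^5. Each of its four terms is
    integrable, so the line argument is applied with 0 as the nonnegative part.\<close>
  define X where "X p = \<eta>' (fst p) * (W p * (F p * v p ^ 5)) + \<eta> (fst p) * (wc p * F p * v p ^ 5)
      + \<eta> (fst p) * (W p * Ft p * v p ^ 5) + 5 * ((\<eta> (fst p) * W p) * (F p * v p ^ 4 * vt p))" for p
  have i4': "integrable lborel (\<lambda>p. 5 * ((\<eta> (fst p) * W p) * (F p * v p ^ 4 * vt p)))"
    by (intro integrable_mult_right i4)
  note s1 = Bochner_Integration.integrable_add[OF id iw]
  note s2 = Bochner_Integration.integrable_add[OF s1 iW]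
  have Xi: "integrable lborel X" unfolding X_def by (rule Bochner_Integration.integrable_add[OF s2 i4'])
  have lines5: "AE x in lborel. integrable lborel (\<lambda>t. 0 + X (t, x)) \<and> (LINT t|lborel. 0 + X (t, x)) = 0"
    using v_lines F_lines
  proof eventually_elim
    case (elim x)
    show ?case
    proof (rule zero[OF ae_ac_mult[OF W_ae_ac[of \<alpha> \<beta> x] ae_ac_mult[OF ae_ac_power[OF elim(1), of 4] elim(2)]]])
      fix t
      show "0 + X (t, x) = \<eta>' t * (W (t, x) * (v (t, x) ^ Suc 4 * F (t, x)))
          + \<eta> t * (wc (t, x) * (v (t, x) ^ Suc 4 * F (t, x))
            + W (t, x) * (real (Suc 4) * v (t, x) ^ 4 * vt (t, x) * F (t, x) + v (t, x) ^ Suc 4 * Ft (t, x)))"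
        by (simp add: X_def algebra_simps)
    qed
  qed
  have "(LINT p|lborel. X p) = 0"
    using integral_by_lines(2)[of "\<lambda>_. 0", OF _ Xi _ lines5] by simp
  then have Xeq: "d0 + ew + eW + 5 * c4 = 0"
    unfolding X_def d0_def ew_def eW_def c4_def
    by (simp only: Bochner_Integration.integral_add[OF s2 i4'] Bochner_Integration.integral_add[OF s1 iW]
        Bochner_Integration.integral_add[OF id iw] integral_mult_right_zero)

  \<comment> \<open>What is left of the forcing after v^5 and 5 v^4 F, the two terms that the
    identities on lines turn into time derivatives.\<close>
  define rem where "rem p = (\<eta> (fst p) * W p) * (((v p + F p) ^ 5 - v p ^ 5 - 5 * v p ^ 4 * F p) * vt p)" for p
  have rem_le: "\<bar>rem p\<bar> \<le> w1 * (10 * (\<bar>F p\<bar>\<^sup>2 * (\<bar>F p\<bar> + \<bar>v p\<bar>) ^ 3 * \<bar>vt p\<bar>))" for p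
  proof -
    have "\<bar>((v p + F p) ^ 5 - v p ^ 5 - 5 * v p ^ 4 * F p) * vt p\<bar> \<le> 10 * (\<bar>F p\<bar>\<^sup>2 * (\<bar>F p\<bar> + \<bar>v p\<bar>) ^ 3) * \<bar>vt p\<bar>"
      unfolding abs_mult[of _ "vt p"] by (intro mult_right_mono quintic_remainder) simp
    then have r: "\<bar>((v p + F p) ^ 5 - v p ^ 5 - 5 * v p ^ 4 * F p) * vt p\<bar> \<le> 10 * (\<bar>F p\<bar>\<^sup>2 * (\<bar>F p\<bar> + \<bar>v p\<bar>) ^ 3 * \<bar>vt p\<bar>)"
      by (simp only: mult.assoc)
    show ?thesis
      unfolding rem_def abs_mult[of "\<eta> (fst p) * W p"]
      by (rule mult_mono[OF \<eta>W_bound r w1_nonneg abs_ge_zero])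
  qed
  have Qi: "integrable lborel (\<lambda>p. w1 * (10 * (\<bar>F p\<bar>\<^sup>2 * (\<bar>F p\<bar> + \<bar>v p\<bar>) ^ 3 * \<bar>vt p\<bar>)))" using intQ by simp
  have rem_i: "integrable lborel rem"
  proof (rule Bochner_Integration.integrable_bound[OF Qi])
    show "rem \<in> borel_measurable lborel" unfolding rem_def by measurable
    show "AE p in lborel. norm (rem p) \<le> norm (w1 * (10 * (\<bar>F p\<bar>\<^sup>2 * (\<bar>F p\<bar> + \<bar>v p\<bar>) ^ 3 * \<bar>vt p\<bar>)))"
      using rem_le by (intro AE_I2) (metis abs_ge_self order_trans real_norm_def)
  qed
  have rem_int: "(LINT p|lborel. rem p) \<le> 10 * w1 * (LINT p|lborel. \<bar>F p\<bar>\<^sup>2 * (\<bar>F p\<bar> + \<bar>v p\<bar>) ^ 3 * \<bar>vt p\<bar>)"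
  proof -
    have "rem p \<le> w1 * (10 * (\<bar>F p\<bar>\<^sup>2 * (\<bar>F p\<bar> + \<bar>v p\<bar>) ^ 3 * \<bar>vt p\<bar>))" for p
      using rem_le[of p] by linarith
    then have "(LINT p|lborel. rem p) \<le> (LINT p|lborel. w1 * (10 * (\<bar>F p\<bar>\<^sup>2 * (\<bar>F p\<bar> + \<bar>v p\<bar>) ^ 3 * \<bar>vt p\<bar>)))"
      by (rule integral_mono[OF rem_i Qi])
    then show ?thesis by simp
  qed
  have flux: "a0 \<le> (LINT p|lborel. G p * (\<eta> (fst p) * W p * vt p))"
    using energy_flux[OF \<alpha>\<beta>(1) less_imp_le[OF \<alpha>\<beta>(2)] \<alpha>\<beta>(3) primitive_continuous[OF w_int]
        primitive_mono[OF w_int w_nonneg] primitive_bounds[OF w_int w_nonneg] \<eta>]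
    unfolding a0_def W_def by (simp add: mult.assoc)
  also have "\<dots> = (LINT p|lborel. (\<eta> (fst p) * W p) * (v p ^ 5 * vt p)
      + 5 * ((\<eta> (fst p) * W p) * (F p * v p ^ 4 * vt p)) + rem p)"
  proof (intro Bochner_Integration.integral_cong refl)
    fix p :: "real \<times> (real^3)"
    show "G p * (\<eta> (fst p) * W p * vt p) = (\<eta> (fst p) * W p) * (v p ^ 5 * vt p)
      + 5 * ((\<eta> (fst p) * W p) * (F p * v p ^ 4 * vt p)) + rem p"
    proof (cases "fst p \<in> {\<alpha>..\<beta>}")
      case True
      then have "G p = (v p + F p) ^ 5" using \<alpha>\<beta> by (intro G_eq) auto
      then show ?thesis unfolding rem_def by (simp only:) (simp add: algebra_simps)
    next
      case False
      then show ?thesis using \<eta>(5) by (simp add: rem_def)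
    qed
  qed
  also have "\<dots> = c5 + 5 * c4 + (LINT p|lborel. rem p)"
    unfolding c5_def c4_def using i5 i4 rem_i by simp
  finally have "a0 \<le> c5 + 5 * c4 + (LINT p|lborel. rem p)" .
  then have "- b6 - c5 \<le> 2 * (w1 * m) + 2 * (w1 * \<kappa>)
      + 10 * w1 * (LINT p|lborel. \<bar>F p\<bar>\<^sup>2 * (\<bar>F p\<bar> + \<bar>v p\<bar>) ^ 3 * \<bar>vt p\<bar>) - ew - eW"
    using ab6 d0 Xeq rem_int by linarith
  moreover have "L \<le> 6 * y" if "- b6 - c5 \<le> y" "L = - (6 * b6 + 6 * c5)" for L y :: real
    using that by linarith
  ultimately show "(LINT p|lborel. \<eta> (fst p) * (wc p * v p ^ 6))
      \<le> 6 * (2 * (w1 * m) + 2 * (w1 * \<kappa>)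
          + 10 * w1 * (LINT p|lborel. \<bar>F p\<bar>\<^sup>2 * (\<bar>F p\<bar> + \<bar>v p\<bar>) ^ 3 * \<bar>vt p\<bar>)
          - (LINT p|lborel. \<eta> (fst p) * (wc p * F p * v p ^ 5))
          - (LINT p|lborel. \<eta> (fst p) * (W p * Ft p * v p ^ 5)))"
    using Yeq unfolding Y_def ew_def[symmetric] eW_def[symmetric] by blast
qed

end

text \<open>The integrand is the nonnegative derivative of a function that climbs from 0 at
  \<open>a\<close> to 1 at \<open>a + 2 / n\<close> and is constant elsewhere; the scale
  \<open>n\<close> therefore does not affect the integral.\<close>

lemma step'_variation:
  fixes a n :: real
  assumes n: "0 < n"
  shows "(\<integral>\<^sup>+t. ennreal (n * step' (n * (t - a) - 1)) \<partial>lborel) = 1"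
proof -
  let ?f = "\<lambda>t. n * step' (n * (t - a) - 1)" and ?F = "\<lambda>t. step (n * (t - a) - 1)"
  have der: "(?F has_real_derivative ?f t) (at t)" for t
  proof -
    have "((\<lambda>t. n * (t - a) - 1) has_real_derivative n) (at t)"
      by (auto intro!: derivative_eq_intros)
    from DERIV_chain2[where f = step and g = "\<lambda>t. n * (t - a) - 1" and x = t, OF step_has_derivative this]
    show ?thesis by (simp add: mult.commute)
  qed
  have "(\<integral>\<^sup>+t. ennreal (?f t) * indicator {a..a + 2 / n} t \<partial>lborel) = ?F (a + 2 / n) - ?F a"
  proof (rule nn_integral_FTC_Icc)
    show "?f \<in> borel_measurable borel"
      by (rule continuous_measurable, intro continuous_intros continuous_on_compose2[OF step'_continuous]) auto
  qed (use der n step'_nonneg in \<open>auto intro: has_field_derivative_at_within\<close>)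
  also have "\<dots> = 1" using n by (simp add: step_eq_0 step_eq_1)
  also have "(\<integral>\<^sup>+t. ennreal (?f t) * indicator {a..a + 2 / n} t \<partial>lborel) = (\<integral>\<^sup>+t. ennreal (?f t) \<partial>lborel)"
  proof (intro nn_integral_cong)
    fix t
    have "step' (n * (t - a) - 1) = 0" if "t \<notin> {a..a + 2 / n}"
    proof (rule step'_eq_0)
      show "n * (t - a) - 1 \<le> 0 \<or> 1 \<le> n * (t - a) - 1"
      proof (cases "t < a")
        case True
        then have "n * (t - a) \<le> 0" using n by (simp add: mult_nonneg_nonpos)
        then show ?thesis by simp
      next
        case False
        then have "2 / n \<le> t - a" using that by auto
        then have "2 \<le> n * (t - a)" using n by (simp add: divide_le_eq mult.commute)
        then show ?thesis by simp
      qed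
    qed
    then show "ennreal (?f t) * indicator {a..a + 2 / n} t = ennreal (?f t)"
      by (cases "t \<in> {a..a + 2 / n}") auto
  qed
  finally show ?thesis by simp
qed

section \<open>Removal of the cut-off\<close>

context forced_wave
begin

text \<open>The cut-offs exhaust the open interval while the mass of their derivatives stays at most
  2, so the boundary terms remain bounded although the cut-offs steepen. Fatou's lemma handles the
  nonnegative left side, dominated convergence the two signed integrals.\<close>

theorem weighted_estimate:
  "(\<integral>\<^sup>+p. ennreal (wc p * v p ^ 6) \<partial>lborel)
    \<le> ennreal (6 * (2 * (w1 * m) + 2 * (w1 * \<kappa>)
          + 10 * w1 * (LINT p|lborel. \<bar>F p\<bar>\<^sup>2 * (\<bar>F p\<bar> + \<bar>v p\<bar>) ^ 3 * \<bar>vt p\<bar>)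
          + \<bar>LINT p|lborel. wc p * F p * v p ^ 5\<bar> + \<bar>LINT p|lborel. W p * Ft p * v p ^ 5\<bar>))"
proof -
  \<comment> \<open>This size of the steepness makes \<open>\<alpha> n < \<beta> n\<close>, that is,
    it leaves room for both flanks to start inside the interval.\<close>
  obtain n0 :: nat where n0: "2 / (b - a) < real n0" using reals_Archimedean2 by blast
  have n0_pos: "0 < real n0" using n0 ab by (smt (verit) divide_pos_pos)
  define N where "N n = real (n0 + n)" for n
  have N: "0 < N n" "2 / (b - a) < N n" for n using n0 n0_pos by (auto simp: N_def)
  define \<eta> where "\<eta> n t = step (N n * (t - a) - 1) * step (N n * (b - t) - 1)" for n t
  define \<eta>' where "\<eta>' n t = step (N n * (t - a) - 1) * (step' (N n * (b - t) - 1) * (- N n))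
      + step' (N n * (t - a) - 1) * N n * step (N n * (b - t) - 1)" for n t
  define \<alpha> where "\<alpha> n = a + 1 / N n" for n
  define \<beta> where "\<beta> n = b - 1 / N n" for n
  have \<alpha>\<beta>: "a < \<alpha> n" "\<alpha> n < \<beta> n" "\<beta> n < b" for n
  proof -
    have "2 < N n * (b - a)" using N(2)[of n] ab by (simp add: divide_less_eq mult.commute)
    then have "2 / N n < b - a" using N(1)[of n] by (simp add: divide_less_eq mult.commute)
    then show "a < \<alpha> n" "\<alpha> n < \<beta> n" "\<beta> n < b" using N(1)[of n] by (auto simp: \<alpha>_def \<beta>_def)
  qed
  have d1: "((\<lambda>t. N n * (t - a) - 1) has_real_derivative N n) (at t)"
    and d2: "((\<lambda>t. N n * (b - t) - 1) has_real_derivative - N n) (at t)" for n t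
    by (auto intro!: derivative_eq_intros)
  have der: "(\<eta> n has_real_derivative \<eta>' n t) (at t)" for n t
    unfolding \<eta>_def[abs_def] \<eta>'_def
    by (rule DERIV_mult'[OF DERIV_chain2[where f = step and g = "\<lambda>t. N n * (t - a) - 1" and x = t, OF step_has_derivative d1]
          DERIV_chain2[where f = step and g = "\<lambda>t. N n * (b - t) - 1" and x = t, OF step_has_derivative d2]])
  have stepc: "continuous_on UNIV step"
    using DERIV_isCont[OF step_has_derivative] by (simp add: continuous_at_imp_continuous_on)
  have \<eta>'c: "continuous_on UNIV (\<eta>' n)" for n
    unfolding \<eta>'_def
    by (intro continuous_intros continuous_on_compose2[OF stepc] continuous_on_compose2[OF step'_continuous]) auto
  have \<eta>01: "0 \<le> \<eta> n t" "\<eta> n t \<le> 1" for n t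
    unfolding \<eta>_def using step_bounds by (simp, intro mult_le_one step_bounds)
  have left: "N n * (t - a) - 1 \<le> 0" if "t \<le> \<alpha> n" for n t
  proof -
    have "t - a \<le> 1 / N n" using that by (simp add: \<alpha>_def)
    then show ?thesis using N(1)[of n] by (simp add: le_divide_eq mult.commute)
  qed
  have right: "N n * (b - t) - 1 \<le> 0" if "\<beta> n \<le> t" for n t
  proof -
    have "b - t \<le> 1 / N n" using that by (simp add: \<beta>_def)
    then show ?thesis using N(1)[of n] by (simp add: le_divide_eq mult.commute)
  qed
  have off: "\<eta> n t = 0" "\<eta>' n t = 0" if "t \<le> \<alpha> n \<or> \<beta> n \<le> t" for n t
    using that left[of t n] right[of n t] unfolding \<eta>_def \<eta>'_def by (auto simp: step_eq_0 step'_eq_0)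
  have var: "(\<integral>\<^sup>+t. ennreal \<bar>\<eta>' n t\<bar> \<partial>lborel) \<le> 2" for n
  proof -
    let ?f = "\<lambda>t. N n * step' (N n * (t - a) - 1)"
    have fm [measurable]: "?f \<in> borel_measurable borel"
      by (rule continuous_measurable, intro continuous_intros continuous_on_compose2[OF step'_continuous]) auto
    have f0: "0 \<le> ?f t" for t using N(1)[of n] step'_nonneg by (simp add: less_imp_le)
    \<comment> \<open>Each term of the product rule is bounded by the derivative of one flank, as
      the other factor is at most 1. Reflection about the midpoint of the interval carries one flank
      to the other, so both have mass 1.\<close>
    have "\<bar>\<eta>' n t\<bar> \<le> ?f t + ?f (a + b - t)" for t
    proof -
      have e: "a + b - t - a = b - t" by simp
      have bound: "\<bar>step x * (step' y * z)\<bar> \<le> \<bar>z\<bar> * step' y" for x y z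
      proof -
        have "step x * (\<bar>z\<bar> * step' y) \<le> 1 * (\<bar>z\<bar> * step' y)"
          using step_bounds step'_nonneg by (intro mult_right_mono) auto
        then show ?thesis using step_bounds(1)[of x] step'_nonneg[of y] by (simp add: abs_mult mult.commute)
      qed
      have 1: "\<bar>step (N n * (t - a) - 1) * (step' (N n * (b - t) - 1) * (- N n))\<bar> \<le> ?f (a + b - t)"
        unfolding e using bound[of "N n * (t - a) - 1" "N n * (b - t) - 1" "- N n"] N(1)[of n] by simp
      have 2: "\<bar>step' (N n * (t - a) - 1) * N n * step (N n * (b - t) - 1)\<bar> \<le> ?f t"
        using bound[of "N n * (b - t) - 1" "N n * (t - a) - 1" "N n"] N(1)[of n]
        by (simp add: mult.commute)
      show ?thesis unfolding \<eta>'_def using 1 2 by linarith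
    qed
    then have "(\<integral>\<^sup>+t. ennreal \<bar>\<eta>' n t\<bar> \<partial>lborel) \<le> (\<integral>\<^sup>+t. ennreal (?f t) + ennreal (?f (a + b - t)) \<partial>lborel)"
      using f0 by (intro nn_integral_mono) (metis ennreal_leI ennreal_plus)
    also have "\<dots> = (\<integral>\<^sup>+t. ennreal (?f t) \<partial>lborel) + (\<integral>\<^sup>+t. ennreal (?f (a + b - t)) \<partial>lborel)"
      by (rule nn_integral_add) measurable
    also have "(\<integral>\<^sup>+t. ennreal (?f (a + b - t)) \<partial>lborel) = (\<integral>\<^sup>+t. ennreal (?f t) \<partial>lborel)"
      by (rule nn_integral_reflect[of "\<lambda>t. ennreal (?f t)"]) measurable
    also have "(\<integral>\<^sup>+t. ennreal (?f t) \<partial>lborel) = 1" by (rule step'_variation[OF N(1)])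
    finally show ?thesis by simp
  qed
  note est = cutoff_estimate[OF \<alpha>\<beta> der \<eta>'c \<eta>01 off(1) off(2) off(1) off(1) var]
  have int_n: "integrable lborel (\<lambda>p. \<eta> n (fst p) * (wc p * v p ^ 6))" for n
    by (rule est(1)) auto
  define Q where "Q = (LINT p|lborel. \<bar>F p\<bar>\<^sup>2 * (\<bar>F p\<bar> + \<bar>v p\<bar>) ^ 3 * \<bar>vt p\<bar>)"
  define c where "c n = 6 * (2 * (w1 * m) + 2 * (w1 * \<kappa>) + 10 * w1 * Q
      - (LINT p|lborel. \<eta> n (fst p) * (wc p * F p * v p ^ 5))
      - (LINT p|lborel. \<eta> n (fst p) * (W p * Ft p * v p ^ 5)))" for n
  have est_n: "(LINT p|lborel. \<eta> n (fst p) * (wc p * v p ^ 6)) \<le> c n" for n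
    unfolding c_def Q_def by (rule est(2)) auto
  have \<eta>lim: "(\<lambda>n. \<eta> n t) \<longlonglongrightarrow> 1" if t: "t \<in> {a<..<b}" for t
  proof -
    obtain k :: nat where k: "2 / (t - a) + 2 / (b - t) < real k" using reals_Archimedean2 by blast
    have pos: "0 < t - a" "0 < b - t" using t by auto
    then have k2: "2 / (t - a) < real k" "2 / (b - t) < real k" using k by (smt (verit) divide_pos_pos)+
    have "\<eta> n t = 1" if "k \<le> n" for n
    proof -
      have "real k \<le> N n" using that by (simp add: N_def)
      then have "2 / (t - a) \<le> N n" "2 / (b - t) \<le> N n" using k2 by linarith+
      then have "2 \<le> N n * (t - a)" "2 \<le> N n * (b - t)" using pos by (simp_all add: divide_le_eq)
      then show ?thesis by (simp add: \<eta>_def step_eq_1)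
    qed
    then show ?thesis by (intro tendsto_eventually eventually_sequentiallyI[of k])
  qed
  have lim: "(\<lambda>n. \<eta> n (fst p) * g p) \<longlonglongrightarrow> g p" if "fst p \<notin> {a<..<b} \<Longrightarrow> g p = 0"
    for g :: "real \<times> (real^3) \<Rightarrow> real" and p
  proof (cases "fst p \<in> {a<..<b}")
    case True
    then show ?thesis using tendsto_mult[OF \<eta>lim[OF True] tendsto_const, of "g p"] by simp
  next
    case False
    then show ?thesis using that by simp
  qed
  have \<eta>m [measurable]: "(\<lambda>p :: real \<times> (real^3). \<eta> n (fst p)) \<in> borel_measurable borel" for n
    unfolding \<eta>_def
    by (rule continuous_measurable, intro continuous_intros continuous_on_compose2[OF stepc]) auto
  have dct: "(\<lambda>n. LINT p|lborel. \<eta> n (fst p) * g p) \<longlonglongrightarrow> (LINT p|lborel. g p)"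
    if g: "integrable lborel g" and g0: "\<And>p. fst p \<notin> {a<..<b} \<Longrightarrow> g p = 0"
    for g :: "real \<times> (real^3) \<Rightarrow> real"
  proof (rule integral_dominated_convergence[where w = "\<lambda>p. \<bar>g p\<bar>"])
    have [measurable]: "g \<in> borel_measurable borel" using g by auto
    show "(\<lambda>p. \<eta> n (fst p) * g p) \<in> borel_measurable lborel" for n by simp
    show "AE p in lborel. (\<lambda>n. \<eta> n (fst p) * g p) \<longlonglongrightarrow> g p" using g0 by (intro AE_I2 lim)
    show "AE p in lborel. norm (\<eta> n (fst p) * g p) \<le> \<bar>g p\<bar>" for n
      using \<eta>01 by (intro AE_I2) (simp add: abs_mult mult_left_le_one_le)
  qed (use g in auto)
  have c_lim: "c \<longlonglongrightarrow> 6 * (2 * (w1 * m) + 2 * (w1 * \<kappa>) + 10 * w1 * Q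
      - (LINT p|lborel. wc p * F p * v p ^ 5) - (LINT p|lborel. W p * Ft p * v p ^ 5))" (is "_ \<longlonglongrightarrow> ?c")
    unfolding c_def[abs_def] using intw intW v_outside
    by (intro tendsto_intros dct) (simp_all add: wc_def[abs_def] W_def[abs_def])
  have "(\<integral>\<^sup>+p. ennreal (wc p * v p ^ 6) \<partial>lborel) = (\<integral>\<^sup>+p. liminf (\<lambda>n. ennreal (\<eta> n (fst p) * (wc p * v p ^ 6))) \<partial>lborel)"
  proof (intro nn_integral_cong)
    fix p :: "real \<times> (real^3)"
    have "(\<lambda>n. ennreal (\<eta> n (fst p) * (wc p * v p ^ 6))) \<longlonglongrightarrow> ennreal (wc p * v p ^ 6)"
      using v_outside[of p] by (intro tendsto_ennrealI lim) simp
    then show "ennreal (wc p * v p ^ 6) = liminf (\<lambda>n. ennreal (\<eta> n (fst p) * (wc p * v p ^ 6)))"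
      using lim_imp_Liminf[OF sequentially_bot] by metis
  qed
  also have "\<dots> \<le> liminf (\<lambda>n. \<integral>\<^sup>+p. ennreal (\<eta> n (fst p) * (wc p * v p ^ 6)) \<partial>lborel)"
    by (rule nn_integral_liminf) measurable
  also have "\<dots> \<le> liminf (\<lambda>n. ennreal (c n))"
  proof (intro Liminf_mono always_eventually allI)
    fix n
    have "(\<integral>\<^sup>+p. ennreal (\<eta> n (fst p) * (wc p * v p ^ 6)) \<partial>lborel) = ennreal (LINT p|lborel. \<eta> n (fst p) * (wc p * v p ^ 6))"
      using \<eta>01 w_nonneg by (intro nn_integral_eq_integral int_n) (auto simp: wc_def)
    also have "\<dots> \<le> ennreal (c n)" by (intro ennreal_leI est_n)
    finally show "(\<integral>\<^sup>+p. ennreal (\<eta> n (fst p) * (wc p * v p ^ 6)) \<partial>lborel) \<le> ennreal (c n)" .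
  qed
  also have "\<dots> = ennreal ?c"
    by (rule lim_imp_Liminf) (use c_lim in \<open>auto intro: tendsto_ennrealI\<close>)
  also have "\<dots> \<le> ennreal (6 * (2 * (w1 * m) + 2 * (w1 * \<kappa>) + 10 * w1 * Q
      + \<bar>LINT p|lborel. wc p * F p * v p ^ 5\<bar> + \<bar>LINT p|lborel. W p * Ft p * v p ^ 5\<bar>))"
    by (intro ennreal_leI mult_left_mono) linarith+
  finally show ?thesis unfolding Q_def .
qed

end

section \<open>Reduction of the statement to the weighted estimate\<close>

lemma epowr_one [simp]: "epowr x 1 = x"
  by (cases x) (auto simp: epowr_def)

lemma epowr_eq_top: "epowr x r = \<infinity> \<longleftrightarrow> x = \<infinity>"
  by (auto simp: epowr_def)

lemma epowr_epowr: "epowr (epowr x r) s = epowr x (r * s)"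
  by (cases x) (auto simp: epowr_def powr_powr)

lemma epowr_mono: "x \<le> y \<Longrightarrow> 0 \<le> r \<Longrightarrow> epowr x r \<le> epowr y r"
proof (cases "y = \<infinity>")
  case False
  assume "x \<le> y" "0 \<le> r"
  then have "x \<noteq> \<infinity>" "enn2real x \<le> enn2real y"
    using False by (auto simp: top.not_eq_extremum enn2real_mono top_unique)
  then show ?thesis using False \<open>0 \<le> r\<close> by (auto simp: epowr_def intro!: ennreal_leI powr_mono2)
qed (simp add: epowr_def)

lemma epowr_measurable [measurable]:
  assumes [measurable]: "f \<in> borel_measurable M"
  shows "(\<lambda>x. epowr (f x) r) \<in> borel_measurable M"
  unfolding epowr_def by measurable

lemma epowr_half: "x \<noteq> \<infinity> \<Longrightarrow> epowr x (1/2) = ennreal (sqrt (enn2real x))"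
  by (simp add: epowr_def powr_half_sqrt)

lemma Lp_norm_1: "Lp_norm 1 f = (\<integral>\<^sup>+x. ennreal (norm (f x)) \<partial>lborel)"
  by (simp add: Lp_norm_def)

lemma powr_numeral_abs: "\<bar>x::real\<bar> powr numeral n = \<bar>x\<bar> ^ numeral n"
  by (cases "x = 0") (simp_all add: powr_numeral)

text \<open>The polynomial x^6 - 6 x y^5 + 5 y^6 has a double zero at x = y, and its cofactor has
  nonnegative coefficients.\<close>

lemma weighted_young:
  fixes x y :: real
  assumes "0 \<le> x" "0 \<le> y"
  shows "x * y ^ 5 \<le> x ^ 6 / 6 + 5 / 6 * y ^ 6"
proof -
  have "0 \<le> (x - y)\<^sup>2 * (x ^ 4 + 2 * (x ^ 3 * y) + 3 * (x ^ 2 * y ^ 2) + 4 * (x * y ^ 3) + 5 * y ^ 4)"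
    using assms by (intro mult_nonneg_nonneg add_nonneg_nonneg) auto
  also have "\<dots> = x ^ 6 - 6 * (x * y ^ 5) + 5 * y ^ 6"
    by (simp add: eval_nat_numeral algebra_simps)
  finally show ?thesis by simp
qed

text \<open>Young's inequality for the functions normalised by \<open>A\<close> and
  \<open>B\<close>, then integrated: the two terms contribute 1/6 and 5/6 of
  \<open>A * B ^ 5\<close>. Normalisation requires positive bounds; otherwise one factor vanishes
  almost everywhere.\<close>

lemma holder_6:
  fixes f g :: "'a \<Rightarrow> real"
  assumes [measurable]: "f \<in> borel_measurable M" "g \<in> borel_measurable M"
    and A: "(\<integral>\<^sup>+x. ennreal (\<bar>f x\<bar> ^ 6) \<partial>M) \<le> ennreal (A ^ 6)" "0 \<le> A"
    and B: "(\<integral>\<^sup>+x. ennreal (\<bar>g x\<bar> ^ 6) \<partial>M) \<le> ennreal (B ^ 6)" "0 \<le> B"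
  shows "(\<integral>\<^sup>+x. ennreal \<bar>f x * g x ^ 5\<bar> \<partial>M) \<le> ennreal (A * B ^ 5)"
proof -
  have zero: "AE x in M. h x = 0"
    if [measurable]: "h \<in> borel_measurable M" and h0: "(\<integral>\<^sup>+x. ennreal (\<bar>h x\<bar> ^ 6) \<partial>M) \<le> ennreal (0 ^ 6)"
    for h :: "'a \<Rightarrow> real"
  proof -
    have "(\<integral>\<^sup>+x. ennreal (\<bar>h x\<bar> ^ 6) \<partial>M) = 0" using h0 by simp
    then have "AE x in M. ennreal (\<bar>h x\<bar> ^ 6) = 0"
      by (subst (asm) nn_integral_0_iff_AE) auto
    then show ?thesis by (rule AE_mp) (auto intro!: AE_I2)
  qed
  consider "A = 0" | "B = 0" | "0 < A" "0 < B" using A B by linarith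
  then show ?thesis
  proof cases
    case 1
    have "AE x in M. f x = 0" using A(1) unfolding 1 by (intro zero) auto
    then have "(\<integral>\<^sup>+x. ennreal \<bar>f x * g x ^ 5\<bar> \<partial>M) = (\<integral>\<^sup>+x. 0 \<partial>M)"
      by (intro nn_integral_cong_AE) (auto elim!: eventually_mono)
    then show ?thesis by simp
  next
    case 2
    have "AE x in M. g x = 0" using B(1) unfolding 2 by (intro zero) auto
    then have "(\<integral>\<^sup>+x. ennreal \<bar>f x * g x ^ 5\<bar> \<partial>M) = (\<integral>\<^sup>+x. 0 \<partial>M)"
      by (intro nn_integral_cong_AE) (auto elim!: eventually_mono)
    then show ?thesis by simp
  next
    case 3
    define p where "p = A * B ^ 5 / (6 * A ^ 6)"
    define q where "q = 5 * (A * B ^ 5) / (6 * B ^ 6)"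
    have pq: "0 \<le> p" "0 \<le> q" using 3 by (auto simp: p_def q_def)
    have le: "\<bar>f x * g x ^ 5\<bar> \<le> p * \<bar>f x\<bar> ^ 6 + q * \<bar>g x\<bar> ^ 6" for x
    proof -
      have "(A * B ^ 5) * ((\<bar>f x\<bar> / A) * (\<bar>g x\<bar> / B) ^ 5) \<le> (A * B ^ 5) * ((\<bar>f x\<bar> / A) ^ 6 / 6 + 5 / 6 * (\<bar>g x\<bar> / B) ^ 6)"
        using 3 by (intro mult_left_mono weighted_young) auto
      moreover have "(A * B ^ 5) * ((\<bar>f x\<bar> / A) * (\<bar>g x\<bar> / B) ^ 5) = \<bar>f x * g x ^ 5\<bar>"
        using 3 by (simp add: power_divide abs_mult power_abs)
      moreover have "(A * B ^ 5) * ((\<bar>f x\<bar> / A) ^ 6 / 6 + 5 / 6 * (\<bar>g x\<bar> / B) ^ 6) = p * \<bar>f x\<bar> ^ 6 + q * \<bar>g x\<bar> ^ 6"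
        by (simp add: power_divide p_def q_def distrib_left)
      ultimately show ?thesis by simp
    qed
    have "(\<integral>\<^sup>+x. ennreal \<bar>f x * g x ^ 5\<bar> \<partial>M)
        \<le> (\<integral>\<^sup>+x. ennreal p * ennreal (\<bar>f x\<bar> ^ 6) + ennreal q * ennreal (\<bar>g x\<bar> ^ 6) \<partial>M)"
    proof (intro nn_integral_mono)
      fix x
      have "ennreal \<bar>f x * g x ^ 5\<bar> \<le> ennreal (p * \<bar>f x\<bar> ^ 6 + q * \<bar>g x\<bar> ^ 6)" by (intro ennreal_leI le)
      then show "ennreal \<bar>f x * g x ^ 5\<bar> \<le> ennreal p * ennreal (\<bar>f x\<bar> ^ 6) + ennreal q * ennreal (\<bar>g x\<bar> ^ 6)"
        using pq by (simp add: ennreal_mult ennreal_plus)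
    qed
    also have "\<dots> = ennreal p * (\<integral>\<^sup>+x. ennreal (\<bar>f x\<bar> ^ 6) \<partial>M) + ennreal q * (\<integral>\<^sup>+x. ennreal (\<bar>g x\<bar> ^ 6) \<partial>M)"
      by (simp add: nn_integral_add nn_integral_cmult)
    also have "\<dots> \<le> ennreal p * ennreal (A ^ 6) + ennreal q * ennreal (B ^ 6)"
      by (intro add_mono mult_left_mono A B) auto
    also have "\<dots> = ennreal (p * A ^ 6 + q * B ^ 6)"
      using pq A B by (simp add: ennreal_mult ennreal_plus)
    also have "p * A ^ 6 + q * B ^ 6 = A * B ^ 5" using 3 by (simp add: p_def q_def)
    finally show ?thesis .
  qed
qed

text \<open>Distributions on \<open>\<Omega>\<close> see only values in \<open>\<Omega>\<close>,
  which allows a solution on the strip to be exchanged for its extension by zero.\<close>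

lemma weak_partial_cong:
  assumes "\<And>p. p \<in> \<Omega> \<Longrightarrow> f p = f' p" "\<And>p. p \<in> \<Omega> \<Longrightarrow> g p = g' p" "weak_partial \<Omega> i f g"
  shows "weak_partial \<Omega> i f' g'"
proof -
  have s: "indicator A x *\<^sub>R h x = indicator A x *\<^sub>R h' x"
    if "A \<subseteq> \<Omega>" "\<And>p. p \<in> \<Omega> \<Longrightarrow> h p = h' p" for A x and h h' :: "'a \<Rightarrow> real"
  proof (cases "x \<in> A")
    case True
    then have "h x = h' x" using that by blast
    then show ?thesis by (simp only:)
  qed simp
  have l: "loc_integrable \<Omega> h'" if "loc_integrable \<Omega> h" "\<And>p. p \<in> \<Omega> \<Longrightarrow> h p = h' p" for h h'
    unfolding loc_integrable_def set_integrable_def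
  proof (intro allI impI)
    fix K :: "'a set" assume K: "compact K \<and> K \<subseteq> \<Omega>"
    then have "integrable lborel (\<lambda>x. indicator K x *\<^sub>R h x)"
      using that(1) by (simp add: loc_integrable_def set_integrable_def)
    moreover have "indicator K x *\<^sub>R h x = indicator K x *\<^sub>R h' x" for x
      using K that(2) by (intro s) auto
    ultimately show "integrable lborel (\<lambda>x. indicator K x *\<^sub>R h' x)" by (simp only:)
  qed
  have e: "(LINT x:\<Omega>|lborel. h x * k x) = (LINT x:\<Omega>|lborel. h' x * k x)"
    if "\<And>p. p \<in> \<Omega> \<Longrightarrow> h p = h' p" for h h' k :: "'a \<Rightarrow> real"
    unfolding set_lebesgue_integral_def
    by (intro Bochner_Integration.integral_cong refl s) (simp_all add: that)
  have f: "loc_integrable \<Omega> f'" and g: "loc_integrable \<Omega> g'"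
    using assms(3) by (auto simp: weak_partial_def intro: l[OF _ assms(1)] l[OF _ assms(2)])
  have "(LINT x:\<Omega>|lborel. f' x * partial i \<phi> x) = - (LINT x:\<Omega>|lborel. g' x * \<phi> x)"
    if \<phi>: "\<phi> \<in> test_functions \<Omega>" for \<phi>
  proof -
    have "(LINT x:\<Omega>|lborel. f x * partial i \<phi> x) = - (LINT x:\<Omega>|lborel. g x * \<phi> x)"
      using assms(3) \<phi> unfolding weak_partial_def by blast
    then show ?thesis
      using e[of f f' "partial i \<phi>", OF assms(1)] e[of g g' \<phi>, OF assms(2)] by (simp only:)
  qed
  then show ?thesis using f g unfolding weak_partial_def by blast
qed

section \<open>Weak space derivatives in spacetime from those on time slices\<close>

lemma partial_slice:
  fixes \<phi> :: "real \<times> 'b::euclidean_space \<Rightarrow> real"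
  assumes "\<And>p. \<phi> differentiable (at p)"
  shows "(\<lambda>x. \<phi> (t, x)) differentiable (at x)" "partial i (\<lambda>x. \<phi> (t, x)) x = partial (0, i) \<phi> (t, x)"
proof -
  have d: "(\<phi> has_derivative frechet_derivative \<phi> (at (t, x))) (at (t, x))"
    using assms frechet_derivative_works by blast
  have "((\<lambda>x. (t, x)) has_derivative (\<lambda>h. (0, h))) (at x)"
    by (auto intro!: derivative_eq_intros)
  from has_derivative_compose[OF this d]
  have d2: "((\<lambda>x. \<phi> (t, x)) has_derivative (\<lambda>h. frechet_derivative \<phi> (at (t, x)) (0, h))) (at x)" .
  then show "(\<lambda>x. \<phi> (t, x)) differentiable (at x)" using differentiable_def by blast
  show "partial i (\<lambda>x. \<phi> (t, x)) x = partial (0, i) \<phi> (t, x)"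
    using partial_eqI[OF d2] by (simp add: partial_def)
qed

lemma C_diff_slice:
  fixes \<phi> :: "real \<times> 'b::euclidean_space \<Rightarrow> real"
  shows "C_diff k \<phi> \<Longrightarrow> C_diff k (\<lambda>x. \<phi> (t, x))"
proof (induction k arbitrary: \<phi>)
  case 0
  then have "continuous_on UNIV \<phi>" by simp
  then have "continuous_on UNIV (\<lambda>x. \<phi> (t, x))"
    by (rule continuous_on_compose2) (auto intro!: continuous_intros)
  then show ?case by simp
next
  case (Suc k)
  have d: "\<phi> differentiable (at p)" for p by (rule C_diff_differentiable[OF Suc.prems])
  have "partial i (\<lambda>x. \<phi> (t, x)) = (\<lambda>x. partial (0, i) \<phi> (t, x))" for i
    using partial_slice(2)[OF d] by blast
  moreover have "C_diff k (\<lambda>x. partial (0, i) \<phi> (t, x))" if "i \<in> Basis" for i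
    using Suc.prems that by (intro Suc.IH) simp
  ultimately show ?case using partial_slice(1)[OF d] by simp
qed

text \<open>Makes the bounds and measurability facts for kernels available for arbitrary test
  functions.\<close>

lemma test_function_bound:
  assumes "\<phi> \<in> test_functions \<Omega>"
  shows "\<exists>r. smooth_kernel r \<phi>"
proof -
  have "bounded (closure {x. \<phi> x \<noteq> 0})"
    using assms compact_imp_bounded by (auto simp: test_functions_def)
  then obtain r where r: "\<And>x. x \<in> closure {x. \<phi> x \<noteq> 0} \<Longrightarrow> norm x \<le> r"
    unfolding bounded_iff by blast
  have "\<phi> x = 0" if "r < norm x" for x
    using r[of x] that closure_subset[of "{x. \<phi> x \<noteq> 0}"] by force
  then show ?thesis using assms by (auto simp: smooth_kernel_def test_functions_def)
qed

text \<open>The gradient of a solution is given at each fixed time. A slice of a spacetime test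
  function is a test function in space, so the slice identities can be integrated in time; Fubini is
  justified by local integrability in spacetime together with the boundedness and compact support of
  the test function.\<close>

lemma weak_partial_of_slices:
  fixes v g :: "real \<times> 'b::euclidean_space \<Rightarrow> real"
  assumes v: "loc_integrable ({a<..<b} \<times> UNIV) v" and g: "loc_integrable ({a<..<b} \<times> UNIV) g"
    and slices: "\<And>t. t \<in> {a<..<b} \<Longrightarrow> weak_partial UNIV i (\<lambda>x. v (t, x)) (\<lambda>x. g (t, x))"
    and i: "i \<in> Basis"
  shows "weak_partial ({a<..<b} \<times> UNIV) (0, i) v g"
  unfolding weak_partial_def
proof (intro conjI v g ballI)
  let ?\<Omega> = "{a<..<b} \<times> (UNIV :: 'b set)"
  fix \<phi> assume \<phi>: "\<phi> \<in> test_functions ?\<Omega>"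
  define K where "K = closure {x. \<phi> x \<noteq> 0}"
  have K: "compact K" "K \<subseteq> ?\<Omega>" using \<phi> by (auto simp: test_functions_def K_def)
  obtain r where k: "smooth_kernel r \<phi>" using test_function_bound[OF \<phi>] by blast
  have ki: "smooth_kernel r (partial (0, i) \<phi>)" by (rule smooth_kernel_partial[OF k]) (use i in simp)
  have \<phi>K: "\<phi> p = 0" if "p \<notin> K" for p
    using that closure_subset[of "{x. \<phi> x \<noteq> 0}"] by (auto simp: K_def)
  have p\<phi>K: "partial (0, i) \<phi> p = 0" if "p \<notin> K" for p
    by (rule partial_eq_0_off_closed[OF _ \<phi>K that]) (use K(1) compact_imp_closed in blast)
  have int: "integrable lborel (\<lambda>p. f p * \<psi> p)"
    if f: "loc_integrable ?\<Omega> f" and \<psi>: "smooth_kernel r \<psi>" and \<psi>K: "\<And>p. p \<notin> K \<Longrightarrow> \<psi> p = 0" for f \<psi>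
  proof -
    have "integrable lborel (\<lambda>p. indicator K p * f p)"
      using f K unfolding loc_integrable_def set_integrable_def by auto
    moreover obtain B where "\<And>p. \<bar>\<psi> p\<bar> \<le> B" using smooth_kernel_bounded[OF \<psi>] by blast
    ultimately have "integrable lborel (\<lambda>p. (indicator K p * f p) * \<psi> p)"
      by (rule integrable_mult_bounded[OF _ smooth_kernel_measurable[OF \<psi>]])
    moreover have "(indicator K p * f p) * \<psi> p = f p * \<psi> p" for p
      using \<psi>K[of p] by (cases "p \<in> K") auto
    ultimately show ?thesis by simp
  qed
  have slice_int: "(LINT p:?\<Omega>|lborel. f p * \<psi> p) = (LINT t|lborel. LINT x|lborel. f (t, x) * \<psi> (t, x))"
    if f: "loc_integrable ?\<Omega> f" and \<psi>: "smooth_kernel r \<psi>" and \<psi>K: "\<And>p. p \<notin> K \<Longrightarrow> \<psi> p = 0" for f \<psi>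
  proof -
    have "indicator ?\<Omega> p *\<^sub>R (f p * \<psi> p) = f p * \<psi> p" for p
      using \<psi>K[of p] K(2) by (cases "p \<in> K") (auto simp: indicator_def)
    then have "(LINT p:?\<Omega>|lborel. f p * \<psi> p) = (LINT p|lborel. f p * \<psi> p)"
      by (simp only: set_lebesgue_integral_def)
    also have "\<dots> = (LINT p|(lborel \<Otimes>\<^sub>M lborel). f p * \<psi> p)" by (simp only: lborel_prod)
    also have "\<dots> = (LINT t|lborel. LINT x|lborel. f (t, x) * \<psi> (t, x))"
      using int[OF f \<psi> \<psi>K] by (intro lborel_pair.integral_fst'[symmetric]) (simp add: lborel_prod)
    finally show ?thesis .
  qed
  have inner: "(LINT x|lborel. v (t, x) * partial (0, i) \<phi> (t, x)) = - (LINT x|lborel. g (t, x) * \<phi> (t, x))" for t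
  proof (cases "t \<in> {a<..<b}")
    case True
    have d: "\<phi> differentiable (at p)" for p by (rule smooth_kernel_differentiable[OF k])
    have sub: "closure {x. \<phi> (t, x) \<noteq> 0} \<subseteq> cball 0 r"
    proof (rule closure_minimal)
      show "{x. \<phi> (t, x) \<noteq> 0} \<subseteq> cball 0 r"
      proof
        fix x assume "x \<in> {x. \<phi> (t, x) \<noteq> 0}"
        then have "norm (t, x) \<le> r" using smooth_kernel_eq_0[OF k, of "(t, x)"] by force
        moreover have "norm x \<le> norm (t, x)" using norm_snd_le[of x t] by simp
        ultimately show "x \<in> cball 0 r" by simp
      qed
    qed simp
    have "(\<lambda>x. \<phi> (t, x)) \<in> test_functions UNIV"
      unfolding test_functions_def
    proof (intro CollectI conjI allI)
      show "C_diff n (\<lambda>x. \<phi> (t, x))" for n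
        using k by (intro C_diff_slice) (simp only: smooth_kernel_def)
      show "compact (closure {x. \<phi> (t, x) \<noteq> 0})"
        using bounded_subset[OF bounded_cball order_trans[OF closure_subset sub]] by (simp add: compact_closure)
    qed simp
    then have "(LINT x:UNIV|lborel. v (t, x) * partial i (\<lambda>x. \<phi> (t, x)) x) = - (LINT x:UNIV|lborel. g (t, x) * \<phi> (t, x))"
      using slices[OF True] unfolding weak_partial_def by blast
    then show ?thesis by (simp add: partial_slice(2)[OF d] set_lebesgue_integral_def)
  next
    case False
    then have "(t, x) \<notin> K" for x using K(2) by blast
    then show ?thesis by (simp add: \<phi>K p\<phi>K)
  qed
  show "(LINT p:?\<Omega>|lborel. v p * partial (0, i) \<phi> p) = - (LINT p:?\<Omega>|lborel. g p * \<phi> p)"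
  proof -
    have "(LINT p:?\<Omega>|lborel. v p * partial (0, i) \<phi> p) = (LINT t|lborel. LINT x|lborel. v (t, x) * partial (0, i) \<phi> (t, x))"
      by (rule slice_int[OF v ki p\<phi>K])
    also have "\<dots> = - (LINT t|lborel. LINT x|lborel. g (t, x) * \<phi> (t, x))"
      by (simp only: inner Bochner_Integration.integral_minus)
    also have "(LINT t|lborel. LINT x|lborel. g (t, x) * \<phi> (t, x)) = (LINT p:?\<Omega>|lborel. g p * \<phi> p)"
      by (rule slice_int[OF g k \<phi>K, symmetric])
    finally show ?thesis .
  qed
qed

section \<open>Iterated integrals over the closed interval and integrals over the open strip\<close>

lemma AE_time_neq: "AE p in lborel. fst (p :: real \<times> 'b::euclidean_space) \<noteq> c"
proof -
  have [measurable]: "{p :: real \<times> 'b. fst p = c} \<in> sets borel"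
    by (intro borel_closed closed_Collect_eq continuous_intros)
  have "(\<integral>\<^sup>+p. indicator {p :: real \<times> 'b. fst p = c} p \<partial>lborel)
      = (\<integral>\<^sup>+t. (\<integral>\<^sup>+x. indicator {p :: real \<times> 'b. fst p = c} (t, x) \<partial>lborel) \<partial>lborel)"
    by (rule nn_integral_slices) measurable
  also have "\<dots> = (\<integral>\<^sup>+(t::real). 0 \<partial>lborel)"
    using AE_lborel_singleton[of c] by (intro nn_integral_cong_AE) (auto elim!: eventually_mono simp: indicator_def)
  finally have "emeasure lborel {p :: real \<times> 'b. fst p = c} = 0" by simp
  then have "{p :: real \<times> 'b. fst p = c} \<in> null_sets lborel" by (auto simp: null_sets_def)
  from AE_not_in[OF this] show ?thesis by simp
qed

text \<open>The two endpoint times form a null set. This connects the iterated integrals over [a,b]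
  in the claim with integrals over spacetime of functions cut to the open strip.\<close>

lemma nn_integral_strip:
  fixes f :: "real \<times> 'b::euclidean_space \<Rightarrow> ennreal"
  assumes m: "(\<lambda>p. indicator ({a<..<b} \<times> UNIV) p * f p) \<in> borel_measurable borel"
  shows "(\<integral>\<^sup>+t\<in>{a..b}. (\<integral>\<^sup>+x. f (t, x) \<partial>lborel) \<partial>lborel) = (\<integral>\<^sup>+p. indicator ({a<..<b} \<times> UNIV) p * f p \<partial>lborel)"
proof -
  have "(\<integral>\<^sup>+p. indicator ({a<..<b} \<times> UNIV) p * f p \<partial>lborel)
      = (\<integral>\<^sup>+t. (\<integral>\<^sup>+x. indicator ({a<..<b} \<times> UNIV) (t, x) * f (t, x) \<partial>lborel) \<partial>lborel)"
    by (rule nn_integral_slices[OF m])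
  also have "\<dots> = (\<integral>\<^sup>+t\<in>{a..b}. (\<integral>\<^sup>+x. f (t, x) \<partial>lborel) \<partial>lborel)"
  proof (rule nn_integral_cong_AE)
    show "AE t in lborel. (\<integral>\<^sup>+x. indicator ({a<..<b} \<times> UNIV) (t, x) * f (t, x) \<partial>lborel)
        = (\<integral>\<^sup>+x. f (t, x) \<partial>lborel) * indicator {a..b} t"
      using AE_lborel_singleton[of a] AE_lborel_singleton[of b]
    proof eventually_elim
      case (elim t)
      have "(\<integral>\<^sup>+x. indicator ({a<..<b} \<times> UNIV) (t, x) * f (t, x) \<partial>lborel)
          = (\<integral>\<^sup>+x. (if t \<in> {a<..<b} then f (t, x) else 0) \<partial>lborel)"
        by (intro nn_integral_cong) (auto simp: indicator_def)
      then show ?case using elim by (auto simp: indicator_def)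
    qed
  qed
  finally show ?thesis by simp
qed

lemma integral_strip:
  fixes f :: "real \<times> 'b::euclidean_space \<Rightarrow> real"
  assumes i: "set_integrable lborel ({a..b} \<times> UNIV) f"
  shows "integrable lborel (\<lambda>p. indicator ({a<..<b} \<times> UNIV) p * f p)"
    "(LINT t:{a..b}|lborel. LINT x|lborel. f (t, x)) = (LINT p|lborel. indicator ({a<..<b} \<times> UNIV) p * f p)"
proof -
  let ?g = "\<lambda>p. indicator ({a..b} \<times> UNIV) p * f p"
  have g: "integrable lborel ?g" using i by (simp add: set_integrable_def)
  have O: "{a<..<b} \<times> (UNIV :: 'b set) \<in> sets borel"
    by (intro borel_open open_Times) auto
  have e: "indicator ({a<..<b} \<times> UNIV) p * ?g p = indicator ({a<..<b} \<times> UNIV) p * f p" for p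
    by (auto simp: indicator_def)
  show s: "integrable lborel (\<lambda>p. indicator ({a<..<b} \<times> UNIV) p * f p)"
    using integrable_indicator_mult'[OF g O] unfolding e .
  have "(LINT t:{a..b}|lborel. LINT x|lborel. f (t, x)) = (LINT t|lborel. LINT x|lborel. ?g (t, x))"
    unfolding set_lebesgue_integral_def
    by (intro Bochner_Integration.integral_cong refl) (auto simp: indicator_def)
  also have "\<dots> = (LINT p|(lborel \<Otimes>\<^sub>M lborel). ?g p)"
    using g by (intro lborel_pair.integral_fst') (simp add: lborel_prod)
  also have "\<dots> = (LINT p|lborel. ?g p)" by (simp only: lborel_prod)
  also have "\<dots> = (LINT p|lborel. indicator ({a<..<b} \<times> UNIV) p * f p)"
  proof (rule integral_cong_AE)
    show "AE p in lborel. ?g p = indicator ({a<..<b} \<times> UNIV) p * f p"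
      using AE_time_neq[of a] AE_time_neq[of b] by eventually_elim (auto simp: indicator_def)
  qed (use g s in auto)
  finally show "(LINT t:{a..b}|lborel. LINT x|lborel. f (t, x)) = (LINT p|lborel. indicator ({a<..<b} \<times> UNIV) p * f p)" .
qed

text \<open>Integrability on each compact set includes measurability there, and compact slabs
  exhaust the strip. A weak derivative such as \<open>Ft\<close> is given with local integrability
  only, so its measurability has to be extracted in this way.\<close>

lemma loc_integrable_measurable:
  fixes f :: "real \<times> 'b::euclidean_space \<Rightarrow> real"
  assumes "loc_integrable ({a<..<b} \<times> UNIV) f"
  shows "(\<lambda>p. indicator ({a<..<b} \<times> UNIV) p * f p) \<in> borel_measurable borel"
proof -
  \<comment> \<open>For small \<open>n\<close> these slabs may be empty; only their eventual
    containment of a given point of the strip matters.\<close>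
  define K where "K n = {a + inverse (real (Suc n))..b - inverse (real (Suc n))} \<times> cball (0::'b) (real n)" for n
  have K: "compact (K n)" "K n \<subseteq> {a<..<b} \<times> UNIV" for n
  proof -
    show "compact (K n)" unfolding K_def by (intro compact_Times compact_Icc compact_cball)
    have pos: "0 < inverse (real (Suc n))" by simp
    show "K n \<subseteq> {a<..<b} \<times> UNIV"
    proof
      fix p assume "p \<in> K n"
      then have "a + inverse (real (Suc n)) \<le> fst p" "fst p \<le> b - inverse (real (Suc n))"
        unfolding K_def mem_Times_iff atLeastAtMost_iff by blast+
      then have "a < fst p" "fst p < b" using pos by linarith+
      then show "p \<in> {a<..<b} \<times> UNIV" by (simp add: mem_Times_iff)
    qed
  qed
  have m: "(\<lambda>p. indicator (K n) p * f p) \<in> borel_measurable borel" for n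
  proof -
    have "integrable lborel (\<lambda>p. indicator (K n) p * f p)"
      using assms K unfolding loc_integrable_def set_integrable_def by auto
    then show ?thesis using borel_measurable_integrable by fastforce
  qed
  show ?thesis
  proof (rule borel_measurable_LIMSEQ_real[OF _ m])
    fix p :: "real \<times> 'b"
    show "(\<lambda>n. indicator (K n) p * f p) \<longlonglongrightarrow> indicator ({a<..<b} \<times> UNIV) p * f p"
    proof (cases "p \<in> {a<..<b} \<times> UNIV")
      case False
      then have "p \<notin> K n" for n using K(2) by blast
      then show ?thesis using False by simp
    next
      case True
      then have "0 < min (fst p - a) (b - fst p)" by auto
      then have 1: "\<forall>\<^sub>F n in sequentially. inverse (real (Suc n)) < min (fst p - a) (b - fst p)"
        using order_tendstoD(2)[OF LIMSEQ_inverse_real_of_nat] by blast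
      obtain n0 where n0: "norm (snd p) \<le> real n0" using real_arch_simple by blast
      have 2: "\<forall>\<^sub>F n in sequentially. norm (snd p) \<le> real n"
        by (rule eventually_sequentiallyI[of n0]) (use n0 in linarith)
      have "\<forall>\<^sub>F n in sequentially. indicator (K n) p * f p = indicator ({a<..<b} \<times> UNIV) p * f p"
        using 1 2
      proof eventually_elim
        case (elim n)
        then have "p \<in> K n" by (cases p) (auto simp: K_def)
        then show ?case using True by simp
      qed
      then show ?thesis by (rule tendsto_eventually)
    qed
  qed
qed

text \<open>The fifth power of the L^10 norm of a slice is the square root of the integral of the
  tenth power. Finiteness of the mixed norm thus says that this square root \<open>\<alpha>\<close>
  is integrable in time.\<close>

lemma mixed_norm_slices:
  fixes f g :: "real \<times> (real^3) \<Rightarrow> real"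
  assumes g [measurable]: "g \<in> borel_measurable borel"
    and le: "\<And>t x. t \<in> I \<Longrightarrow> \<bar>g (t, x)\<bar> \<le> \<bar>f (t, x)\<bar>" and zero: "\<And>t x. t \<notin> I \<Longrightarrow> g (t, x) = 0"
    and fin: "LtLx_norm 5 10 I f < \<infinity>"
  obtains \<alpha> where "\<alpha> \<in> borel_measurable borel" "\<And>t. 0 \<le> \<alpha> t" "(\<integral>\<^sup>+t. ennreal (\<alpha> t) \<partial>lborel) < \<infinity>"
    "AE t in lborel. (\<integral>\<^sup>+x. ennreal (\<bar>g (t, x)\<bar> ^ 10) \<partial>lborel) \<le> ennreal (\<alpha> t ^ 2)"
proof -
  define A where "A t = (\<integral>\<^sup>+x. ennreal (\<bar>g (t, x)\<bar> ^ 10) \<partial>lborel)" for t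
  have A [measurable]: "A \<in> borel_measurable borel"
    unfolding A_def by (rule slice_integral_measurable) measurable
  \<comment> \<open>\<open>enn2real\<close> sends infinity to 0. This keeps \<open>\<alpha>\<close>
    real, and the slice bound may fail only where \<open>A\<close> is infinite, which happens on a
    null set of times.\<close>
  define \<alpha> where "\<alpha> t = sqrt (enn2real (A t))" for t
  have le_A: "epowr (A t) (1/2) \<le> epowr (Lp_norm 10 (\<lambda>x. f (t, x))) 5 * indicator I t" for t
  proof (cases "t \<in> I")
    case True
    have "epowr (A t) (1/2) \<le> epowr (\<integral>\<^sup>+x. ennreal (norm (f (t, x)) powr 10) \<partial>lborel) (1/2)"
      unfolding A_def
    proof (intro epowr_mono nn_integral_mono ennreal_leI)
      show "\<bar>g (t, x)\<bar> ^ 10 \<le> norm (f (t, x)) powr 10" for x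
        unfolding real_norm_def powr_numeral_abs by (rule power_mono[OF le[OF True]]) simp
    qed simp
    then show ?thesis using True by (simp add: Lp_norm_def epowr_epowr)
  next
    case False
    then show ?thesis by (simp add: A_def zero epowr_def)
  qed
  have "(\<integral>\<^sup>+t. epowr (A t) (1/2) \<partial>lborel) \<le> (\<integral>\<^sup>+t\<in>I. epowr (Lp_norm 10 (\<lambda>x. f (t, x))) 5 \<partial>lborel)"
    by (intro nn_integral_mono le_A)
  also have "\<dots> < \<infinity>"
  proof -
    have "LtLx_norm 5 10 I f \<noteq> \<infinity>" using fin by (rule less_imp_neq)
    then have "(\<integral>\<^sup>+t\<in>I. epowr (Lp_norm 10 (\<lambda>x. f (t, x))) 5 \<partial>lborel) \<noteq> \<infinity>"
      unfolding LtLx_norm_def epowr_eq_top .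
    then show ?thesis unfolding infinity_ennreal_def top.not_eq_extremum .
  qed
  finally have int: "(\<integral>\<^sup>+t. epowr (A t) (1/2) \<partial>lborel) < \<infinity>" .
  have "AE t in lborel. epowr (A t) (1/2) \<noteq> \<infinity>"
    using int by (intro nn_integral_PInf_AE) auto
  then have fin_AE: "AE t in lborel. A t \<noteq> \<infinity>" by (simp only: epowr_eq_top)
  show thesis
  proof
    show "\<alpha> \<in> borel_measurable borel" unfolding \<alpha>_def by measurable
    show "0 \<le> \<alpha> t" for t by (simp add: \<alpha>_def)
    have "ennreal (\<alpha> t) \<le> epowr (A t) (1/2)" for t
    proof (cases "A t = \<infinity>")
      case True
      then have "epowr (A t) (1/2) = \<infinity>" by (simp only: epowr_eq_top)
      then show ?thesis by simp
    next
      case False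
      then show ?thesis unfolding \<alpha>_def by (subst epowr_half) auto
    qed
    then show "(\<integral>\<^sup>+t. ennreal (\<alpha> t) \<partial>lborel) < \<infinity>"
      using int by (meson le_less_trans nn_integral_mono)
    show "AE t in lborel. (\<integral>\<^sup>+x. ennreal (\<bar>g (t, x)\<bar> ^ 10) \<partial>lborel) \<le> ennreal (\<alpha> t ^ 2)"
      using fin_AE
    proof eventually_elim
      case (elim t)
      then have "ennreal (\<alpha> t ^ 2) = A t" by (simp add: \<alpha>_def less_top)
      then show ?case by (simp add: A_def)
    qed
  qed
qed

lemma power_10_add_le: "(\<bar>x::real\<bar> + \<bar>y\<bar>) ^ 10 \<le> 1024 * \<bar>x\<bar> ^ 10 + 1024 * \<bar>y\<bar> ^ 10"
proof -
  have "(\<bar>x\<bar> + \<bar>y\<bar>) ^ 10 \<le> (2 * max \<bar>x\<bar> \<bar>y\<bar>) ^ 10" by (intro power_mono) auto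
  also have "\<dots> = 1024 * max \<bar>x\<bar> \<bar>y\<bar> ^ 10" by (simp add: power_mult_distrib)
  also have "\<dots> \<le> 1024 * \<bar>x\<bar> ^ 10 + 1024 * \<bar>y\<bar> ^ 10" by (cases "\<bar>x\<bar> \<le> \<bar>y\<bar>") (simp_all add: max_def)
  finally show ?thesis .
qed

text \<open>The square of a quintic expression is of degree ten, and (|f| + |g|)^10 is at most 2^10
  times the sum of the tenth powers; 32 is the square root of 2^10. Quintic expressions are thus
  integrable in time with values in L^2 whenever \<open>\<alpha>\<close> and \<open>\<beta>\<close>
  are integrable.\<close>

lemma quintic_slices:
  fixes f g H :: "real \<times> (real^3) \<Rightarrow> real"
  assumes f: "f \<in> borel_measurable borel" and g: "g \<in> borel_measurable borel"
    and \<alpha>: "AE t in lborel. (\<integral>\<^sup>+x. ennreal (\<bar>f (t, x)\<bar> ^ 10) \<partial>lborel) \<le> ennreal (\<alpha> t ^ 2)" "\<And>t. 0 \<le> \<alpha> t"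
    and \<beta>: "AE t in lborel. (\<integral>\<^sup>+x. ennreal (\<bar>g (t, x)\<bar> ^ 10) \<partial>lborel) \<le> ennreal (\<beta> t ^ 2)" "\<And>t. 0 \<le> \<beta> t"
    and H: "\<And>p. \<bar>H p\<bar> \<le> (\<bar>f p\<bar> + \<bar>g p\<bar>) ^ 5"
  shows "AE t in lborel. (\<integral>\<^sup>+x. ennreal (\<bar>H (t, x)\<bar> ^ 2) \<partial>lborel) \<le> ennreal ((32 * (\<alpha> t + \<beta> t)) ^ 2)"
  using \<alpha>(1) \<beta>(1)
proof eventually_elim
  case (elim t)
  have [measurable]: "(\<lambda>x. f (t, x)) \<in> borel_measurable borel" "(\<lambda>x. g (t, x)) \<in> borel_measurable borel"
    by (rule slice_measurable[OF f], rule slice_measurable[OF g])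
  have "(\<integral>\<^sup>+x. ennreal (\<bar>H (t, x)\<bar> ^ 2) \<partial>lborel)
      \<le> (\<integral>\<^sup>+x. ennreal 1024 * ennreal (\<bar>f (t, x)\<bar> ^ 10) + ennreal 1024 * ennreal (\<bar>g (t, x)\<bar> ^ 10) \<partial>lborel)"
  proof (intro nn_integral_mono)
    fix x
    have "\<bar>H (t, x)\<bar> ^ 2 \<le> ((\<bar>f (t, x)\<bar> + \<bar>g (t, x)\<bar>) ^ 5) ^ 2" by (intro power_mono H) simp
    also have "\<dots> = (\<bar>f (t, x)\<bar> + \<bar>g (t, x)\<bar>) ^ 10" by (simp add: power_mult[symmetric])
    also note power_10_add_le
    finally have "ennreal (\<bar>H (t, x)\<bar> ^ 2) \<le> ennreal (1024 * \<bar>f (t, x)\<bar> ^ 10 + 1024 * \<bar>g (t, x)\<bar> ^ 10)"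
      by (rule ennreal_leI)
    also have "\<dots> = ennreal 1024 * ennreal (\<bar>f (t, x)\<bar> ^ 10) + ennreal 1024 * ennreal (\<bar>g (t, x)\<bar> ^ 10)"
      by (subst ennreal_plus) (simp_all only: ennreal_mult zero_le_power abs_ge_zero zero_le_numeral mult_nonneg_nonneg)
    finally show "ennreal (\<bar>H (t, x)\<bar> ^ 2) \<le> \<dots>" .
  qed
  also have "\<dots> = ennreal 1024 * (\<integral>\<^sup>+x. ennreal (\<bar>f (t, x)\<bar> ^ 10) \<partial>lborel)
      + ennreal 1024 * (\<integral>\<^sup>+x. ennreal (\<bar>g (t, x)\<bar> ^ 10) \<partial>lborel)"
    by (subst nn_integral_add) (simp_all add: nn_integral_cmult)
  also have "\<dots> \<le> ennreal 1024 * ennreal (\<alpha> t ^ 2) + ennreal 1024 * ennreal (\<beta> t ^ 2)"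
    by (intro add_mono mult_left_mono elim) simp_all
  also have "\<dots> = ennreal (1024 * \<alpha> t ^ 2 + 1024 * \<beta> t ^ 2)"
    by (subst ennreal_plus) (simp_all only: ennreal_mult zero_le_power2 zero_le_numeral mult_nonneg_nonneg)
  also have "\<dots> \<le> ennreal ((32 * (\<alpha> t + \<beta> t)) ^ 2)"
  proof (rule ennreal_leI)
    have "0 \<le> \<alpha> t * \<beta> t" by (intro mult_nonneg_nonneg \<alpha> \<beta>)
    then show "1024 * \<alpha> t ^ 2 + 1024 * \<beta> t ^ 2 \<le> (32 * (\<alpha> t + \<beta> t)) ^ 2"
      by (simp add: power2_eq_square algebra_simps)
  qed
  finally show ?case .
qed

text \<open>The slice bound times the length of the interval gives square integrability over the
  strip, and |y| \<le> 1 + y^2 gives integrability on compact sets.\<close>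

lemma loc_integrable_square_slices:
  fixes f g :: "real \<times> (real^3) \<Rightarrow> real"
  assumes g [measurable]: "g \<in> borel_measurable borel"
    and slices: "\<And>t. (\<integral>\<^sup>+x. ennreal (\<bar>g (t, x)\<bar> ^ 2) \<partial>lborel) \<le> ennreal (M ^ 2)"
    and eq: "\<And>p. p \<in> {a<..<b} \<times> UNIV \<Longrightarrow> g p = f p" and zero: "\<And>t x. t \<notin> {a<..<b} \<Longrightarrow> g (t, x) = 0"
  shows "loc_integrable ({a<..<b} \<times> UNIV) f"
  unfolding loc_integrable_def set_integrable_def
proof (intro allI impI)
  fix K :: "(real \<times> (real^3)) set" assume K: "compact K \<and> K \<subseteq> {a<..<b} \<times> UNIV"
  have "(\<integral>\<^sup>+p. ennreal (\<bar>g p\<bar> ^ 2) \<partial>lborel) = (\<integral>\<^sup>+t. (\<integral>\<^sup>+x. ennreal (\<bar>g (t, x)\<bar> ^ 2) \<partial>lborel) \<partial>lborel)"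
    by (rule nn_integral_slices) measurable
  also have "\<dots> \<le> (\<integral>\<^sup>+t. ennreal (M ^ 2) * indicator {a<..<b} t \<partial>lborel)"
  proof (intro nn_integral_mono)
    fix t
    show "(\<integral>\<^sup>+x. ennreal (\<bar>g (t, x)\<bar> ^ 2) \<partial>lborel) \<le> ennreal (M ^ 2) * indicator {a<..<b} t"
    proof (cases "t \<in> {a<..<b}")
      case True
      then show ?thesis using slices[of t] by simp
    next
      case False
      then have "g (t, x) = 0" for x by (rule zero)
      then show ?thesis by (simp only: abs_zero zero_power2 ennreal_0 nn_integral_const) simp
    qed
  qed
  also have "\<dots> = ennreal (M ^ 2) * emeasure lborel {a<..<b}" by (rule nn_integral_cmult_indicator) simp
  also have "\<dots> < \<infinity>" 
    using emeasure_bounded_finite[OF bounded_box, of a b]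
    unfolding infinity_ennreal_def ennreal_mult_less_top box_real by simp
  finally have 2: "integrable lborel (\<lambda>p. g p ^ 2)" by (intro integrableI_bounded) (simp_all add: power_abs)
  have Kb: "K \<in> sets borel" using K by (simp add: borel_compact)
  have 1: "integrable lborel (indicator K :: real \<times> (real^3) \<Rightarrow> real)"
    using K Kb emeasure_compact_finite[of K] by (intro integrable_real_indicator) (auto simp: sets_lborel)
  have "integrable lborel (\<lambda>p. indicator K p * g p)"
  proof (rule Bochner_Integration.integrable_bound[OF Bochner_Integration.integrable_add[OF 1 2]])
    show "(\<lambda>p. indicator K p * g p) \<in> borel_measurable lborel" using Kb by measurable
    have "\<bar>y\<bar> \<le> 1 + y ^ 2" for y :: real
    proof -
      have "0 \<le> (\<bar>y\<bar> - 1) ^ 2" by simp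
      then show ?thesis by (simp add: power2_eq_square algebra_simps)
    qed
    then have "norm (indicator K p * g p) \<le> norm (indicator K p + g p ^ 2)" for p
      by (cases "p \<in> K") simp_all
    then show "AE p in lborel. norm (indicator K p * g p) \<le> norm (indicator K p + g p ^ 2)"
      by (rule AE_I2)
  qed
  moreover have "indicator K p * g p = indicator K p *\<^sub>R f p" for p
    using eq[of p] K by (cases "p \<in> K") auto
  ultimately show "integrable lborel (\<lambda>p. indicator K p *\<^sub>R f p)" by (simp only:)
qed

section \<open>The solution cut to the open strip\<close>

locale forced_solution =
  fixes a b :: real and F Ft v vt :: "real \<times> (real^3) \<Rightarrow> real" and Dv :: "real \<times> (real^3) \<Rightarrow> real^3"
  assumes ab: "a < b" and lin: "linear_wave_solution F"
    and Ft: "weak_partial ({a<..<b} \<times> UNIV) (1, 0) F Ft"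
    and sol: "forced_nlw_solution a b F v Dv vt"
begin

abbreviation cut :: "real \<times> (real^3) \<Rightarrow> real" where "cut \<equiv> indicator ({a<..<b} \<times> UNIV)"

definition V :: "real \<times> (real^3) \<Rightarrow> real" where "V p = cut p * v p"
definition FT :: "real \<times> (real^3) \<Rightarrow> real" where "FT p = cut p * Ft p"
definition FI :: "real \<times> (real^3) \<Rightarrow> real" where "FI p = cut p * F p"
text \<open>All first derivatives in one family indexed by the spacetime basis. The time direction
  needs a separate case, since its spatial component \<open>snd j\<close> is 0.\<close>

definition DV :: "real \<times> (real^3) \<Rightarrow> real \<times> (real^3) \<Rightarrow> real" where
  "DV j p = cut p * (if j = (1, 0) then vt p else Dv p \<bullet> snd j)"
definition GV :: "real \<times> (real^3) \<Rightarrow> real" where "GV p = cut p * (v p + F p) ^ 5"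
definition EV :: "real \<times> (real^3) \<Rightarrow> real" where
  "EV p = ((DV (1, 0) p)\<^sup>2 + (\<Sum>i\<in>Basis. (DV (0, i) p)\<^sup>2)) / 2 + \<bar>V p\<bar> ^ 6 / 6"

lemma cut_sets [measurable]: "{a<..<b} \<times> (UNIV :: (real^3) set) \<in> sets borel"
  by (intro borel_open open_Times) auto

lemma cut_in [simp]: "t \<in> {a<..<b} \<Longrightarrow> cut (t, x) = 1" and cut_out [simp]: "t \<notin> {a<..<b} \<Longrightarrow> cut (t, x) = 0"
  by (auto simp: indicator_def)

lemma cut_measurable:
  fixes f :: "real \<times> (real^3) \<Rightarrow> 'c::{second_countable_topology, real_normed_vector}"
  assumes "set_borel_measurable borel ({a..b} \<times> UNIV) f"
  shows "(\<lambda>p. cut p *\<^sub>R f p) \<in> borel_measurable borel"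
proof -
  have [measurable]: "(\<lambda>p. indicator ({a..b} \<times> UNIV) p *\<^sub>R f p) \<in> borel_measurable borel"
    using assms by (simp add: set_borel_measurable_def)
  have "(\<lambda>p. cut p *\<^sub>R (indicator ({a..b} \<times> UNIV) p *\<^sub>R f p)) \<in> borel_measurable borel" by measurable
  moreover have "cut p *\<^sub>R (indicator ({a..b} \<times> UNIV) p *\<^sub>R f p) = cut p *\<^sub>R f p" for p
    by (auto simp: indicator_def)
  ultimately show ?thesis by (simp only:)
qed

lemma F_meas [measurable]: "F \<in> borel_measurable borel"
  using lin by (simp add: linear_wave_solution_def)

lemma V_meas [measurable]: "V \<in> borel_measurable borel"
proof -
  have "(\<lambda>p. cut p *\<^sub>R v p) \<in> borel_measurable borel"
    using sol by (intro cut_measurable) (simp add: forced_nlw_solution_def)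
  moreover have "V = (\<lambda>p. cut p *\<^sub>R v p)" by (simp add: V_def fun_eq_iff)
  ultimately show ?thesis by (simp only:)
qed

lemma DV_meas [measurable]: "DV j \<in> borel_measurable borel"
proof (cases "j = (1, 0)")
  case True
  have "(\<lambda>p. cut p *\<^sub>R vt p) \<in> borel_measurable borel"
    using sol by (intro cut_measurable) (simp add: forced_nlw_solution_def)
  moreover have "DV j = (\<lambda>p. cut p *\<^sub>R vt p)" unfolding True by (rule ext) (simp add: DV_def)
  ultimately show ?thesis by (simp only:)
next
  case False
  have [measurable]: "(\<lambda>p. cut p *\<^sub>R Dv p) \<in> borel_measurable borel"
    using sol by (intro cut_measurable) (simp add: forced_nlw_solution_def)
  have "(\<lambda>p. (cut p *\<^sub>R Dv p) \<bullet> snd j) \<in> borel_measurable borel" by measurable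
  moreover have "DV j = (\<lambda>p. (cut p *\<^sub>R Dv p) \<bullet> snd j)" using False by (intro ext) (simp add: DV_def)
  ultimately show ?thesis by (simp only:)
qed

lemma FT_meas [measurable]: "FT \<in> borel_measurable borel"
proof -
  have "loc_integrable ({a<..<b} \<times> UNIV) Ft" using Ft by (simp add: weak_partial_def)
  then show ?thesis using loc_integrable_measurable unfolding FT_def[abs_def] by blast
qed

lemma FI_meas [measurable]: "FI \<in> borel_measurable borel"
  unfolding FI_def[abs_def] by measurable

lemma GV_eq: "GV p = (V p + FI p) ^ 5"
  by (cases "p \<in> {a<..<b} \<times> UNIV") (simp_all add: GV_def V_def FI_def)

lemma GV_meas [measurable]: "GV \<in> borel_measurable borel"
  unfolding GV_eq[abs_def] by measurable

lemma EV_meas [measurable]: "EV \<in> borel_measurable borel"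
  unfolding EV_def[abs_def] by measurable

lemma EV_ge: "(DV (1, 0) p)\<^sup>2 \<le> 2 * EV p" "i \<in> Basis \<Longrightarrow> (DV (0, i) p)\<^sup>2 \<le> 2 * EV p" "\<bar>V p\<bar> ^ 6 \<le> 6 * EV p"
proof -
  have S: "0 \<le> (\<Sum>i\<in>Basis. (DV (0, i) p)\<^sup>2)" by (intro sum_nonneg) simp
  have V6: "0 \<le> \<bar>V p\<bar> ^ 6" by simp
  have T: "0 \<le> (DV (1, 0) p)\<^sup>2" by simp
  have split: "x \<le> 2 * ((x + s) / 2 + y / 6)" "y \<le> 6 * ((x + s) / 2 + y / 6)"
    if "0 \<le> x" "0 \<le> s" "0 \<le> y" for x s y :: real
    using that by (auto simp: field_simps)
  show "(DV (1, 0) p)\<^sup>2 \<le> 2 * EV p" unfolding EV_def by (rule split(1)[OF T S V6])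
  show "\<bar>V p\<bar> ^ 6 \<le> 6 * EV p" unfolding EV_def by (rule split(2)[OF T S V6])
  assume "i \<in> Basis"
  then have "(DV (0, i) p)\<^sup>2 \<le> (\<Sum>i\<in>Basis. (DV (0, i) p)\<^sup>2)" by (intro member_le_sum) auto
  also have "\<dots> \<le> 2 * EV p" unfolding EV_def add.commute[of "(DV (1, 0) p)\<^sup>2"] by (rule split(1)[OF S T V6])
  finally show "(DV (0, i) p)\<^sup>2 \<le> 2 * EV p" .
qed

lemma EV_inside: "t \<in> {a<..<b} \<Longrightarrow> EV (t, x) = 1/2 * (norm (Dv (t, x)))\<^sup>2 + 1/2 * \<bar>vt (t, x)\<bar>\<^sup>2 + 1/6 * \<bar>v (t, x)\<bar> ^ 6"
proof -
  assume t: "t \<in> {a<..<b}"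
  have "(\<Sum>i\<in>Basis. (DV (0, i) (t, x))\<^sup>2) = (\<Sum>i\<in>Basis. (Dv (t, x) \<bullet> i) * (Dv (t, x) \<bullet> i))"
    using t by (intro sum.cong refl) (simp add: DV_def power2_eq_square)
  also have "\<dots> = (norm (Dv (t, x)))\<^sup>2" by (simp only: euclidean_inner[symmetric] power2_norm_eq_inner)
  finally show ?thesis using t by (simp add: EV_def V_def DV_def[of "(1, 0)"])
qed

lemma EV_outside: "t \<notin> {a<..<b} \<Longrightarrow> EV (t, x) = 0"
  by (simp add: EV_def V_def DV_def)

lemma EV_slice: "t \<in> {a<..<b} \<Longrightarrow> (\<integral>\<^sup>+x. ennreal (EV (t, x)) \<partial>lborel) = energy v Dv vt t"
  by (simp only: EV_inside energy_def)

lemma weight_measurable: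
  fixes w :: "real \<Rightarrow> real"
  assumes w: "w \<in> borel_measurable borel"
  shows "(\<lambda>p :: real \<times> (real^3). w (fst p - norm (snd p))) \<in> borel_measurable borel"
  by (rule measurable_compose[OF _ w]) (intro borel_measurable_continuous_onI continuous_intros)

lemma weighted_integral_eq:
  fixes w :: "real \<Rightarrow> real"
  assumes w: "w \<in> borel_measurable borel"
  shows "(\<integral>\<^sup>+t\<in>{a..b}. (\<integral>\<^sup>+x. ennreal (w (t - norm x) * \<bar>v (t, x)\<bar> ^ 6) \<partial>lborel) \<partial>lborel)
    = (\<integral>\<^sup>+p. ennreal (w (fst p - norm (snd p)) * V p ^ 6) \<partial>lborel)"
proof -
  note weight_measurable[OF w, measurable]
  have e: "indicator ({a<..<b} \<times> UNIV) p * ennreal (w (fst p - norm (snd p)) * \<bar>v p\<bar> ^ 6)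
      = ennreal (w (fst p - norm (snd p)) * V p ^ 6)" for p
    by (cases "p \<in> {a<..<b} \<times> UNIV") (simp_all add: V_def)
  have "(\<lambda>p. indicator ({a<..<b} \<times> UNIV) p * ennreal (w (fst p - norm (snd p)) * \<bar>v p\<bar> ^ 6)) \<in> borel_measurable borel"
    unfolding e by measurable
  from nn_integral_strip[OF this] show ?thesis unfolding e fst_conv snd_conv .
qed

text \<open>In the extended reals 0 times infinity is 0, so a weight of norm zero annihilates the
  energy term even if the energy is unbounded, and the left side has to vanish by itself. On each
  time line the shifted weight is zero almost everywhere.\<close>

lemma weighted_integral_null_weight:
  fixes w :: "real \<Rightarrow> real"
  assumes w [measurable]: "w \<in> borel_measurable borel" and 0: "(\<integral>\<^sup>+\<tau>. ennreal (w \<tau>) \<partial>lborel) = 0"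
  shows "(\<integral>\<^sup>+p. ennreal (w (fst p - norm (snd p)) * V p ^ 6) \<partial>lborel) = 0"
proof -
  note weight_measurable[OF w, measurable]
  have "(\<integral>\<^sup>+(p :: real \<times> (real^3)). ennreal (w (fst p - norm (snd p))) \<partial>lborel)
      = (\<integral>\<^sup>+(x :: real^3). (\<integral>\<^sup>+t. ennreal (w (fst (t, x) - norm (snd (t, x)))) \<partial>lborel) \<partial>lborel)"
    by (rule nn_integral_slices') measurable
  also have "\<dots> = (\<integral>\<^sup>+(x :: real^3). 0 \<partial>lborel)"
  proof (intro nn_integral_cong)
    fix x :: "real^3"
    have "(\<integral>\<^sup>+t. ennreal (w (- norm x + t)) \<partial>lborel) = 0"
      using nn_integral_translate[of "\<lambda>\<tau>. ennreal (w \<tau>)" "- norm x"] 0 by simp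
    then show "(\<integral>\<^sup>+t. ennreal (w (fst (t, x) - norm (snd (t, x)))) \<partial>lborel) = 0" by simp
  qed
  finally have "(\<integral>\<^sup>+(p :: real \<times> (real^3)). ennreal (w (fst p - norm (snd p))) \<partial>lborel) = 0" by simp
  then have "AE p in (lborel :: (real \<times> (real^3)) measure). ennreal (w (fst p - norm (snd p))) = 0"
    by (subst (asm) nn_integral_0_iff_AE) auto
  then have "(\<integral>\<^sup>+p. ennreal (w (fst p - norm (snd p)) * V p ^ 6) \<partial>lborel) = (\<integral>\<^sup>+(p :: real \<times> (real^3)). 0 \<partial>lborel)"
    by (intro nn_integral_cong_AE) (auto elim!: eventually_mono simp: ennreal_eq_0_iff mult_nonpos_nonneg)
  then show ?thesis by simp
qed

end

section \<open>Solutions of bounded energy\<close>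

locale bounded_energy_solution = forced_solution +
  fixes m :: real
  assumes m_nonneg: "0 \<le> m" and energy_m: "\<And>t. t \<in> {a..b} \<Longrightarrow> energy v Dv vt t \<le> ennreal m"
begin

lemma EV_le: "(\<integral>\<^sup>+x. ennreal (EV (t, x)) \<partial>lborel) \<le> ennreal m"
proof (cases "t \<in> {a<..<b}")
  case True
  then show ?thesis using energy_m[of t] by (simp only: EV_slice) auto
qed (simp add: EV_outside)

lemma slice_le:
  assumes le: "\<And>x. h x \<le> c * EV (t, x)" and c: "0 \<le> c" and e: "(\<integral>\<^sup>+x. ennreal (EV (t, x)) \<partial>lborel) \<le> ennreal e"
    and e0: "0 \<le> e"
  shows "(\<integral>\<^sup>+x. ennreal (h x) \<partial>lborel) \<le> ennreal (c * e)"
proof -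
  have [measurable]: "(\<lambda>x. EV (t, x)) \<in> borel_measurable borel" by (rule slice_measurable) measurable
  have "(\<integral>\<^sup>+x. ennreal (h x) \<partial>lborel) \<le> (\<integral>\<^sup>+x. ennreal c * ennreal (EV (t, x)) \<partial>lborel)"
    using le c by (intro nn_integral_mono) (metis ennreal_leI ennreal_mult')
  also have "\<dots> = ennreal c * (\<integral>\<^sup>+x. ennreal (EV (t, x)) \<partial>lborel)" by (intro nn_integral_cmult) measurable
  also have "\<dots> \<le> ennreal c * ennreal e" by (intro mult_left_mono e) simp
  also have "\<dots> = ennreal (c * e)" using c e0 by (simp add: ennreal_mult)
  finally show ?thesis .
qed

lemma Basis_cases:
  assumes "j \<in> (Basis :: (real \<times> (real^3)) set)"
  obtains "j = (1, 0)" | i where "i \<in> Basis" "j = (0, i)"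
  using assms by (auto simp: Basis_prod_def)

lemma DV_slice: "j \<in> Basis \<Longrightarrow> (\<integral>\<^sup>+x. ennreal (\<bar>DV j (t, x)\<bar> ^ 2) \<partial>lborel) \<le> ennreal (sqrt (2 * m) ^ 2)"
proof -
  assume j: "j \<in> Basis"
  have "\<bar>DV j p\<bar> ^ 2 \<le> 2 * EV p" for p
    using j by (rule Basis_cases) (simp_all add: EV_ge)
  from slice_le[OF this _ EV_le m_nonneg] show ?thesis using m_nonneg by simp
qed

lemma weak_DV:
  assumes "j \<in> Basis"
  shows "weak_partial ({a<..<b} \<times> UNIV) j V (DV j)"
  using assms
proof (rule Basis_cases)
  assume j: "j = (1, 0)"
  have "weak_partial ({a<..<b} \<times> UNIV) (1, 0) v vt" using sol by (simp add: forced_nlw_solution_def)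
  then show ?thesis unfolding j by (rule weak_partial_cong[rotated 2]) (auto simp: V_def DV_def)
next
  fix i :: "real^3" assume i: "i \<in> Basis" and j: "j = (0, i)"
  have "weak_partial ({a<..<b} \<times> UNIV) (0, i) v (\<lambda>p. Dv p \<bullet> i)"
  proof (rule weak_partial_of_slices[OF _ _ _ i])
    show "loc_integrable ({a<..<b} \<times> UNIV) v"
      using sol by (simp add: forced_nlw_solution_def weak_partial_def)
    have B: "(0, i) \<in> (Basis :: (real \<times> (real^3)) set)" using i by (simp add: Basis_prod_def)
    show "loc_integrable ({a<..<b} \<times> UNIV) (\<lambda>p. Dv p \<bullet> i)"
      by (rule loc_integrable_square_slices[OF DV_meas DV_slice[OF B]]) (auto simp: DV_def)
    show "weak_partial UNIV i (\<lambda>x. v (t, x)) (\<lambda>x. Dv (t, x) \<bullet> i)" if "t \<in> {a<..<b}" for t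
      using sol that i by (simp add: forced_nlw_solution_def cont_in_Hdot1_def Hdot1_with_gradient_def)
  qed
  then show ?thesis unfolding j by (rule weak_partial_cong[rotated 2]) (auto simp: V_def DV_def)
qed

lemma weak_eq_V:
  assumes \<phi>: "\<phi> \<in> test_functions ({a<..<b} \<times> UNIV)"
  shows "(LINT p:{a<..<b} \<times> UNIV|lborel. V p * wave_op \<phi> p) = (LINT p:{a<..<b} \<times> UNIV|lborel. GV p * \<phi> p)"
proof -
  have e: "(LINT p:{a<..<b} \<times> UNIV|lborel. (cut p * f p) * k p) = (LINT p:{a<..<b} \<times> UNIV|lborel. f p * k p)"
    for f k :: "real \<times> (real^3) \<Rightarrow> real"
    unfolding set_lebesgue_integral_def
    by (intro Bochner_Integration.integral_cong refl) (simp add: indicator_def)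
  show ?thesis
    unfolding V_def GV_def e using sol \<phi> unfolding forced_nlw_solution_def wave_eq_on_def by blast
qed

text \<open>A single integrable \<open>\<gamma>\<close> serves all quintic expressions in
  \<open>V\<close> and \<open>FI\<close> at once: the forcing and each term of its expansion. The
  quantification over \<open>H\<close> is internal so that \<open>\<gamma>\<close> can be fixed
  before \<open>H\<close>.\<close>

lemma time_envelope:
  obtains \<gamma> where "\<gamma> \<in> borel_measurable borel" "\<And>t. 0 \<le> \<gamma> t" "(\<integral>\<^sup>+t. ennreal (\<gamma> t) \<partial>lborel) < \<infinity>"
    "\<forall>H. (\<forall>p. \<bar>H p\<bar> \<le> (\<bar>V p\<bar> + \<bar>FI p\<bar>) ^ 5) \<longrightarrow>
      (AE t in lborel. (\<integral>\<^sup>+x. ennreal (\<bar>H (t, x)\<bar> ^ 2) \<partial>lborel) \<le> ennreal (\<gamma> t ^ 2))"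
proof -
  obtain \<alpha> where \<alpha> [measurable]: "\<alpha> \<in> borel_measurable borel" and \<alpha>0: "\<And>t. 0 \<le> \<alpha> t"
    and \<alpha>i: "(\<integral>\<^sup>+t. ennreal (\<alpha> t) \<partial>lborel) < \<infinity>"
    and \<alpha>s: "AE t in lborel. (\<integral>\<^sup>+x. ennreal (\<bar>V (t, x)\<bar> ^ 10) \<partial>lborel) \<le> ennreal (\<alpha> t ^ 2)"
  proof (rule mixed_norm_slices[OF V_meas])
    show "LtLx_norm 5 10 {a..b} v < \<infinity>" using sol by (simp add: forced_nlw_solution_def)
  qed (auto simp: V_def indicator_def)
  obtain \<beta> where \<beta> [measurable]: "\<beta> \<in> borel_measurable borel" and \<beta>0: "\<And>t. 0 \<le> \<beta> t"
    and \<beta>i: "(\<integral>\<^sup>+t. ennreal (\<beta> t) \<partial>lborel) < \<infinity>"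
    and \<beta>s: "AE t in lborel. (\<integral>\<^sup>+x. ennreal (\<bar>FI (t, x)\<bar> ^ 10) \<partial>lborel) \<le> ennreal (\<beta> t ^ 2)"
  proof (rule mixed_norm_slices[OF FI_meas])
    show "LtLx_norm 5 10 UNIV F < \<infinity>" using lin by (simp add: linear_wave_solution_def)
  qed (auto simp: FI_def indicator_def)
  show thesis
  proof
    show "(\<lambda>t. 32 * (\<alpha> t + \<beta> t)) \<in> borel_measurable borel" by measurable
    show "0 \<le> 32 * (\<alpha> t + \<beta> t)" for t using \<alpha>0[of t] \<beta>0[of t] by simp
    have "(\<integral>\<^sup>+t. ennreal (32 * (\<alpha> t + \<beta> t)) \<partial>lborel) = (\<integral>\<^sup>+t. ennreal 32 * (ennreal (\<alpha> t) + ennreal (\<beta> t)) \<partial>lborel)"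
      using \<alpha>0 \<beta>0 by (intro nn_integral_cong) (simp add: ennreal_mult')
    also have "\<dots> = ennreal 32 * ((\<integral>\<^sup>+t. ennreal (\<alpha> t) \<partial>lborel) + (\<integral>\<^sup>+t. ennreal (\<beta> t) \<partial>lborel))"
      by (subst nn_integral_cmult) (simp_all add: nn_integral_add)
    also have "\<dots> < \<infinity>" using \<alpha>i \<beta>i by (simp add: ennreal_mult_less_top)
    finally show "(\<integral>\<^sup>+t. ennreal (32 * (\<alpha> t + \<beta> t)) \<partial>lborel) < \<infinity>" .
  qed (intro allI impI quintic_slices[OF V_meas FI_meas \<alpha>s \<alpha>0 \<beta>s \<beta>0], blast)
qed

text \<open>A quintic expression is integrable in time with values in L^2, while the energy bounds
  the time derivative in L^2 uniformly in time.\<close>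

lemma quintic_integrable:
  assumes [measurable]: "H \<in> borel_measurable borel" and H: "\<And>p. \<bar>H p\<bar> \<le> (\<bar>V p\<bar> + \<bar>FI p\<bar>) ^ 5"
  shows "integrable lborel (\<lambda>p. H p * DV (1, 0) p)"
proof -
  obtain \<gamma> where \<gamma>: "\<gamma> \<in> borel_measurable borel" "\<And>t. 0 \<le> \<gamma> t" "(\<integral>\<^sup>+t. ennreal (\<gamma> t) \<partial>lborel) < \<infinity>"
    and env: "\<forall>H. (\<forall>p. \<bar>H p\<bar> \<le> (\<bar>V p\<bar> + \<bar>FI p\<bar>) ^ 5) \<longrightarrow>
      (AE t in lborel. (\<integral>\<^sup>+x. ennreal (\<bar>H (t, x)\<bar> ^ 2) \<partial>lborel) \<le> ennreal (\<gamma> t ^ 2))"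
    by (rule time_envelope) (rule that)
  have Hs: "AE t in lborel. (\<integral>\<^sup>+x. ennreal (\<bar>H (t, x)\<bar> ^ 2) \<partial>lborel) \<le> ennreal (\<gamma> t ^ 2)"
    using env H by blast
  have B: "(1, 0) \<in> (Basis :: (real \<times> (real^3)) set)" by (simp add: Basis_prod_def)
  have "(\<integral>\<^sup>+p. ennreal \<bar>H p * DV (1, 0) p\<bar> \<partial>lborel) \<le> ennreal (sqrt (2 * m)) * (\<integral>\<^sup>+t. ennreal (\<gamma> t) \<partial>lborel)"
    using m_nonneg by (intro L1L2_pair_bound[OF assms(1) DV_meas \<gamma>(1,2) Hs DV_slice[OF B]]) simp
  also have "\<dots> < \<infinity>" using \<gamma>(3) by (simp add: ennreal_mult_less_top)
  finally show ?thesis by (intro integrableI_bounded) simp_all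
qed

text \<open>Specialises the weighted estimate to the solution cut to the strip. The integrands with
  \<open>V ^ 5\<close>, with \<open>FI * V ^ 4\<close> and with the cubic remainder factor are all
  quintic in \<open>V\<close> and \<open>FI\<close>, hence integrable against the time derivative.
  Wherever a factor \<open>V\<close> or \<open>DV\<close> occurs, the cut-off of \<open>F\<close>
  comes for free, so \<open>F\<close> and \<open>FI\<close> may be exchanged.\<close>

lemma weighted_bound:
  assumes w: "integrable lborel w" "\<And>\<tau>. 0 \<le> w \<tau>"
    and iW: "integrable lborel (\<lambda>p. cut p * (primitive w (fst p - norm (snd p)) * Ft p * v p ^ 5))"
    and iw: "integrable lborel (\<lambda>p. cut p * (w (fst p - norm (snd p)) * F p * v p ^ 5))"
    and cross: "AE t in lborel. (\<integral>\<^sup>+x. ennreal \<bar>F (t, x) * V (t, x) ^ 5\<bar> \<partial>lborel) \<le> ennreal \<kappa>" and \<kappa>: "0 \<le> \<kappa>"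
  shows "(\<integral>\<^sup>+p. ennreal (w (fst p - norm (snd p)) * V p ^ 6) \<partial>lborel)
    \<le> ennreal (6 * (2 * ((LINT r|lborel. w r) * m) + 2 * ((LINT r|lborel. w r) * \<kappa>)
          + 10 * (LINT r|lborel. w r) * (LINT p|lborel. cut p * (\<bar>F p\<bar>\<^sup>2 * (\<bar>F p\<bar> + \<bar>v p\<bar>) ^ 3 * \<bar>vt p\<bar>))
          + \<bar>LINT p|lborel. cut p * (w (fst p - norm (snd p)) * F p * v p ^ 5)\<bar>
          + \<bar>LINT p|lborel. cut p * (primitive w (fst p - norm (snd p)) * Ft p * v p ^ 5)\<bar>))"
    "integrable lborel (\<lambda>p. cut p * (\<bar>F p\<bar>\<^sup>2 * (\<bar>F p\<bar> + \<bar>v p\<bar>) ^ 3 * \<bar>vt p\<bar>))"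
proof -
  obtain \<gamma> where \<gamma>: "\<gamma> \<in> borel_measurable borel" "\<And>t. 0 \<le> \<gamma> t" "(\<integral>\<^sup>+t. ennreal (\<gamma> t) \<partial>lborel) < \<infinity>"
    and Hs: "\<forall>H. (\<forall>p. \<bar>H p\<bar> \<le> (\<bar>V p\<bar> + \<bar>FI p\<bar>) ^ 5) \<longrightarrow>
      (AE t in lborel. (\<integral>\<^sup>+x. ennreal (\<bar>H (t, x)\<bar> ^ 2) \<partial>lborel) \<le> ennreal (\<gamma> t ^ 2))"
    by (rule time_envelope) (rule that)
  have GV_bound: "\<bar>GV p\<bar> \<le> (\<bar>V p\<bar> + \<bar>FI p\<bar>) ^ 5" for p
    unfolding GV_eq power_abs by (intro power_mono abs_triangle_ineq) simp
  have Q_eq: "\<bar>F p\<bar>\<^sup>2 * (\<bar>F p\<bar> + \<bar>V p\<bar>) ^ 3 * \<bar>DV (1, 0) p\<bar> = cut p * (\<bar>F p\<bar>\<^sup>2 * (\<bar>F p\<bar> + \<bar>v p\<bar>) ^ 3 * \<bar>vt p\<bar>)" for p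
    by (cases "p \<in> {a<..<b} \<times> UNIV") (simp_all add: V_def DV_def)
  have iw_eq: "w (fst p - norm (snd p)) * F p * V p ^ 5 = cut p * (w (fst p - norm (snd p)) * F p * v p ^ 5)" for p
    by (cases "p \<in> {a<..<b} \<times> UNIV") (simp_all add: V_def)
  have iW_eq: "primitive w (fst p - norm (snd p)) * FT p * V p ^ 5
      = cut p * (primitive w (fst p - norm (snd p)) * Ft p * v p ^ 5)" for p
    by (cases "p \<in> {a<..<b} \<times> UNIV") (simp_all add: V_def FT_def)
  have i5: "integrable lborel (\<lambda>p. V p ^ 5 * DV (1, 0) p)"
    by (rule quintic_integrable) (auto simp: power_abs intro!: power_mono)
  have "integrable lborel (\<lambda>p. (FI p * V p ^ 4) * DV (1, 0) p)"
  proof (rule quintic_integrable)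
    fix p
    have "\<bar>FI p * V p ^ 4\<bar> = \<bar>FI p\<bar> * \<bar>V p\<bar> ^ 4" by (simp add: abs_mult power_abs)
    also have "\<dots> \<le> (\<bar>V p\<bar> + \<bar>FI p\<bar>) ^ 1 * (\<bar>V p\<bar> + \<bar>FI p\<bar>) ^ 4"
      by (intro mult_mono power_mono) auto
    also have "\<dots> = (\<bar>V p\<bar> + \<bar>FI p\<bar>) ^ 5" by (subst power_add[symmetric]) simp
    finally show "\<bar>FI p * V p ^ 4\<bar> \<le> (\<bar>V p\<bar> + \<bar>FI p\<bar>) ^ 5" .
  qed measurable
  moreover have "(FI p * V p ^ 4) * DV (1, 0) p = F p * V p ^ 4 * DV (1, 0) p" for p
    by (cases "p \<in> {a<..<b} \<times> UNIV") (simp_all add: V_def FI_def)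
  ultimately have i4: "integrable lborel (\<lambda>p. F p * V p ^ 4 * DV (1, 0) p)" by (simp only:)
  have "integrable lborel (\<lambda>p. (\<bar>FI p\<bar>\<^sup>2 * (\<bar>FI p\<bar> + \<bar>V p\<bar>) ^ 3) * DV (1, 0) p)"
  proof (rule quintic_integrable)
    fix p
    have "\<bar>\<bar>FI p\<bar>\<^sup>2 * (\<bar>FI p\<bar> + \<bar>V p\<bar>) ^ 3\<bar> = \<bar>FI p\<bar>\<^sup>2 * (\<bar>FI p\<bar> + \<bar>V p\<bar>) ^ 3" by simp
    also have "\<dots> \<le> (\<bar>V p\<bar> + \<bar>FI p\<bar>) ^ 2 * (\<bar>V p\<bar> + \<bar>FI p\<bar>) ^ 3"
      by (intro mult_mono power_mono) auto
    also have "\<dots> = (\<bar>V p\<bar> + \<bar>FI p\<bar>) ^ 5" by (subst power_add[symmetric]) simp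
    finally show "\<bar>\<bar>FI p\<bar>\<^sup>2 * (\<bar>FI p\<bar> + \<bar>V p\<bar>) ^ 3\<bar> \<le> (\<bar>V p\<bar> + \<bar>FI p\<bar>) ^ 5" .
  qed measurable
  then have "integrable lborel (\<lambda>p. \<bar>(\<bar>FI p\<bar>\<^sup>2 * (\<bar>FI p\<bar> + \<bar>V p\<bar>) ^ 3) * DV (1, 0) p\<bar>)"
    by (rule integrable_abs)
  moreover have "\<bar>(\<bar>FI p\<bar>\<^sup>2 * (\<bar>FI p\<bar> + \<bar>V p\<bar>) ^ 3) * DV (1, 0) p\<bar>
      = cut p * (\<bar>F p\<bar>\<^sup>2 * (\<bar>F p\<bar> + \<bar>v p\<bar>) ^ 3 * \<bar>vt p\<bar>)" for p
    by (cases "p \<in> {a<..<b} \<times> UNIV") (simp_all add: V_def FI_def DV_def abs_mult)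
  ultimately show iQ: "integrable lborel (\<lambda>p. cut p * (\<bar>F p\<bar>\<^sup>2 * (\<bar>F p\<bar> + \<bar>v p\<bar>) ^ 3 * \<bar>vt p\<bar>))"
    by (simp only:)
  interpret few: finite_energy_wave a b V GV DV "sqrt (2 * m)" \<gamma>
  proof
    show "0 \<le> sqrt (2 * m)" using m_nonneg by simp
    show "AE t in lborel. (\<integral>\<^sup>+x. ennreal (\<bar>GV (t, x)\<bar> ^ 2) \<partial>lborel) \<le> ennreal (\<gamma> t ^ 2)"
      using Hs GV_bound by blast
  qed (fact weak_DV weak_eq_V DV_meas GV_meas DV_slice \<gamma>)+
  interpret fw: forced_wave a b V GV DV "sqrt (2 * m)" \<gamma> F FT w m \<kappa>
  proof
    show "weak_partial ({a<..<b} \<times> UNIV) (1, 0) F FT"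
      using Ft by (rule weak_partial_cong[rotated 2]) (auto simp: FT_def)
    show "GV p = (V p + F p) ^ 5" if "fst p \<in> {a<..<b}" for p
    proof -
      have "p \<in> {a<..<b} \<times> UNIV" using that by (simp add: mem_Times_iff)
      then show ?thesis by (simp add: GV_def V_def)
    qed
    show "V p = 0" if "fst p \<notin> {a<..<b}" for p
    proof -
      have "p \<notin> {a<..<b} \<times> UNIV" using that by (simp add: mem_Times_iff)
      then show ?thesis by (simp add: V_def)
    qed
    show "(\<integral>\<^sup>+x. ennreal (few.kin (t, x) + \<bar>V (t, x)\<bar> ^ 6 / 6) \<partial>lborel) \<le> ennreal m" for t
      using EV_le[of t] unfolding few.kin_def EV_def .
    show "integrable lborel (\<lambda>p. \<bar>F p\<bar>\<^sup>2 * (\<bar>F p\<bar> + \<bar>V p\<bar>) ^ 3 * \<bar>DV (1, 0) p\<bar>)" unfolding Q_eq by (rule iQ)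
    show "integrable lborel (\<lambda>p. w (fst p - norm (snd p)) * F p * V p ^ 5)" unfolding iw_eq by (rule iw)
    show "integrable lborel (\<lambda>p. primitive w (fst p - norm (snd p)) * FT p * V p ^ 5)" unfolding iW_eq by (rule iW)
  qed (fact ab V_meas F_meas FT_meas w m_nonneg cross \<kappa> i5 i4)+
  show "(\<integral>\<^sup>+p. ennreal (w (fst p - norm (snd p)) * V p ^ 6) \<partial>lborel)
    \<le> ennreal (6 * (2 * ((LINT r|lborel. w r) * m) + 2 * ((LINT r|lborel. w r) * \<kappa>)
          + 10 * (LINT r|lborel. w r) * (LINT p|lborel. cut p * (\<bar>F p\<bar>\<^sup>2 * (\<bar>F p\<bar> + \<bar>v p\<bar>) ^ 3 * \<bar>vt p\<bar>))
          + \<bar>LINT p|lborel. cut p * (w (fst p - norm (snd p)) * F p * v p ^ 5)\<bar>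
          + \<bar>LINT p|lborel. cut p * (primitive w (fst p - norm (snd p)) * Ft p * v p ^ 5)\<bar>))"
    using fw.weighted_estimate unfolding fw.wc_def fw.W_def fw.w1_def Q_eq iw_eq iW_eq .
qed

text \<open>The other degenerate case: zero energy forces \<open>V\<close> to vanish almost
  everywhere, which is used when the supremum of the powers of the energy is 0 and could multiply an
  infinite norm of \<open>F\<close>.\<close>

lemma weighted_integral_null_energy:
  fixes w :: "real \<Rightarrow> real"
  assumes w: "w \<in> borel_measurable borel" and m: "m = 0"
  shows "(\<integral>\<^sup>+p. ennreal (w (fst p - norm (snd p)) * V p ^ 6) \<partial>lborel) = 0"
proof -
  note weight_measurable[OF w, measurable]
  have "(\<integral>\<^sup>+p. ennreal (\<bar>V p\<bar> ^ 6) \<partial>lborel) = (\<integral>\<^sup>+t. (\<integral>\<^sup>+x. ennreal (\<bar>V (t, x)\<bar> ^ 6) \<partial>lborel) \<partial>lborel)"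
    by (rule nn_integral_slices) measurable
  also have "\<dots> = (\<integral>\<^sup>+(t::real). 0 \<partial>lborel)"
  proof (intro nn_integral_cong)
    fix t
    show "(\<integral>\<^sup>+x. ennreal (\<bar>V (t, x)\<bar> ^ 6) \<partial>lborel) = 0"
      using slice_le[OF EV_ge(3) _ EV_le m_nonneg, of t] m by simp
  qed
  finally have "(\<integral>\<^sup>+p. ennreal (\<bar>V p\<bar> ^ 6) \<partial>lborel) = 0" by simp
  then have "AE p in lborel. ennreal (\<bar>V p\<bar> ^ 6) = 0"
    by (subst (asm) nn_integral_0_iff_AE) auto
  then have "AE p in lborel. V p = 0" by eventually_elim simp
  then have "(\<integral>\<^sup>+p. ennreal (w (fst p - norm (snd p)) * V p ^ 6) \<partial>lborel) = (\<integral>\<^sup>+(p :: real \<times> (real^3)). 0 \<partial>lborel)"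
    by (intro nn_integral_cong_AE) (auto elim!: eventually_mono)
  then show ?thesis by simp
qed

text \<open>Hoelder with the exponents 6 and 6/5 on a time slice. The norm of \<open>F\<close> is an
  essential supremum, so the bound holds at almost every time.\<close>

lemma cross_bound:
  assumes L: "LtinfLx_norm 6 {a..b} F = ennreal L" "0 \<le> L"
    and s: "\<And>t. t \<in> {a..b} \<Longrightarrow> epowr (energy v Dv vt t) (5/6) \<le> ennreal s" "0 \<le> s"
  shows "AE t in lborel. (\<integral>\<^sup>+x. ennreal \<bar>F (t, x) * V (t, x) ^ 5\<bar> \<partial>lborel) \<le> ennreal (6 * (L * s))"
proof -
  have "AE t in restrict_space lborel {a..b}. Lp_norm 6 (\<lambda>x. F (t, x)) \<le> ennreal L"
    using esssup_AE[where M = "restrict_space lborel {a..b}" and f = "\<lambda>t. Lp_norm 6 (\<lambda>x. F (t, x))"] L(1)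
    unfolding LtinfLx_norm_def by simp
  then have "AE t in lborel. t \<in> {a..b} \<longrightarrow> Lp_norm 6 (\<lambda>x. F (t, x)) \<le> ennreal L"
    by (subst (asm) AE_restrict_space_iff) auto
  then show ?thesis
  proof eventually_elim
    case (elim t)
    show ?case
    proof (cases "t \<in> {a<..<b}")
      case False
      then show ?thesis by (simp add: V_def)
    next
      case True
      then have t: "t \<in> {a..b}" by simp
      have "(\<integral>\<^sup>+x. ennreal (\<bar>F (t, x)\<bar> ^ 6) \<partial>lborel) = epowr (Lp_norm 6 (\<lambda>x. F (t, x))) 6"
        by (simp add: Lp_norm_def epowr_epowr powr_numeral_abs)
      also have "\<dots> \<le> epowr (ennreal L) 6" using elim t by (intro epowr_mono) auto
      also have "\<dots> = ennreal (L ^ 6)" using L(2) powr_numeral_abs[of L] by (simp add: epowr_def)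
      finally have F6: "(\<integral>\<^sup>+x. ennreal (\<bar>F (t, x)\<bar> ^ 6) \<partial>lborel) \<le> ennreal (L ^ 6)" .
      define e where "e = enn2real (energy v Dv vt t)"
      have fin: "energy v Dv vt t < top" using energy_m[OF t] ennreal_less_top le_less_trans by blast
      then have e: "energy v Dv vt t = ennreal e" by (simp add: e_def)
      have e0: "0 \<le> e" by (simp add: e_def)
      have "ennreal (e powr (5/6)) \<le> ennreal s" using s(1)[OF t] e0 by (simp add: e epowr_def)
      then have es: "e powr (5/6) \<le> s" using s(2) by simp
      \<comment> \<open>A bound for the L^6 norm of the slice of \<open>V\<close>, since the sixth
        power of \<open>V\<close> is at most 6 times the energy density. Its fifth power is 6 powr
        (5/6) times the power 5/6 of the energy, and the numerical factor is rounded up to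
        6.\<close>
      define B where "B = (6 * e) powr (1/6)"
      have B0: "0 \<le> B" by (simp add: B_def)
      have Bn: "B ^ numeral n = (6 * e) powr (numeral n / 6)" for n
      proof -
        have "B ^ numeral n = B powr numeral n" using powr_numeral_abs[of B n] B0 by simp
        then show ?thesis by (simp add: B_def powr_powr)
      qed
      have B6: "B ^ 6 = 6 * e" unfolding Bn using e0 by simp
      have "B ^ 5 = (6 * e) powr (5/6)" by (rule Bn)
      also have "\<dots> = 6 powr (5/6) * e powr (5/6)" using e0 by (simp add: powr_mult)
      also have "\<dots> \<le> 6 * s"
        using powr_mono[of "5/6" 1 "6::real"] es s(2) by (intro mult_mono) auto
      finally have B5: "B ^ 5 \<le> 6 * s" .
      have "(\<integral>\<^sup>+x. ennreal (EV (t, x)) \<partial>lborel) \<le> ennreal e" using EV_slice[OF True] e by simp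
      then have V6: "(\<integral>\<^sup>+x. ennreal (\<bar>V (t, x)\<bar> ^ 6) \<partial>lborel) \<le> ennreal (B ^ 6)"
        unfolding B6 by (intro slice_le[OF EV_ge(3) _ _ e0]) auto
      have "(\<integral>\<^sup>+x. ennreal \<bar>F (t, x) * V (t, x) ^ 5\<bar> \<partial>lborel) \<le> ennreal (L * B ^ 5)"
        using F6 V6 L(2) B0
        by (intro holder_6) (simp_all add: slice_measurable[OF F_meas] slice_measurable[OF V_meas])
      also have "\<dots> \<le> ennreal (6 * (L * s))"
        using mult_left_mono[OF B5 L(2)] by (intro ennreal_leI) simp
      finally show ?thesis .
    qed
  qed
qed

end

section \<open>Degenerate cases and the absolute constant\<close>

lemma epowr_eq_0: "epowr x r = 0 \<longleftrightarrow> x = 0"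
  by (auto simp: epowr_def enn2real_eq_0_iff)

theorem proposition6p6:
  shows "\<exists>C::real. C > 0 \<and>
    (\<forall>(a::real) (b::real) (F :: real \<times> (real^3) \<Rightarrow> real) (Ft :: real \<times> (real^3) \<Rightarrow> real)
      (v :: real \<times> (real^3) \<Rightarrow> real) (Dv :: real \<times> (real^3) \<Rightarrow> real^3) (vt :: real \<times> (real^3) \<Rightarrow> real)
      (w :: real \<Rightarrow> real).
      0 \<le> a \<longrightarrow> a \<le> b \<longrightarrow>
      linear_wave_solution F \<longrightarrow>
      weak_partial ({a<..<b} \<times> UNIV) (1, 0) F Ft \<longrightarrow>
      forced_nlw_solution a b F v Dv vt \<longrightarrow>
      in_Lp 1 w \<longrightarrow> (\<forall>\<tau>. 0 \<le> w \<tau>) \<longrightarrow>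
      set_integrable lborel ({a..b} \<times> UNIV)
        (\<lambda>(t, x). (LINT \<tau>:{..t - norm x}|lborel. w \<tau>) * Ft (t, x) * v (t, x) ^ 5) \<longrightarrow>
      set_integrable lborel ({a..b} \<times> UNIV)
        (\<lambda>(t, x). w (t - norm x) * F (t, x) * v (t, x) ^ 5) \<longrightarrow>
      (\<integral>\<^sup>+t\<in>{a..b}. (\<integral>\<^sup>+x. ennreal (w (t - norm x) * \<bar>v (t, x)\<bar> ^ 6) \<partial>lborel) \<partial>lborel)
      \<le> ennreal C *
        (Lp_norm 1 w * (SUP t\<in>{a..b}. energy v Dv vt t)
         + Lp_norm 1 w * LtinfLx_norm 6 {a..b} F * (SUP t\<in>{a..b}. epowr (energy v Dv vt t) (5/6))
         + ennreal \<bar>LINT t:{a..b}|lborel. LINT x|lborel.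
              (LINT \<tau>:{..t - norm x}|lborel. w \<tau>) * Ft (t, x) * v (t, x) ^ 5\<bar>
         + ennreal \<bar>LINT t:{a..b}|lborel. LINT x|lborel.
              w (t - norm x) * F (t, x) * v (t, x) ^ 5\<bar>
         + Lp_norm 1 w *
           (\<integral>\<^sup>+t\<in>{a..b}. (\<integral>\<^sup>+x. ennreal (\<bar>F (t, x)\<bar>\<^sup>2 * (\<bar>F (t, x)\<bar> + \<bar>v (t, x)\<bar>) ^ 3
              * \<bar>vt (t, x)\<bar>) \<partial>lborel) \<partial>lborel)))"
proof (intro exI[of _ 100] conjI allI impI)
  show "(0::real) < 100" by simp
next
  fix a b :: real and F Ft v vt :: "real \<times> (real^3) \<Rightarrow> real" and Dv :: "real \<times> (real^3) \<Rightarrow> real^3"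
    and w :: "real \<Rightarrow> real"
  assume lin: "linear_wave_solution F"
    and Ft: "weak_partial ({a<..<b} \<times> UNIV) (1, 0) F Ft"
    and sol: "forced_nlw_solution a b F v Dv vt"
    and w: "in_Lp 1 w" and w0: "\<forall>\<tau>. 0 \<le> w \<tau>"
    and iW: "set_integrable lborel ({a..b} \<times> UNIV)
        (\<lambda>(t, x). (LINT \<tau>:{..t - norm x}|lborel. w \<tau>) * Ft (t, x) * v (t, x) ^ 5)"
    and iw: "set_integrable lborel ({a..b} \<times> UNIV) (\<lambda>(t, x). w (t - norm x) * F (t, x) * v (t, x) ^ 5)"
  let ?lhs = "\<integral>\<^sup>+t\<in>{a..b}. (\<integral>\<^sup>+x. ennreal (w (t - norm x) * \<bar>v (t, x)\<bar> ^ 6) \<partial>lborel) \<partial>lborel"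
  let ?E = "SUP t\<in>{a..b}. energy v Dv vt t"
  let ?S = "SUP t\<in>{a..b}. epowr (energy v Dv vt t) (5/6)"
  let ?F = "LtinfLx_norm 6 {a..b} F"
  let ?Y = "LINT t:{a..b}|lborel. LINT x|lborel. (LINT \<tau>:{..t - norm x}|lborel. w \<tau>) * Ft (t, x) * v (t, x) ^ 5"
  let ?X = "LINT t:{a..b}|lborel. LINT x|lborel. w (t - norm x) * F (t, x) * v (t, x) ^ 5"
  let ?Q = "\<integral>\<^sup>+t\<in>{a..b}. (\<integral>\<^sup>+x. ennreal (\<bar>F (t, x)\<bar>\<^sup>2 * (\<bar>F (t, x)\<bar> + \<bar>v (t, x)\<bar>) ^ 3 * \<bar>vt (t, x)\<bar>) \<partial>lborel) \<partial>lborel"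
  have w_meas: "w \<in> borel_measurable borel" and w_fin: "Lp_norm 1 w < \<infinity>" using w by (auto simp: in_Lp_def)
  have w_norm: "Lp_norm 1 w = (\<integral>\<^sup>+\<tau>. ennreal (w \<tau>) \<partial>lborel)" using w0 by (simp add: Lp_norm_1)
  show "?lhs \<le> ennreal 100 * (Lp_norm 1 w * ?E + Lp_norm 1 w * ?F * ?S + ennreal \<bar>?Y\<bar> + ennreal \<bar>?X\<bar> + Lp_norm 1 w * ?Q)"
    (is "_ \<le> ?rhs")
  proof (cases "a < b")
    \<comment> \<open>The time interval has at most one point, so the left side is 0.\<close>
    case False
    have "AE t in lborel. t \<noteq> a" by (rule AE_lborel_singleton)
    then have "?lhs = (\<integral>\<^sup>+(t::real). 0 \<partial>lborel)"
      using False by (intro nn_integral_cong_AE) (auto elim!: eventually_mono simp: indicator_def)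
    then show ?thesis by simp
  next
    case True
    interpret forced_solution a b F Ft v vt Dv by unfold_locales (fact True lin Ft sol)+
    note lhs = weighted_integral_eq[OF w_meas]
    have top: "x \<le> ennreal 100 * (a1 + a2 + a3 + a4 + a5)" if "a1 = \<infinity> \<or> a2 = \<infinity>" for x a1 a2 a3 a4 a5 :: ennreal
    proof -
      have "ennreal 100 * (a1 + a2 + a3 + a4 + a5) = \<infinity>"
        using that by (auto simp: ennreal_mult_eq_top_iff)
      then show ?thesis by (simp only: infinity_ennreal_def top_greatest)
    qed
    have fin: "x = ennreal (enn2real x)" if "x \<noteq> \<infinity>" for x using that by (simp add: less_top)
    \<comment> \<open>Because 0 times infinity is 0, an infinite factor does not by itself make the
      right side infinite. In cases 2 and 4 the infinite factor meets nonzero ones and the claim is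
      trivial; in cases 1 and 3 the left side vanishes; in case 5 all factors are finite and the
      real estimate applies.\<close>
    consider "Lp_norm 1 w = 0" | "Lp_norm 1 w \<noteq> 0" "?E = \<infinity>" | "?E \<noteq> \<infinity>" "?S = 0"
      | "Lp_norm 1 w \<noteq> 0" "?S \<noteq> 0" "?F = \<infinity>" | "?E \<noteq> \<infinity>" "?F \<noteq> \<infinity>" by blast
    then show ?thesis
    proof cases
      case 1
      then show ?thesis using weighted_integral_null_weight[OF w_meas] unfolding lhs w_norm by simp
    next
      case 2
      have "Lp_norm 1 w * ?E = \<infinity>" unfolding 2(2) using 2(1) by (simp add: ennreal_mult_eq_top_iff)
      then show ?thesis by (intro top disjI1)
    next
      case 3
      have "energy v Dv vt t = 0" if "t \<in> {a..b}" for t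
      proof -
        have "epowr (energy v Dv vt t) (5/6) \<le> ?S" using that by (intro SUP_upper)
        then have "epowr (energy v Dv vt t) (5/6) \<le> 0" unfolding 3(2) .
        then show ?thesis by (simp add: epowr_eq_0)
      qed
      then interpret bounded_energy_solution a b F Ft v vt Dv 0 by unfold_locales simp_all
      show ?thesis unfolding lhs weighted_integral_null_energy[OF w_meas refl] by simp
    next
      case 4
      have "x * \<infinity> * y = \<infinity>" if "x \<noteq> 0" "y \<noteq> 0" for x y :: ennreal
        using that by (simp add: ennreal_mult_eq_top_iff)
      from this[OF 4(1,2)] have "Lp_norm 1 w * ?F * ?S = \<infinity>" unfolding 4(3) .
      then show ?thesis by (intro top disjI2)
    next
      case 5
      define m where "m = enn2real ?E"
      define L where "L = enn2real ?F"
      define s where "s = enn2real ?S"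
      have E: "?E = ennreal m" unfolding m_def by (rule fin[OF 5(1)])
      have L: "?F = ennreal L" unfolding L_def by (rule fin[OF 5(2)])
      \<comment> \<open>Finiteness of the supremum of the powers follows from that of the energy by
        monotonicity of the power.\<close>
      have "?S \<le> epowr ?E (5/6)"
        by (intro SUP_least epowr_mono SUP_upper) auto
      also have "\<dots> < \<infinity>" using 5(1) unfolding infinity_ennreal_def top.not_eq_extremum[symmetric]
        by (simp only: epowr_eq_top[unfolded infinity_ennreal_def] not_False_eq_True)
      finally have "?S \<noteq> \<infinity>" by (rule less_imp_neq)
      then have S: "?S = ennreal s" unfolding s_def by (rule fin)
      have nonneg: "0 \<le> m" "0 \<le> L" "0 \<le> s" by (simp_all add: m_def L_def s_def)
      interpret bounded_energy_solution a b F Ft v vt Dv m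
      proof
        show "energy v Dv vt t \<le> ennreal m" if "t \<in> {a..b}" for t
          unfolding E[symmetric] using that by (rule SUP_upper)
      qed (fact nonneg)
      define w1 where "w1 = (LINT r|lborel. w r)"
      have w_int: "integrable lborel w"
        using w_meas w_fin w0 unfolding w_norm by (intro integrableI_bounded) simp_all
      have w1: "Lp_norm 1 w = ennreal w1"
        unfolding w_norm w1_def using w_int w0 by (intro nn_integral_eq_integral) auto
      have w1_nonneg: "0 \<le> w1" unfolding w1_def using w0 by (intro Bochner_Integration.integral_nonneg) auto
      have prim: "(LINT \<tau>:{..c}|lborel. w \<tau>) = primitive w c" for c
        by (simp add: primitive_def set_lebesgue_integral_def)
      have "set_integrable lborel ({a..b} \<times> UNIV) (\<lambda>p. primitive w (fst p - norm (snd p)) * Ft p * v p ^ 5)"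
        using iW unfolding prim case_prod_beta' prod.collapse .
      note Y = integral_strip[OF this, unfolded fst_conv snd_conv]
      have "set_integrable lborel ({a..b} \<times> UNIV) (\<lambda>p. w (fst p - norm (snd p)) * F p * v p ^ 5)"
        using iw unfolding case_prod_beta' prod.collapse .
      note X = integral_strip[OF this, unfolded fst_conv snd_conv]
      have "AE t in lborel. (\<integral>\<^sup>+x. ennreal \<bar>F (t, x) * V (t, x) ^ 5\<bar> \<partial>lborel) \<le> ennreal (6 * (L * s))"
      proof (rule cross_bound[OF L])
        show "epowr (energy v Dv vt t) (5/6) \<le> ennreal s" if "t \<in> {a..b}" for t
          unfolding S[symmetric] using that by (rule SUP_upper)
      qed (fact nonneg)+
      note bound = weighted_bound[OF w_int spec[OF w0] Y(1) X(1) this]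
      define Q where "Q = (LINT p|lborel. cut p * (\<bar>F p\<bar>\<^sup>2 * (\<bar>F p\<bar> + \<bar>v p\<bar>) ^ 3 * \<bar>vt p\<bar>))"
      have LS: "0 \<le> 6 * (L * s)" using nonneg by simp
      have iQ: "integrable lborel (\<lambda>p. cut p * (\<bar>F p\<bar>\<^sup>2 * (\<bar>F p\<bar> + \<bar>v p\<bar>) ^ 3 * \<bar>vt p\<bar>))" by (rule bound(2)[OF LS])
      have cut_ennreal: "indicator ({a<..<b} \<times> UNIV) p * ennreal r = ennreal (cut p * r)" for p r
        by (cases "p \<in> {a<..<b} \<times> UNIV") simp_all
      have "?Q = (\<integral>\<^sup>+p. indicator ({a<..<b} \<times> UNIV) p
          * ennreal (\<bar>F p\<bar>\<^sup>2 * (\<bar>F p\<bar> + \<bar>v p\<bar>) ^ 3 * \<bar>vt p\<bar>) \<partial>lborel)"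
      proof (rule nn_integral_strip)
        show "(\<lambda>p. indicator ({a<..<b} \<times> UNIV) p * ennreal (\<bar>F p\<bar>\<^sup>2 * (\<bar>F p\<bar> + \<bar>v p\<bar>) ^ 3 * \<bar>vt p\<bar>))
          \<in> borel_measurable borel"
          unfolding cut_ennreal using iQ by (intro measurable_compose[OF _ measurable_ennreal]) auto
      qed
      also have "\<dots> = ennreal Q"
        unfolding cut_ennreal Q_def by (intro nn_integral_eq_integral iQ AE_I2 mult_nonneg_nonneg) auto
      finally have Q: "?Q = ennreal Q" .
      have Q_nonneg: "0 \<le> Q" unfolding Q_def by (intro Bochner_Integration.integral_nonneg mult_nonneg_nonneg) auto
      have "?lhs \<le> ennreal (6 * (2 * (w1 * m) + 2 * (w1 * (6 * (L * s))) + 10 * w1 * Q + \<bar>?X\<bar> + \<bar>?Y\<bar>))"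
        using bound(1)[OF LS] unfolding lhs prim X(2) Y(2) w1_def Q_def .
      also have "\<dots> \<le> ennreal (100 * (w1 * m + w1 * L * s + \<bar>?Y\<bar> + \<bar>?X\<bar> + w1 * Q))"
      proof (rule ennreal_leI)
        \<comment> \<open>The coefficients to be covered by 100 are 12 for the energy, 72 for the
          cross term, 60 for the remainder and 6 for each signed integral.\<close>
        have "0 \<le> w1 * m" "0 \<le> w1 * (L * s)" "0 \<le> w1 * Q"
          using w1_nonneg nonneg Q_nonneg by simp_all
        then show "6 * (2 * (w1 * m) + 2 * (w1 * (6 * (L * s))) + 10 * w1 * Q + \<bar>?X\<bar> + \<bar>?Y\<bar>)
            \<le> 100 * (w1 * m + w1 * L * s + \<bar>?Y\<bar> + \<bar>?X\<bar> + w1 * Q)"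
          by (simp add: algebra_simps)
      qed
      also have "\<dots> = ?rhs"
        unfolding E L S w1 Q using w1_nonneg nonneg Q_nonneg by (simp add: ennreal_mult ennreal_plus)
      finally show ?thesis .
    qed
  qed
qed

end
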